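(* Let $\mathfrak{X}$ be a differentiable Deligne-Mumford stack with inertia stack $\Lambda\mathfrak{X}$ and evaluation morphism $\epsilon\colon\Lambda\mathfrak{X}\to\mathfrak{X}$, and let $f\colon\mathfrak{X}\to\mathbb{R}$ be Morse. Then $f\circ\epsilon\colon\Lambda\mathfrak{X}\to\mathbb{R}$ is also Morse. Moreover, the critical points of $f\circ\epsilon$ are precisely the points $c^g$, where $c$ is a critical point of $f$ and $g\in\mathrm{Aut}_c$. Further, $$\mathrm{ind}_{c^g}=(\mathrm{ind}_c)^g,\qquad \mathrm{coind}_{c^g}=(\mathrm{coind}_c)^g.$$
   Context: Manifolds are smooth, Hausdorff and second countable. A differentiable stack is a stack of groupoids over the site of smooth manifolds that admits an atlas (a representable surjective submersion from a manifold). A differentiable Deligne-Mumford stack is a differentiable stack $\mathfrak{X}$ that admits an étale surjection $X\to\mathfrak{X}$ from a manifold and whose diagonal $\mathfrak{X}\to\mathfrak{X}\times\mathfrak{X}$ is proper (equivalently, a stack represented by a proper étale Lie groupoid). $\bar{\mathfrak{X}}$ is the set of 2-isomorphism classes $[\mathrm{pt}\to\mathfrak{X}]$ of points of $\mathfrak{X}$. For $x\in\bar{\mathfrak{X}}$, choose an étale $U\to\mathfrak{X}$ and $u\in U$ with $[u\to\mathfrak{X}]=x$. Then $\mathrm{Aut}_x$ is the (finite) automorphism group of $u$ in the groupoid $U\times_{\mathfrak{X}}U\rightrightarrows U$, and $T_x\mathfrak{X}=T_uU$, a linear representation of $\mathrm{Aut}_x$ (well defined up to isomorphism). $d_xf$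 is the derivative at $u$ of $U\to\mathfrak{X}\xrightarrow{f}\mathbb{R}$; $x$ is a critical point if $d_xf=0$, and then the Hessian $H_{f,x}$ is the Hessian of this composite at $u$; the critical point is degenerate if $H_{f,x}$ is singular. $f$ is Morse if it has no degenerate critical points. For a critical point $c$ of a Morse function choose an $\mathrm{Aut}_c$-invariant splitting $T_c\mathfrak{X}=T_c\mathfrak{X}_+\oplus T_c\mathfrak{X}_-$ with $H_{f,c}$ positive definite on $T_c\mathfrak{X}_+$ and negative definite on $T_c\mathfrak{X}_-$. The index $\mathrm{ind}_c$ and co-index $\mathrm{coind}_c$ are the isomorphism classes of the $\mathrm{Aut}_c$-representations $T_c\mathfrak{X}_-$ and $T_c\mathfrak{X}_+$ respectively. Inertia stack: $\Lambda\mathfrak{X}(U)$ has objects $(u,\phi)$ with $u\in\mathfrak{X}(U)$ and $\phi\in\mathrm{Aut}(u)$, and morphisms $(u,\phi)\to(v,\psi)$ the $\lambda\colon u\to v$ with $\lambda\phi=\psi\lambda$. It is again differentiable Deligne-Mumford, and $\epsilon$ sends $(u,\phi)$ to $u$. The set $\overline{\Lambda\mathfrak{X}}$ consists of pairs $(x,(g))$, $x\in\bar{\mathfrak{X}}$, $(g)$ the conjugacy class of $g\in\mathrm{Aut}_x$; this point is written $x^g$. One has $\mathrm{Aut}_{x^g}=C_{\mathrm{Aut}_x}(g)$ (the centralizer) and $T_{x^g}\Lambda\mathfrak{X}=(T_x\mathfrak{X})^g$, where $(-)^g$ denotes the fixed points of $g$, viewed as a representation of $C_{\mathrm{Aut}_x}(g)$.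 *)

theory Defs
  imports "HOL-Analysis.Analysis"
begin

section \<open>Smooth functions on open subsets of Euclidean space\<close>

text \<open>
  As in the library's \<^const>\<open>Euclidean_space\<close>, the space \<open>R^n\<close> is the set of those
  \<open>x :: nat \<Rightarrow> real\<close> with \<open>x i = 0\<close> for \<open>i \<ge> n\<close>; so one type contains all \<open>R^n\<close>.
\<close>

type_synonym vec = "nat \<Rightarrow> real"

abbreviation Rn :: "nat \<Rightarrow> vec set"
  where "Rn n \<equiv> topspace (Euclidean_space n)"

definition pdiff :: "nat \<Rightarrow> (vec \<Rightarrow> real) \<Rightarrow> vec \<Rightarrow> real"
  where "pdiff j G y = deriv (\<lambda>t. G (y(j := t))) (y j)"

fun pdiffs :: "nat list \<Rightarrow> (vec \<Rightarrow> real) \<Rightarrow> vec \<Rightarrow> real"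
  where
    "pdiffs [] G = G"
  | "pdiffs (j # js) G = pdiff j (pdiffs js G)"

text \<open>\<open>C\<^sup>\<infinity>\<close> on an open subset \<open>S\<close> of \<open>R^n\<close>: all iterated partial derivatives exist and are
  continuous.\<close>

definition smooth_fun_on :: "nat \<Rightarrow> vec set \<Rightarrow> (vec \<Rightarrow> real) \<Rightarrow> bool"
  where "smooth_fun_on n S G \<longleftrightarrow>
    (\<forall>js. set js \<subseteq> {..<n} \<longrightarrow>
       continuous_map (subtopology (Euclidean_space n) S) euclideanreal (pdiffs js G) \<and>
       (\<forall>j<n. \<forall>y\<in>S. (\<lambda>t. pdiffs js G (y(j := t))) differentiable (at (y j))))"


section \<open>Manifolds and smooth maps\<close>

text \<open>
  The underlying set of a manifold is a subset of the type \<open>nat \<Rightarrow> real\<close>, which carries no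
  further meaning here: every second countable Hausdorff manifold has at most continuum many
  points, so this yields every manifold up to diffeomorphism. The dimension of a chart belongs to
  the chart, so different connected components may have different dimensions.
\<close>

type_synonym point = "nat \<Rightarrow> real"

record chart =
  cdim :: nat
  cdom :: "point set"
  cmap :: "point \<Rightarrow> vec"

record manifold =
  pts :: "point set"
  charts :: "chart set"

abbreviation cinv :: "chart \<Rightarrow> vec \<Rightarrow> point"
  where "cinv K \<equiv> inv_into (cdom K) (cmap K)"

definition mtop :: "manifold \<Rightarrow> point topology"
  where "mtop M = topology (\<lambda>S. S \<subseteq> pts M \<and>
    (\<forall>K\<in>charts M. openin (Euclidean_space (cdim K)) (cmap K ` (S \<inter> cdom K))))"

definition is_manifold :: "manifold \<Rightarrow> bool"
  where "is_manifold M \<longleftrightarrow>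
    (\<forall>K\<in>charts M. cdom K \<subseteq> pts M \<and> inj_on (cmap K) (cdom K)) \<and>
    (\<Union>K\<in>charts M. cdom K) = pts M \<and>
    (\<forall>K\<in>charts M. \<forall>L\<in>charts M.
       openin (Euclidean_space (cdim K)) (cmap K ` (cdom K \<inter> cdom L)) \<and>
       (\<forall>i<cdim L. smooth_fun_on (cdim K) (cmap K ` (cdom K \<inter> cdom L))
                      (\<lambda>y. cmap L (cinv K y) i))) \<and>
    Hausdorff_space (mtop M) \<and> second_countable (mtop M)"

text \<open>Maps are taken extensional, so that equality of arrows of the site is equality of HOL
  functions.\<close>

definition smooth_map :: "manifold \<Rightarrow> manifold \<Rightarrow> (point \<Rightarrow> point) \<Rightarrow> bool"
  where "smooth_map M N F \<longleftrightarrow>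
    F \<in> extensional (pts M) \<and> continuous_map (mtop M) (mtop N) F \<and>
    (\<forall>K\<in>charts M. \<forall>L\<in>charts N. \<forall>i<cdim L.
       smooth_fun_on (cdim K) (cmap K ` {x \<in> cdom K. F x \<in> cdom L})
         (\<lambda>y. cmap L (F (cinv K y)) i))"

definition coord_fun :: "chart \<Rightarrow> (point \<Rightarrow> real) \<Rightarrow> vec \<Rightarrow> real"
  where "coord_fun K h = (\<lambda>y. h (cinv K y))"

definition smooth_real :: "manifold \<Rightarrow> (point \<Rightarrow> real) \<Rightarrow> bool"
  where "smooth_real M h \<longleftrightarrow>
    (\<forall>K\<in>charts M. smooth_fun_on (cdim K) (cmap K ` cdom K) (coord_fun K h))"

definition open_sub :: "manifold \<Rightarrow> point set \<Rightarrow> manifold"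
  where "open_sub M S =
    \<lparr>pts = S, charts = (\<lambda>K. K\<lparr>cdom := cdom K \<inter> S\<rparr>) ` charts M\<rparr>"

definition incl :: "point set \<Rightarrow> point \<Rightarrow> point"
  where "incl S = restrict (\<lambda>x. x) S"

definition pt :: manifold
  where "pt = \<lparr>pts = {\<lambda>_. 0}, charts = {\<lparr>cdim = 0, cdom = {\<lambda>_. 0}, cmap = (\<lambda>x. x)\<rparr>}\<rparr>"

text \<open>The derivative at \<open>x\<close> of a map, in coordinates \<open>K\<close> around \<open>x\<close> and \<open>L\<close> around \<open>F x\<close>. A chart
  \<open>K\<close> around \<open>x\<close> identifies the tangent space at \<open>x\<close> with \<open>Rn (cdim K)\<close>.\<close>

definition dmap :: "chart \<Rightarrow> chart \<Rightarrow> (point \<Rightarrow> point) \<Rightarrow> point \<Rightarrow> vec \<Rightarrow> vec"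
  where "dmap K L F x v = (\<lambda>i. if i < cdim L
    then \<Sum>j<cdim K. pdiff j (\<lambda>y. cmap L (F (cinv K y)) i) (cmap K x) * v j else 0)"

definition submersion :: "manifold \<Rightarrow> manifold \<Rightarrow> (point \<Rightarrow> point) \<Rightarrow> bool"
  where "submersion M N F \<longleftrightarrow> smooth_map M N F \<and>
    (\<forall>K\<in>charts M. \<forall>L\<in>charts N. \<forall>x\<in>cdom K. F x \<in> cdom L \<longrightarrow>
       dmap K L F x ` Rn (cdim K) = Rn (cdim L))"

definition etale_map :: "manifold \<Rightarrow> manifold \<Rightarrow> (point \<Rightarrow> point) \<Rightarrow> bool"
  where "etale_map M N F \<longleftrightarrow> smooth_map M N F \<and>
    (\<forall>x\<in>pts M. \<exists>S. x \<in> S \<and> openin (mtop M) S \<and> openin (mtop N) (F ` S) \<and> inj_on F S \<and>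
       smooth_map (open_sub N (F ` S)) (open_sub M S) (restrict (inv_into S F) (F ` S)))"


section \<open>Stacks over the site of manifolds\<close>

text \<open>
  A category over the category of manifolds, given by its total category together with the
  projection (\<open>base\<close>, \<open>bmap\<close>). \<open>cmp X n m\<close> is "first \<open>m\<close>, then \<open>n\<close>".
\<close>

record ('o, 'm) fibcat =
  Obj :: "'o set"
  Arr :: "'m set"
  dom :: "'m \<Rightarrow> 'o"
  cod :: "'m \<Rightarrow> 'o"
  idn :: "'o \<Rightarrow> 'm"
  cmp :: "'m \<Rightarrow> 'm \<Rightarrow> 'm"
  base :: "'o \<Rightarrow> manifold"
  bmap :: "'m \<Rightarrow> point \<Rightarrow> point"

definition in_hom :: "('o, 'm) fibcat \<Rightarrow> 'm \<Rightarrow> 'o \<Rightarrow> 'o \<Rightarrow> bool"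
  where "in_hom X m a b \<longleftrightarrow> m \<in> Arr X \<and> dom X m = a \<and> cod X m = b"

definition category_over_manifolds :: "('o, 'm) fibcat \<Rightarrow> bool"
  where "category_over_manifolds X \<longleftrightarrow>
    (\<forall>m\<in>Arr X. dom X m \<in> Obj X \<and> cod X m \<in> Obj X) \<and>
    (\<forall>a\<in>Obj X. in_hom X (idn X a) a a) \<and>
    (\<forall>m n a b c. in_hom X m a b \<and> in_hom X n b c \<longrightarrow> in_hom X (cmp X n m) a c) \<and>
    (\<forall>m a b. in_hom X m a b \<longrightarrow> cmp X m (idn X a) = m \<and> cmp X (idn X b) m = m) \<and>
    (\<forall>k m n a b c d. in_hom X k a b \<and> in_hom X m b c \<and> in_hom X n c d \<longrightarrow>
       cmp X n (cmp X m k) = cmp X (cmp X n m) k) \<and>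
    (\<forall>a\<in>Obj X. is_manifold (base X a)) \<and>
    (\<forall>m a b. in_hom X m a b \<longrightarrow> smooth_map (base X a) (base X b) (bmap X m)) \<and>
    (\<forall>a\<in>Obj X. bmap X (idn X a) = incl (pts (base X a))) \<and>
    (\<forall>m n a b c. in_hom X m a b \<and> in_hom X n b c \<longrightarrow>
       bmap X (cmp X n m) = compose (pts (base X a)) (bmap X n) (bmap X m))"

definition fibred_in_groupoids :: "('o, 'm) fibcat \<Rightarrow> bool"
  where "fibred_in_groupoids X \<longleftrightarrow> category_over_manifolds X \<and>
    (\<forall>a\<in>Obj X. \<forall>M F. is_manifold M \<and> smooth_map M (base X a) F \<longrightarrow>
       (\<exists>b m. in_hom X m b a \<and> base X b = M \<and> bmap X m = F)) \<and>
    (\<forall>a b c m n F. in_hom X m b a \<and> in_hom X n c a \<and> smooth_map (base X c) (base X b) F \<and>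
       compose (pts (base X c)) (bmap X m) F = bmap X n \<longrightarrow>
       (\<exists>!k. in_hom X k c b \<and> bmap X k = F \<and> cmp X m k = n))"

definition open_cover :: "manifold \<Rightarrow> point set set \<Rightarrow> bool"
  where "open_cover M C \<longleftrightarrow> (\<forall>W\<in>C. openin (mtop M) W) \<and> \<Union>C = pts M"

text \<open>Isomorphisms form a sheaf. No cleavage is chosen: \<open>r W\<close> exhibits its domain as a restriction
  of \<open>a\<close> to \<open>W\<close>, and \<open>s W\<close> encodes an isomorphism from this restriction to \<open>b\<close> restricted to \<open>W\<close>.
  The domain of \<open>k\<close> and \<open>k'\<close> plays the role of a restriction to \<open>W \<inter> W'\<close>.\<close>

definition morphisms_glue :: "('o, 'm) fibcat \<Rightarrow> bool"
  where "morphisms_glue X \<longleftrightarrow>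
    (\<forall>a\<in>Obj X. \<forall>b\<in>Obj X. \<forall>C x r s.
       base X a = base X b \<and> open_cover (base X a) C \<and>
       (\<forall>W\<in>C. in_hom X (r W) (x W) a \<and> in_hom X (s W) (x W) b \<and>
          base X (x W) = open_sub (base X a) W \<and>
          bmap X (r W) = incl W \<and> bmap X (s W) = incl W) \<and>
       (\<forall>W\<in>C. \<forall>W'\<in>C. \<forall>z k k'. in_hom X k z (x W) \<and> in_hom X k' z (x W') \<and>
          cmp X (r W) k = cmp X (r W') k' \<longrightarrow> cmp X (s W) k = cmp X (s W') k') \<longrightarrow>
       (\<exists>!t. in_hom X t a b \<and> bmap X t = incl (pts (base X a)) \<and>
          (\<forall>W\<in>C. cmp X t (r W) = s W)))"

text \<open>Descent data are effective. The isomorphism from \<open>x W\<close> to \<open>x W'\<close> over \<open>W \<inter> W'\<close> is encoded by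
  the span \<open>x W \<leftarrow> d W W' \<rightarrow> x W'\<close> over the two inclusions. Arrows \<open>k : z \<rightarrow> x W\<close> and
  \<open>k' : z \<rightarrow> x W'\<close> are identified by it if they factor through the span.\<close>

definition factors_through ::
    "('o, 'm) fibcat \<Rightarrow> 'm \<Rightarrow> 'm \<Rightarrow> 'm \<Rightarrow> 'm \<Rightarrow> bool"
  where "factors_through X p q k k' \<longleftrightarrow>
    (\<exists>l. in_hom X l (dom X k) (dom X p) \<and> cmp X p l = k \<and> cmp X q l = k')"

definition objects_glue :: "('o, 'm) fibcat \<Rightarrow> bool"
  where "objects_glue X \<longleftrightarrow>
    (\<forall>M C x d p q.
       is_manifold M \<and> open_cover M C \<and>
       (\<forall>W\<in>C. x W \<in> Obj X \<and> base X (x W) = open_sub M W) \<and>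
       (\<forall>W\<in>C. \<forall>W'\<in>C. base X (d W W') = open_sub M (W \<inter> W') \<and>
          in_hom X (p W W') (d W W') (x W) \<and> bmap X (p W W') = incl (W \<inter> W') \<and>
          in_hom X (q W W') (d W W') (x W') \<and> bmap X (q W W') = incl (W \<inter> W')) \<and>
       (\<forall>W\<in>C. \<forall>W'\<in>C. \<forall>W''\<in>C. \<forall>z k k' k''.
          in_hom X k z (x W) \<and> in_hom X k' z (x W') \<and> in_hom X k'' z (x W'') \<and>
          factors_through X (p W W') (q W W') k k' \<and>
          factors_through X (p W' W'') (q W' W'') k' k'' \<longrightarrow>
          factors_through X (p W W'') (q W W'') k k'') \<longrightarrow>
       (\<exists>a r. a \<in> Obj X \<and> base X a = M \<and>
          (\<forall>W\<in>C. in_hom X (r W) (x W) a \<and> bmap X (r W) = incl W) \<and>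
          (\<forall>W\<in>C. \<forall>W'\<in>C. cmp X (r W) (p W W') = cmp X (r W') (q W W'))))"

definition stack :: "('o, 'm) fibcat \<Rightarrow> bool"
  where "stack X \<longleftrightarrow> fibred_in_groupoids X \<and> morphisms_glue X \<and> objects_glue X"


section \<open>Differentiable Deligne-Mumford stacks\<close>

text \<open>
  A morphism from a manifold \<open>U\<close> to \<open>X\<close> is identified with an object over \<open>U\<close>. For objects \<open>a\<close> over
  \<open>U\<close> and \<open>b\<close> over \<open>V\<close>, the fibre product of \<open>U\<close> and \<open>V\<close> over \<open>X\<close> has as its objects over \<open>W\<close> the
  triples of maps \<open>W \<rightarrow> U\<close>, \<open>W \<rightarrow> V\<close> and an isomorphism between the two pullbacks to \<open>W\<close>, i.e.
  the spans \<open>a \<leftarrow> w \<rightarrow> b\<close> with \<open>w\<close> over \<open>W\<close>. It is represented by the manifold \<open>base X c\<close>, with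
  projections \<open>bmap X \<alpha>\<close> and \<open>bmap X \<beta>\<close>, if \<open>a \<leftarrow> c \<rightarrow> b\<close> is a universal span.
\<close>

definition fibre_product :: "('o, 'm) fibcat \<Rightarrow> 'o \<Rightarrow> 'o \<Rightarrow> 'o \<Rightarrow> 'm \<Rightarrow> 'm \<Rightarrow> bool"
  where "fibre_product X a b c \<alpha> \<beta> \<longleftrightarrow> in_hom X \<alpha> c a \<and> in_hom X \<beta> c b \<and>
    (\<forall>w \<alpha>' \<beta>'. in_hom X \<alpha>' w a \<and> in_hom X \<beta>' w b \<longrightarrow>
       (\<exists>!k. in_hom X k w c \<and> cmp X \<alpha> k = \<alpha>' \<and> cmp X \<beta> k = \<beta>'))"

text \<open>The object \<open>a\<close> is a representable morphism all of whose base changes to manifolds have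
  property \<open>P\<close>.\<close>

definition representable_with ::
    "(manifold \<Rightarrow> manifold \<Rightarrow> (point \<Rightarrow> point) \<Rightarrow> bool) \<Rightarrow> ('o, 'm) fibcat \<Rightarrow> 'o \<Rightarrow> bool"
  where "representable_with P X a \<longleftrightarrow> a \<in> Obj X \<and>
    (\<forall>b\<in>Obj X. \<exists>c \<alpha> \<beta>. fibre_product X a b c \<alpha> \<beta> \<and> P (base X c) (base X b) (bmap X \<beta>))"

definition surjective :: "manifold \<Rightarrow> manifold \<Rightarrow> (point \<Rightarrow> point) \<Rightarrow> bool"
  where "surjective M N F \<longleftrightarrow> F ` pts M = pts N"

definition differentiable_stack :: "('o, 'm) fibcat \<Rightarrow> bool"
  where "differentiable_stack X \<longleftrightarrow> stack X \<and>
    (\<exists>a. representable_with submersion X a \<and> representable_with surjective X a)"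

text \<open>The diagonal of a differentiable stack need not be representable by manifolds; as usual,
  properness is tested after base change along \<open>U \<times> V \<rightarrow> X \<times> X\<close> for representable submersions
  \<open>U \<rightarrow> X\<close> and \<open>V \<rightarrow> X\<close>, where it becomes the map from \<open>U \<times>\<^sub>X V\<close> to \<open>U \<times> V\<close>.\<close>

definition proper_diagonal :: "('o, 'm) fibcat \<Rightarrow> bool"
  where "proper_diagonal X \<longleftrightarrow>
    (\<forall>a b c \<alpha> \<beta>. representable_with submersion X a \<and> representable_with submersion X b \<and>
       fibre_product X a b c \<alpha> \<beta> \<longrightarrow>
       proper_map (mtop (base X c)) (prod_topology (mtop (base X a)) (mtop (base X b)))
         (\<lambda>x. (bmap X \<alpha> x, bmap X \<beta> x)))"

definition deligne_mumford_stack :: "('o, 'm) fibcat \<Rightarrow> bool"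
  where "deligne_mumford_stack X \<longleftrightarrow> differentiable_stack X \<and>
    (\<exists>a. representable_with etale_map X a \<and> representable_with surjective X a) \<and>
    proper_diagonal X"


section \<open>Points, automorphisms and the inertia stack\<close>

definition point_objects :: "('o, 'm) fibcat \<Rightarrow> 'o set"
  where "point_objects X = {p \<in> Obj X. base X p = pt}"

text \<open>Any arrow between objects over \<open>pt\<close> lies over the identity and hence is an isomorphism.\<close>

definition iso_class :: "('o, 'm) fibcat \<Rightarrow> 'o \<Rightarrow> 'o set"
  where "iso_class X p = {q \<in> point_objects X. \<exists>m. in_hom X m q p}"

definition points :: "('o, 'm) fibcat \<Rightarrow> 'o set set"
  where "points X = iso_class X ` point_objects X"

definition Aut :: "('o, 'm) fibcat \<Rightarrow> 'o \<Rightarrow> 'm set"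
  where "Aut X a = {h. in_hom X h a a \<and> bmap X h = incl (pts (base X a))}"

text \<open>An arrow of the inertia stack is an arrow \<open>\<lambda>\<close> of \<open>X\<close> together with the automorphisms \<open>\<phi>\<close> and
  \<open>\<psi>\<close> of its domain and codomain that it intertwines.\<close>

definition inertia :: "('o, 'm) fibcat \<Rightarrow> ('o \<times> 'm, 'm \<times> 'm \<times> 'm) fibcat"
  where "inertia X =
    \<lparr>Obj = {(a, \<phi>). a \<in> Obj X \<and> \<phi> \<in> Aut X a},
     Arr = {(\<phi>, l, \<psi>). l \<in> Arr X \<and> \<phi> \<in> Aut X (dom X l) \<and> \<psi> \<in> Aut X (cod X l) \<and>
              cmp X l \<phi> = cmp X \<psi> l},
     dom = (\<lambda>(\<phi>, l, \<psi>). (dom X l, \<phi>)),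
     cod = (\<lambda>(\<phi>, l, \<psi>). (cod X l, \<psi>)),
     idn = (\<lambda>(a, \<phi>). (\<phi>, idn X a, \<phi>)),
     cmp = (\<lambda>(\<phi>', l', \<psi>') (\<phi>, l, \<psi>). (\<phi>, cmp X l' l, \<psi>')),
     base = (\<lambda>(a, \<phi>). base X a),
     bmap = (\<lambda>(\<phi>, l, \<psi>). bmap X l)\<rparr>"

text \<open>The evaluation morphism, on objects and on arrows.\<close>

definition ev_obj :: "'o \<times> 'm \<Rightarrow> 'o"
  where "ev_obj = (\<lambda>(a, \<phi>). a)"

definition ev_arr :: "'m \<times> 'm \<times> 'm \<Rightarrow> 'm"
  where "ev_arr = (\<lambda>(\<phi>, l, \<psi>). l)"


section \<open>Morse functions\<close>

text \<open>A morphism from \<open>X\<close> to the manifold \<open>R\<close>: a functor over the site to the category of real valued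
  smooth functions on manifolds. Its value at \<open>a\<close> is the composite of \<open>f\<close> with the morphism
  \<open>base X a \<rightarrow> X\<close> given by \<open>a\<close>; composing \<open>f\<close> with a morphism of stacks is composing with its map on
  objects.\<close>

definition stack_function :: "('o, 'm) fibcat \<Rightarrow> ('o \<Rightarrow> point \<Rightarrow> real) \<Rightarrow> bool"
  where "stack_function X f \<longleftrightarrow>
    (\<forall>a\<in>Obj X. smooth_real (base X a) (f a)) \<and>
    (\<forall>m\<in>Arr X. \<forall>x\<in>pts (base X (dom X m)). f (dom X m) x = f (cod X m) (bmap X m x))"

text \<open>The data chosen to compute at the point represented by \<open>p\<close>: an etale \<open>a\<close> from \<open>U = base X a\<close>
  to \<open>X\<close>; an arrow \<open>\<theta> : p \<rightarrow> a\<close>, i.e. a point \<open>u\<close> of \<open>U\<close> (the image of \<open>pt\<close>) with an isomorphism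
  from \<open>p\<close> to the pullback of \<open>a\<close> to \<open>u\<close>; and coordinates \<open>K\<close> of \<open>U\<close> around \<open>u\<close>. They identify
  the tangent space of \<open>X\<close> at \<open>p\<close> with \<open>Rn (cdim K)\<close>.\<close>

definition foot :: "('o, 'm) fibcat \<Rightarrow> 'm \<Rightarrow> point"
  where "foot X \<theta> = bmap X \<theta> (\<lambda>_. 0)"

definition etale_chart_at :: "('o, 'm) fibcat \<Rightarrow> 'o \<Rightarrow> 'o \<Rightarrow> 'm \<Rightarrow> chart \<Rightarrow> bool"
  where "etale_chart_at X p a \<theta> K \<longleftrightarrow> p \<in> point_objects X \<and>
    representable_with etale_map X a \<and> in_hom X \<theta> p a \<and>
    K \<in> charts (base X a) \<and> foot X \<theta> \<in> cdom K"

text \<open>The action of \<open>h \<in> Aut X p\<close> on the tangent space. In the etale groupoid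
  \<open>R = U \<times>\<^sub>X U \<rightrightarrows> U\<close> with source \<open>bmap X \<alpha>\<close> and target \<open>bmap X \<beta>\<close>, the pair \<open>(\<theta>, \<theta> h)\<close>
  defines an arrow \<open>x \<in> R\<close> from \<open>u\<close> to \<open>u\<close>, and \<open>h\<close> acts by the derivative of the target
  map at \<open>x\<close> after the inverse of that of the source map.\<close>

definition tangent_action ::
    "('o, 'm) fibcat \<Rightarrow> 'o \<Rightarrow> 'm \<Rightarrow> chart \<Rightarrow> 'm \<Rightarrow> vec \<Rightarrow> vec"
  where "tangent_action X a \<theta> K h v = (THE w. \<exists>c \<alpha> \<beta> \<gamma> L z.
    fibre_product X a a c \<alpha> \<beta> \<and> in_hom X \<gamma> (dom X \<theta>) c \<and>
    cmp X \<alpha> \<gamma> = \<theta> \<and> cmp X \<beta> \<gamma> = cmp X \<theta> h \<and>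
    L \<in> charts (base X c) \<and> foot X \<gamma> \<in> cdom L \<and> z \<in> Rn (cdim L) \<and>
    dmap L K (bmap X \<alpha>) (foot X \<gamma>) z = v \<and> dmap L K (bmap X \<beta>) (foot X \<gamma>) z = w)"

definition diff_vanishes :: "chart \<Rightarrow> (point \<Rightarrow> real) \<Rightarrow> point \<Rightarrow> bool"
  where "diff_vanishes K h u \<longleftrightarrow> (\<forall>i<cdim K. pdiff i (coord_fun K h) (cmap K u) = 0)"

definition hessian :: "chart \<Rightarrow> (point \<Rightarrow> real) \<Rightarrow> point \<Rightarrow> vec \<Rightarrow> vec \<Rightarrow> real"
  where "hessian K h u v w =
    (\<Sum>i<cdim K. \<Sum>j<cdim K. pdiff i (pdiff j (coord_fun K h)) (cmap K u) * v i * w j)"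

definition singular_form :: "nat \<Rightarrow> (vec \<Rightarrow> vec \<Rightarrow> real) \<Rightarrow> bool"
  where "singular_form n H \<longleftrightarrow> (\<exists>v\<in>Rn n. v \<noteq> (\<lambda>_. 0) \<and> (\<forall>w\<in>Rn n. H v w = 0))"

definition critical_at :: "('o, 'm) fibcat \<Rightarrow> ('o \<Rightarrow> point \<Rightarrow> real) \<Rightarrow> 'o \<Rightarrow> bool"
  where "critical_at X f p \<longleftrightarrow>
    (\<exists>a \<theta> K. etale_chart_at X p a \<theta> K \<and> diff_vanishes K (f a) (foot X \<theta>))"

definition critical_points :: "('o, 'm) fibcat \<Rightarrow> ('o \<Rightarrow> point \<Rightarrow> real) \<Rightarrow> 'o set set"
  where "critical_points X f = {x \<in> points X. \<exists>p\<in>x. critical_at X f p}"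

definition degenerate_at :: "('o, 'm) fibcat \<Rightarrow> ('o \<Rightarrow> point \<Rightarrow> real) \<Rightarrow> 'o \<Rightarrow> bool"
  where "degenerate_at X f p \<longleftrightarrow>
    (\<exists>a \<theta> K. etale_chart_at X p a \<theta> K \<and> diff_vanishes K (f a) (foot X \<theta>) \<and>
       singular_form (cdim K) (hessian K (f a) (foot X \<theta>)))"

definition morse :: "('o, 'm) fibcat \<Rightarrow> ('o \<Rightarrow> point \<Rightarrow> real) \<Rightarrow> bool"
  where "morse X f \<longleftrightarrow> stack_function X f \<and>
    (\<forall>x\<in>critical_points X f. \<forall>p\<in>x. \<not> degenerate_at X f p)"


section \<open>Index and co-index\<close>

definition lin_subspace :: "nat \<Rightarrow> vec set \<Rightarrow> bool"
  where "lin_subspace n V \<longleftrightarrow> V \<subseteq> Rn n \<and> (\<lambda>_. 0) \<in> V \<and>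
    (\<forall>v\<in>V. \<forall>w\<in>V. \<forall>r s. (\<lambda>i. r * v i + s * w i) \<in> V)"

definition linear_on_set :: "vec set \<Rightarrow> (vec \<Rightarrow> vec) \<Rightarrow> bool"
  where "linear_on_set V T \<longleftrightarrow>
    (\<forall>v\<in>V. \<forall>w\<in>V. \<forall>r s. T (\<lambda>i. r * v i + s * w i) = (\<lambda>i. r * T v i + s * T w i))"

text \<open>A representation of a group with underlying set \<open>G\<close> is a pair \<open>(V, \<rho>)\<close> of a finite-dimensional
  space \<open>V\<close> of vectors and an action; the values of \<open>\<rho>\<close> outside \<open>G\<close> and \<open>V\<close> are irrelevant. If
  \<open>(V, \<rho>)\<close> is a representation, then so is any \<open>(W, \<sigma>)\<close> isomorphic to it in the sense below.\<close>

type_synonym 'g rep = "vec set \<times> ('g \<Rightarrow> vec \<Rightarrow> vec)"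

definition rep_iso :: "'g set \<Rightarrow> 'g rep \<Rightarrow> 'g rep \<Rightarrow> bool"
  where "rep_iso G R S \<longleftrightarrow> (case R of (V, \<rho>) \<Rightarrow> case S of (W, \<sigma>) \<Rightarrow>
    (\<exists>T. linear_on_set V T \<and> bij_betw T V W \<and>
       (\<forall>h\<in>G. \<forall>v\<in>V. T (\<rho> h v) = \<sigma> h (T v))))"

definition invariant_splitting ::
    "'g set \<Rightarrow> ('g \<Rightarrow> vec \<Rightarrow> vec) \<Rightarrow> nat \<Rightarrow> (vec \<Rightarrow> vec \<Rightarrow> real) \<Rightarrow> vec set \<Rightarrow> vec set \<Rightarrow> bool"
  where "invariant_splitting G \<rho> n H Vp Vm \<longleftrightarrow>
    lin_subspace n Vp \<and> lin_subspace n Vm \<and>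
    (\<forall>v\<in>Rn n. \<exists>!(x, y). x \<in> Vp \<and> y \<in> Vm \<and> v = (\<lambda>i. x i + y i)) \<and>
    (\<forall>h\<in>G. \<rho> h ` Vp \<subseteq> Vp \<and> \<rho> h ` Vm \<subseteq> Vm) \<and>
    (\<forall>v\<in>Vp. v \<noteq> (\<lambda>_. 0) \<longrightarrow> H v v > 0) \<and>
    (\<forall>v\<in>Vm. v \<noteq> (\<lambda>_. 0) \<longrightarrow> H v v < 0)"

text \<open>The index and co-index at a critical point \<open>p\<close>, as isomorphism classes of representations of
  \<open>Aut X p\<close>: all representations isomorphic to the negative (positive) part for some choice of
  etale chart and splitting.\<close>

definition index ::
    "('o, 'm) fibcat \<Rightarrow> ('o \<Rightarrow> point \<Rightarrow> real) \<Rightarrow> 'o \<Rightarrow> 'm rep set"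
  where "index X f p = {R. \<exists>a \<theta> K Vp Vm.
    etale_chart_at X p a \<theta> K \<and> diff_vanishes K (f a) (foot X \<theta>) \<and>
    invariant_splitting (Aut X p) (tangent_action X a \<theta> K) (cdim K)
      (hessian K (f a) (foot X \<theta>)) Vp Vm \<and>
    rep_iso (Aut X p) (Vm, tangent_action X a \<theta> K) R}"

definition coindex ::
    "('o, 'm) fibcat \<Rightarrow> ('o \<Rightarrow> point \<Rightarrow> real) \<Rightarrow> 'o \<Rightarrow> 'm rep set"
  where "coindex X f p = {R. \<exists>a \<theta> K Vp Vm.
    etale_chart_at X p a \<theta> K \<and> diff_vanishes K (f a) (foot X \<theta>) \<and>
    invariant_splitting (Aut X p) (tangent_action X a \<theta> K) (cdim K)
      (hessian K (f a) (foot X \<theta>)) Vp Vm \<and>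
    rep_iso (Aut X p) (Vp, tangent_action X a \<theta> K) R}"

text \<open>For a class \<open>\<C>\<close> of representations of \<open>Aut X p\<close> and \<open>g \<in> Aut X p\<close>, the class of the fixed
  points of \<open>g\<close>, as representations of the automorphism group of \<open>(p, g)\<close> in the inertia stack;
  \<^const>\<open>ev_arr\<close> identifies this group with the centralizer of \<open>g\<close> in \<open>Aut X p\<close>.\<close>

definition fixed_class ::
    "('o, 'm) fibcat \<Rightarrow> 'o \<Rightarrow> 'm \<Rightarrow> 'm rep set \<Rightarrow> ('m \<times> 'm \<times> 'm) rep set"
  where "fixed_class X p g \<C> = {R. \<exists>(V, \<rho>)\<in>\<C>.
    rep_iso (Aut (inertia X) (p, g)) ({v \<in> V. \<rho> g v = v}, \<lambda>h. \<rho> (ev_arr h)) R}"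

end

theory Submission
  imports Defs
begin

text \<open>
  Near a point \<open>p\<close>, an automorphism \<open>g\<close> of \<open>p\<close> is the germ of a local diffeomorphism \<open>\<sigma>\<close> of an etale
  chart \<open>U\<close>, and \<open>g\<close> has finite order because the diagonal is proper. In coordinates in which \<open>\<sigma>\<close> is
  linear (Bochner) the fixed points of \<open>\<sigma>\<close> form a submanifold; it carries a tautological automorphism
  and is an etale chart of the inertia stack at \<open>(p, g)\<close>. So the derivative of the evaluation
  morphism identifies the tangent space of the inertia stack equivariantly with the fixed vectors of
  \<open>g\<close>, and \<open>f\<close> restricts to the fixed locus. A linear form invariant under \<open>g\<close> vanishes if it
  vanishes on the fixed vectors, by averaging; applied to \<open>df\<close> and to the Hessian paired with a fixed
  vector, this gives the critical points and the Morse property. An invariant splitting is compatible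
  with fixed vectors, and by the law of inertia the negative part is unique up to equivariant
  isomorphism.
\<close>

section \<open>Calculus on open subsets of Euclidean spaces\<close>

text \<open>The index classes range over all etale charts and all splittings, so no single good
  chart suffices: tangent spaces, actions, differentials and Hessians in different charts are
  compared through spans, by the maps \<open>transition\<close>. To find an index of
  \<open>(p, g)\<close> in the fixed class, an invariant splitting at \<open>p\<close> itself must
  be exhibited; it comes from an invariant positive subspace of maximal dimension, enlarged as long
  as possible by eigenspaces. A chart of the inertia stack must be representable over all of its
  objects, not only near \<open>(p, g)\<close>. Hence the fixed locus is cut out where the
  automorphism is read off from the section \<open>t\<close>, and its fibre product with an
  arbitrary object is constructed explicitly. Since \<open>R^n\<close> sits inside
  \<open>nat \<Rightarrow> real\<close> with the product topology, derivatives are taken coordinate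
  by coordinate; the chain rule, the symmetry of second derivatives and local inversion all rest on
  the mean value theorem in one variable, the last one also on compactness.\<close>

lemma Rn_iff: "x \<in> Rn n \<longleftrightarrow> (\<forall>i\<ge>n. x i = 0)"
  by (simp add: topspace_Euclidean_space)

lemma Rn_zero [simp]: "(\<lambda>_. 0) \<in> Rn n"
  by (simp add: Rn_iff)

lemma Rn_upd: "y \<in> Rn n \<Longrightarrow> j < n \<Longrightarrow> y(j := t) \<in> Rn n"
  by (simp add: Rn_iff)

lemma Rn_eqI: "x \<in> Rn n \<Longrightarrow> y \<in> Rn n \<Longrightarrow> (\<And>i. i < n \<Longrightarrow> x i = y i) \<Longrightarrow> x = y"
  by (rule ext) (metis Rn_iff linorder_not_le)

lemma openin_Rn: "openin (Euclidean_space n) S \<longleftrightarrow> openin (top_of_set (Rn n)) S"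
  by (simp add: Euclidean_space_def euclidean_product_topology)

lemma open_Rn_subset: "openin (Euclidean_space n) S \<Longrightarrow> S \<subseteq> Rn n"
  by (rule openin_subset)

lemma continuous_map_Euclidean_sub:
  "S \<subseteq> Rn n \<Longrightarrow> continuous_map (subtopology (Euclidean_space n) S) euclideanreal G \<longleftrightarrow> continuous_on S G"
  by (simp add: Euclidean_space_def euclidean_product_topology subtopology_subtopology Int_absorb1)

text \<open>The open ball of the maximum norm. Paths parallel to the axes between two of its points
  stay inside, as the coordinatewise mean value argument requires.\<close>

definition box_nhd :: "nat \<Rightarrow> vec \<Rightarrow> real \<Rightarrow> vec set"
  where "box_nhd n a e = {x \<in> Rn n. \<forall>i<n. \<bar>x i - a i\<bar> < e}"

lemma box_nhdD: "x \<in> box_nhd n a e \<Longrightarrow> i < n \<Longrightarrow> \<bar>x i - a i\<bar> < e"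
  by (simp add: box_nhd_def)

lemma box_nhd_Rn: "x \<in> box_nhd n a e \<Longrightarrow> x \<in> Rn n"
  by (simp add: box_nhd_def)

lemma box_nhd_center: "a \<in> Rn n \<Longrightarrow> 0 < e \<Longrightarrow> a \<in> box_nhd n a e"
  by (simp add: box_nhd_def)

lemma box_nhd_mono: "d \<le> e \<Longrightarrow> box_nhd n a d \<subseteq> box_nhd n a e"
  by (force simp: box_nhd_def)

lemma continuous_on_coord [continuous_intros]: "continuous_on S (\<lambda>x::vec. x i)"
  by (rule continuous_on_product_then_coordinatewise) (rule continuous_on_id)

lemma openin_Collect_less:
  fixes f :: "vec \<Rightarrow> real"
  assumes "openin (Euclidean_space n) S" "continuous_on S f"
  shows "openin (Euclidean_space n) {x \<in> S. f x < c}"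
proof -
  have "{x \<in> S. f x < c} = S \<inter> f -` {..<c}" by auto
  moreover have "openin (top_of_set S) (S \<inter> f -` {..<c})"
    using assms(2) continuous_openin_preimage_gen open_lessThan by blast
  ultimately show ?thesis
    using assms(1) unfolding openin_Rn by (metis openin_trans)
qed

lemma openin_preimage_Rn:
  assumes S: "openin (Euclidean_space m) S" and T: "openin (Euclidean_space n) T"
    and F: "\<And>i. i < n \<Longrightarrow> continuous_on S (\<lambda>y. F y i)" "\<And>y. y \<in> S \<Longrightarrow> F y \<in> Rn n"
  shows "openin (Euclidean_space m) {y \<in> S. F y \<in> T}"
proof -
  have cF: "continuous_on S F"
  proof (rule continuous_on_coordinatewise_then_product)
    fix i show "continuous_on S (\<lambda>x. F x i)"
    proof (cases "i < n")
      case False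
      then have "\<And>x. x \<in> S \<Longrightarrow> F x i = 0" using F(2) by (simp add: Rn_iff)
      then show ?thesis by (metis (mono_tags, lifting) continuous_on_cong continuous_on_const)
    qed (use F in auto)
  qed
  obtain U where U: "open U" "T = Rn n \<inter> U"
    using T unfolding openin_Rn by (auto simp: openin_open)
  have "{y \<in> S. F y \<in> T} = S \<inter> F -` U" using U F(2) by auto
  moreover have "openin (top_of_set S) (S \<inter> F -` U)"
    using cF U continuous_openin_preimage_gen by blast
  ultimately show ?thesis
    using S unfolding openin_Rn by (metis openin_trans)
qed

lemma openin_box_nhd: "openin (Euclidean_space n) (box_nhd n a e)"
proof -
  have "box_nhd n a e = topspace (Euclidean_space n) \<inter> (\<Inter>i\<in>{..<n}. {x \<in> Rn n. \<bar>x i - a i\<bar> < e})"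
    by (auto simp: box_nhd_def)
  also have "openin (Euclidean_space n) \<dots>"
  proof (cases "n = 0")
    case False
    then show ?thesis
      by (intro openin_Int openin_topspace openin_INT2 openin_Collect_less openin_topspace continuous_intros) auto
  qed auto
  finally show ?thesis .
qed

lemma open_contains_box:
  assumes S: "openin (Euclidean_space n) S" and a: "a \<in> S"
  obtains e where "0 < e" "box_nhd n a e \<subseteq> S"
proof -
  obtain U where U: "open U" "S = Rn n \<inter> U"
    using S unfolding openin_Rn by (auto simp: openin_open)
  have "openin (product_topology (\<lambda>i. euclideanreal) UNIV) U"
    using U by (simp add: euclidean_product_topology)
  then obtain X where X: "a \<in> Pi\<^sub>E UNIV X" "\<And>i. open (X i)" "Pi\<^sub>E UNIV X \<subseteq> U"
    using product_topology_open_contains_basis[of "\<lambda>i. euclideanreal" UNIV U a] U a by auto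
  have "\<forall>i. \<exists>e>0. \<forall>x. \<bar>x - a i\<bar> < e \<longrightarrow> x \<in> X i"
  proof
    fix i
    have "a i \<in> X i" using X(1) by auto
    then show "\<exists>e>0. \<forall>x. \<bar>x - a i\<bar> < e \<longrightarrow> x \<in> X i"
      using X(2)[of i] unfolding open_dist dist_real_def by blast
  qed
  then obtain e where e: "\<And>i. e i > 0" "\<And>i x. \<bar>x - a i\<bar> < e i \<Longrightarrow> x \<in> X i"
    by metis
  \<comment> \<open>Only the finitely many coordinates below \<open>n\<close> constrain the radius;
    the element 1 keeps the minimum defined when \<open>n = 0\<close>.\<close>
  define d where "d = Min (insert 1 (e ` {..<n}))"
  have d: "d > 0" "\<And>i. i < n \<Longrightarrow> d \<le> e i"
    using e(1) by (auto simp: d_def)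
  have "box_nhd n a d \<subseteq> S"
  proof
    fix x assume x: "x \<in> box_nhd n a d"
    have "x i \<in> X i" for i
    proof (cases "i < n")
      case True
      then show ?thesis using box_nhdD[OF x True] d(2)[OF True] e(2) by auto
    next
      case False
      then have "x i = a i" using x a open_Rn_subset[OF S] by (auto simp: box_nhd_def Rn_iff)
      then show ?thesis using e by simp
    qed
    then have "x \<in> U" using X(3) by auto
    then show "x \<in> S" using U(2) x box_nhd_Rn by blast
  qed
  then show thesis using d that by blast
qed

lemma eventually_upd_in:
  assumes "openin (Euclidean_space n) S" "y \<in> S" "j < n"
  shows "eventually (\<lambda>t. y(j := t) \<in> S) (nhds (y j))"
proof -
  obtain e where e: "e > 0" "box_nhd n y e \<subseteq> S" using open_contains_box assms by metis
  have "y(j := t) \<in> S" if "dist t (y j) < e" for t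
  proof -
    have "y(j:=t) \<in> Rn n" using assms open_Rn_subset Rn_upd by blast
    then have "y(j:=t) \<in> box_nhd n y e" using that e by (auto simp: box_nhd_def dist_real_def)
    then show ?thesis using e by blast
  qed
  then show ?thesis using e eventually_nhds_metric by blast
qed

lemma eventually_curve_in:
  assumes S: "openin (Euclidean_space n) S" "c t0 \<in> S"
    and c: "\<And>i. i < n \<Longrightarrow> ((\<lambda>t. c t i) \<longlongrightarrow> c t0 i) F" "eventually (\<lambda>t. c t \<in> Rn n) F"
  shows "eventually (\<lambda>t. c t \<in> S) F"
proof -
  obtain e where e: "e > 0" "box_nhd n (c t0) e \<subseteq> S" using open_contains_box S by metis
  have "eventually (\<lambda>t. \<forall>i\<in>{..<n}. \<bar>c t i - c t0 i\<bar> < e) F"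
    using c(1) e(1) unfolding tendsto_iff dist_real_def
    by (intro eventually_ball_finite) auto
  then show ?thesis using c(2)
    by eventually_elim (use e in \<open>auto simp: box_nhd_def\<close>)
qed


subsection \<open>Functions of class C^k\<close>

lemma pdiff_eq: "((\<lambda>t. G (y(j := t))) has_real_derivative D) (at (y j)) \<Longrightarrow> pdiff j G y = D"
  by (simp add: pdiff_def DERIV_imp_deriv)

lemma pdiff_has_derivative:
  "(\<lambda>t. G (y(j := t))) differentiable (at (y j)) \<Longrightarrow>
   ((\<lambda>t. G (y(j := t))) has_real_derivative pdiff j G y) (at (y j))"
  unfolding pdiff_def by (simp add: DERIV_deriv_iff_real_differentiable)

text \<open>\<open>pdiff\<close> differentiates along a whole coordinate line, while functions read
  in charts are controlled only on an open set. Close to \<open>y\<close> the line stays in that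
  set, and the derivative at \<open>y\<close> sees nothing else.\<close>

lemma has_derivative_upd_cong:
  fixes G H :: "vec \<Rightarrow> real"
  assumes "openin (Euclidean_space n) S" "y \<in> S" "j < n" "\<forall>x\<in>S. G x = H x"
  shows "((\<lambda>t. G (y(j := t))) has_real_derivative D) (at (y j)) \<longleftrightarrow>
         ((\<lambda>t. H (y(j := t))) has_real_derivative D) (at (y j))"
  by (rule DERIV_cong_ev[OF refl _ refl])
     (use eventually_upd_in[OF assms(1-3)] assms(4) in \<open>auto elim: eventually_mono\<close>)

lemma differentiable_upd_cong:
  fixes G H :: "vec \<Rightarrow> real"
  assumes "openin (Euclidean_space n) S" "y \<in> S" "j < n" "\<forall>x\<in>S. G x = H x"
  shows "(\<lambda>t. G (y(j := t))) differentiable (at (y j)) \<longleftrightarrow>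
         (\<lambda>t. H (y(j := t))) differentiable (at (y j))"
  using has_derivative_upd_cong[OF assms] unfolding real_differentiable_def by simp

lemma pdiff_cong:
  assumes "openin (Euclidean_space n) S" "y \<in> S" "j < n" "\<forall>x\<in>S. G x = H x"
  shows "pdiff j G y = pdiff j H y"
  unfolding pdiff_def deriv_def using has_derivative_upd_cong[OF assms] by simp

text \<open>Smoothness in a form suited to induction: each order asks for one more partial
  derivative, so products, composites and local inverses can be treated order by order.
  \<open>smooth_fun_on_iff\<close> returns to the official notion.\<close>

fun Ck :: "nat \<Rightarrow> nat \<Rightarrow> vec set \<Rightarrow> (vec \<Rightarrow> real) \<Rightarrow> bool" where
  "Ck 0 n S G \<longleftrightarrow> continuous_on S G"
| "Ck (Suc k) n S G \<longleftrightarrow> continuous_on S G \<and>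
     (\<forall>j<n. (\<forall>y\<in>S. (\<lambda>t. G (y(j := t))) differentiable (at (y j))) \<and> Ck k n S (pdiff j G))"

lemma Ck_continuous: "Ck k n S G \<Longrightarrow> continuous_on S G"
  by (cases k) auto

lemma Ck_Suc_imp: "Ck (Suc k) n S G \<Longrightarrow> Ck k n S G"
  by (induction k arbitrary: G) auto

lemma Ck_le: "l \<le> k \<Longrightarrow> Ck k n S G \<Longrightarrow> Ck l n S G"
  by (induction rule: inc_induct) (use Ck_Suc_imp in blast)+

lemma pdiffs_append: "pdiffs (js @ [j]) G = pdiffs js (pdiff j G)"
  by (induction js) auto

text \<open>The recursion of \<open>Ck\<close> removes the derivative that is applied first, while
  the head of a list in \<open>pdiffs\<close> is the one applied last. Hence the list is split at
  its last element.\<close>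

lemma Ck_iff_pdiffs:
  "Ck k n S G \<longleftrightarrow> (\<forall>js. set js \<subseteq> {..<n} \<longrightarrow>
     (length js \<le> k \<longrightarrow> continuous_on S (pdiffs js G)) \<and>
     (length js < k \<longrightarrow> (\<forall>j<n. \<forall>y\<in>S. (\<lambda>t. pdiffs js G (y(j := t))) differentiable (at (y j)))))"
proof (induction k arbitrary: G)
  case 0
  show ?case by auto
next
  case (Suc k)
  show ?case (is "?L \<longleftrightarrow> ?R")
  proof
    assume L: ?L
    show ?R
    proof (intro allI impI)
      fix js :: "nat list" assume js: "set js \<subseteq> {..<n}"
      show "(length js \<le> Suc k \<longrightarrow> continuous_on S (pdiffs js G)) \<and>
        (length js < Suc k \<longrightarrow> (\<forall>j<n. \<forall>y\<in>S. (\<lambda>t. pdiffs js G (y(j := t))) differentiable (at (y j))))"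
      proof (cases js rule: rev_cases)
        case Nil
        then show ?thesis using L by auto
      next
        case (snoc ks i)
        then have "Ck k n S (pdiff i G)" using L js by auto
        then have "(length ks \<le> k \<longrightarrow> continuous_on S (pdiffs ks (pdiff i G))) \<and>
          (length ks < k \<longrightarrow> (\<forall>j<n. \<forall>y\<in>S. (\<lambda>t. pdiffs ks (pdiff i G) (y(j := t))) differentiable (at (y j))))"
          using js snoc unfolding Suc by (metis Un_subset_iff set_append)
        then show ?thesis unfolding snoc pdiffs_append by simp
      qed
    qed
  next
    assume R: ?R
    have "Ck k n S (pdiff j G)" if "j < n" for j
      unfolding Suc
    proof (intro allI impI)
      fix js :: "nat list" assume "set js \<subseteq> {..<n}"
      then show "(length js \<le> k \<longrightarrow> continuous_on S (pdiffs js (pdiff j G))) \<and>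
        (length js < k \<longrightarrow> (\<forall>ja<n. \<forall>y\<in>S. (\<lambda>t. pdiffs js (pdiff j G) (y(ja := t))) differentiable (at (y ja))))"
        using R[rule_format, of "js @ [j]"] that by (auto simp: pdiffs_append)
    qed
    moreover have "continuous_on S G" "\<forall>j<n. \<forall>y\<in>S. (\<lambda>t. G (y(j := t))) differentiable (at (y j))"
      using R[rule_format, of "[]"] by auto
    ultimately show ?L by auto
  qed
qed

lemma smooth_fun_on_iff: "S \<subseteq> Rn n \<Longrightarrow> smooth_fun_on n S G \<longleftrightarrow> (\<forall>k. Ck k n S G)"
  unfolding smooth_fun_on_def Ck_iff_pdiffs
  by (simp add: continuous_map_Euclidean_sub) (meson lessI order_refl)

lemma Ck_cong:
  assumes S: "openin (Euclidean_space n) S" and GH: "\<And>x. x \<in> S \<Longrightarrow> G x = H x"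
  shows "Ck k n S G \<longleftrightarrow> Ck k n S H"
proof -
  have "\<forall>x\<in>S. G x = H x" using GH by blast
  then show ?thesis
proof (induction k arbitrary: G H)
  case 0
  then show ?case by (auto cong: continuous_on_cong)
next
  case (Suc k)
  have "continuous_on S G \<longleftrightarrow> continuous_on S H" using Suc.prems by (auto cong: continuous_on_cong)
  moreover have "Ck k n S (pdiff j G) \<longleftrightarrow> Ck k n S (pdiff j H)" if "j < n" for j
    using Suc.IH[of "pdiff j G" "pdiff j H"] pdiff_cong[OF S _ that Suc.prems] by blast
  ultimately show ?case
    using differentiable_upd_cong[OF S _ _ Suc.prems] unfolding Ck.simps by blast
qed
qed

lemma Ck_subset: "Ck k n S G \<Longrightarrow> T \<subseteq> S \<Longrightarrow> Ck k n T G"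
proof (induction k arbitrary: G)
  case (Suc k)
  then show ?case by (simp add: subset_iff) (meson continuous_on_subset subsetI)
qed (simp add: continuous_on_subset)

text \<open>Continuity is the clause with content: a relatively open neighbourhood of
  \<open>y\<close> does not change the filter \<open>at y within S\<close>. Differentiability is a
  condition at single points, and the recursive clause is the induction hypothesis.\<close>

lemma Ck_local:
  assumes S: "openin (Euclidean_space n) S"
    and loc: "\<And>y. y \<in> S \<Longrightarrow> \<exists>T. openin (Euclidean_space n) T \<and> y \<in> T \<and> Ck k n T G"
  shows "Ck k n S G"
proof -
  have cont: "continuous_on S G" if loc: "\<forall>y\<in>S. \<exists>T. openin (Euclidean_space n) T \<and> y \<in> T \<and> continuous_on T G"
    for G :: "vec \<Rightarrow> real"
  proof -
    have "continuous (at y within S) G" if y: "y \<in> S" for y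
    proof -
      obtain T where T: "openin (Euclidean_space n) T" "y \<in> T" "continuous_on T G" using loc y by blast
      obtain U where U: "open U" "T = Rn n \<inter> U"
        using T(1) unfolding openin_Rn by (auto simp: openin_open)
      have "continuous_on (S \<inter> U) G"
        using T(3) U open_Rn_subset[OF S] by (metis continuous_on_subset inf_mono order_refl)
      then have "continuous (at y within S \<inter> U) G"
        using y T(2) U by (auto simp: continuous_on_eq_continuous_within)
      moreover have "at y within U \<inter> S = at y within S"
        using U T(2) by (intro at_within_nhd[of _ U]) auto
      ultimately show ?thesis by (simp add: Int_commute)
    qed
    then show ?thesis by (simp add: continuous_on_eq_continuous_within)
  qed
  show ?thesis using loc
  proof (induction k arbitrary: G)
    case 0
    then show ?case using cont[of G] by simp
  next
    case (Suc k)
    have "continuous_on S G"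
    proof (rule cont, intro ballI)
      fix y assume "y \<in> S"
      then show "\<exists>T. openin (Euclidean_space n) T \<and> y \<in> T \<and> continuous_on T G"
        using Suc.prems[of y] Ck_continuous by blast
    qed
    moreover have "Ck k n S (pdiff j G)" if "j < n" for j
    proof (rule Suc.IH)
      fix y assume "y \<in> S"
      then show "\<exists>T. openin (Euclidean_space n) T \<and> y \<in> T \<and> Ck k n T (pdiff j G)"
        using Suc.prems[of y] that unfolding Ck.simps by blast
    qed
    moreover have "(\<lambda>t. G (y(j := t))) differentiable (at (y j))" if "j < n" "y \<in> S" for y j
      using Suc.prems[OF that(2)] that unfolding Ck.simps by blast
    ultimately show ?case unfolding Ck.simps by blast
  qed
qed

lemma pdiff_const: "pdiff j (\<lambda>_. c) = (\<lambda>_. 0)"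
  by (rule ext, rule pdiff_eq) simp

lemma Ck_const: "Ck k n S (\<lambda>_. c)"
  by (induction k arbitrary: c) (auto simp: pdiff_const)

lemma has_derivative_coord:
  "((\<lambda>t. (y(j := t)) i) has_real_derivative (if i = j then 1 else 0)) (at (y j :: real))"
  by (cases "i = j") auto

lemma pdiff_coord: "pdiff j (\<lambda>y. y i) = (\<lambda>_. if i = j then 1 else 0)"
  by (rule ext, rule pdiff_eq) (rule has_derivative_coord)

lemma Ck_coord: "Ck k n S (\<lambda>y. y i)"
proof (cases k)
  case (Suc l)
  then show ?thesis
    using has_derivative_coord[of _ _ i] unfolding Suc Ck.simps pdiff_coord real_differentiable_def
    by (blast intro: Ck_const continuous_on_coord)
qed (simp add: continuous_on_coord)

lemma pdiff_add:
  assumes "(\<lambda>t. G (y(j := t))) differentiable (at (y j))" "(\<lambda>t. H (y(j := t))) differentiable (at (y j))"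
  shows "pdiff j (\<lambda>y. G y + H y) y = pdiff j G y + pdiff j H y"
  by (rule pdiff_eq) (intro DERIV_add pdiff_has_derivative assms)

lemma pdiff_mult:
  assumes "(\<lambda>t. G (y(j := t))) differentiable (at (y j))" "(\<lambda>t. H (y(j := t))) differentiable (at (y j))"
  shows "pdiff j (\<lambda>y. G y * H y) y = pdiff j G y * H y + pdiff j H y * G y"
proof (rule pdiff_eq)
  show "((\<lambda>t. G (y(j := t)) * H (y(j := t))) has_real_derivative pdiff j G y * H y + pdiff j H y * G y) (at (y j))"
    using DERIV_mult[OF pdiff_has_derivative[OF assms(1)] pdiff_has_derivative[OF assms(2)]] by (simp only: fun_upd_triv)
qed

context
  fixes n :: nat and S :: "vec set"
  assumes S: "openin (Euclidean_space n) S"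
begin

lemma Ck_add: "Ck k n S G \<Longrightarrow> Ck k n S H \<Longrightarrow> Ck k n S (\<lambda>y. G y + H y)"
proof (induction k arbitrary: G H)
  case 0
  then show ?case by (auto intro: continuous_intros)
next
  case (Suc k)
  have "Ck k n S (pdiff j (\<lambda>y. G y + H y))" if "j < n" for j
    using Suc that by (subst Ck_cong[OF S pdiff_add]) auto
  then show ?case using Suc.prems by (auto intro!: continuous_intros derivative_intros)
qed

lemma Ck_mult: "Ck k n S G \<Longrightarrow> Ck k n S H \<Longrightarrow> Ck k n S (\<lambda>y. G y * H y)"
proof (induction k arbitrary: G H)
  case 0
  then show ?case by (auto intro: continuous_intros)
next
  case (Suc k)
  have "Ck k n S (pdiff j (\<lambda>y. G y * H y))" if "j < n" for j
    using Suc.prems that Suc_le_eq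
    by (subst Ck_cong[OF S pdiff_mult]) (auto intro!: Ck_add Suc.IH Ck_Suc_imp[OF Suc.prems(1)] Ck_Suc_imp[OF Suc.prems(2)])
  then show ?case using Suc.prems by (auto intro!: continuous_intros derivative_intros)
qed

lemma Ck_sum: "(\<And>i. i \<in> I \<Longrightarrow> Ck k n S (G i)) \<Longrightarrow> Ck k n S (\<lambda>y. \<Sum>i\<in>I. G i y)"
  by (induction I rule: infinite_finite_induct) (auto intro: Ck_const Ck_add)

end

subsection \<open>The mean value theorem and the chain rule\<close>

lemma mvt_coordinate:
  assumes d: "\<And>s. min a b \<le> s \<Longrightarrow> s \<le> max a b \<Longrightarrow> (h has_real_derivative h' s) (at s)"
  shows "\<exists>\<xi>. min a b \<le> \<xi> \<and> \<xi> \<le> max a b \<and> h b - h a = h' \<xi> * (b - a)"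
proof -
  consider "a = b" | "a < b" | "b < a" by linarith
  then show ?thesis
  proof cases
    case 2
    then obtain z where "z > a" "z < b" "h b - h a = (b - a) * h' z"
      using MVT2[of a b h h'] d by auto
    then show ?thesis by (intro exI[of _ z]) auto
  next
    case 3
    then obtain z where "z > b" "z < a" "h a - h b = (a - b) * h' z"
      using MVT2[of b a h h'] d by auto
    then show ?thesis by (intro exI[of _ z]) (auto simp: algebra_simps)
  qed auto
qed

text \<open>The increment is telescoped along the path from \<open>y\<close> to \<open>x\<close> parallel to the axes.\<close>

lemma mvt_box:
  assumes sub: "box_nhd n a e \<subseteq> S" and x: "x \<in> box_nhd n a e" and y: "y \<in> box_nhd n a e"
    and G: "\<forall>j<n. \<forall>z\<in>S. (\<lambda>t. G (z(j := t))) differentiable (at (z j))"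
  shows "\<exists>\<xi>. (\<forall>i<n. \<xi> i \<in> box_nhd n a e \<and> (\<forall>k<n. \<bar>\<xi> i k - y k\<bar> \<le> \<bar>x k - y k\<bar>)) \<and>
     G x - G y = (\<Sum>i<n. pdiff i G (\<xi> i) * (x i - y i))"
proof -
  define m where "m i = (\<lambda>k. if k < i then x k else y k)" for i :: nat
  have m0: "m 0 = y" by (simp add: m_def)
  have mn: "m n = x"
    using x y by (auto simp: m_def box_nhd_def Rn_iff)
  have mS: "m (Suc i) = (m i)(i := x i)" for i
    by (auto simp: m_def)
  have mi: "m i i = y i" for i by (simp add: m_def)
  have between: "\<bar>s - c\<bar> < e" if "min u v \<le> s" "s \<le> max u v" "\<bar>u - c\<bar> < e" "\<bar>v - c\<bar> < e" for s u v c :: real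
    using that by (auto simp: min_def max_def split: if_splits)
  have between': "\<bar>s - v\<bar> \<le> \<bar>u - v\<bar>" if "min v u \<le> s" "s \<le> max v u" for s u v :: real
    using that by (auto simp: min_def max_def split: if_splits)
  have inb: "(m i)(i := s) \<in> box_nhd n a e" if "i < n" "min (y i) (x i) \<le> s" "s \<le> max (y i) (x i)" for i s
    using that x y between[OF that(2,3)] by (auto simp: m_def box_nhd_def Rn_iff)
  have "\<exists>s. min (y i) (x i) \<le> s \<and> s \<le> max (y i) (x i) \<and>
      G (m (Suc i)) - G (m i) = pdiff i G ((m i)(i := s)) * (x i - y i)" if i: "i < n" for i
  proof -
    have "((\<lambda>t. G ((m i)(i := t))) has_real_derivative pdiff i G ((m i)(i := s))) (at s)"
      if "min (y i) (x i) \<le> s" "s \<le> max (y i) (x i)" for s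
    proof -
      have "(m i)(i := s) \<in> S" using inb[OF i that] sub by blast
      from pdiff_has_derivative[OF G[rule_format, OF i this]] show ?thesis
        by (simp only: fun_upd_upd fun_upd_same)
    qed
    from mvt_coordinate[OF this] show ?thesis
      by (metis mS mi fun_upd_triv)
  qed
  then obtain s where s: "\<And>i. i < n \<Longrightarrow> min (y i) (x i) \<le> s i \<and> s i \<le> max (y i) (x i) \<and>
      G (m (Suc i)) - G (m i) = pdiff i G ((m i)(i := s i)) * (x i - y i)" by metis
  have "G x - G y = (\<Sum>i<n. G (m (Suc i)) - G (m i))"
    using sum_lessThan_telescope[of "\<lambda>i. G (m i)" n] by (simp add: mn m0)
  also have "\<dots> = (\<Sum>i<n. pdiff i G ((m i)(i := s i)) * (x i - y i))"
    using s by (intro sum.cong) auto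
  finally have "G x - G y = (\<Sum>i<n. pdiff i G ((m i)(i := s i)) * (x i - y i))" .
  moreover have "(m i)(i := s i) \<in> box_nhd n a e" if "i < n" for i using inb s that by blast
  moreover have "\<bar>((m i)(i := s i)) k - y k\<bar> \<le> \<bar>x k - y k\<bar>" if "i < n" for i k
    using s[OF that] between'[of "y i" "x i" "s i"] by (auto simp: m_def)
  ultimately show ?thesis by (intro exI[of _ "\<lambda>i. (m i)(i := s i)"]) auto
qed

lemma continuous_on_box:
  assumes S: "openin (Euclidean_space n) S" and G: "continuous_on S G" and y: "y \<in> S" and e: "0 < (e::real)"
  obtains d where "0 < d" "box_nhd n y d \<subseteq> S" "\<And>x. x \<in> box_nhd n y d \<Longrightarrow> \<bar>G x - G y\<bar> < e"
proof -
  have "continuous_on S (\<lambda>x. \<bar>G x - G y\<bar>)" by (intro continuous_intros G)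
  from openin_Collect_less[OF S this, of e] obtain d where "0 < d" "box_nhd n y d \<subseteq> {x \<in> S. \<bar>G x - G y\<bar> < e}"
    using open_contains_box[of n "{x \<in> S. \<bar>G x - G y\<bar> < e}" y] y e by auto
  then show thesis using that by blast
qed

text \<open>The increment of \<open>G\<close> is a combination of the coordinate increments of the
  curve with mean value slopes as coefficients. The slopes converge because the partial derivatives
  are continuous, the difference quotients of the coordinates by assumption.\<close>

lemma chain_rule_curve:
  assumes S: "openin (Euclidean_space n) S" and G: "Ck (Suc 0) n S G" and c0: "c t0 \<in> S"
    and cR: "eventually (\<lambda>t. c t \<in> Rn n) (at t0)"
    and cd: "\<And>i. i < n \<Longrightarrow> ((\<lambda>t. c t i) has_real_derivative d i) (at t0)"
  shows "((\<lambda>t. G (c t)) has_real_derivative (\<Sum>i<n. pdiff i G (c t0) * d i)) (at t0)"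
proof -
  define y where "y = c t0"
  obtain e where e: "0 < e" "box_nhd n y e \<subseteq> S" using open_contains_box[OF S] c0 y_def by blast
  \<comment> \<open>The slopes \<open>q\<close> are partial derivatives at points that are, in every
    coordinate, no farther from \<open>y\<close> than \<open>x\<close> is. This forces them to
    converge as \<open>x\<close> tends to \<open>y\<close>.\<close>
  define good where "good x q \<longleftrightarrow> (\<exists>\<xi>. (\<forall>i<n. \<xi> i \<in> box_nhd n y e \<and> (\<forall>k<n. \<bar>\<xi> i k - y k\<bar> \<le> \<bar>x k - y k\<bar>) \<and> q i = pdiff i G (\<xi> i)) \<and>
     G x - G y = (\<Sum>i<n. q i * (x i - y i)))" for x and q :: "nat \<Rightarrow> real"
  have yb: "y \<in> box_nhd n y e" using e c0 y_def open_Rn_subset[OF S] by (auto intro: box_nhd_center)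
  have "\<exists>q. good x q" if xb: "x \<in> box_nhd n y e" for x
  proof -
    obtain \<xi> where "\<forall>i<n. \<xi> i \<in> box_nhd n y e \<and> (\<forall>k<n. \<bar>\<xi> i k - y k\<bar> \<le> \<bar>x k - y k\<bar>)"
      "G x - G y = (\<Sum>i<n. pdiff i G (\<xi> i) * (x i - y i))"
      using mvt_box[where G = G, OF e(2) xb yb] G unfolding Ck.simps by blast
    then show ?thesis unfolding good_def by (intro exI[of _ "\<lambda>i. pdiff i G (\<xi> i)"] exI[of _ \<xi>]) auto
  qed
  then obtain q where q: "\<And>x. x \<in> box_nhd n y e \<Longrightarrow> good x (q x)" by metis
  have lim: "((\<lambda>t. c t i) \<longlongrightarrow> c t0 i) (at t0)" if "i < n" for i
    using cd[OF that] DERIV_isCont isCont_def by blast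
  have qlim: "((\<lambda>t. q (c t) i) \<longlongrightarrow> pdiff i G y) (at t0)" if i: "i < n" for i
    unfolding tendsto_iff dist_real_def
  proof (intro allI impI)
    fix r :: real assume "r > 0"
    have "continuous_on S (pdiff i G)" using G i by simp
    from continuous_on_box[OF S this _ \<open>r > 0\<close>, of y] c0 y_def
    obtain \<delta> where \<delta>: "\<delta> > 0" "box_nhd n y \<delta> \<subseteq> S" "\<And>x. x \<in> box_nhd n y \<delta> \<Longrightarrow> \<bar>pdiff i G x - pdiff i G y\<bar> < r"
      by metis
    have "eventually (\<lambda>t. c t \<in> box_nhd n y (min \<delta> e)) (at t0)"
      using \<delta>(1) e c0 y_def open_Rn_subset[OF S] lim cR
      by (intro eventually_curve_in[OF openin_box_nhd]) (auto intro: box_nhd_center)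
    then show "\<forall>\<^sub>F t in at t0. \<bar>q (c t) i - pdiff i G y\<bar> < r"
    proof eventually_elim
      case (elim t)
      then have "c t \<in> box_nhd n y e" "c t \<in> box_nhd n y \<delta>"
        by (auto simp: box_nhd_def)
      with q[of "c t"] i obtain \<xi> where \<xi>: "\<xi> \<in> box_nhd n y e" "\<And>k. k < n \<Longrightarrow> \<bar>\<xi> k - y k\<bar> \<le> \<bar>c t k - y k\<bar>"
        "q (c t) i = pdiff i G \<xi>" unfolding good_def by auto
      have "\<xi> \<in> box_nhd n y \<delta>"
        using \<xi>(1,2) \<open>c t \<in> box_nhd n y \<delta>\<close> by (fastforce simp: box_nhd_def)
      then show ?case using \<delta>(3) \<xi>(3) by simp
    qed
  qed
  have "((\<lambda>t. \<Sum>i<n. q (c t) i * ((c t i - c t0 i) / (t - t0))) \<longlongrightarrow> (\<Sum>i<n. pdiff i G y * d i)) (at t0)"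
    using cd unfolding has_field_derivative_iff by (intro tendsto_intros qlim) auto
  moreover have "eventually (\<lambda>t. (\<Sum>i<n. q (c t) i * ((c t i - c t0 i) / (t - t0))) = (G (c t) - G (c t0)) / (t - t0)) (at t0)"
  proof -
    have "eventually (\<lambda>t. c t \<in> box_nhd n y e) (at t0)"
      using e c0 y_def open_Rn_subset[OF S] lim cR
      by (intro eventually_curve_in[OF openin_box_nhd]) (auto intro: box_nhd_center)
    then show ?thesis
    proof eventually_elim
      case (elim t)
      from q[OF this] show ?case unfolding good_def y_def by (auto simp: sum_divide_distrib)
    qed
  qed
  ultimately show ?thesis
    unfolding has_field_derivative_iff y_def by (rule Lim_transform_eventually)
qed

lemma chain_rule:
  assumes S: "openin (Euclidean_space m) S" and T: "openin (Euclidean_space n) T"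
    and F: "\<And>y. y \<in> S \<Longrightarrow> F y \<in> T"
      "\<And>i. i < n \<Longrightarrow> (\<lambda>t. F (y(j := t)) i) differentiable (at (y j))"
    and G: "Ck (Suc 0) n T G" and y: "y \<in> S" and j: "j < m"
  shows "((\<lambda>t. G (F (y(j := t)))) has_real_derivative
     (\<Sum>i<n. pdiff i G (F y) * pdiff j (\<lambda>y. F y i) y)) (at (y j))"
proof -
  have "eventually (\<lambda>t. F (y(j := t)) \<in> Rn n) (nhds (y j))"
    using eventually_upd_in[OF S y j] F open_Rn_subset[OF T]  by (force elim: eventually_mono)
  then have ev: "eventually (\<lambda>t. F (y(j := t)) \<in> Rn n) (at (y j))"
    by (simp add: eventually_nhds_conv_at)
  show ?thesis
    using chain_rule_curve[OF T G _ ev, of "\<lambda>i. pdiff j (\<lambda>y. F y i) y"]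
      pdiff_has_derivative[where G = "\<lambda>y. F y _", OF F(2)] F(1)[OF y] by simp
qed

lemma pdiff_compose:
  assumes "openin (Euclidean_space m) S" "openin (Euclidean_space n) T"
    and "\<And>y. y \<in> S \<Longrightarrow> F y \<in> T" "\<And>i. i < n \<Longrightarrow> Ck (Suc 0) m S (\<lambda>y. F y i)"
    and "Ck (Suc 0) n T G" "y \<in> S" "j < m"
  shows "pdiff j (\<lambda>y. G (F y)) y = (\<Sum>i<n. pdiff i G (F y) * pdiff j (\<lambda>y. F y i) y)"
proof (rule pdiff_eq, rule chain_rule[OF assms(1,2)])
  show "(\<lambda>t. F (y(j := t)) i) differentiable at (y j)" if "i < n" for i
    using assms(4)[OF that] assms(6,7) unfolding Ck.simps by blast
qed (use assms in auto)

text \<open>By the chain rule a partial derivative of the composite is a sum of products; one factor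
  is again a composite, of lower order, and the other is a derivative of \<open>F\<close>.\<close>

lemma Ck_compose:
  assumes S: "openin (Euclidean_space m) S" and T: "openin (Euclidean_space n) T"
    and F: "\<And>y. y \<in> S \<Longrightarrow> F y \<in> T"
  shows "(\<And>i. i < n \<Longrightarrow> Ck k m S (\<lambda>y. F y i)) \<Longrightarrow> Ck k n T G \<Longrightarrow> Ck k m S (\<lambda>y. G (F y))"
proof (induction k arbitrary: G)
  case 0
  have "continuous_on S F"
  proof (rule continuous_on_coordinatewise_then_product)
    fix i show "continuous_on S (\<lambda>x. F x i)"
    proof (cases "i < n")
      case False
      then have "F x i = 0" if "x \<in> S" for x
        using F[OF that] open_Rn_subset[OF T] by (auto simp: Rn_iff)
      then show ?thesis by (metis (mono_tags, lifting) continuous_on_cong continuous_on_const)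
    qed (use 0 in auto)
  qed
  then show ?case using 0 F continuous_on_compose2[of T G S F] by (auto simp: image_subset_iff)
next
  case (Suc k)
  have 1: "\<And>i. i < n \<Longrightarrow> Ck k m S (\<lambda>y. F y i)" using Suc.prems Ck_Suc_imp by blast
  have F1: "\<And>i. i < n \<Longrightarrow> Ck (Suc 0) m S (\<lambda>y. F y i)" and G1: "Ck (Suc 0) n T G"
    using Suc.prems Ck_le[of "Suc 0" "Suc k"] by blast+
  have "continuous_on S (\<lambda>y. G (F y))"
    using Suc.IH[OF 1 Ck_Suc_imp[OF Suc.prems(2)]] Ck_continuous by blast
  moreover have "(\<lambda>t. G (F (y(j := t)))) differentiable (at (y j))" if "y \<in> S" "j < m" for y j
  proof -
    have "(\<lambda>t. F (y(j := t)) i) differentiable (at (y j))" if "i < n" for i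
      using F1[OF that] \<open>y \<in> S\<close> \<open>j < m\<close> unfolding Ck.simps by blast
    from chain_rule[OF S T F this G1 that] show ?thesis
      by (auto simp only: real_differentiable_def)
  qed
  moreover have "Ck k m S (pdiff j (\<lambda>y. G (F y)))" if "j < m" for j
  proof -
    have "Ck k m S (\<lambda>x. \<Sum>i<n. pdiff i G (F x) * pdiff j (\<lambda>y. F y i) x)"
    proof (intro Ck_sum[OF S] Ck_mult[OF S])
      fix i assume "i \<in> {..<n}"
      then show "Ck k m S (\<lambda>x. pdiff i G (F x))"
        using Suc.IH[OF 1] Suc.prems(2) by simp
      show "Ck k m S (pdiff j (\<lambda>y. F y i))"
        using Suc.prems(1)[of i] \<open>i \<in> {..<n}\<close> that by simp
    qed
    moreover have "pdiff j (\<lambda>y. G (F y)) y = (\<Sum>i<n. pdiff i G (F y) * pdiff j (\<lambda>y. F y i) y)" if "y \<in> S" for y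
      by (rule pdiff_compose[OF S T F F1 G1 that \<open>j < m\<close>])
    ultimately show ?thesis using Ck_cong[OF S, where G = "pdiff j (\<lambda>y. G (F y))" and k = k] by simp
  qed
  ultimately show ?case unfolding Ck.simps by blast
qed

lemma smooth_compose:
  assumes "openin (Euclidean_space m) S" "openin (Euclidean_space n) T"
    and "\<And>y. y \<in> S \<Longrightarrow> F y \<in> T" "\<And>i. i < n \<Longrightarrow> smooth_fun_on m S (\<lambda>y. F y i)" "smooth_fun_on n T G"
  shows "smooth_fun_on m S (\<lambda>y. G (F y))"
  using assms(4,5) Ck_compose[OF assms(1,2), of F] assms(3) open_Rn_subset[OF assms(1)] open_Rn_subset[OF assms(2)]
  by (simp add: smooth_fun_on_iff)

subsection \<open>Symmetry of second derivatives\<close>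

text \<open>Two applications of the mean value theorem to the second difference over a square of
  side \<open>h\<close>: in direction \<open>i\<close> to the difference of two parallel edges, then
  in direction \<open>j\<close> to \<open>pdiff i G\<close>.\<close>

lemma second_difference:
  assumes sub: "box_nhd n a e \<subseteq> S" and a: "a \<in> Rn n"
    and G: "Ck 2 n S G" and ij: "i < n" "j < n" "i \<noteq> j" and h: "0 < h" "h < e"
  shows "\<exists>\<xi>\<in>box_nhd n a e. (\<forall>k<n. \<bar>\<xi> k - a k\<bar> \<le> h) \<and>
    G (a(i := a i + h, j := a j + h)) - G (a(i := a i + h)) - G (a(j := a j + h)) + G a =
      h * h * pdiff j (pdiff i G) \<xi>"
proof -
  have inb: "a(i := s, j := t) \<in> box_nhd n a e"
    if "a i \<le> s" "s \<le> a i + h" "a j \<le> t" "t \<le> a j + h" for s t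
    using that h ij a by (auto simp: box_nhd_def Rn_iff)
  have G2: "Ck (Suc (Suc 0)) n S G" using G by (simp add: numeral_2_eq_2)
  have d1: "((\<lambda>t. G (y(i := t))) has_real_derivative pdiff i G y) (at (y i))" if "y \<in> S" for y
    using G2 ij that by (intro pdiff_has_derivative) auto
  have d2: "((\<lambda>t. pdiff i G (y(j := t))) has_real_derivative pdiff j (pdiff i G) y) (at (y j))" if "y \<in> S" for y
    using G2 ij that by (intro pdiff_has_derivative) auto
  define \<phi> where "\<phi> s = G (a(i := s, j := a j + h)) - G (a(i := s, j := a j))" for s
  have "((\<lambda>s. \<phi> s) has_real_derivative pdiff i G (a(i := s, j := a j + h)) - pdiff i G (a(i := s, j := a j))) (at s)"
    if "a i \<le> s" "s \<le> a i + h" for s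
  proof -
    have "((\<lambda>s. G (a(i := s, j := t))) has_real_derivative pdiff i G (a(i := s, j := t))) (at s)"
      if "a j \<le> t" "t \<le> a j + h" for t
    proof -
      have "a(i := s, j := t) \<in> S" using inb \<open>a i \<le> s\<close> \<open>s \<le> a i + h\<close> that sub by blast
      from d1[OF this] ij show ?thesis by (simp add: fun_upd_twist)
    qed
    from this[of "a j + h"] this[of "a j"] show ?thesis
      unfolding \<phi>_def using h by (intro DERIV_diff) auto
  qed
  from MVT2[of "a i" "a i + h" \<phi>, OF _ this] h obtain s where
    s: "a i < s" "s < a i + h" "\<phi> (a i + h) - \<phi> (a i) = h * (pdiff i G (a(i := s, j := a j + h)) - pdiff i G (a(i := s, j := a j)))"
    by auto
  have "((\<lambda>t. pdiff i G (a(i := s, j := t))) has_real_derivative pdiff j (pdiff i G) (a(i := s, j := t))) (at t)"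
    if "a j \<le> t" "t \<le> a j + h" for t
  proof -
    have "a(i := s, j := t) \<in> S" using inb s that sub by fastforce
    from d2[OF this] show ?thesis by simp
  qed
  from MVT2[of "a j" "a j + h" "\<lambda>t. pdiff i G (a(i := s, j := t))", OF _ this] h obtain t where
    t: "a j < t" "t < a j + h" "pdiff i G (a(i := s, j := a j + h)) - pdiff i G (a(i := s, j := a j)) =
       h * pdiff j (pdiff i G) (a(i := s, j := t))"
    by auto
  have "a(i := s, j := t) \<in> box_nhd n a e" using inb s t by simp
  moreover have "\<forall>k<n. \<bar>(a(i := s, j := t)) k - a k\<bar> \<le> h" using s t h by auto
  moreover have "a(i := a i + h, j := a j) = a(i := a i + h)" "a(i := a i, j := a j + h) = a(j := a j + h)"
     "a(i := a i, j := a j) = a"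
    using ij by (auto simp: fun_eq_iff)
  ultimately show ?thesis
    using s(3) unfolding t(3) \<phi>_def by (intro bexI[of _ "a(i := s, j := t)"]) (auto simp: algebra_simps)
qed

text \<open>The second difference is symmetric in \<open>i\<close> and \<open>j\<close>, so the two
  mixed derivatives agree at suitable points near \<open>y\<close>. By continuity their values at
  \<open>y\<close> differ by less than any positive bound.\<close>

lemma pdiff_commute:
  assumes S: "openin (Euclidean_space n) S" and G: "Ck 2 n S G" and y: "y \<in> S" and ij: "i < n" "j < n"
  shows "pdiff i (pdiff j G) y = pdiff j (pdiff i G) y"
proof (cases "i = j")
  case False
  define D where "D = pdiff j (pdiff i G) y - pdiff i (pdiff j G) y"
  have "\<bar>D\<bar> < 2 * r" if "r > 0" for r
  proof -
    have G2: "Ck (Suc (Suc 0)) n S G" using G by (simp add: numeral_2_eq_2)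
    obtain d1 where d1: "0 < d1" "box_nhd n y d1 \<subseteq> S"
      "\<And>x. x \<in> box_nhd n y d1 \<Longrightarrow> \<bar>pdiff j (pdiff i G) x - pdiff j (pdiff i G) y\<bar> < r"
      using continuous_on_box[OF S _ y \<open>r > 0\<close>, of "pdiff j (pdiff i G)"] G2 ij by auto
    obtain d2 where d2: "0 < d2" "box_nhd n y d2 \<subseteq> S"
      "\<And>x. x \<in> box_nhd n y d2 \<Longrightarrow> \<bar>pdiff i (pdiff j G) x - pdiff i (pdiff j G) y\<bar> < r"
      using continuous_on_box[OF S _ y \<open>r > 0\<close>, of "pdiff i (pdiff j G)"] G2 ij by auto
    define d where "d = min d1 d2"
    have d: "0 < d" "box_nhd n y d \<subseteq> S" "box_nhd n y d \<subseteq> box_nhd n y d1" "box_nhd n y d \<subseteq> box_nhd n y d2"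
      using d1 d2 box_nhd_mono[of d d1 n y] box_nhd_mono[of d d2 n y] by (auto simp: d_def)
    have yR: "y \<in> Rn n" using y open_Rn_subset[OF S] by blast
    obtain \<xi> where \<xi>: "\<xi> \<in> box_nhd n y d" "G (y(i := y i + d/2, j := y j + d/2)) - G (y(i := y i + d/2)) - G (y(j := y j + d/2)) + G y =
      d/2 * (d/2) * pdiff j (pdiff i G) \<xi>"
      using second_difference[OF d(2) yR G ij False, of "d/2"] d by auto
    obtain \<zeta> where \<zeta>: "\<zeta> \<in> box_nhd n y d" "G (y(j := y j + d/2, i := y i + d/2)) - G (y(j := y j + d/2)) - G (y(i := y i + d/2)) + G y =
      d/2 * (d/2) * pdiff i (pdiff j G) \<zeta>"
      using second_difference[OF d(2) yR G ij(2,1) False[symmetric], of "d/2"] d by auto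
    have "y(j := y j + d/2, i := y i + d/2) = y(i := y i + d/2, j := y j + d/2)"
      using False by (auto simp: fun_upd_twist)
    then have "d/2 * (d/2) * pdiff j (pdiff i G) \<xi> = d/2 * (d/2) * pdiff i (pdiff j G) \<zeta>"
      unfolding \<xi>(2)[symmetric] \<zeta>(2)[symmetric] by simp
    then have "pdiff j (pdiff i G) \<xi> = pdiff i (pdiff j G) \<zeta>" using d(1) by simp
    then show ?thesis using d1(3)[of \<xi>] d2(3)[of \<zeta>] \<xi>(1) \<zeta>(1) d(3,4) unfolding D_def by fastforce
  qed
  from this[of "\<bar>D\<bar> / 2"] show ?thesis unfolding D_def by (cases "D = 0") (auto simp: D_def)
qed simp


subsection \<open>Local inversion\<close>

text \<open>A product over all indices of closed intervals below \<open>n\<close> and of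
  \<open>{0}\<close> from \<open>n\<close> on, to which Tychonoff's theorem applies.\<close>

lemma compact_closed_box: "compact {x \<in> Rn n. \<forall>i<n. \<bar>x i - a i\<bar> \<le> C}"
proof -
  have "{x \<in> Rn n. \<forall>i<n. \<bar>x i - a i\<bar> \<le> C} = (\<Pi>\<^sub>E i\<in>UNIV. if i < n then cball (a i) C else {0})"
    by (auto simp: Rn_iff PiE_iff dist_real_def abs_minus_commute split: if_splits)
  moreover have "compactin (product_topology (\<lambda>i. euclideanreal) UNIV) (\<Pi>\<^sub>E i\<in>UNIV. if i < n then cball (a i) C else {0})"
    unfolding compactin_PiE by auto
  ultimately show ?thesis by (simp add: euclidean_product_topology)
qed

section \<open>Small perturbations of the identity in the sum norm\<close>

definition norm1 :: "nat \<Rightarrow> vec \<Rightarrow> real"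
  where "norm1 n v = (\<Sum>i<n. \<bar>v i\<bar>)"

lemma norm1_nonneg [simp]: "0 \<le> norm1 n v"
  by (simp add: norm1_def sum_nonneg)

lemma norm1_component: "i < n \<Longrightarrow> \<bar>v i\<bar> \<le> norm1 n v"
  unfolding norm1_def by (rule member_le_sum) auto

lemma norm1_triangle: "norm1 n (\<lambda>i. v i + w i) \<le> norm1 n v + norm1 n w"
  unfolding norm1_def sum.distrib[symmetric] by (rule sum_mono) (rule abs_triangle_ineq)

lemma norm1_minus_commute: "norm1 n (\<lambda>i. v i - w i) = norm1 n (\<lambda>i. w i - v i)"
  unfolding norm1_def by (simp add: abs_minus_commute)

lemma norm1_eq_0: "norm1 n v = 0 \<longleftrightarrow> (\<forall>i<n. v i = 0)"
  unfolding norm1_def by (subst sum_nonneg_eq_0_iff) auto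

lemma norm1_matrix:
  fixes \<eta> :: real
  assumes "\<And>i k. i < n \<Longrightarrow> k < n \<Longrightarrow> \<bar>M i k\<bar> \<le> \<eta>" "n * \<eta> \<le> c"
  shows "norm1 n (\<lambda>i. \<Sum>k<n. M i k * v k) \<le> c * norm1 n v"
proof -
  have "norm1 n (\<lambda>i. \<Sum>k<n. M i k * v k) \<le> (\<Sum>i<n. \<Sum>k<n. \<eta> * \<bar>v k\<bar>)"
    unfolding norm1_def
  proof (rule sum_mono)
    fix i assume "i \<in> {..<n}"
    then have "\<bar>M i k * v k\<bar> \<le> \<eta> * \<bar>v k\<bar>" if "k < n" for k
      using assms(1) that by (simp add: abs_mult mult_right_mono)
    then show "\<bar>\<Sum>k<n. M i k * v k\<bar> \<le> (\<Sum>k<n. \<eta> * \<bar>v k\<bar>)"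
      by (intro order_trans[OF sum_abs] sum_mono) simp
  qed
  also have "\<dots> = n * \<eta> * norm1 n v" by (simp add: norm1_def sum_distrib_left mult.assoc)
  also have "\<dots> \<le> c * norm1 n v" using assms(2) by (simp add: mult_right_mono)
  finally show ?thesis .
qed

text \<open>The residual of \<open>x + P x = z\<close> attains its minimum on the closed ball, and one Picard step
  would halve it.\<close>

lemma solve_perturbation:
  assumes a: "a \<in> Rn n" and z: "z \<in> Rn n" and r: "0 \<le> r"
    and PR: "\<And>x. x \<in> Rn n \<Longrightarrow> norm1 n (\<lambda>i. x i - a i) \<le> r \<Longrightarrow> P x \<in> Rn n"
    and Pc: "\<And>i. i < n \<Longrightarrow> continuous_on {x \<in> Rn n. norm1 n (\<lambda>i. x i - a i) \<le> r} (\<lambda>x. P x i)"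
    and lip: "\<And>x y. x \<in> Rn n \<Longrightarrow> y \<in> Rn n \<Longrightarrow> norm1 n (\<lambda>i. x i - a i) \<le> r \<Longrightarrow> norm1 n (\<lambda>i. y i - a i) \<le> r \<Longrightarrow>
      norm1 n (\<lambda>i. P x i - P y i) \<le> norm1 n (\<lambda>i. x i - y i) / 2"
    and zr: "norm1 n (\<lambda>i. z i - (a i + P a i)) \<le> r / 2"
  shows "\<exists>x\<in>Rn n. norm1 n (\<lambda>i. x i - a i) \<le> r \<and> (\<forall>i. x i + P x i = z i)"
proof -
  define D where "D = {x \<in> Rn n. norm1 n (\<lambda>i. x i - a i) \<le> r}"
  have "closed {x::vec. norm1 n (\<lambda>i. x i - a i) \<le> r}"
    unfolding norm1_def by (intro closed_Collect_le continuous_intros)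
  moreover have "D = {x \<in> Rn n. \<forall>i<n. \<bar>x i - a i\<bar> \<le> r} \<inter> {x. norm1 n (\<lambda>i. x i - a i) \<le> r}"
    unfolding D_def using order_trans[OF norm1_component] by blast
  ultimately have "compact D"
    using compact_Int_closed[OF compact_closed_box] by simp
  moreover have aD: "a \<in> D" using a r by (simp add: D_def norm1_def)
  moreover have "continuous_on D (\<lambda>x. norm1 n (\<lambda>i. x i + P x i - z i))"
    unfolding norm1_def D_def by (intro continuous_intros Pc[unfolded norm1_def]) auto
  ultimately obtain x where x: "x \<in> D" "\<And>y. y \<in> D \<Longrightarrow> norm1 n (\<lambda>i. x i + P x i - z i) \<le> norm1 n (\<lambda>i. y i + P y i - z i)"
    using continuous_attains_inf[of D] by blast
  define x' where "x' i = z i - P x i" for i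
  have xR: "x \<in> Rn n" "norm1 n (\<lambda>i. x i - a i) \<le> r" using x(1) by (auto simp: D_def)
  have x'R: "x' \<in> Rn n" using z PR[OF xR] by (auto simp: x'_def Rn_iff)
  \<comment> \<open>The Picard step stays in the ball: the residual at the centre and the Lipschitz
    bound contribute \<open>r / 2\<close> each.\<close>
  have "norm1 n (\<lambda>i. x' i - a i) \<le> norm1 n (\<lambda>i. z i - (a i + P a i)) + norm1 n (\<lambda>i. P a i - P x i)"
    using norm1_triangle[of n "\<lambda>i. z i - (a i + P a i)" "\<lambda>i. P a i - P x i"] by (simp add: x'_def algebra_simps)
  also have "norm1 n (\<lambda>i. P a i - P x i) \<le> r / 2"
    using lip[of a x] xR a r norm1_minus_commute[of n a x] by (simp add: norm1_def)
  finally have x'r: "norm1 n (\<lambda>i. x' i - a i) \<le> r" using zr by simp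
  have "norm1 n (\<lambda>i. x i + P x i - z i) \<le> norm1 n (\<lambda>i. x' i + P x' i - z i)"
    using x(2) x'R x'r by (simp add: D_def)
  also have "\<dots> = norm1 n (\<lambda>i. P x' i - P x i)" by (simp add: x'_def)
  also have "\<dots> \<le> norm1 n (\<lambda>i. x' i - x i) / 2" by (rule lip[OF x'R xR(1) x'r xR(2)])
  also have "\<dots> = norm1 n (\<lambda>i. x i + P x i - z i) / 2"
    using norm1_minus_commute[of n x' x] by (simp add: x'_def algebra_simps)
  finally have "norm1 n (\<lambda>i. x i + P x i - z i) = 0"
    using norm1_nonneg[of n "\<lambda>i. x i + P x i - z i"] by linarith
  then have "\<And>i. i < n \<Longrightarrow> x i + P x i = z i" by (simp add: norm1_eq_0)
  then have "x i + P x i = z i" for i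
    using xR(1) PR[OF xR] z by (cases "i < n") (auto simp: Rn_iff)
  then show ?thesis using xR by blast
qed

lemma continuous_on_from_bound:
  fixes g :: "'a::t2_space \<Rightarrow> real"
  assumes "\<And>y. y \<in> T \<Longrightarrow> \<exists>h. continuous_on T h \<and> h y = 0 \<and> (\<forall>x\<in>T. \<bar>g x - g y\<bar> \<le> h x)"
  shows "continuous_on T g"
  unfolding continuous_on_def
proof
  fix y assume y: "y \<in> T"
  obtain h where h: "continuous_on T h" "h y = 0" "\<forall>x\<in>T. \<bar>g x - g y\<bar> \<le> h x" using assms[OF y] by blast
  have "(h \<longlongrightarrow> 0) (at y within T)" using h(1,2) y unfolding continuous_on_def by metis
  then have "((\<lambda>x. g x - g y) \<longlongrightarrow> 0) (at y within T)"
    by (rule Lim_null_comparison[rotated]) (use h(3) in \<open>auto simp: eventually_at_filter\<close>)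
  then show "(g \<longlongrightarrow> g y) (at y within T)" by (simp add: LIM_zero_iff)
qed

lemma tendsto_upd:
  assumes S: "openin (Euclidean_space n) S" and g: "continuous_on S g" and y: "y \<in> S" and j: "j < n"
  shows "((\<lambda>t. g (y(j := t))) \<longlongrightarrow> (g y :: real)) (at (y j))"
  unfolding tendsto_iff dist_real_def
proof (intro allI impI)
  fix e :: real assume "e > 0"
  obtain d where d: "d > 0" "\<And>x. x \<in> box_nhd n y d \<Longrightarrow> \<bar>g x - g y\<bar> < e"
    using continuous_on_box[OF S g y \<open>e > 0\<close>] by metis
  have "y \<in> box_nhd n y d" using d y open_Rn_subset[OF S] by (auto intro: box_nhd_center)
  from eventually_upd_in[OF openin_box_nhd this j] show "\<forall>\<^sub>F t in at (y j). \<bar>g (y(j := t)) - g y\<bar> < e"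
    by (auto simp: eventually_nhds_conv_at elim: eventually_mono intro: d(2))
qed

text \<open>A map whose Jacobian is close to the unit matrix on a box. A deviation of at most
  \<open>1 / (2 * real n + 2)\<close> in each of the \<open>n\<close> entries of a row makes the
  perturbation \<open>F x - x\<close> Lipschitz with constant 1/2 in \<open>norm1\<close>; the added
  2 keeps the bound meaningful for \<open>n = 0\<close>.\<close>

locale near_identity =
  fixes n :: nat and S :: "vec set" and F :: "vec \<Rightarrow> vec" and B :: "vec set" and J :: "vec \<Rightarrow> nat \<Rightarrow> nat \<Rightarrow> real"
    and x0 :: vec and e :: real
  assumes S: "openin (Euclidean_space n) S" and x0: "x0 \<in> S"
    and FR: "\<And>x. x \<in> S \<Longrightarrow> F x \<in> Rn n"
    and F: "\<And>i k. i < n \<Longrightarrow> Ck k n S (\<lambda>y. F y i)"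
    and e: "0 < e" and BS: "box_nhd n x0 e \<subseteq> S"
    and J_def: "J = (\<lambda>x i j. pdiff j (\<lambda>y. F y i) x)"
    and B_def: "B = box_nhd n x0 e"
    and J_small: "\<And>x i j. x \<in> B \<Longrightarrow> i < n \<Longrightarrow> j < n \<Longrightarrow>
      \<bar>J x i j - (if i = j then 1 else 0)\<bar> \<le> 1 / (2 * real n + 2)"
begin

lemma sum_delta_row: "i < n \<Longrightarrow> (\<Sum>k<n. (if i = k then 1 else 0) * v k) = (v i :: real)"
  by (simp add: if_distrib[of "\<lambda>c. c * _"] cong: if_cong)

lemma J_near_1: "x \<in> B \<Longrightarrow> norm1 n (\<lambda>i. \<Sum>k<n. (J x i k - (if i = k then 1 else 0)) * v k) \<le> norm1 n v / 2"
  using norm1_matrix[of n "\<lambda>i k. J x i k - (if i = k then 1 else 0)" "1 / (2 * real n + 2)" "1/2" v] J_small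
  by (simp add: divide_simps)

text \<open>Every entry of \<open>Q\<close> has its own intermediate point, so \<open>Q\<close> is
  not the Jacobian at one point; but its entries obey every bound that holds for the entries of
  \<open>J\<close> on \<open>B\<close>.\<close>

lemma mean_value:
  assumes "x \<in> B" "y \<in> B"
  obtains Q where "\<And>i. i < n \<Longrightarrow> F x i - F y i = (\<Sum>k<n. Q i k * (x k - y k))"
    "\<And>i k. i < n \<Longrightarrow> k < n \<Longrightarrow> \<exists>\<xi>\<in>B. (\<forall>l<n. \<bar>\<xi> l - y l\<bar> \<le> \<bar>x l - y l\<bar>) \<and> Q i k = J \<xi> i k"
proof -
  define P where "P i \<xi> \<longleftrightarrow> (\<forall>k<n. \<xi> k \<in> B \<and> (\<forall>l<n. \<bar>\<xi> k l - y l\<bar> \<le> \<bar>x l - y l\<bar>)) \<and>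
     F x i - F y i = (\<Sum>k<n. J (\<xi> k) i k * (x k - y k))" for i \<xi>
  have "\<exists>\<xi>. P i \<xi>" if "i < n" for i
  proof -
    have "\<forall>j<n. \<forall>z\<in>S. (\<lambda>t. F (z(j := t)) i) differentiable (at (z j))"
      using F[OF that, of "Suc 0"] unfolding Ck.simps by blast
    from mvt_box[OF BS assms[unfolded B_def] this] show ?thesis unfolding P_def J_def B_def .
  qed
  then obtain \<xi> where \<xi>: "\<And>i. i < n \<Longrightarrow> P i (\<xi> i)" by metis
  show thesis by (rule that[of "\<lambda>i k. J (\<xi> i k) i k"]) (use \<xi> P_def in blast)+
qed

lemma perturbation_lipschitz:
  assumes "x \<in> B" "y \<in> B"
  shows "norm1 n (\<lambda>i. (F x i - x i) - (F y i - y i)) \<le> norm1 n (\<lambda>i. x i - y i) / 2"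
proof -
  obtain Q where Q: "\<And>i. i < n \<Longrightarrow> F x i - F y i = (\<Sum>k<n. Q i k * (x k - y k))"
    "\<And>i k. i < n \<Longrightarrow> k < n \<Longrightarrow> \<exists>\<xi>\<in>B. (\<forall>l<n. \<bar>\<xi> l - y l\<bar> \<le> \<bar>x l - y l\<bar>) \<and> Q i k = J \<xi> i k"
    using mean_value[OF assms] by blast
  have "(F x i - x i) - (F y i - y i) = (\<Sum>k<n. (Q i k - (if i = k then 1 else 0)) * (x k - y k))" if "i < n" for i
    using Q(1)[OF that] sum_delta_row[OF that, of "\<lambda>k. x k - y k"] by (simp add: left_diff_distrib sum_subtractf)
  then have "norm1 n (\<lambda>i. (F x i - x i) - (F y i - y i)) =
      norm1 n (\<lambda>i. \<Sum>k<n. (Q i k - (if i = k then 1 else 0)) * (x k - y k))"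
    unfolding norm1_def by (intro sum.cong) auto
  also have "\<dots> \<le> 1/2 * norm1 n (\<lambda>i. x i - y i)"
  proof (rule norm1_matrix)
    fix i k assume ik: "i < n" "k < n"
    then show "\<bar>Q i k - (if i = k then 1 else 0)\<bar> \<le> 1 / (2 * real n + 2)" using Q(2)[OF ik] J_small by metis
  qed (simp add: divide_simps)
  finally show ?thesis by simp
qed

text \<open>The perturbation absorbs at most half of a distance, so the other half survives. This
  yields injectivity of \<open>F\<close> and the Lipschitz bound for its inverse.\<close>

lemma expansion:
  assumes "x \<in> B" "y \<in> B"
  shows "norm1 n (\<lambda>i. x i - y i) \<le> 2 * norm1 n (\<lambda>i. F x i - F y i)"
proof -
  have "norm1 n (\<lambda>i. x i - y i) = norm1 n (\<lambda>i. (F x i - F y i) + ((F y i - y i) - (F x i - x i)))" by simp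
  also have "\<dots> \<le> norm1 n (\<lambda>i. F x i - F y i) + norm1 n (\<lambda>i. (F y i - y i) - (F x i - x i))" by (rule norm1_triangle)
  also have "norm1 n (\<lambda>i. (F y i - y i) - (F x i - x i)) \<le> norm1 n (\<lambda>i. x i - y i) / 2"
    using perturbation_lipschitz[OF assms(2,1)] norm1_minus_commute[of n x y] by simp
  finally show ?thesis by simp
qed

lemma J_expansion:
  assumes "x \<in> B"
  shows "norm1 n v \<le> 2 * norm1 n (\<lambda>i. \<Sum>k<n. J x i k * v k)"
proof -
  have "norm1 n v = norm1 n (\<lambda>i. (\<Sum>k<n. J x i k * v k) + - (\<Sum>k<n. (J x i k - (if i = k then 1 else 0)) * v k))"
    unfolding norm1_def
  proof (rule sum.cong[OF refl])
    fix i assume "i \<in> {..<n}"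
    then show "\<bar>v i\<bar> = \<bar>(\<Sum>k<n. J x i k * v k) + - (\<Sum>k<n. (J x i k - (if i = k then 1 else 0)) * v k)\<bar>"
      using sum_delta_row[of i v] by (simp add: left_diff_distrib sum_subtractf)
  qed
  also have "\<dots> \<le> norm1 n (\<lambda>i. \<Sum>k<n. J x i k * v k) + norm1 n (\<lambda>i. - (\<Sum>k<n. (J x i k - (if i = k then 1 else 0)) * v k))"
    by (rule norm1_triangle)
  also have "norm1 n (\<lambda>i. - (\<Sum>k<n. (J x i k - (if i = k then 1 else 0)) * v k)) \<le> norm1 n v / 2"
    using J_near_1[OF assms, of v] by (simp add: norm1_def)
  finally show ?thesis by simp
qed

text \<open>The columns of the inverse matrix are found by \<open>solve_perturbation\<close>,
  applied to the linear map \<open>J x\<close> itself. At the centre \<open>0\<close> the residual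
  is a unit vector of norm 1, half of the radius 2.\<close>

lemma J_right_inverse_ex:
  assumes x: "x \<in> B" and j: "j < n"
  shows "\<exists>w. \<forall>i<n. (\<Sum>k<n. J x i k * w k) = (if i = j then 1 else 0)"
proof -
  let ?P = "\<lambda>v i. if i < n then \<Sum>k<n. (J x i k - (if i = k then 1 else 0)) * v k else 0"
  have "\<exists>w\<in>Rn n. norm1 n (\<lambda>i. w i - 0) \<le> 2 \<and> (\<forall>i. w i + ?P w i = (if i = j then 1 else 0))"
  proof (rule solve_perturbation)
    show "continuous_on {x \<in> Rn n. norm1 n (\<lambda>i. x i - 0) \<le> 2} (\<lambda>v. ?P v i)" if "i < n" for i
      using that by (auto intro!: continuous_intros)
    fix v w :: vec
    have "norm1 n (\<lambda>i. ?P v i - ?P w i) = norm1 n (\<lambda>i. \<Sum>k<n. (J x i k - (if i = k then 1 else 0)) * (v k - w k))"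
      unfolding norm1_def by (intro sum.cong) (auto simp: right_diff_distrib sum_subtractf)
    then show "norm1 n (\<lambda>i. ?P v i - ?P w i) \<le> norm1 n (\<lambda>i. v i - w i) / 2" using J_near_1[OF x] by simp
  next
    have "norm1 n (\<lambda>i. (if i = j then 1 else 0) - (0 + ?P (\<lambda>_. 0) i)) = (\<Sum>i<n. if i = j then 1 else 0)"
      unfolding norm1_def by (intro sum.cong) auto
    then show "norm1 n (\<lambda>i. (if i = j then 1 else 0) - (0 + ?P (\<lambda>_. 0) i)) \<le> 2 / 2" using j by simp
  qed (use j in \<open>auto simp: Rn_iff\<close>)
  then obtain w where w: "\<And>i. w i + ?P w i = (if i = j then 1 else 0)" by blast
  have "(\<Sum>k<n. J x i k * w k) = (if i = j then 1 else 0)" if "i < n" for i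
    using w[of i] that sum_delta_row[OF that, of w] by (simp add: left_diff_distrib sum_subtractf)
  then show ?thesis by blast
qed

definition W :: "vec \<Rightarrow> nat \<Rightarrow> nat \<Rightarrow> real"
  where "W x i j = (SOME w. \<forall>i<n. (\<Sum>k<n. J x i k * w k) = (if i = j then 1 else 0)) i"

lemma J_W: "x \<in> B \<Longrightarrow> i < n \<Longrightarrow> j < n \<Longrightarrow> (\<Sum>k<n. J x i k * W x k j) = (if i = j then 1 else 0)"
  unfolding W_def using someI_ex[OF J_right_inverse_ex[of x j]] by blast

lemma J_inj: "x \<in> B \<Longrightarrow> (\<And>i. i < n \<Longrightarrow> (\<Sum>k<n. J x i k * v k) = 0) \<Longrightarrow> i < n \<Longrightarrow> v i = 0"
  using J_expansion[of x v] norm1_component[of i n v] norm1_eq_0[of n "\<lambda>i. \<Sum>k<n. J x i k * v k"] by simp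

text \<open>A right inverse of an injective matrix is also a left inverse, because \<open>J\<close>
  annihilates the columns of \<open>W J - 1\<close>.\<close>

lemma W_J:
  assumes x: "x \<in> B" and ij: "i < n" "j < n"
  shows "(\<Sum>k<n. W x i k * J x k j) = (if i = j then 1 else 0)"
proof -
  have "(\<Sum>i<n. J x c i * ((\<Sum>k<n. W x i k * J x k j) - (if i = j then 1 else 0))) = 0" if c: "c < n" for c
  proof -
    have "(\<Sum>i<n. J x c i * (\<Sum>k<n. W x i k * J x k j)) = (\<Sum>k<n. (\<Sum>i<n. J x c i * W x i k) * J x k j)"
      unfolding sum_distrib_left sum_distrib_right by (subst sum.swap) (simp add: mult.assoc)
    also have "\<dots> = (\<Sum>k<n. (if c = k then 1 else 0) * J x k j)"
      using J_W[OF x c] by (intro sum.cong) auto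
    also have "\<dots> = J x c j" by (rule sum_delta_row[OF c])
    also have "\<dots> = (\<Sum>i<n. J x c i * (if i = j then 1 else 0))"
      using ij by (simp add: if_distrib[of "\<lambda>c. _ * c"] cong: if_cong)
    finally show ?thesis by (simp add: right_diff_distrib sum_subtractf)
  qed
  from J_inj[OF x this ij(1)] show ?thesis by simp
qed

section \<open>Existence and continuity of the local inverse\<close>

definition r where "r = e / 2"
text \<open>\<open>solve_perturbation\<close> tolerates an initial residual of half the radius,
  whence \<open>r / 2\<close>. The number \<open>r\<close> is half of \<open>e\<close> so that the
  closed \<open>norm1\<close> ball of radius \<open>r\<close> lies in the open box
  \<open>B\<close>.\<close>

definition T where "T = {z \<in> Rn n. norm1 n (\<lambda>i. z i - F x0 i) < r / 2}"
definition S' where "S' = {x \<in> B. norm1 n (\<lambda>i. x i - x0 i) < r \<and> F x \<in> T}"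
definition G where "G z = (SOME x. x \<in> S' \<and> F x = z)"

lemma x0R: "x0 \<in> Rn n" using x0 open_Rn_subset[OF S] by blast

lemma B_open: "openin (Euclidean_space n) B" unfolding B_def by (rule openin_box_nhd)

lemma B_S: "x \<in> B \<Longrightarrow> x \<in> S" using BS B_def by blast

lemma ball_B: "x \<in> Rn n \<Longrightarrow> norm1 n (\<lambda>i. x i - x0 i) \<le> r \<Longrightarrow> x \<in> B"
  unfolding B_def box_nhd_def using order_trans[OF norm1_component[of _ n "\<lambda>i. x i - x0 i"]] e r_def
  by fastforce

lemma x0_B: "x0 \<in> B" using ball_B[of x0] x0R e by (simp add: r_def norm1_def)

lemma F_cont: "i < n \<Longrightarrow> continuous_on B (\<lambda>x. F x i)"
  using Ck_continuous[OF F] continuous_on_subset B_S by blast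

lemma T_open: "openin (Euclidean_space n) T"
  unfolding T_def norm1_def by (intro openin_Collect_less openin_topspace continuous_intros)

lemma S'_open: "openin (Euclidean_space n) S'"
proof -
  have "openin (Euclidean_space n) {x \<in> B. norm1 n (\<lambda>i. x i - x0 i) < r}"
    unfolding norm1_def by (intro openin_Collect_less B_open continuous_intros)
  from openin_preimage_Rn[OF this T_open, of F] show ?thesis
    unfolding S'_def using F_cont FR B_S
    by (smt (verit, del_insts) Collect_cong continuous_on_subset mem_Collect_eq subsetI)
qed

lemma T_Rn: "z \<in> T \<Longrightarrow> z \<in> Rn n" by (simp add: T_def)

lemma G_ex:
  assumes z: "z \<in> T"
  shows "\<exists>x. x \<in> S' \<and> F x = z"
proof -
  have "\<exists>x\<in>Rn n. norm1 n (\<lambda>i. x i - x0 i) \<le> r \<and> (\<forall>i. x i + (F x i - x i) = z i)"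
  proof (rule solve_perturbation[OF x0R T_Rn[OF z]])
    show "(\<lambda>i. F x i - x i) \<in> Rn n" if "x \<in> Rn n" "norm1 n (\<lambda>i. x i - x0 i) \<le> r" for x
      using FR[OF B_S[OF ball_B[OF that]]] that by (auto simp: Rn_iff)
    show "continuous_on {x \<in> Rn n. norm1 n (\<lambda>i. x i - x0 i) \<le> r} (\<lambda>x. F x i - x i)" if "i < n" for i
      by (intro continuous_intros continuous_on_subset[OF F_cont[OF that]]) (auto intro: ball_B)
    show "norm1 n (\<lambda>i. (F x i - x i) - (F y i - y i)) \<le> norm1 n (\<lambda>i. x i - y i) / 2"
      if "x \<in> Rn n" "y \<in> Rn n" "norm1 n (\<lambda>i. x i - x0 i) \<le> r" "norm1 n (\<lambda>i. y i - x0 i) \<le> r" for x y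
      using perturbation_lipschitz ball_B that by blast
  qed (use z e in \<open>auto simp: T_def r_def\<close>)
  then obtain x where x: "x \<in> Rn n" "norm1 n (\<lambda>i. x i - x0 i) \<le> r" "\<And>i. F x i = z i" by auto
  have Fx: "F x = z" using x(3) by auto
  have xB: "x \<in> B" using ball_B x by blast
  \<comment> \<open>The solution was found in the closed ball; \<open>expansion\<close> and the
    strict bound defining \<open>T\<close> move it into the open one, as membership in
    \<open>S'\<close> demands.\<close>
  have "norm1 n (\<lambda>i. x i - x0 i) < r"
    using expansion[OF xB x0_B] z Fx by (simp add: T_def)
  then show ?thesis using xB Fx z by (auto simp: S'_def)
qed

lemma G: "z \<in> T \<Longrightarrow> G z \<in> S'" "z \<in> T \<Longrightarrow> F (G z) = z"
  unfolding G_def using someI_ex[OF G_ex] by blast+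

lemma S'_B: "x \<in> S' \<Longrightarrow> x \<in> B" by (simp add: S'_def)

lemma F_inj: "x \<in> B \<Longrightarrow> y \<in> B \<Longrightarrow> F x = F y \<Longrightarrow> x = y"
  using expansion[of x y] box_nhd_Rn Rn_eqI[of x n y] norm1_component[of _ n "\<lambda>i. x i - y i"]
  by (force simp: B_def norm1_def)

lemma S'_T: "x \<in> S' \<Longrightarrow> F x \<in> T" by (simp add: S'_def)

lemma G_F: "x \<in> S' \<Longrightarrow> G (F x) = x"
  using G[OF S'_T] F_inj S'_B by blast

lemma x0_S': "x0 \<in> S'"
  using x0_B e FR[OF x0] by (simp add: S'_def T_def norm1_def r_def)

lemma G_lipschitz: "z \<in> T \<Longrightarrow> y \<in> T \<Longrightarrow> norm1 n (\<lambda>i. G z i - G y i) \<le> 2 * norm1 n (\<lambda>i. z i - y i)"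
  using expansion[of "G z" "G y"] G S'_B by simp

lemma G_Rn: "z \<in> T \<Longrightarrow> G z \<in> Rn n" using G S'_B box_nhd_Rn B_def by blast

lemma G_cont: "i < n \<Longrightarrow> continuous_on T (\<lambda>z. G z i)"
proof (rule continuous_on_from_bound)
  fix y assume i: "i < n" and y: "y \<in> T"
  have "\<bar>G z i - G y i\<bar> \<le> 2 * norm1 n (\<lambda>i. z i - y i)" if "z \<in> T" for z
    using norm1_component[OF i, of "\<lambda>i. G z i - G y i"] G_lipschitz[OF that y] by simp
  then show "\<exists>h. continuous_on T h \<and> h y = 0 \<and> (\<forall>z\<in>T. \<bar>G z i - G y i\<bar> \<le> h z)"
    by (intro exI[of _ "\<lambda>z. 2 * norm1 n (\<lambda>i. z i - y i)"]) (auto simp: norm1_def intro!: continuous_intros)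
qed

section \<open>Derivatives of the local inverse\<close>

lemma J_Ck: "i < n \<Longrightarrow> j < n \<Longrightarrow> Ck k n B (\<lambda>x. J x i j)"
  using F[of i "Suc k"] Ck_subset[of k n S _ B] B_S unfolding J_def Ck.simps by blast

lemma compose_G: "(\<And>i. i < n \<Longrightarrow> Ck k n T (\<lambda>z. G z i)) \<Longrightarrow> Ck k n B H \<Longrightarrow> Ck k n T (\<lambda>z. H (G z))"
  using Ck_compose[OF T_open B_open, of G k H] G(1) S'_B by blast

lemma J_G_cont: "i < n \<Longrightarrow> j < n \<Longrightarrow> continuous_on T (\<lambda>z. J (G z) i j)"
  using compose_G[of 0 "\<lambda>x. J x i j"] G_cont J_Ck[of i j 0] by simp

text \<open>From \<open>J(z) (W(z) - W(y)) = (J(y) - J(z)) W(y)\<close> and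
  \<open>J_expansion\<close> the change of the inverse matrix is bounded by the change of
  \<open>J\<close>, with the factor \<open>W(y)\<close> fixed.\<close>

lemma W_G_cont:
  assumes ij: "i < n" "j < n"
  shows "continuous_on T (\<lambda>z. W (G z) i j)"
proof (rule continuous_on_from_bound)
  fix y assume y: "y \<in> T"
  let ?h = "\<lambda>z. 2 * norm1 n (\<lambda>a. \<Sum>k<n. (J (G y) a k - J (G z) a k) * W (G y) k j)"
  have "\<bar>W (G z) i j - W (G y) i j\<bar> \<le> ?h z" if z: "z \<in> T" for z
  proof -
    have zB: "G z \<in> B" and yB: "G y \<in> B" using G S'_B z y by auto
    have "\<bar>W (G z) i j - W (G y) i j\<bar> \<le> norm1 n (\<lambda>i. W (G z) i j - W (G y) i j)"
      using norm1_component[OF ij(1), of "\<lambda>i. W (G z) i j - W (G y) i j"] .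
    also have "\<dots> \<le> 2 * norm1 n (\<lambda>a. \<Sum>k<n. J (G z) a k * (W (G z) k j - W (G y) k j))"
      by (rule J_expansion[OF zB])
    also have "norm1 n (\<lambda>a. \<Sum>k<n. J (G z) a k * (W (G z) k j - W (G y) k j)) =
        norm1 n (\<lambda>a. \<Sum>k<n. (J (G y) a k - J (G z) a k) * W (G y) k j)"
      unfolding norm1_def using J_W[OF zB _ ij(2)] J_W[OF yB _ ij(2)]
      by (intro sum.cong) (auto simp: left_diff_distrib right_diff_distrib sum_subtractf)
    finally show ?thesis .
  qed
  moreover have "continuous_on T ?h" unfolding norm1_def by (intro continuous_intros J_G_cont) auto
  ultimately show "\<exists>h. continuous_on T h \<and> h y = 0 \<and> (\<forall>z\<in>T. \<bar>W (G z) i j - W (G y) i j\<bar> \<le> h z)"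
    by (intro exI[of _ ?h]) (auto simp: norm1_def)
qed

text \<open>The difference quotient \<open>w\<close> of \<open>G\<close> solves
  \<open>Q w = e_j\<close> for a mean value matrix \<open>Q\<close> near \<open>J\<close>, the
  column of \<open>W\<close> solves the same equation for \<open>J\<close>. Thus \<open>J\<close>
  maps their difference to \<open>(J - Q) w\<close>, which is small as \<open>w\<close> is
  bounded.\<close>

lemma G_derivative:
  assumes z: "z \<in> T" and ij: "i < n" "j < n"
  shows "((\<lambda>t. G (z(j := t)) i) has_real_derivative W (G z) i j) (at (z j))"
  unfolding has_field_derivative_iff tendsto_iff dist_real_def
proof (intro allI impI)
  fix s :: real assume s: "s > 0"
  define x where "x = G z"
  have xB: "x \<in> B" using G z S'_B x_def by blast
  \<comment> \<open>The final error is \<open>4 * n * \<mu>\<close>: one factor 2 from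
    \<open>J_expansion\<close>, another from the bound 2 on \<open>w\<close>.\<close>
  define \<mu> where "\<mu> = s / (4 * real n + 4)"
  have \<mu>: "\<mu> > 0" "4 * real n * \<mu> < s" using s by (auto simp: \<mu>_def divide_simps)
  \<comment> \<open>One continuous function that controls all entries of the Jacobian at
    once.\<close>
  have "continuous_on B (\<lambda>y. \<Sum>a<n. \<Sum>b<n. \<bar>J y a b - J x a b\<bar>)"
    using Ck_continuous[OF J_Ck] by (intro continuous_intros) auto
  from continuous_on_box[OF B_open this xB \<mu>(1)] obtain d where
    d: "d > 0" "box_nhd n x d \<subseteq> B" "\<And>y. y \<in> box_nhd n x d \<Longrightarrow> (\<Sum>a<n. \<Sum>b<n. \<bar>J y a b - J x a b\<bar>) < \<mu>"
    by (auto simp: sum_nonneg)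
  have Jd: "\<bar>J y a b - J x a b\<bar> \<le> \<mu>" if "y \<in> box_nhd n x d" "a < n" "b < n" for y a b
  proof -
    have "\<bar>J y a b - J x a b\<bar> \<le> (\<Sum>b<n. \<bar>J y a b - J x a b\<bar>)" using that by (intro member_le_sum) auto
    also have "\<dots> \<le> (\<Sum>a<n. \<Sum>b<n. \<bar>J y a b - J x a b\<bar>)"
      using that by (intro member_le_sum[of a "{..<n}" "\<lambda>a. \<Sum>b<n. \<bar>J y a b - J x a b\<bar>"]) (auto intro: sum_nonneg)
    finally show ?thesis using d(3)[OF that(1)] by simp
  qed
  have evT: "eventually (\<lambda>t. z(j := t) \<in> T) (at (z j))"
    using eventually_upd_in[OF T_open z ij(2)] by (simp add: eventually_nhds_conv_at)
  have "eventually (\<lambda>t. G (z(j := t)) \<in> box_nhd n x d) (at (z j))"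
  proof (rule eventually_curve_in[OF openin_box_nhd, where c = "\<lambda>t. G (z(j := t))" and ?t0.0 = "z j"])
    show "((\<lambda>t. G (z(j := t)) i) \<longlongrightarrow> G (z(j := z j)) i) (at (z j))" if "i < n" for i
      using tendsto_upd[OF T_open G_cont[OF that] z ij(2)] by simp
    show "\<forall>\<^sub>F t in at (z j). G (z(j := t)) \<in> Rn n" using evT by eventually_elim (rule G_Rn)
    show "G (z(j := z j)) \<in> box_nhd n x d" using d(1) x_def G_Rn[OF z] by (simp add: box_nhd_center)
  qed
  with evT have "\<forall>\<^sub>F t in at (z j). t \<noteq> z j \<and> z(j := t) \<in> T \<and> G (z(j := t)) \<in> box_nhd n x d"
    by (auto simp: eventually_conj_iff eventually_at_filter)
  then show "\<forall>\<^sub>F t in at (z j). \<bar>(G (z(j := t)) i - G (z(j := z j)) i) / (t - z j) - W (G z) i j\<bar> < s"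
  proof eventually_elim
    case (elim t)
    define h where "h = t - z j"
    define y where "y = G (z(j := t))"
    define w where "w k = (y k - x k) / h" for k
    have h: "h \<noteq> 0" using elim by (simp add: h_def)
    have yB: "y \<in> B" using elim G S'_B y_def by blast
    have Fy: "F y a - F x a = (if a = j then h else 0)" for a
      unfolding x_def y_def using G(2)[OF z] G(2)[of "z(j := t)"] elim by (simp add: h_def)
    obtain Q where Q: "\<And>i. i < n \<Longrightarrow> F y i - F x i = (\<Sum>k<n. Q i k * (y k - x k))"
      "\<And>i k. i < n \<Longrightarrow> k < n \<Longrightarrow> \<exists>\<xi>\<in>B. (\<forall>l<n. \<bar>\<xi> l - x l\<bar> \<le> \<bar>y l - x l\<bar>) \<and> Q i k = J \<xi> i k"
      using mean_value[OF yB xB] by blast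
    have QJ: "\<bar>J x a b - Q a b\<bar> \<le> \<mu>" if ab: "a < n" "b < n" for a b
    proof -
      obtain \<xi> where \<xi>: "\<xi> \<in> B" "\<forall>l<n. \<bar>\<xi> l - x l\<bar> \<le> \<bar>y l - x l\<bar>" "Q a b = J \<xi> a b" using Q(2)[OF ab] by blast
      have "y \<in> box_nhd n x d" using elim y_def by blast
      then have "\<bar>\<xi> l - x l\<bar> < d" if "l < n" for l using box_nhdD[OF _ that] \<xi>(2) that by fastforce
      then have "\<xi> \<in> box_nhd n x d" using \<xi>(1) unfolding B_def box_nhd_def by blast
      then show ?thesis using Jd[OF _ ab] \<xi>(3) by (simp add: abs_minus_commute)
    qed
    have Qw: "(\<Sum>k<n. Q a k * w k) = (if a = j then 1 else 0)" if "a < n" for a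
      using Q(1)[OF that] Fy[of a] h unfolding w_def by (simp add: sum_divide_distrib[symmetric] split: if_splits)
    have "norm1 n (\<lambda>i. y i - x i) \<le> 2 * norm1 n (\<lambda>i. F y i - F x i)" by (rule expansion[OF yB xB])
    also have "norm1 n (\<lambda>i. F y i - F x i) = \<bar>h\<bar>"
      unfolding Fy norm1_def using ij by (simp add: if_distrib[of abs] cong: if_cong)
    finally have wn: "norm1 n w \<le> 2"
      using h unfolding w_def norm1_def by (simp add: sum_divide_distrib[symmetric] divide_simps)
    have "\<bar>w i - W x i j\<bar> \<le> norm1 n (\<lambda>i. w i - W x i j)"
      using norm1_component[OF ij(1), of "\<lambda>i. w i - W x i j"] .
    also have "\<dots> \<le> 2 * norm1 n (\<lambda>a. \<Sum>k<n. J x a k * (w k - W x k j))" by (rule J_expansion[OF xB])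
    also have "norm1 n (\<lambda>a. \<Sum>k<n. J x a k * (w k - W x k j)) = norm1 n (\<lambda>a. \<Sum>k<n. (J x a k - Q a k) * w k)"
      unfolding norm1_def using J_W[OF xB _ ij(2)] Qw
      by (intro sum.cong) (auto simp: left_diff_distrib right_diff_distrib sum_subtractf)
    also have "\<dots> \<le> (n * \<mu>) * norm1 n w" by (rule norm1_matrix[OF QJ]) auto
    also have "\<dots> \<le> (n * \<mu>) * 2" using wn \<mu>(1) by (intro mult_left_mono) auto
    finally have "\<bar>w i - W x i j\<bar> < s" using \<mu>(2) by simp
    then show ?case by (simp add: w_def x_def y_def h_def)
  qed
qed

lemma pdiff_G: "z \<in> T \<Longrightarrow> i < n \<Longrightarrow> j < n \<Longrightarrow> pdiff j (\<lambda>z. G z i) z = W (G z) i j"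
  by (rule pdiff_eq) (rule G_derivative)

lemma G_Ck_Suc:
  assumes "\<And>i j. i < n \<Longrightarrow> j < n \<Longrightarrow> Ck k n T (\<lambda>z. W (G z) i j)" "i < n"
  shows "Ck (Suc k) n T (\<lambda>z. G z i)"
proof -
  have "Ck k n T (pdiff j (\<lambda>z. G z i))" if "j < n" for j
    using Ck_cong[OF T_open, of "pdiff j (\<lambda>z. G z i)" "\<lambda>z. W (G z) i j" k] pdiff_G assms that by simp
  moreover have "(\<lambda>t. G (z(j := t)) i) differentiable (at (z j))" if "j < n" "z \<in> T" for j z
    using G_derivative[OF that(2) assms(2) that(1)] real_differentiable_def by blast
  ultimately show ?thesis using G_cont[OF assms(2)] unfolding Ck.simps by blast
qed

text \<open>The derivative of a matrix inverse is \<open>- W J' W\<close>. The exact identity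
  \<open>W(x) (J(y) - J(x)) W(y) = W(x) - W(y)\<close> turns difference quotients of
  \<open>W\<close> into those of \<open>J\<close>, and the limit uses only the continuity of
  \<open>W\<close>.\<close>

lemma W_derivative:
  assumes z: "z \<in> T" and ijc: "i < n" "j < n" "c < n"
  shows "((\<lambda>t. W (G (z(c := t))) i j) has_real_derivative
    - (\<Sum>a<n. \<Sum>b<n. W (G z) i a * pdiff c (\<lambda>z. J (G z) a b) z * W (G z) b j)) (at (z c))"
proof -
  have G1: "Ck (Suc 0) n T (\<lambda>z. G z i)" if "i < n" for i
    using G_Ck_Suc[OF _ that, of 0] W_G_cont by simp
  have lim: "((\<lambda>t. (J (G (z(c := t))) a b - J (G z) a b) / (t - z c)) \<longlongrightarrow> pdiff c (\<lambda>z. J (G z) a b) z) (at (z c))"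
    if "a < n" "b < n" for a b
  proof -
    have "Ck (Suc 0) n T (\<lambda>z. J (G z) a b)" by (rule compose_G[OF G1 J_Ck[OF that]])
    then have "(\<lambda>t. J (G (z(c := t))) a b) differentiable (at (z c))"
      using z ijc(3) unfolding Ck.simps by blast
    from pdiff_has_derivative[where G = "\<lambda>z. J (G z) a b", OF this] show ?thesis
      unfolding has_field_derivative_iff by (simp only: fun_upd_triv)
  qed
  let ?q = "\<lambda>t. - (\<Sum>a<n. \<Sum>b<n. W (G z) i a * ((J (G (z(c := t))) a b - J (G z) a b) / (t - z c)) * W (G (z(c := t))) b j)"
  have "(?q \<longlongrightarrow> - (\<Sum>a<n. \<Sum>b<n. W (G z) i a * pdiff c (\<lambda>z. J (G z) a b) z * W (G z) b j)) (at (z c))"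
    by (intro tendsto_intros lim tendsto_upd[OF T_open W_G_cont z]) (use ijc in auto)
  moreover have "\<forall>\<^sub>F t in at (z c). ?q t = (W (G (z(c := t))) i j - W (G (z(c := z c))) i j) / (t - z c)"
  proof -
    have "\<forall>\<^sub>F t in at (z c). z(c := t) \<in> T"
      using eventually_upd_in[OF T_open z ijc(3)] by (simp add: eventually_nhds_conv_at)
    then show ?thesis
    proof eventually_elim
      case (elim t)
      define x y where "x = G z" and "y = G (z(c := t))"
      have xB: "x \<in> B" and yB: "y \<in> B" using G S'_B z elim by (auto simp: x_def y_def)
      have "(\<Sum>a<n. \<Sum>b<n. W x i a * (J y a b - J x a b) * W y b j) =
         (\<Sum>a<n. W x i a * (\<Sum>b<n. J y a b * W y b j)) - (\<Sum>b<n. (\<Sum>a<n. W x i a * J x a b) * W y b j)"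
        unfolding sum_distrib_left sum_distrib_right
        by (subst (3) sum.swap) (simp add: algebra_simps sum_subtractf)
      also have "(\<Sum>a<n. W x i a * (\<Sum>b<n. J y a b * W y b j)) = (\<Sum>a<n. W x i a * (if a = j then 1 else 0))"
        using J_W[OF yB _ ijc(2)] by (intro sum.cong) auto
      also have "\<dots> = W x i j" using ijc by (simp add: if_distrib[of "\<lambda>c. _ * c"] cong: if_cong)
      also have "(\<Sum>b<n. (\<Sum>a<n. W x i a * J x a b) * W y b j) = (\<Sum>b<n. (if i = b then 1 else 0) * W y b j)"
        using W_J[OF xB ijc(1)] by (intro sum.cong) auto
      also have "\<dots> = W y i j" by (rule sum_delta_row[OF ijc(1)])
      finally have "(\<Sum>a<n. \<Sum>b<n. W x i a * (J y a b - J x a b) * W y b j) = W x i j - W y i j" .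
      then have "(\<Sum>a<n. \<Sum>b<n. W x i a * ((J y a b - J x a b) / (t - z c)) * W y b j) = (W x i j - W y i j) / (t - z c)"
        by (simp add: sum_divide_distrib[symmetric])
      then show ?case unfolding x_def y_def by (simp add: minus_divide_left)
    qed
  qed
  ultimately show ?thesis unfolding has_field_derivative_iff by (rule Lim_transform_eventually)
qed

text \<open>A bootstrap: the derivatives of \<open>G\<close> are the entries of \<open>W\<close>, so
  \<open>G\<close> is one order better than \<open>W\<close>; the derivatives of \<open>W\<close>
  are polynomials in \<open>W\<close> and in derivatives of \<open>J\<close> along \<open>G\<close>,
  so \<open>W\<close> follows with the same order.\<close>

lemma G_W_Ck: "(\<forall>i<n. Ck k n T (\<lambda>z. G z i)) \<and> (\<forall>i<n. \<forall>j<n. Ck k n T (\<lambda>z. W (G z) i j))"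
proof (induction k)
  case 0
  show ?case using G_cont W_G_cont by simp
next
  case (Suc k)
  then have Gk: "\<And>i. i < n \<Longrightarrow> Ck k n T (\<lambda>z. G z i)" and Wk: "\<And>i j. i < n \<Longrightarrow> j < n \<Longrightarrow> Ck k n T (\<lambda>z. W (G z) i j)" by auto
  have GS: "\<And>i. i < n \<Longrightarrow> Ck (Suc k) n T (\<lambda>z. G z i)" using G_Ck_Suc Wk by blast
  have "Ck (Suc k) n T (\<lambda>z. W (G z) i j)" if ij: "i < n" "j < n" for i j
  proof -
    have "Ck k n T (pdiff c (\<lambda>z. W (G z) i j))" if c: "c < n" for c
    proof -
      have eq: "pdiff c (\<lambda>z. W (G z) i j) z = (-1) * (\<Sum>a<n. \<Sum>b<n. W (G z) i a * pdiff c (\<lambda>z. J (G z) a b) z * W (G z) b j)" if "z \<in> T" for z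
        using pdiff_eq[where G = "\<lambda>z. W (G z) i j", OF W_derivative[OF that ij c]] by simp
      have "Ck k n T (pdiff c (\<lambda>z. J (G z) a b))" if "a < n" "b < n" for a b
        using compose_G[OF GS J_Ck[OF that]] c by simp
      then have "Ck k n T (\<lambda>z. (-1) * (\<Sum>a<n. \<Sum>b<n. W (G z) i a * pdiff c (\<lambda>z. J (G z) a b) z * W (G z) b j))"
        using ij by (intro Ck_mult[OF T_open] Ck_sum[OF T_open] Ck_const Wk) auto
      then show ?thesis using Ck_cong[OF T_open eq] by simp
    qed
    moreover have "(\<lambda>t. W (G (z(c := t))) i j) differentiable (at (z c))" if "c < n" "z \<in> T" for c z
      using W_derivative[OF that(2) ij that(1)] real_differentiable_def by blast
    ultimately show ?thesis using W_G_cont[OF ij] unfolding Ck.simps by blast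
  qed
  then show ?case using GS by blast
qed

end

text \<open>The inverse function theorem, normalised to the identity as derivative at
  \<open>x0\<close>; the averaged map \<open>\<psi>\<close> of the linearisation argument has this
  derivative.\<close>

theorem local_inverse:
  assumes S: "openin (Euclidean_space n) S" and x0: "x0 \<in> S"
    and FR: "\<And>x. x \<in> S \<Longrightarrow> F x \<in> Rn n"
    and F: "\<And>i. i < n \<Longrightarrow> smooth_fun_on n S (\<lambda>y. F y i)"
    and D: "\<And>i j. i < n \<Longrightarrow> j < n \<Longrightarrow> pdiff j (\<lambda>y. F y i) x0 = (if i = j then 1 else 0)"
  obtains S' T G where "openin (Euclidean_space n) S'" "x0 \<in> S'" "S' \<subseteq> S" "openin (Euclidean_space n) T"
    "\<And>x. x \<in> S' \<Longrightarrow> F x \<in> T \<and> G (F x) = x" "\<And>z. z \<in> T \<Longrightarrow> G z \<in> S' \<and> F (G z) = z"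
    "\<And>i. i < n \<Longrightarrow> smooth_fun_on n T (\<lambda>z. G z i)"
proof -
  have SR: "S \<subseteq> Rn n" by (rule open_Rn_subset[OF S])
  have FC: "\<And>i k. i < n \<Longrightarrow> Ck k n S (\<lambda>y. F y i)" using F by (simp add: smooth_fun_on_iff[OF SR])
  define J where "J = (\<lambda>x i j. pdiff j (\<lambda>y. F y i) x)"
  \<comment> \<open>The total deviation of the Jacobian from the unit matrix, a continuous function
    that vanishes at \<open>x0\<close>.\<close>
  let ?s = "\<lambda>x. \<Sum>i<n. \<Sum>j<n. \<bar>J x i j - (if i = j then 1 else 0)\<bar>"
  have "continuous_on S (\<lambda>x. J x i j)" if "i < n" "j < n" for i j
    using FC[OF that(1), of "Suc 0"] that(2) unfolding J_def by auto
  then have "continuous_on S ?s" by (intro continuous_intros) auto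
  moreover have s0: "?s x0 = 0" using D by (simp add: J_def)
  ultimately obtain e where e: "0 < e" "box_nhd n x0 e \<subseteq> S" "\<And>x. x \<in> box_nhd n x0 e \<Longrightarrow> \<bar>?s x - ?s x0\<bar> < 1 / (2 * real n + 2)"
    using continuous_on_box[OF S _ x0, of ?s "1 / (2 * real n + 2)"] by auto
  interpret near_identity n S F "box_nhd n x0 e" J x0 e
  proof unfold_locales
    fix x i j assume x: "x \<in> box_nhd n x0 e" and ij: "i < n" "j < n"
    have "\<bar>J x i j - (if i = j then 1 else 0)\<bar> \<le> (\<Sum>j<n. \<bar>J x i j - (if i = j then 1 else 0)\<bar>)"
      using ij by (intro member_le_sum) auto
    also have "\<dots> \<le> ?s x"
      using ij by (intro member_le_sum[of i "{..<n}" "\<lambda>i. \<Sum>j<n. \<bar>J x i j - (if i = j then 1 else 0)\<bar>"]) (auto intro: sum_nonneg)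
    finally show "\<bar>J x i j - (if i = j then 1 else 0)\<bar> \<le> 1 / (2 * real n + 2)"
      using e(3)[OF x] s0 by linarith
  qed (use S x0 FR FC e in \<open>auto simp: J_def\<close>)
  show thesis
  proof (rule that[OF S'_open x0_S' _ T_open, of G])
    show "S' \<subseteq> S" using S'_B B_S by blast
    show "smooth_fun_on n T (\<lambda>z. G z i)" if "i < n" for i
      using G_W_Ck that by (simp add: smooth_fun_on_iff[OF open_Rn_subset[OF T_open]])
  qed (use G S'_T G_F in auto)
qed

section \<open>Manifolds\<close>

lemma smooth_continuous: "openin (Euclidean_space n) S \<Longrightarrow> smooth_fun_on n S G \<Longrightarrow> continuous_on S G"
  using Ck_continuous smooth_fun_on_iff open_Rn_subset by blast

lemma smooth_subset: "openin (Euclidean_space n) S \<Longrightarrow> T \<subseteq> S \<Longrightarrow> smooth_fun_on n S G \<Longrightarrow> smooth_fun_on n T G"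
  using Ck_subset smooth_fun_on_iff open_Rn_subset by (metis subset_trans)

lemma smooth_local:
  assumes "openin (Euclidean_space n) S"
    and "\<And>y. y \<in> S \<Longrightarrow> \<exists>T. openin (Euclidean_space n) T \<and> y \<in> T \<and> smooth_fun_on n T G"
  shows "smooth_fun_on n S G"
  unfolding smooth_fun_on_iff[OF open_Rn_subset[OF assms(1)]]
proof
  fix k show "Ck k n S G"
  proof (rule Ck_local[OF assms(1)])
    fix y assume "y \<in> S"
    from assms(2)[OF this] obtain T where T: "openin (Euclidean_space n) T" "y \<in> T" "smooth_fun_on n T G" by blast
    then have "Ck k n T G" using smooth_fun_on_iff[OF open_Rn_subset[OF T(1)]] by simp
    then show "\<exists>T. openin (Euclidean_space n) T \<and> y \<in> T \<and> Ck k n T G" using T by blast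
  qed
qed

lemma smooth_cong:
  "openin (Euclidean_space n) S \<Longrightarrow> (\<And>x. x \<in> S \<Longrightarrow> G x = H x) \<Longrightarrow> smooth_fun_on n S G \<longleftrightarrow> smooth_fun_on n S H"
  using Ck_cong[of n S G H] by (simp add: smooth_fun_on_iff open_Rn_subset)

lemma smooth_coord: "openin (Euclidean_space n) S \<Longrightarrow> smooth_fun_on n S (\<lambda>y. y i)"
  by (simp add: smooth_fun_on_iff open_Rn_subset Ck_coord)

lemma smooth_Ck: "openin (Euclidean_space n) S \<Longrightarrow> smooth_fun_on n S G \<Longrightarrow> Ck k n S G"
  by (simp add: smooth_fun_on_iff open_Rn_subset)

subsection \<open>Topology and charts\<close>

text \<open>The sets in \<open>mtop\<close> form a topology once the charts are injective, since
  images then commute with intersections. Only injectivity is assumed so that the topology can be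
  computed while a candidate is still to be shown to be a manifold.\<close>

lemma openin_mtop_inj:
  assumes inj: "\<And>K. K \<in> charts M \<Longrightarrow> inj_on (cmap K) (cdom K)"
  shows "openin (mtop M) S \<longleftrightarrow> S \<subseteq> pts M \<and>
    (\<forall>K\<in>charts M. openin (Euclidean_space (cdim K)) (cmap K ` (S \<inter> cdom K)))"
proof -
  let ?P = "\<lambda>S. S \<subseteq> pts M \<and> (\<forall>K\<in>charts M. openin (Euclidean_space (cdim K)) (cmap K ` (S \<inter> cdom K)))"
  have "istopology ?P"
    unfolding istopology_def
  proof (intro conjI allI impI)
    fix S T assume S: "?P S" and T: "?P T"
    show "S \<inter> T \<subseteq> pts M" using S by auto
    show "\<forall>K\<in>charts M. openin (Euclidean_space (cdim K)) (cmap K ` (S \<inter> T \<inter> cdom K))"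
    proof
      fix K assume K: "K \<in> charts M"
      have "cmap K ` (S \<inter> T \<inter> cdom K) = cmap K ` ((S \<inter> cdom K) \<inter> (T \<inter> cdom K))" by (rule arg_cong[of _ _ "image _"]) auto
      also have "\<dots> = cmap K ` (S \<inter> cdom K) \<inter> cmap K ` (T \<inter> cdom K)"
        by (rule inj_on_image_Int[OF inj[OF K]]) auto
      finally show "openin (Euclidean_space (cdim K)) (cmap K ` (S \<inter> T \<inter> cdom K))"
        using S T K by (simp add: openin_Int)
    qed
  next
    fix \<K> assume \<K>: "\<forall>S\<in>\<K>. ?P S"
    then show "\<Union>\<K> \<subseteq> pts M" by auto
    show "\<forall>K\<in>charts M. openin (Euclidean_space (cdim K)) (cmap K ` (\<Union>\<K> \<inter> cdom K))"
    proof
      fix K assume K: "K \<in> charts M"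
      have "cmap K ` (\<Union>\<K> \<inter> cdom K) = (\<Union>S\<in>\<K>. cmap K ` (S \<inter> cdom K))" by auto
      then show "openin (Euclidean_space (cdim K)) (cmap K ` (\<Union>\<K> \<inter> cdom K))"
        using \<K> K by auto
    qed
  qed
  then show ?thesis unfolding mtop_def by (simp add: topology_inverse')
qed

lemma chart_inj: "is_manifold M \<Longrightarrow> K \<in> charts M \<Longrightarrow> inj_on (cmap K) (cdom K)"
  by (simp add: is_manifold_def)

lemma openin_mtop:
  "is_manifold M \<Longrightarrow> openin (mtop M) S \<longleftrightarrow> S \<subseteq> pts M \<and>
    (\<forall>K\<in>charts M. openin (Euclidean_space (cdim K)) (cmap K ` (S \<inter> cdom K)))"
  by (rule openin_mtop_inj) (rule chart_inj)

context
  fixes M assumes M: "is_manifold M"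
begin

lemma cdom_pts: "K \<in> charts M \<Longrightarrow> x \<in> cdom K \<Longrightarrow> x \<in> pts M"
  using M by (auto simp: is_manifold_def)

lemma chart_at: "x \<in> pts M \<Longrightarrow> \<exists>K\<in>charts M. x \<in> cdom K"
  using M by (auto simp: is_manifold_def)

lemma chart_overlap: "K \<in> charts M \<Longrightarrow> L \<in> charts M \<Longrightarrow> openin (Euclidean_space (cdim K)) (cmap K ` (cdom K \<inter> cdom L))"
  using M by (auto simp: is_manifold_def)

lemma transition_smooth:
  "K \<in> charts M \<Longrightarrow> L \<in> charts M \<Longrightarrow> i < cdim L \<Longrightarrow>
   smooth_fun_on (cdim K) (cmap K ` (cdom K \<inter> cdom L)) (\<lambda>y. cmap L (cinv K y) i)"
  using M by (auto simp: is_manifold_def)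

lemma openin_pts: "openin (mtop M) (pts M)"
  unfolding openin_mtop[OF M] using chart_overlap[of K K for K] cdom_pts
  by (metis Int_absorb1 order_refl subsetI Int_absorb)

lemma topspace_mtop: "topspace (mtop M) = pts M"
  using openin_pts openin_subset[of "mtop M"] openin_mtop[OF M] by (metis openin_topspace subset_antisym)

lemma open_pts: "openin (mtop M) S \<Longrightarrow> S \<subseteq> pts M"
  using openin_mtop[OF M] by blast

lemma openin_cdom: "K \<in> charts M \<Longrightarrow> openin (mtop M) (cdom K)"
  unfolding openin_mtop[OF M] using chart_overlap cdom_pts by (metis Int_commute subsetI)

lemma chart_image_open: "openin (mtop M) S \<Longrightarrow> K \<in> charts M \<Longrightarrow> S \<subseteq> cdom K \<Longrightarrow> openin (Euclidean_space (cdim K)) (cmap K ` S)"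
  using openin_mtop[OF M] by (metis inf.absorb1)

lemma cmap_Rn: "K \<in> charts M \<Longrightarrow> x \<in> cdom K \<Longrightarrow> cmap K x \<in> Rn (cdim K)"
  using chart_image_open[OF openin_cdom] open_Rn_subset by blast

lemma cinv_cmap: "K \<in> charts M \<Longrightarrow> x \<in> cdom K \<Longrightarrow> cinv K (cmap K x) = x"
  using chart_inj[OF M] by (simp add: inv_into_f_f)

text \<open>In another chart \<open>L\<close> the image of \<open>S\<close> is the preimage of an
  open set under the transition function from \<open>L\<close> to \<open>K\<close>, which is
  continuous.\<close>

lemma openin_from_chart:
  assumes K: "K \<in> charts M" and S: "S \<subseteq> cdom K" and o: "openin (Euclidean_space (cdim K)) (cmap K ` S)"
  shows "openin (mtop M) S"
  unfolding openin_mtop[OF M]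
proof (intro conjI ballI)
  show "S \<subseteq> pts M" using S K cdom_pts by blast
  fix L assume L: "L \<in> charts M"
  have "cmap L ` (S \<inter> cdom L) = {y \<in> cmap L ` (cdom L \<inter> cdom K). cmap K (cinv L y) \<in> cmap K ` S}" (is "?A = ?B")
  proof
    show "?A \<subseteq> ?B" using S cinv_cmap[OF L] by auto
    show "?B \<subseteq> ?A"
    proof
      fix y assume "y \<in> ?B"
      then obtain x where x: "x \<in> cdom L" "x \<in> cdom K" "y = cmap L x" "cmap K x \<in> cmap K ` S"
        using cinv_cmap[OF L] by auto
      then have "x \<in> S" using chart_inj[OF M K] S by (auto simp: inj_on_def)
      then show "y \<in> ?A" using x by auto
    qed
  qed
  moreover have "openin (Euclidean_space (cdim L)) ?B"
  proof (rule openin_preimage_Rn[OF chart_overlap[OF L K] o])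
    show "continuous_on (cmap L ` (cdom L \<inter> cdom K)) (\<lambda>y. cmap K (cinv L y) i)" if "i < cdim K" for i
      using smooth_continuous[OF chart_overlap[OF L K] transition_smooth[OF L K that]] .
    show "cmap K (cinv L y) \<in> Rn (cdim K)" if "y \<in> cmap L ` (cdom L \<inter> cdom K)" for y
      using that cinv_cmap[OF L] cmap_Rn[OF K] by auto
  qed
  ultimately show "openin (Euclidean_space (cdim L)) (cmap L ` (S \<inter> cdom L))" by simp
qed

text \<open>\<open>inv_into\<close> depends on the domain, so restricting a chart changes its
  inverse as a function on all vectors; on the image of the smaller domain the two agree.\<close>

lemma cinv_restrict:
  assumes "K \<in> charts M" "A \<subseteq> cdom K" "y \<in> cmap K ` A"
  shows "inv_into A (cmap K) y = cinv K y"
proof -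
  obtain x where x: "x \<in> A" "y = cmap K x" using assms(3) by blast
  have "inj_on (cmap K) A" using chart_inj[OF M assms(1)] assms(2) by (rule inj_on_subset)
  then show ?thesis using x assms(2) cinv_cmap[OF assms(1)] by (auto simp: inv_into_f_f)
qed

end

lemma smooth_map_pts: "is_manifold M \<Longrightarrow> is_manifold N \<Longrightarrow> smooth_map M N F \<Longrightarrow> x \<in> pts M \<Longrightarrow> F x \<in> pts N"
  unfolding smooth_map_def continuous_map_def using topspace_mtop by blast

lemma smooth_map_preimage_open:
  assumes "is_manifold M" "smooth_map M N F" "openin (mtop N) V"
  shows "openin (mtop M) {x \<in> pts M. F x \<in> V}"
  using assms unfolding smooth_map_def continuous_map_def by (simp add: topspace_mtop)

lemma smooth_map_coord:
  assumes M: "is_manifold M" and N: "is_manifold N" and F: "smooth_map M N F" and K: "K \<in> charts M" and L: "L \<in> charts N"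
    and W: "W \<subseteq> cdom K" "F ` W \<subseteq> cdom L" and i: "i < cdim L"
  shows "smooth_fun_on (cdim K) (cmap K ` W) (\<lambda>y. cmap L (F (cinv K y)) i)"
proof (rule smooth_subset)
  have "{x \<in> cdom K. F x \<in> cdom L} = cdom K \<inter> {x \<in> pts M. F x \<in> cdom L}" using cdom_pts[OF M K] by auto
  then have "openin (mtop M) {x \<in> cdom K. F x \<in> cdom L}"
    using openin_Int[OF openin_cdom[OF M K] smooth_map_preimage_open[OF M F openin_cdom[OF N L]]] by simp
  then show "openin (Euclidean_space (cdim K)) (cmap K ` {x \<in> cdom K. F x \<in> cdom L})"
    by (rule chart_image_open[OF M _ K]) auto
  show "smooth_fun_on (cdim K) (cmap K ` {x \<in> cdom K. F x \<in> cdom L}) (\<lambda>y. cmap L (F (cinv K y)) i)"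
    using F K L i by (simp add: smooth_map_def)
qed (use W in auto)

lemma smooth_map_nbhd:
  assumes M: "is_manifold M" and N: "is_manifold N" and F: "smooth_map M N F"
    and K: "K \<in> charts M" "x \<in> cdom K" and V: "openin (mtop N) V" "F x \<in> V"
  obtains W where "openin (mtop M) W" "x \<in> W" "W \<subseteq> cdom K" "F ` W \<subseteq> V"
proof (rule that)
  show "openin (mtop M) (cdom K \<inter> {x \<in> pts M. F x \<in> V})"
    by (intro openin_Int openin_cdom[OF M K(1)] smooth_map_preimage_open[OF M F V(1)])
qed (use K V cdom_pts[OF M K] in auto)

text \<open>Continuity and smoothness in all pairs of charts are reduced to smoothness in one pair
  of charts around each point: the coordinate expression is continuous, and other charts differ by
  transition functions.\<close>

lemma smooth_mapI:
  assumes M: "is_manifold M" and N: "is_manifold N" and ext: "F \<in> extensional (pts M)"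
    and loc: "\<And>x. x \<in> pts M \<Longrightarrow> \<exists>K\<in>charts M. \<exists>L\<in>charts N. \<exists>W. openin (mtop M) W \<and> x \<in> W \<and> W \<subseteq> cdom K \<and> F ` W \<subseteq> cdom L \<and>
      (\<forall>i<cdim L. smooth_fun_on (cdim K) (cmap K ` W) (\<lambda>y. cmap L (F (cinv K y)) i))"
  shows "smooth_map M N F"
proof -
  have Fpts: "F x \<in> pts N" if x: "x \<in> pts M" for x
    using loc[OF x] cdom_pts[OF N] by blast
  have op: "openin (mtop M) {x \<in> pts M. F x \<in> V}" if V: "openin (mtop N) V" for V
  proof (subst openin_subopen, intro ballI)
    fix x assume x: "x \<in> {x \<in> pts M. F x \<in> V}"
    obtain K L W where K: "K \<in> charts M" and L: "L \<in> charts N" and W: "openin (mtop M) W" "x \<in> W" "W \<subseteq> cdom K" "F ` W \<subseteq> cdom L"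
      and sm: "\<And>i. i < cdim L \<Longrightarrow> smooth_fun_on (cdim K) (cmap K ` W) (\<lambda>y. cmap L (F (cinv K y)) i)"
      using loc[of x] x by blast
    have oW: "openin (Euclidean_space (cdim K)) (cmap K ` W)" by (rule chart_image_open[OF M W(1) K W(3)])
    have oV: "openin (Euclidean_space (cdim L)) (cmap L ` (V \<inter> cdom L))"
      using V L openin_mtop[OF N] by blast
    let ?W' = "{x \<in> W. F x \<in> V}"
    have "cmap K ` ?W' = {y \<in> cmap K ` W. cmap L (F (cinv K y)) \<in> cmap L ` (V \<inter> cdom L)}" (is "?A = ?B")
    proof
      show "?A \<subseteq> ?B" using cinv_cmap[OF M K] W by (fastforce simp: subset_iff)
      show "?B \<subseteq> ?A"
      proof
        fix y assume "y \<in> ?B"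
        then obtain x where x: "x \<in> W" "y = cmap K x" "cmap L (F x) \<in> cmap L ` (V \<inter> cdom L)"
          using cinv_cmap[OF M K] W by auto
        then have "F x \<in> V" using chart_inj[OF N L] W(4) by (auto simp: inj_on_def)
        then show "y \<in> ?A" using x by auto
      qed
    qed
    moreover have "openin (Euclidean_space (cdim K)) ?B"
    proof (rule openin_preimage_Rn[OF oW oV])
      show "continuous_on (cmap K ` W) (\<lambda>y. cmap L (F (cinv K y)) i)" if "i < cdim L" for i
        by (rule smooth_continuous[OF oW sm[OF that]])
      show "cmap L (F (cinv K y)) \<in> Rn (cdim L)" if "y \<in> cmap K ` W" for y
        using that cinv_cmap[OF M K] W cmap_Rn[OF N L] by (fastforce simp: subset_iff)
    qed
    ultimately have "openin (Euclidean_space (cdim K)) (cmap K ` ?W')" by simp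
    then have "openin (mtop M) ?W'" using openin_from_chart[OF M K, of ?W'] W(3) by auto
    then show "\<exists>T. openin (mtop M) T \<and> x \<in> T \<and> T \<subseteq> {x \<in> pts M. F x \<in> V}"
      using x W open_pts[OF M] by (intro exI[of _ ?W']) auto
  qed
  have "continuous_map (mtop M) (mtop N) F"
    unfolding continuous_map_def using Fpts op topspace_mtop[OF M] topspace_mtop[OF N] by auto
  moreover have "smooth_fun_on (cdim K') (cmap K' ` {x \<in> cdom K'. F x \<in> cdom L'}) (\<lambda>y. cmap L' (F (cinv K' y)) j)"
    if K': "K' \<in> charts M" and L': "L' \<in> charts N" and j: "j < cdim L'" for K' L' j
  proof (rule smooth_local)
    have "{x \<in> cdom K'. F x \<in> cdom L'} = cdom K' \<inter> {x \<in> pts M. F x \<in> cdom L'}" using cdom_pts[OF M K'] by auto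
    then have oD: "openin (mtop M) {x \<in> cdom K'. F x \<in> cdom L'}"
      using openin_Int[OF openin_cdom[OF M K'] op[OF openin_cdom[OF N L']]] by simp
    then show "openin (Euclidean_space (cdim K')) (cmap K' ` {x \<in> cdom K'. F x \<in> cdom L'})"
      by (rule chart_image_open[OF M _ K']) auto
    fix y assume "y \<in> cmap K' ` {x \<in> cdom K'. F x \<in> cdom L'}"
    then obtain x where x: "x \<in> cdom K'" "F x \<in> cdom L'" "y = cmap K' x" by blast
    obtain K L W where K: "K \<in> charts M" and L: "L \<in> charts N" and W: "openin (mtop M) W" "x \<in> W" "W \<subseteq> cdom K" "F ` W \<subseteq> cdom L"
      and sm: "\<And>i. i < cdim L \<Longrightarrow> smooth_fun_on (cdim K) (cmap K ` W) (\<lambda>y. cmap L (F (cinv K y)) i)"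
      using loc[of x] x cdom_pts[OF M K'] by blast
    let ?W = "W \<inter> {x \<in> cdom K'. F x \<in> cdom L'}"
    have oW: "openin (mtop M) ?W" by (rule openin_Int[OF W(1) oD])
    have o1: "openin (Euclidean_space (cdim K')) (cmap K' ` ?W)" by (rule chart_image_open[OF M oW K']) auto
    have o2: "openin (Euclidean_space (cdim K)) (cmap K ` ?W)" by (rule chart_image_open[OF M oW K]) (use W in auto)
    have o3: "openin (Euclidean_space (cdim L)) (cmap L ` (cdom L \<inter> cdom L'))" by (rule chart_overlap[OF N L L'])
    \<comment> \<open>Change of the chart in the target, from \<open>L\<close> to
      \<open>L'\<close>.\<close>
    have sm1: "smooth_fun_on (cdim K) (cmap K ` ?W) (\<lambda>z. cmap L' (cinv L (cmap L (F (cinv K z)))) j)"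
    proof (rule smooth_compose[OF o2 o3, where F = "\<lambda>z. cmap L (F (cinv K z))" and G = "\<lambda>z. cmap L' (cinv L z) j"])
      show "cmap L (F (cinv K z)) \<in> cmap L ` (cdom L \<inter> cdom L')" if "z \<in> cmap K ` ?W" for z
      proof -
        from that obtain x where x: "x \<in> ?W" "z = cmap K x" by blast
        then have "cinv K z = x" using cinv_cmap[OF M K] W(3) by blast
        then show ?thesis using x W(4) by auto
      qed
      show "smooth_fun_on (cdim K) (cmap K ` ?W) (\<lambda>y. cmap L (F (cinv K y)) i)" if "i < cdim L" for i
        by (rule smooth_subset[OF chart_image_open[OF M W(1) K W(3)] _ sm[OF that]]) auto
    qed (rule transition_smooth[OF N L L' j])
    \<comment> \<open>Change of the chart in the source, from \<open>K\<close> to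
      \<open>K'\<close>.\<close>
    have "smooth_fun_on (cdim K') (cmap K' ` ?W) (\<lambda>y. cmap L' (cinv L (cmap L (F (cinv K (cmap K (cinv K' y)))))) j)"
    proof (rule smooth_compose[OF o1 o2 _ _ sm1, where F = "\<lambda>y. cmap K (cinv K' y)"])
      show "cmap K (cinv K' y) \<in> cmap K ` ?W" if "y \<in> cmap K' ` ?W" for y
        using that cinv_cmap[OF M K'] by auto
      show "smooth_fun_on (cdim K') (cmap K' ` ?W) (\<lambda>y. cmap K (cinv K' y) i)" if "i < cdim K" for i
        by (rule smooth_subset[OF chart_overlap[OF M K' K] _ transition_smooth[OF M K' K that]]) (use W in auto)
    qed
    then have "smooth_fun_on (cdim K') (cmap K' ` ?W) (\<lambda>y. cmap L' (F (cinv K' y)) j)"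
    proof (rule smooth_cong[OF o1, THEN iffD1, rotated])
      fix y assume "y \<in> cmap K' ` ?W"
      then obtain x where x: "x \<in> ?W" "y = cmap K' x" by blast
      then have "cinv K' y = x" using cinv_cmap[OF M K'] by auto
      moreover have "cinv K (cmap K x) = x" using x W(3) cinv_cmap[OF M K] by auto
      moreover have "cinv L (cmap L (F x)) = F x" using x W(4) cinv_cmap[OF N L] by auto
      ultimately show "cmap L' (cinv L (cmap L (F (cinv K (cmap K (cinv K' y)))))) j = cmap L' (F (cinv K' y)) j" by simp
    qed
    then show "\<exists>T. openin (Euclidean_space (cdim K')) T \<and> y \<in> T \<and> smooth_fun_on (cdim K') T (\<lambda>y. cmap L' (F (cinv K' y)) j)"
      using o1 x W by (intro exI[of _ "cmap K' ` ?W"]) auto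
  qed
  ultimately show ?thesis using ext by (simp add: smooth_map_def)
qed

lemma smooth_map_compose:
  assumes M: "is_manifold M" and N: "is_manifold N" and P: "is_manifold P"
    and F: "smooth_map M N F" and G: "smooth_map N P G"
  shows "smooth_map M P (compose (pts M) G F)"
proof (rule smooth_mapI[OF M P])
  fix x assume x: "x \<in> pts M"
  obtain K where K: "K \<in> charts M" "x \<in> cdom K" using chart_at[OF M x] by blast
  obtain L where L: "L \<in> charts N" "F x \<in> cdom L" using chart_at[OF N] smooth_map_pts[OF M N F x] by blast
  obtain Q where Q: "Q \<in> charts P" "G (F x) \<in> cdom Q"
    using chart_at[OF P] smooth_map_pts[OF N P G] smooth_map_pts[OF M N F x] by blast
  obtain V where V: "openin (mtop N) V" "F x \<in> V" "V \<subseteq> cdom L" "G ` V \<subseteq> cdom Q"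
    using smooth_map_nbhd[OF N P G L openin_cdom[OF P Q(1)] Q(2)] by blast
  obtain W where W: "openin (mtop M) W" "x \<in> W" "W \<subseteq> cdom K" "F ` W \<subseteq> V"
    using smooth_map_nbhd[OF M N F K V(1,2)] by blast
  have Wp: "W \<subseteq> pts M" using W(3) cdom_pts[OF M K(1)] by blast
  have oW: "openin (Euclidean_space (cdim K)) (cmap K ` W)" by (rule chart_image_open[OF M W(1) K(1) W(3)])
  have oV: "openin (Euclidean_space (cdim L)) (cmap L ` V)" by (rule chart_image_open[OF N V(1) L(1) V(3)])
  have "smooth_fun_on (cdim K) (cmap K ` W) (\<lambda>y. cmap Q (compose (pts M) G F (cinv K y)) i)" if i: "i < cdim Q" for i
  proof -
    have "smooth_fun_on (cdim K) (cmap K ` W) (\<lambda>y. cmap Q (G (cinv L (cmap L (F (cinv K y))))) i)"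
    proof (rule smooth_compose[OF oW oV, where F = "\<lambda>y. cmap L (F (cinv K y))" and G = "\<lambda>z. cmap Q (G (cinv L z)) i"])
      show "cmap L (F (cinv K y)) \<in> cmap L ` V" if "y \<in> cmap K ` W" for y
        using that W cinv_cmap[OF M K(1)] by (fastforce simp: subset_iff)
      show "smooth_fun_on (cdim K) (cmap K ` W) (\<lambda>y. cmap L (F (cinv K y)) i)" if "i < cdim L" for i
        by (rule smooth_map_coord[OF M N F K(1) L(1) W(3) _ that]) (use W V in auto)
      show "smooth_fun_on (cdim L) (cmap L ` V) (\<lambda>y. cmap Q (G (cinv L y)) i)"
        by (rule smooth_map_coord[OF N P G L(1) Q(1) V(3,4) i])
    qed
    then show ?thesis
    proof (rule smooth_cong[OF oW, THEN iffD1, rotated])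
      fix y assume "y \<in> cmap K ` W"
      then obtain x where x: "x \<in> W" "y = cmap K x" by blast
      then have "cinv K y = x" using cinv_cmap[OF M K(1)] W(3) by auto
      moreover have "cinv L (cmap L (F x)) = F x" using x W(4) V(3) cinv_cmap[OF N L(1)] by auto
      ultimately show "cmap Q (G (cinv L (cmap L (F (cinv K y))))) i = cmap Q (compose (pts M) G F (cinv K y)) i"
        using x Wp by (auto simp: compose_def)
    qed
  qed
  moreover have "compose (pts M) G F ` W \<subseteq> cdom Q" using W(4) V(4) Wp by (auto simp: compose_def)
  ultimately show "\<exists>K\<in>charts M. \<exists>L\<in>charts P. \<exists>W. openin (mtop M) W \<and> x \<in> W \<and> W \<subseteq> cdom K \<and> compose (pts M) G F ` W \<subseteq> cdom L \<and>
      (\<forall>i<cdim L. smooth_fun_on (cdim K) (cmap K ` W) (\<lambda>y. cmap L (compose (pts M) G F (cinv K y)) i))"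
    using K(1) Q(1) W(1-3) by blast
qed (simp add: compose_def)


subsection \<open>Open submanifolds\<close>

abbreviation chart_restrict :: "chart \<Rightarrow> point set \<Rightarrow> chart"
  where "chart_restrict K S \<equiv> K\<lparr>cdom := cdom K \<inter> S\<rparr>"

lemma open_sub_simps [simp]: "pts (open_sub M S) = S" "charts (open_sub M S) = (\<lambda>K. chart_restrict K S) ` charts M"
  by (auto simp: open_sub_def)

lemma open_sub_open_sub: "T \<subseteq> S \<Longrightarrow> open_sub (open_sub M S) T = open_sub M T"
  by (auto simp: open_sub_def image_image Int_assoc Int_absorb1)

context
  fixes M S assumes M: "is_manifold M" and S: "openin (mtop M) S"
begin

lemma openin_open_sub: "openin (mtop (open_sub M S)) T \<longleftrightarrow> T \<subseteq> S \<and> openin (mtop M) T"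
proof -
  have "openin (mtop (open_sub M S)) T \<longleftrightarrow> T \<subseteq> pts (open_sub M S) \<and>
    (\<forall>K\<in>charts (open_sub M S). openin (Euclidean_space (cdim K)) (cmap K ` (T \<inter> cdom K)))"
    by (rule openin_mtop_inj) (use chart_inj[OF M] in \<open>auto simp: inj_on_def\<close>)
  then have "openin (mtop (open_sub M S)) T \<longleftrightarrow>
      T \<subseteq> S \<and> (\<forall>K\<in>charts M. openin (Euclidean_space (cdim K)) (cmap K ` (T \<inter> (cdom K \<inter> S))))"
    by simp
  also have "\<dots> \<longleftrightarrow> T \<subseteq> S \<and> openin (mtop M) T"
  proof -
    have "T \<inter> (cdom K \<inter> S) = T \<inter> cdom K" if "T \<subseteq> S" for K :: chart using that by auto
    then show ?thesis unfolding openin_mtop[OF M] using open_pts[OF M S] by (metis (no_types, lifting) subset_trans)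
  qed
  finally show ?thesis .
qed

lemma mtop_open_sub: "mtop (open_sub M S) = subtopology (mtop M) S"
  unfolding topology_eq openin_open_sub openin_open_subtopology[OF S] by auto

lemma is_manifold_open_sub: "is_manifold (open_sub M S)"
proof -
  have "openin (Euclidean_space (cdim K)) (cmap K ` (cdom K \<inter> S \<inter> (cdom L \<inter> S)))" if "K \<in> charts M" "L \<in> charts M" for K L
    using that S by (intro chart_image_open[OF M]) (auto intro!: openin_Int openin_cdom[OF M])
  moreover have "smooth_fun_on (cdim K) (cmap K ` (cdom K \<inter> S \<inter> (cdom L \<inter> S))) (\<lambda>y. cmap L (inv_into (cdom K \<inter> S) (cmap K) y) i)"
    if K: "K \<in> charts M" and L: "L \<in> charts M" and i: "i < cdim L" for K L i
  proof -
    have o: "openin (Euclidean_space (cdim K)) (cmap K ` (cdom K \<inter> S \<inter> (cdom L \<inter> S)))"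
      using K L S by (intro chart_image_open[OF M]) (auto intro!: openin_Int openin_cdom[OF M])
    have "smooth_fun_on (cdim K) (cmap K ` (cdom K \<inter> S \<inter> (cdom L \<inter> S))) (\<lambda>y. cmap L (cinv K y) i)"
      by (rule smooth_subset[OF chart_overlap[OF M K L] _ transition_smooth[OF M K L i]]) auto
    then show ?thesis
    proof (rule smooth_cong[OF o, THEN iffD1, rotated])
      fix y assume "y \<in> cmap K ` (cdom K \<inter> S \<inter> (cdom L \<inter> S))"
      then show "cmap L (cinv K y) i = cmap L (inv_into (cdom K \<inter> S) (cmap K) y) i"
        using cinv_restrict[OF M K, of "cdom K \<inter> S" y] by auto
    qed
  qed
  moreover have "(\<Union>K\<in>charts M. cdom K \<inter> S) = S" using chart_at[OF M] open_pts[OF M S] by blast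
  moreover have "Hausdorff_space (mtop (open_sub M S))" "second_countable (mtop (open_sub M S))"
    unfolding mtop_open_sub using M
    by (auto simp: is_manifold_def Hausdorff_space_subtopology second_countable_subtopology)
  ultimately show ?thesis
    unfolding is_manifold_def using chart_inj[OF M] by (auto simp: inj_on_def)
qed

lemma smooth_map_restrict:
  assumes N: "is_manifold N" and F: "smooth_map M N F"
  shows "smooth_map (open_sub M S) N (restrict F S)"
proof (rule smooth_mapI[OF is_manifold_open_sub N])
  fix x assume x: "x \<in> pts (open_sub M S)"
  then have xS: "x \<in> S" by simp
  then have xM: "x \<in> pts M" using open_pts[OF M S] by blast
  obtain K where K: "K \<in> charts M" "x \<in> cdom K" using chart_at[OF M xM] by blast
  obtain L where L: "L \<in> charts N" "F x \<in> cdom L" using chart_at[OF N] smooth_map_pts[OF M N F xM] by blast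
  obtain W0 where W0: "openin (mtop M) W0" "x \<in> W0" "W0 \<subseteq> cdom K" "F ` W0 \<subseteq> cdom L"
    using smooth_map_nbhd[OF M N F K openin_cdom[OF N L(1)] L(2)] by blast
  define W where "W = W0 \<inter> S"
  have W: "openin (mtop M) W" "x \<in> W" "W \<subseteq> cdom K \<inter> S" "F ` W \<subseteq> cdom L"
    using W0 xS S by (auto simp: W_def)
  have oW: "openin (Euclidean_space (cdim K)) (cmap K ` W)" by (rule chart_image_open[OF M W(1) K(1)]) (use W in auto)
  have "smooth_fun_on (cdim K) (cmap K ` W) (\<lambda>y. cmap L (restrict F S (inv_into (cdom K \<inter> S) (cmap K) y)) i)" if i: "i < cdim L" for i
  proof -
    have "smooth_fun_on (cdim K) (cmap K ` W) (\<lambda>y. cmap L (F (cinv K y)) i)"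
      by (rule smooth_map_coord[OF M N F K(1) L(1) _ _ i]) (use W in auto)
    then show ?thesis
    proof (rule smooth_cong[OF oW, THEN iffD1, rotated])
      fix y assume "y \<in> cmap K ` W"
      then obtain x where x: "x \<in> W" "y = cmap K x" by blast
      then have "cinv K y = x" using cinv_cmap[OF M K(1)] W(3) by auto
      moreover have "inv_into (cdom K \<inter> S) (cmap K) y = cinv K y"
        using cinv_restrict[OF M K(1), of "cdom K \<inter> S" y] x W(3) by auto
      ultimately show "cmap L (F (cinv K y)) i = cmap L (restrict F S (inv_into (cdom K \<inter> S) (cmap K) y)) i"
        using x W(3) by auto
    qed
  qed
  then show "\<exists>K\<in>charts (open_sub M S). \<exists>L\<in>charts N. \<exists>W. openin (mtop (open_sub M S)) W \<and> x \<in> W \<and> W \<subseteq> cdom K \<and> restrict F S ` W \<subseteq> cdom L \<and>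
      (\<forall>i<cdim L. smooth_fun_on (cdim K) (cmap K ` W) (\<lambda>y. cmap L (restrict F S (cinv K y)) i))"
    using K(1) L(1) W openin_open_sub[of W]
    by (intro bexI[of _ "chart_restrict K S"] bexI[of _ L] exI[of _ W]) auto
qed simp

lemma smooth_map_into_open:
  assumes N: "is_manifold N" and F: "smooth_map N M F" "F ` pts N \<subseteq> S"
  shows "smooth_map N (open_sub M S) F"
proof (rule smooth_mapI[OF N is_manifold_open_sub])
  show "F \<in> extensional (pts N)" using F by (simp add: smooth_map_def)
  fix x assume x: "x \<in> pts N"
  obtain K where K: "K \<in> charts N" "x \<in> cdom K" using chart_at[OF N x] by blast
  obtain L where L: "L \<in> charts M" "F x \<in> cdom L" using chart_at[OF M] smooth_map_pts[OF N M F(1) x] by blast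
  obtain W where W: "openin (mtop N) W" "x \<in> W" "W \<subseteq> cdom K" "F ` W \<subseteq> cdom L"
    using smooth_map_nbhd[OF N M F(1) K openin_cdom[OF M L(1)] L(2)] by blast
  have "F ` W \<subseteq> S" using F(2) W(1) open_pts[OF N] by blast
  moreover have "smooth_fun_on (cdim K) (cmap K ` W) (\<lambda>y. cmap L (F (cinv K y)) i)" if i: "i < cdim L" for i
    by (rule smooth_map_coord[OF N M F(1) K(1) L(1) W(3,4) i])
  ultimately show "\<exists>K\<in>charts N. \<exists>L\<in>charts (open_sub M S). \<exists>W. openin (mtop N) W \<and> x \<in> W \<and> W \<subseteq> cdom K \<and> F ` W \<subseteq> cdom L \<and>
      (\<forall>i<cdim L. smooth_fun_on (cdim K) (cmap K ` W) (\<lambda>y. cmap L (F (cinv K y)) i))"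
    using K(1) L(1) W
    by (intro bexI[of _ K] bexI[of _ "chart_restrict L S"] exI[of _ W]) auto
qed

end

lemma smooth_map_id:
  assumes M: "is_manifold M"
  shows "smooth_map M M (incl (pts M))"
proof (rule smooth_mapI[OF M M])
  fix x assume x: "x \<in> pts M"
  obtain K where K: "K \<in> charts M" "x \<in> cdom K" using chart_at[OF M x] by blast
  have o: "openin (Euclidean_space (cdim K)) (cmap K ` cdom K)" by (rule chart_image_open[OF M openin_cdom[OF M K(1)] K(1)]) auto
  have "smooth_fun_on (cdim K) (cmap K ` cdom K) (\<lambda>y. cmap K (incl (pts M) (cinv K y)) i)" for i
  proof (rule smooth_cong[OF o, THEN iffD1, OF _ smooth_coord[OF o, of i]])
    fix y assume "y \<in> cmap K ` cdom K"
    then show "y i = cmap K (incl (pts M) (cinv K y)) i"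
      using cinv_cmap[OF M K(1)] cdom_pts[OF M K(1)] by (auto simp: incl_def)
  qed
  then show "\<exists>K\<in>charts M. \<exists>L\<in>charts M. \<exists>W. openin (mtop M) W \<and> x \<in> W \<and> W \<subseteq> cdom K \<and> incl (pts M) ` W \<subseteq> cdom L \<and>
      (\<forall>i<cdim L. smooth_fun_on (cdim K) (cmap K ` W) (\<lambda>y. cmap L (incl (pts M) (cinv K y)) i))"
    using K openin_cdom[OF M K(1)] cdom_pts[OF M K(1)]
    by (intro bexI[of _ K] exI[of _ "cdom K"]) (auto simp: incl_def)
qed (simp add: incl_def)

lemma smooth_map_incl: "is_manifold M \<Longrightarrow> openin (mtop M) S \<Longrightarrow> smooth_map (open_sub M S) M (incl S)"
  using smooth_map_restrict[OF _ _ _ smooth_map_id, of M S] open_pts[of M S]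
  by (metis (no_types, lifting) incl_def restrict_restrict inf.absorb2)


subsection \<open>Open subsets of Euclidean space as manifolds\<close>

text \<open>Points and coordinate vectors have the same type, so the identity can serve as a chart.
  Both \<open>pt\<close> and the parameter domains of fixed loci are of this form.\<close>

definition euclidean_manifold :: "nat \<Rightarrow> vec set \<Rightarrow> manifold"
  where "euclidean_manifold n B = \<lparr>pts = B, charts = {\<lparr>cdim = n, cdom = B, cmap = (\<lambda>x. x)\<rparr>}\<rparr>"

lemma second_countable_Euclidean_space: "second_countable (Euclidean_space n)"
proof -
  obtain \<B> :: "vec set set" where \<B>: "countable \<B>" "topological_basis \<B>" using ex_countable_basis by blast
  have "second_countable (euclidean :: vec topology)"
    unfolding second_countable_def using \<B> topological_basis_open[OF \<B>(2)] topological_basisE[OF \<B>(2)]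
    by (metis open_openin)
  then show ?thesis
    unfolding Euclidean_space_def euclidean_product_topology by (rule second_countable_subtopology)
qed

lemma inv_into_ident: "y \<in> B \<Longrightarrow> inv_into B (\<lambda>x. x) y = y"
  by (rule inv_into_f_f) auto

context
  fixes n B assumes B: "openin (Euclidean_space n) B"
begin

lemma openin_euclidean_manifold: "openin (mtop (euclidean_manifold n B)) T \<longleftrightarrow> T \<subseteq> B \<and> openin (Euclidean_space n) T"
  by (subst openin_mtop_inj) (auto simp: euclidean_manifold_def Int_absorb2)

lemma is_manifold_euclidean: "is_manifold (euclidean_manifold n B)"
proof -
  have "mtop (euclidean_manifold n B) = subtopology (Euclidean_space n) B"
    unfolding topology_eq openin_euclidean_manifold openin_open_subtopology[OF B] by auto
  moreover have "smooth_fun_on n B (\<lambda>y. inv_into B (\<lambda>x. x) y i)" for i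
    by (rule smooth_cong[OF B, THEN iffD1, OF _ smooth_coord[OF B, of i]]) (simp add: inv_into_ident)
  ultimately show ?thesis
    unfolding is_manifold_def using B
    by (simp add: Hausdorff_space_subtopology Hausdorff_Euclidean_space second_countable_subtopology
        second_countable_Euclidean_space)
       (auto simp: euclidean_manifold_def)
qed

end

lemma pt_eq: "pt = euclidean_manifold 0 {\<lambda>_. 0}"
  by (simp add: pt_def euclidean_manifold_def)

lemma Rn_0: "Rn 0 = {\<lambda>_. 0}"
  by (auto simp: Rn_iff)

lemma openin_Rn_0: "openin (Euclidean_space 0) {\<lambda>_. 0}"
  using openin_topspace[of "Euclidean_space 0"] unfolding Rn_0 .

lemma is_manifold_pt: "is_manifold pt"
  unfolding pt_eq by (rule is_manifold_euclidean[OF openin_Rn_0])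

lemma pts_pt [simp]: "pts pt = {\<lambda>_. 0}"
  by (simp add: pt_def)

lemma smooth_map_pt:
  assumes M: "is_manifold M" and x: "x \<in> pts M"
  shows "smooth_map pt M (\<lambda>z\<in>{\<lambda>_. 0}. x)"
proof (rule smooth_mapI[OF is_manifold_pt M])
  obtain L where L: "L \<in> charts M" "x \<in> cdom L" using chart_at[OF M x] by blast
  have "smooth_fun_on 0 {\<lambda>_. 0} G" for G
    unfolding smooth_fun_on_iff[OF equalityD2[OF Rn_0]]
  proof
    fix k show "Ck k 0 {\<lambda>_. 0} G" by (cases k) auto
  qed
  moreover have "openin (mtop pt) {\<lambda>_. 0}" unfolding pt_eq openin_euclidean_manifold[OF openin_Rn_0] by (simp add: openin_Rn_0)
  ultimately show "\<exists>K\<in>charts pt. \<exists>L\<in>charts M. \<exists>W. openin (mtop pt) W \<and> y \<in> W \<and> W \<subseteq> cdom K \<and> (\<lambda>z\<in>{\<lambda>_. 0}. x) ` W \<subseteq> cdom L \<and>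
      (\<forall>i<cdim L. smooth_fun_on (cdim K) (cmap K ` W) (\<lambda>y. cmap L ((\<lambda>z\<in>{\<lambda>_. 0}. x) (cinv K y)) i))" if "y \<in> pts pt" for y
    using that L unfolding pt_def by auto
qed simp


subsection \<open>Derivatives\<close>

lemma dmap_Rn: "dmap K L F x v \<in> Rn (cdim L)"
  by (simp add: dmap_def Rn_iff)

lemma dmap_linear: "dmap K L F x (\<lambda>i. r * v i + s * w i) = (\<lambda>i. r * dmap K L F x v i + s * dmap K L F x w i)"
  by (auto simp: dmap_def sum_distrib_left sum.distrib[symmetric] algebra_simps intro!: sum.cong)

text \<open>The chain rule for maps that are smooth only near the points concerned. The local
  inverse of an etale map is such a map.\<close>

lemma dmap_compose_local:
  assumes M: "is_manifold M" and N: "is_manifold N" and K: "K \<in> charts M" and L: "L \<in> charts N"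
    and W: "openin (mtop M) W" "x \<in> W" "W \<subseteq> cdom K" and V: "openin (mtop N) V" "V \<subseteq> cdom L" "F ` W \<subseteq> V"
    and F: "\<And>i. i < cdim L \<Longrightarrow> smooth_fun_on (cdim K) (cmap K ` W) (\<lambda>y. cmap L (F (cinv K y)) i)"
    and G: "\<And>i. i < cdim Q \<Longrightarrow> smooth_fun_on (cdim L) (cmap L ` V) (\<lambda>y. cmap Q (G (cinv L y)) i)"
    and H: "\<And>y. y \<in> W \<Longrightarrow> H y = G (F y)"
  shows "dmap K Q H x v = dmap L Q G (F x) (dmap K L F x v)"
proof
  fix i
  show "dmap K Q H x v i = dmap L Q G (F x) (dmap K L F x v) i"
  proof (cases "i < cdim Q")
    case True
    have oW: "openin (Euclidean_space (cdim K)) (cmap K ` W)" by (rule chart_image_open[OF M W(1) K W(3)])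
    have oV: "openin (Euclidean_space (cdim L)) (cmap L ` V)" by (rule chart_image_open[OF N V(1) L V(2)])
    define \<Phi> where "\<Phi> y = cmap L (F (cinv K y))" for y
    define \<Psi> where "\<Psi> y = cmap Q (G (cinv L y)) i" for y
    have cx: "cmap K x \<in> cmap K ` W" using W by auto
    have \<Phi>x: "\<Phi> (cmap K x) = cmap L (F x)" using cinv_cmap[OF M K] W by (auto simp: \<Phi>_def)
    have "pdiff j (\<lambda>y. cmap Q (H (cinv K y)) i) (cmap K x) =
       (\<Sum>l<cdim L. pdiff l \<Psi> (cmap L (F x)) * pdiff j (\<lambda>y. \<Phi> y l) (cmap K x))" if j: "j < cdim K" for j
    proof -
      have "pdiff j (\<lambda>y. cmap Q (H (cinv K y)) i) (cmap K x) = pdiff j (\<lambda>y. \<Psi> (\<Phi> y)) (cmap K x)"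
      proof (rule pdiff_cong[OF oW cx j], intro ballI)
        fix y assume "y \<in> cmap K ` W"
        then obtain z where z: "z \<in> W" "y = cmap K z" by blast
        then have "cinv K y = z" using cinv_cmap[OF M K] W by auto
        moreover have "cinv L (cmap L (F z)) = F z" using cinv_cmap[OF N L] z V by auto
        ultimately show "cmap Q (H (cinv K y)) i = \<Psi> (\<Phi> y)" using H z by (simp add: \<Psi>_def \<Phi>_def)
      qed
      also have "\<dots> = (\<Sum>l<cdim L. pdiff l \<Psi> (\<Phi> (cmap K x)) * pdiff j (\<lambda>y. \<Phi> y l) (cmap K x))"
      proof (rule pdiff_compose[OF oW oV _ _ _ cx j])
        show "\<Phi> y \<in> cmap L ` V" if "y \<in> cmap K ` W" for y
          using that cinv_cmap[OF M K] W V by (fastforce simp: \<Phi>_def subset_iff)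
        show "Ck (Suc 0) (cdim K) (cmap K ` W) (\<lambda>y. \<Phi> y i)" if "i < cdim L" for i
          using smooth_Ck[OF oW F[OF that]] by (simp only: \<Phi>_def)
        show "Ck (Suc 0) (cdim L) (cmap L ` V) \<Psi>"
          using smooth_Ck[OF oV G[OF True]] unfolding \<Psi>_def .
      qed
      finally show ?thesis by (simp only: \<Phi>x)
    qed
    then have "dmap K Q H x v i = (\<Sum>j<cdim K. (\<Sum>l<cdim L. pdiff l \<Psi> (cmap L (F x)) * pdiff j (\<lambda>y. \<Phi> y l) (cmap K x)) * v j)"
      using True by (simp add: dmap_def)
    also have "\<dots> = (\<Sum>l<cdim L. pdiff l \<Psi> (cmap L (F x)) * (\<Sum>j<cdim K. pdiff j (\<lambda>y. \<Phi> y l) (cmap K x) * v j))"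
      unfolding sum_distrib_left sum_distrib_right by (subst sum.swap) (simp add: mult.assoc)
    also have "\<dots> = dmap L Q G (F x) (dmap K L F x v) i"
      unfolding \<Psi>_def \<Phi>_def dmap_def using True by simp
    finally show ?thesis .
  qed (simp add: dmap_def)
qed

lemma dmap_compose:
  assumes M: "is_manifold M" and N: "is_manifold N" and P: "is_manifold P"
    and F: "smooth_map M N F" and G: "smooth_map N P G"
    and K: "K \<in> charts M" "x \<in> cdom K" and L: "L \<in> charts N" "F x \<in> cdom L" and Q: "Q \<in> charts P" "G (F x) \<in> cdom Q"
  shows "dmap K Q (compose (pts M) G F) x v = dmap L Q G (F x) (dmap K L F x v)"
proof -
  obtain V where V: "openin (mtop N) V" "F x \<in> V" "V \<subseteq> cdom L" "G ` V \<subseteq> cdom Q"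
    using smooth_map_nbhd[OF N P G L openin_cdom[OF P Q(1)] Q(2)] by blast
  obtain W where W: "openin (mtop M) W" "x \<in> W" "W \<subseteq> cdom K" "F ` W \<subseteq> V"
    using smooth_map_nbhd[OF M N F K V(1,2)] by blast
  show ?thesis
  proof (rule dmap_compose_local[OF M N K(1) L(1) W(1-3) V(1,3) W(4)])
    show "smooth_fun_on (cdim K) (cmap K ` W) (\<lambda>y. cmap L (F (cinv K y)) i)" if "i < cdim L" for i
      by (rule smooth_map_coord[OF M N F K(1) L(1) W(3) _ that]) (use W V in auto)
    show "smooth_fun_on (cdim L) (cmap L ` V) (\<lambda>y. cmap Q (G (cinv L y)) i)" if "i < cdim Q" for i
      by (rule smooth_map_coord[OF N P G L(1) Q(1) V(3,4) that])
    show "compose (pts M) G F y = G (F y)" if "y \<in> W" for y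
      using that W open_pts[OF M W(1)] by (auto simp: compose_def)
  qed
qed

lemma dmap_ident:
  assumes M: "is_manifold M" and K: "K \<in> charts M" and W: "openin (mtop M) W" "x \<in> W" "W \<subseteq> cdom K"
    and F: "\<And>y. y \<in> W \<Longrightarrow> F y = y" and v: "v \<in> Rn (cdim K)"
  shows "dmap K K F x v = v"
proof
  fix i
  show "dmap K K F x v i = v i"
  proof (cases "i < cdim K")
    case True
    have oW: "openin (Euclidean_space (cdim K)) (cmap K ` W)" by (rule chart_image_open[OF M W(1) K W(3)])
    have cx: "cmap K x \<in> cmap K ` W" using W by auto
    have "pdiff j (\<lambda>y. cmap K (F (cinv K y)) i) (cmap K x) = (if i = j then 1 else 0)" if j: "j < cdim K" for j
    proof -
      have "pdiff j (\<lambda>y. cmap K (F (cinv K y)) i) (cmap K x) = pdiff j (\<lambda>y. y i) (cmap K x)"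
        by (rule pdiff_cong[OF oW cx j]) (use cinv_cmap[OF M K] W F in auto)
      then show ?thesis by (simp add: pdiff_coord)
    qed
    then have "dmap K K F x v i = (\<Sum>j<cdim K. (if i = j then 1 else 0) * v j)"
      using True by (simp add: dmap_def)
    also have "\<dots> = v i" using True by (simp add: if_distrib[of "\<lambda>c. c * _"] cong: if_cong)
    finally show ?thesis .
  next
    case False
    then show ?thesis using v by (simp add: dmap_def Rn_iff)
  qed
qed

lemma etale_smooth: "etale_map M N F \<Longrightarrow> smooth_map M N F"
  by (simp add: etale_map_def)

text \<open>Both composites of \<open>F\<close> with its local inverse \<open>G\<close> are the
  identity near the points concerned, so by the chain rule the derivatives are inverse to each
  other.\<close>

lemma etale_dmap_bij:
  assumes M: "is_manifold M" and N: "is_manifold N" and F: "etale_map M N F"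
    and K: "K \<in> charts M" "x \<in> cdom K" and L: "L \<in> charts N" "F x \<in> cdom L"
  shows "bij_betw (dmap K L F x) (Rn (cdim K)) (Rn (cdim L))"
proof -
  have x: "x \<in> pts M" using K cdom_pts[OF M] by blast
  obtain S where S: "x \<in> S" "openin (mtop M) S" "openin (mtop N) (F ` S)" "inj_on F S"
    and I: "smooth_map (open_sub N (F ` S)) (open_sub M S) (restrict (inv_into S F) (F ` S))"
    using F x unfolding etale_map_def by blast
  define G where "G = restrict (inv_into S F) (F ` S)"
  have sF: "smooth_map M N F" by (rule etale_smooth[OF F])
  have GF: "G (F y) = y" if "y \<in> S" for y using that S(4) by (simp add: G_def)
  obtain W0 where W0: "openin (mtop M) W0" "x \<in> W0" "W0 \<subseteq> cdom K" "F ` W0 \<subseteq> cdom L"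
    using smooth_map_nbhd[OF M N sF K openin_cdom[OF N L(1)] L(2)] by blast
  define W where "W = W0 \<inter> S"
  have W: "openin (mtop M) W" "x \<in> W" "W \<subseteq> cdom K" "F ` W \<subseteq> cdom L" "W \<subseteq> S"
    using W0 S by (auto simp: W_def)
  have mS: "is_manifold (open_sub M S)" and mFS: "is_manifold (open_sub N (F ` S))"
    by (rule is_manifold_open_sub[OF M S(2)], rule is_manifold_open_sub[OF N S(3)])
  \<comment> \<open>The image of the smaller set is the preimage of \<open>W\<close> under the
    continuous local inverse, hence open.\<close>
  have "F ` W = {y \<in> pts (open_sub N (F ` S)). G y \<in> W}"
  proof (intro equalityI subsetI)
    fix y assume y: "y \<in> {y \<in> pts (open_sub N (F ` S)). G y \<in> W}"
    then have "F (G y) = y" by (simp add: G_def f_inv_into_f)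
    then show "y \<in> F ` W" using y by (metis (no_types, lifting) imageI mem_Collect_eq)
  qed (use GF W(5) in auto)
  also have "openin (mtop (open_sub N (F ` S))) \<dots>"
    using smooth_map_preimage_open[OF mFS I[folded G_def], of W] openin_open_sub[OF M S(2), of W] W by blast
  finally have V: "openin (mtop N) (F ` W)" using openin_open_sub[OF N S(3)] by blast
  have oV: "openin (Euclidean_space (cdim L)) (cmap L ` F ` W)" by (rule chart_image_open[OF N V L(1) W(4)])
  have GV: "G ` F ` W \<subseteq> W" using GF W(5) by auto
  have Gsm: "smooth_fun_on (cdim L) (cmap L ` F ` W) (\<lambda>y. cmap K (G (cinv L y)) i)" if i: "i < cdim K" for i
  proof -
    have "smooth_fun_on (cdim (chart_restrict L (F ` S))) (cmap (chart_restrict L (F ` S)) ` F ` W)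
       (\<lambda>y. cmap (chart_restrict K S) (G (cinv (chart_restrict L (F ` S)) y)) i)"
      by (rule smooth_map_coord[OF mFS mS I[folded G_def]]) (use L K i W GV in \<open>auto 4 3\<close>)
    then have "smooth_fun_on (cdim L) (cmap L ` F ` W) (\<lambda>y. cmap K (G (inv_into (cdom L \<inter> F ` S) (cmap L) y)) i)" by simp
    then show ?thesis
    proof (rule smooth_cong[OF oV, THEN iffD1, rotated])
      fix y assume "y \<in> cmap L ` F ` W"
      then have "y \<in> cmap L ` (cdom L \<inter> F ` S)" using W(4,5) by blast
      then show "cmap K (G (inv_into (cdom L \<inter> F ` S) (cmap L) y)) i = cmap K (G (cinv L y)) i"
        using cinv_restrict[OF N L(1), of "cdom L \<inter> F ` S" y] by auto
    qed
  qed
  have Fsm: "smooth_fun_on (cdim K) (cmap K ` W) (\<lambda>y. cmap L (F (cinv K y)) i)" if "i < cdim L" for i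
    by (rule smooth_map_coord[OF M N sF K(1) L(1) W(3) _ that]) (use W in auto)
  have 1: "dmap L K G (F x) (dmap K L F x v) = v" if "v \<in> Rn (cdim K)" for v
  proof -
    have "dmap K K (\<lambda>y. y) x v = dmap L K G (F x) (dmap K L F x v)"
      by (rule dmap_compose_local[OF M N K(1) L(1) W(1-3) V W(4) _ Fsm Gsm]) (use GF W(5) in auto)
    then show ?thesis using dmap_ident[OF M K(1) W(1-3) _ that, of "\<lambda>y. y"] by simp
  qed
  have 2: "dmap K L F x (dmap L K G (F x) w) = w" if "w \<in> Rn (cdim L)" for w
  proof -
    have "dmap L L (\<lambda>y. y) (F x) w = dmap K L F (G (F x)) (dmap L K G (F x) w)"
      by (rule dmap_compose_local[OF N M L(1) K(1) V _ W(4) W(1,3) GV Gsm Fsm]) (use GF W in auto)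
    then show ?thesis using dmap_ident[OF N L(1) V _ W(4) _ that, of "F x" "\<lambda>y. y"] GF[OF S(1)] W(2) by simp
  qed
  show ?thesis
    by (rule bij_betw_byWitness[where f' = "dmap L K G (F x)"]) (use 1 2 dmap_Rn in auto)
qed

lemma etale_imp_submersion: "is_manifold M \<Longrightarrow> is_manifold N \<Longrightarrow> etale_map M N F \<Longrightarrow> submersion M N F"
  unfolding submersion_def using etale_smooth etale_dmap_bij bij_betw_imp_surj_on by metis

lemma etale_locally_inj:
  assumes "etale_map M N F" "x \<in> pts M"
  obtains S where "openin (mtop M) S" "x \<in> S" "inj_on F S"
  using assms unfolding etale_map_def by metis

text \<open>The local inverse on \<open>S\<close> is cut down to the image of
  \<open>S \<inter> U\<close>. Iterated open submanifolds depend only on the smallest open set, so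
  its target may be read inside \<open>U\<close> as well as inside \<open>S\<close>.\<close>

lemma etale_restrict:
  assumes M: "is_manifold M" and N: "is_manifold N" and F: "etale_map M N F" and U: "openin (mtop M) U"
  shows "etale_map (open_sub M U) N (restrict F U)"
  unfolding etale_map_def
proof (intro conjI ballI)
  show "smooth_map (open_sub M U) N (restrict F U)" by (rule smooth_map_restrict[OF M U N etale_smooth[OF F]])
  fix x assume "x \<in> pts (open_sub M U)"
  then have xU: "x \<in> U" by simp
  then obtain S where S: "x \<in> S" "openin (mtop M) S" "openin (mtop N) (F ` S)" "inj_on F S"
    and I: "smooth_map (open_sub N (F ` S)) (open_sub M S) (restrict (inv_into S F) (F ` S))"
    using F open_pts[OF M U] unfolding etale_map_def by blast
  define G where "G = restrict (inv_into S F) (F ` S)"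
  have GF: "G (F y) = y" if "y \<in> S" for y using that S(4) by (simp add: G_def)
  define W where "W = S \<inter> U"
  have W: "openin (mtop M) W" "W \<subseteq> S" "W \<subseteq> U" "x \<in> W" using S U xU by (auto simp: W_def)
  have mS: "is_manifold (open_sub M S)" and mFS: "is_manifold (open_sub N (F ` S))"
    by (rule is_manifold_open_sub[OF M S(2)], rule is_manifold_open_sub[OF N S(3)])
  have oW: "openin (mtop (open_sub M S)) W" using openin_open_sub[OF M S(2)] W by blast
  have "F ` W = {y \<in> pts (open_sub N (F ` S)). G y \<in> W}"
  proof (intro equalityI subsetI)
    fix y assume y: "y \<in> {y \<in> pts (open_sub N (F ` S)). G y \<in> W}"
    then have "F (G y) = y" by (simp add: G_def f_inv_into_f)
    then show "y \<in> F ` W" using y by (metis (no_types, lifting) imageI mem_Collect_eq)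
  qed (use GF W(2) in auto)
  also have "openin (mtop (open_sub N (F ` S))) \<dots>"
    by (rule smooth_map_preimage_open[OF mFS I[folded G_def] oW])
  finally have oFW: "openin (mtop (open_sub N (F ` S))) (F ` W)" .
  then have V: "openin (mtop N) (F ` W)" using openin_open_sub[OF N S(3)] by blast
  have "smooth_map (open_sub (open_sub N (F ` S)) (F ` W)) (open_sub M S) (restrict G (F ` W))"
    by (rule smooth_map_restrict[OF mFS oFW mS I[folded G_def]])
  then have "smooth_map (open_sub N (F ` W)) (open_sub M S) (restrict G (F ` W))"
    using open_sub_open_sub[OF image_mono[OF W(2)]] by simp
  then have "smooth_map (open_sub N (F ` W)) (open_sub (open_sub M S) W) (restrict G (F ` W))"
    by (rule smooth_map_into_open[OF mS oW is_manifold_open_sub[OF N V]]) (use GF W(2) in auto)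
  moreover have "open_sub (open_sub M S) W = open_sub (open_sub M U) W"
    using W by (simp add: open_sub_open_sub)
  moreover have "restrict (inv_into W (restrict F U)) (restrict F U ` W) = restrict G (F ` W)"
  proof -
    have "restrict F U ` W = F ` W" using W by auto
    moreover have "inv_into W (restrict F U) y = G y" if "y \<in> F ` W" for y
    proof -
      from that obtain z where z: "z \<in> W" "y = F z" by blast
      have "inj_on (restrict F U) W" using inj_on_subset[OF S(4) W(2)] W(3) by (auto simp: inj_on_def)
      then have "inv_into W (restrict F U) (restrict F U z) = z" using z(1) by (rule inv_into_f_f)
      moreover have "restrict F U z = y" using z W(3) by auto
      ultimately show ?thesis using GF z W(2) by auto
    qed
    ultimately show ?thesis by auto
  qed
  moreover have "restrict F U ` W = F ` W" using W by auto
  moreover have "inj_on (restrict F U) W" using inj_on_subset[OF S(4) W(2)] W(3) by (auto simp: inj_on_def)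
  moreover have "openin (mtop (open_sub M U)) W" using openin_open_sub[OF M U] W by blast
  ultimately show "\<exists>S. x \<in> S \<and> openin (mtop (open_sub M U)) S \<and> openin (mtop N) (restrict F U ` S) \<and> inj_on (restrict F U) S \<and>
       smooth_map (open_sub N (restrict F U ` S)) (open_sub (open_sub M U) S) (restrict (inv_into S (restrict F U)) (restrict F U ` S))"
    using V W(4) by (intro exI[of _ W]) simp
qed


subsection \<open>First and second derivatives of functions\<close>

lemma Ck_pdiff: "Ck (Suc k) n S G \<Longrightarrow> j < n \<Longrightarrow> Ck k n S (pdiff j G)"
  by simp

lemma Ck_differentiable: "Ck (Suc k) n S G \<Longrightarrow> j < n \<Longrightarrow> y \<in> S \<Longrightarrow> (\<lambda>t. G (y(j := t))) differentiable (at (y j))"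
  unfolding Ck.simps by blast

lemma pdiff_sum:
  assumes "\<And>l. l \<in> I \<Longrightarrow> (\<lambda>t. G l (y(j := t))) differentiable (at (y j))"
  shows "pdiff j (\<lambda>y. \<Sum>l\<in>I. G l y) y = (\<Sum>l\<in>I. pdiff j (G l) y)"
  by (rule pdiff_eq) (intro DERIV_sum pdiff_has_derivative assms)

text \<open>The differential as a linear form on the coordinate space. In this form averaging over a
  group applies to it.\<close>

definition dfun :: "chart \<Rightarrow> (point \<Rightarrow> real) \<Rightarrow> point \<Rightarrow> vec \<Rightarrow> real"
  where "dfun K h x v = (\<Sum>i<cdim K. pdiff i (coord_fun K h) (cmap K x) * v i)"

lemma diff_vanishes_iff: "diff_vanishes K h x \<longleftrightarrow> (\<forall>v\<in>Rn (cdim K). dfun K h x v = 0)"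
proof
  assume R: "\<forall>v\<in>Rn (cdim K). dfun K h x v = 0"
  show "diff_vanishes K h x"
    unfolding diff_vanishes_def
  proof (intro allI impI)
    fix i assume i: "i < cdim K"
    have "dfun K h x (\<lambda>k. if k = i then 1 else 0) = pdiff i (coord_fun K h) (cmap K x)"
      using i by (simp add: dfun_def if_distrib[of "\<lambda>c. _ * c"] cong: if_cong)
    moreover have "(\<lambda>k. if k = i then 1 else 0) \<in> Rn (cdim K)" using i by (simp add: Rn_iff)
    ultimately show "pdiff i (coord_fun K h) (cmap K x) = 0" using R by metis
  qed
qed (simp add: diff_vanishes_def dfun_def)

lemma dfun_linear: "dfun K h x (\<lambda>i. r * v i + s * w i) = r * dfun K h x v + s * dfun K h x w"
  by (simp add: dfun_def sum_distrib_left sum.distrib[symmetric] algebra_simps)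

lemma hessian_linear_left: "hessian K h x (\<lambda>i. r * v i + s * w i) u = r * hessian K h x v u + s * hessian K h x w u"
  by (simp add: hessian_def sum_distrib_left sum.distrib[symmetric] algebra_simps)

lemma hessian_linear_right: "hessian K h x u (\<lambda>i. r * v i + s * w i) = r * hessian K h x u v + s * hessian K h x u w"
  by (simp add: hessian_def sum_distrib_left sum.distrib[symmetric] algebra_simps)

lemma hessian_sym:
  assumes M: "is_manifold M" and h: "smooth_real M h" and K: "K \<in> charts M" and x: "x \<in> cdom K"
  shows "hessian K h x v w = hessian K h x w v"
proof -
  have o: "openin (Euclidean_space (cdim K)) (cmap K ` cdom K)" by (rule chart_image_open[OF M openin_cdom[OF M K] K]) auto
  have "Ck 2 (cdim K) (cmap K ` cdom K) (coord_fun K h)"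
    by (rule smooth_Ck[OF o]) (use h K in \<open>simp add: smooth_real_def\<close>)
  then have "pdiff i (pdiff j (coord_fun K h)) (cmap K x) = pdiff j (pdiff i (coord_fun K h)) (cmap K x)"
    if "i < cdim K" "j < cdim K" for i j
    using pdiff_commute[OF o] that x by blast
  then have "hessian K h x v w = (\<Sum>i<cdim K. \<Sum>j<cdim K. pdiff j (pdiff i (coord_fun K h)) (cmap K x) * v i * w j)"
    unfolding hessian_def by (intro sum.cong) auto
  also have "\<dots> = hessian K h x w v"
    unfolding hessian_def by (subst sum.swap) (simp add: mult_ac)
  finally show ?thesis .
qed

context
  fixes M N F h k K L x
  assumes M: "is_manifold M" and N: "is_manifold N" and F: "smooth_map M N F" and h: "smooth_real N h"
    and K: "K \<in> charts M" "x \<in> cdom K" and L: "L \<in> charts N" "F x \<in> cdom L"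
    and k: "\<And>y. y \<in> pts M \<Longrightarrow> k y = h (F y)"
begin

text \<open>Differentiating the chain rule once more produces second derivatives of the coordinate
  map, each multiplied by a first derivative of \<open>h\<close>. At a critical point these terms
  vanish, so the Hessian transforms as a bilinear form.\<close>

lemma pullback_derivatives:
  shows "i < cdim K \<Longrightarrow> pdiff i (coord_fun K k) (cmap K x) =
      (\<Sum>l<cdim L. pdiff l (coord_fun L h) (cmap L (F x)) * pdiff i (\<lambda>y. cmap L (F (cinv K y)) l) (cmap K x))"
    and "i < cdim K \<Longrightarrow> j < cdim K \<Longrightarrow> diff_vanishes L h (F x) \<Longrightarrow> pdiff i (pdiff j (coord_fun K k)) (cmap K x) =
      (\<Sum>l<cdim L. \<Sum>m<cdim L. pdiff m (pdiff l (coord_fun L h)) (cmap L (F x)) *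
         pdiff i (\<lambda>y. cmap L (F (cinv K y)) m) (cmap K x) * pdiff j (\<lambda>y. cmap L (F (cinv K y)) l) (cmap K x))"
proof -
  obtain W where W: "openin (mtop M) W" "x \<in> W" "W \<subseteq> cdom K" "F ` W \<subseteq> cdom L"
    using smooth_map_nbhd[OF M N F K openin_cdom[OF N L(1)] L(2)] by blast
  define S where "S = cmap K ` W"
  define T where "T = cmap L ` cdom L"
  define \<Phi> where "\<Phi> y = cmap L (F (cinv K y))" for y
  define \<Psi> where "\<Psi> = coord_fun L h"
  define G where "G = coord_fun K k"
  have oS: "openin (Euclidean_space (cdim K)) S" unfolding S_def by (rule chart_image_open[OF M W(1) K(1) W(3)])
  have oT: "openin (Euclidean_space (cdim L)) T" unfolding T_def by (rule chart_image_open[OF N openin_cdom[OF N L(1)] L(1)]) auto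
  define c where "c = cmap K x"
  have cS: "c \<in> S" using W by (auto simp: S_def c_def)
  have \<Phi>c: "\<Phi> c = cmap L (F x)" using cinv_cmap[OF M K(1)] K by (auto simp: \<Phi>_def c_def)
  have \<Phi>T: "\<Phi> y \<in> T" if "y \<in> S" for y
    using that cinv_cmap[OF M K(1)] W by (fastforce simp: \<Phi>_def S_def T_def subset_iff)
  have \<Phi>2: "Ck n (cdim K) S (\<lambda>y. \<Phi> y l)" if "l < cdim L" for n l
    using smooth_Ck[OF oS smooth_map_coord[OF M N F K(1) L(1) W(3,4) that, folded S_def]] by (simp only: \<Phi>_def)
  have \<Psi>2: "Ck n (cdim L) T \<Psi>" for n
    by (rule smooth_Ck[OF oT]) (use h L in \<open>simp add: smooth_real_def \<Psi>_def T_def\<close>)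
  have Geq: "G y = \<Psi> (\<Phi> y)" if "y \<in> S" for y
  proof -
    obtain z where z: "z \<in> W" "y = cmap K z" using \<open>y \<in> S\<close> S_def by blast
    then have "cinv K y = z" "z \<in> pts M" using cinv_cmap[OF M K(1)] W(3) open_pts[OF M W(1)] by auto
    moreover have "cinv L (cmap L (F z)) = F z" using cinv_cmap[OF N L(1)] z W by auto
    ultimately show ?thesis using k[of z] by (simp add: G_def \<Psi>_def \<Phi>_def coord_fun_def)
  qed
  have d1: "pdiff i G y = (\<Sum>l<cdim L. pdiff l \<Psi> (\<Phi> y) * pdiff i (\<lambda>y. \<Phi> y l) y)" if "i < cdim K" "y \<in> S" for i y
    using pdiff_cong[OF oS that(2,1)] Geq pdiff_compose[OF oS oT \<Phi>T \<Phi>2 \<Psi>2 that(2,1)] by metis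
  show "i < cdim K \<Longrightarrow> pdiff i (coord_fun K k) (cmap K x) =
      (\<Sum>l<cdim L. pdiff l (coord_fun L h) (cmap L (F x)) * pdiff i (\<lambda>y. cmap L (F (cinv K y)) l) (cmap K x))"
    using d1[of i c] cS \<Phi>c unfolding c_def G_def \<Psi>_def \<Phi>_def by simp
  assume ij: "i < cdim K" "j < cdim K" and v: "diff_vanishes L h (F x)"
  have \<Psi>0: "pdiff l \<Psi> (\<Phi> c) = 0" if "l < cdim L" for l
    using v that unfolding diff_vanishes_def \<Psi>_def \<Phi>c by blast
  have A: "Ck (Suc 0) (cdim K) S (\<lambda>y. pdiff l \<Psi> (\<Phi> y))" if "l < cdim L" for l
    by (rule Ck_compose[OF oS oT \<Phi>T \<Phi>2 Ck_pdiff[OF \<Psi>2 that]])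
  have B: "Ck (Suc 0) (cdim K) S (pdiff j (\<lambda>y. \<Phi> y l))" if "l < cdim L" for l
    by (rule Ck_pdiff[OF \<Phi>2[OF that] ij(2)])
  have "pdiff i (pdiff j G) c = pdiff i (\<lambda>y. \<Sum>l<cdim L. pdiff l \<Psi> (\<Phi> y) * pdiff j (\<lambda>y. \<Phi> y l) y) c"
    by (rule pdiff_cong[OF oS cS ij(1)]) (use d1 ij in blast)
  also have "\<dots> = (\<Sum>l<cdim L. pdiff i (\<lambda>y. pdiff l \<Psi> (\<Phi> y) * pdiff j (\<lambda>y. \<Phi> y l) y) c)"
    by (rule pdiff_sum) (use Ck_differentiable[OF Ck_mult[OF oS A B] ij(1) cS] in blast)
  also have "\<dots> = (\<Sum>l<cdim L. pdiff i (\<lambda>y. pdiff l \<Psi> (\<Phi> y)) c * pdiff j (\<lambda>y. \<Phi> y l) c)"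
  proof (rule sum.cong[OF refl])
    fix l assume "l \<in> {..<cdim L}"
    then have l: "l < cdim L" by simp
    have "pdiff i (\<lambda>y. pdiff l \<Psi> (\<Phi> y) * pdiff j (\<lambda>y. \<Phi> y l) y) c =
        pdiff i (\<lambda>y. pdiff l \<Psi> (\<Phi> y)) c * pdiff j (\<lambda>y. \<Phi> y l) c + pdiff i (pdiff j (\<lambda>y. \<Phi> y l)) c * pdiff l \<Psi> (\<Phi> c)"
      by (rule pdiff_mult[OF Ck_differentiable[OF A[OF l] ij(1) cS] Ck_differentiable[OF B[OF l] ij(1) cS]])
    then show "pdiff i (\<lambda>y. pdiff l \<Psi> (\<Phi> y) * pdiff j (\<lambda>y. \<Phi> y l) y) c = pdiff i (\<lambda>y. pdiff l \<Psi> (\<Phi> y)) c * pdiff j (\<lambda>y. \<Phi> y l) c"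
      using \<Psi>0[OF l] by simp
  qed
  also have "\<dots> = (\<Sum>l<cdim L. \<Sum>m<cdim L. pdiff m (pdiff l \<Psi>) (\<Phi> c) * pdiff i (\<lambda>y. \<Phi> y m) c * pdiff j (\<lambda>y. \<Phi> y l) c)"
  proof (rule sum.cong[OF refl])
    fix l assume "l \<in> {..<cdim L}"
    then have "pdiff i (\<lambda>y. pdiff l \<Psi> (\<Phi> y)) c = (\<Sum>m<cdim L. pdiff m (pdiff l \<Psi>) (\<Phi> c) * pdiff i (\<lambda>y. \<Phi> y m) c)"
      using pdiff_compose[OF oS oT \<Phi>T \<Phi>2 Ck_pdiff[OF \<Psi>2] cS ij(1)] by simp
    then show "pdiff i (\<lambda>y. pdiff l \<Psi> (\<Phi> y)) c * pdiff j (\<lambda>y. \<Phi> y l) c =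
        (\<Sum>m<cdim L. pdiff m (pdiff l \<Psi>) (\<Phi> c) * pdiff i (\<lambda>y. \<Phi> y m) c * pdiff j (\<lambda>y. \<Phi> y l) c)"
      by (simp add: sum_distrib_right)
  qed
  finally show "pdiff i (pdiff j (coord_fun K k)) (cmap K x) =
      (\<Sum>l<cdim L. \<Sum>m<cdim L. pdiff m (pdiff l (coord_fun L h)) (cmap L (F x)) *
         pdiff i (\<lambda>y. cmap L (F (cinv K y)) m) (cmap K x) * pdiff j (\<lambda>y. cmap L (F (cinv K y)) l) (cmap K x))"
    unfolding \<Phi>c unfolding G_def \<Psi>_def c_def \<Phi>_def .
qed

lemma dfun_pullback: "dfun K k x v = dfun L h (F x) (dmap K L F x v)"
proof -
  have "dfun K k x v = (\<Sum>i<cdim K. (\<Sum>l<cdim L. pdiff l (coord_fun L h) (cmap L (F x)) * pdiff i (\<lambda>y. cmap L (F (cinv K y)) l) (cmap K x)) * v i)"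
    unfolding dfun_def using pullback_derivatives(1) by (intro sum.cong) auto
  also have "\<dots> = (\<Sum>l<cdim L. pdiff l (coord_fun L h) (cmap L (F x)) * (\<Sum>i<cdim K. pdiff i (\<lambda>y. cmap L (F (cinv K y)) l) (cmap K x) * v i))"
    unfolding sum_distrib_left sum_distrib_right by (subst sum.swap) (simp add: mult.assoc)
  also have "\<dots> = dfun L h (F x) (dmap K L F x v)" by (simp add: dfun_def dmap_def)
  finally show ?thesis .
qed

lemma hessian_pullback:
  assumes v: "diff_vanishes L h (F x)"
  shows "hessian K k x v w = hessian L h (F x) (dmap K L F x v) (dmap K L F x w)"
proof -
  define a where "a i m = pdiff i (\<lambda>y. cmap L (F (cinv K y)) m) (cmap K x)" for i m
  define H where "H m l = pdiff m (pdiff l (coord_fun L h)) (cmap L (F x))" for m l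
  have "hessian K k x v w = (\<Sum>i<cdim K. \<Sum>j<cdim K. \<Sum>l<cdim L. \<Sum>m<cdim L. H m l * (a i m * v i) * (a j l * w j))"
    unfolding hessian_def
  proof (intro sum.cong refl)
    fix i j assume "i \<in> {..<cdim K}" "j \<in> {..<cdim K}"
    then have "pdiff i (pdiff j (coord_fun K k)) (cmap K x) = (\<Sum>l<cdim L. \<Sum>m<cdim L. H m l * a i m * a j l)"
      using pullback_derivatives(2)[OF _ _ v] by (simp add: a_def H_def)
    then show "pdiff i (pdiff j (coord_fun K k)) (cmap K x) * v i * w j = (\<Sum>l<cdim L. \<Sum>m<cdim L. H m l * (a i m * v i) * (a j l * w j))"
      by (simp add: sum_distrib_right sum_distrib_left mult_ac)
  qed
  also have "\<dots> = (\<Sum>i<cdim K. \<Sum>l<cdim L. \<Sum>m<cdim L. \<Sum>j<cdim K. H m l * (a i m * v i) * (a j l * w j))"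
    by (subst sum.swap[of _ "{..<cdim L}" "{..<cdim K}"], subst sum.swap[of _ "{..<cdim L}" "{..<cdim K}"]) simp
  also have "\<dots> = (\<Sum>l<cdim L. \<Sum>m<cdim L. \<Sum>i<cdim K. \<Sum>j<cdim K. H m l * (a i m * v i) * (a j l * w j))"
    by (subst sum.swap, subst sum.swap[of _ "{..<cdim L}" "{..<cdim K}"]) simp
  also have "\<dots> = (\<Sum>l<cdim L. \<Sum>m<cdim L. H m l * (\<Sum>i<cdim K. a i m * v i) * (\<Sum>j<cdim K. a j l * w j))"
    by (simp add: sum_distrib_left sum_distrib_right mult_ac)
  also have "\<dots> = hessian L h (F x) (dmap K L F x v) (dmap K L F x w)"
    unfolding hessian_def by (subst sum.swap) (simp add: dmap_def a_def H_def)
  finally show ?thesis .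
qed

end

section \<open>Categories fibred in groupoids over manifolds\<close>

lemma bij_betw_preimage: "bij_betw f A B \<Longrightarrow> y \<in> B \<Longrightarrow> \<exists>x\<in>A. y = f x"
  by (auto simp: bij_betw_def)

locale fibred =
  fixes Y :: "('o, 'm) fibcat"
  assumes fib: "fibred_in_groupoids Y"
begin

abbreviation hom :: "'m \<Rightarrow> 'o \<Rightarrow> 'o \<Rightarrow> bool" where "hom \<equiv> in_hom Y"
abbreviation comp :: "'m \<Rightarrow> 'm \<Rightarrow> 'm" (infixr "\<cdot>" 75) where "n \<cdot> m \<equiv> cmp Y n m"

lemma cat: "category_over_manifolds Y"
  using fib by (simp add: fibred_in_groupoids_def)

lemma hom_Obj: "hom m a b \<Longrightarrow> a \<in> Obj Y" "hom m a b \<Longrightarrow> b \<in> Obj Y"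
  using cat by (auto simp: category_over_manifolds_def in_hom_def)

lemma hom_dom: "hom m a b \<Longrightarrow> dom Y m = a" and hom_cod: "hom m a b \<Longrightarrow> cod Y m = b" and hom_Arr: "hom m a b \<Longrightarrow> m \<in> Arr Y"
  by (auto simp: in_hom_def)

lemma idn_hom: "a \<in> Obj Y \<Longrightarrow> hom (idn Y a) a a"
  using cat by (simp add: category_over_manifolds_def)

lemma comp_hom: "hom m a b \<Longrightarrow> hom n b c \<Longrightarrow> hom (n \<cdot> m) a c"
  using cat unfolding category_over_manifolds_def by metis

lemma comp_idn: "hom m a b \<Longrightarrow> m \<cdot> idn Y a = m" and idn_comp: "hom m a b \<Longrightarrow> idn Y b \<cdot> m = m"
  using cat unfolding category_over_manifolds_def by blast+

lemma assoc: "hom k a b \<Longrightarrow> hom m b c \<Longrightarrow> hom n c d \<Longrightarrow> n \<cdot> (m \<cdot> k) = (n \<cdot> m) \<cdot> k"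
  using cat unfolding category_over_manifolds_def by blast

lemma base_manifold: "a \<in> Obj Y \<Longrightarrow> is_manifold (base Y a)"
  using cat by (simp add: category_over_manifolds_def)

lemma bmap_smooth: "hom m a b \<Longrightarrow> smooth_map (base Y a) (base Y b) (bmap Y m)"
  using cat by (simp add: category_over_manifolds_def)

lemma bmap_idn: "a \<in> Obj Y \<Longrightarrow> bmap Y (idn Y a) = incl (pts (base Y a))"
  using cat by (simp add: category_over_manifolds_def)

lemma bmap_comp: "hom m a b \<Longrightarrow> hom n b c \<Longrightarrow> bmap Y (n \<cdot> m) = compose (pts (base Y a)) (bmap Y n) (bmap Y m)"
  using cat unfolding category_over_manifolds_def by blast

lemma bmap_comp_apply: "hom m a b \<Longrightarrow> hom n b c \<Longrightarrow> x \<in> pts (base Y a) \<Longrightarrow> bmap Y (n \<cdot> m) x = bmap Y n (bmap Y m x)"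
  by (simp add: bmap_comp compose_def)

lemma hom_manifold: "hom m a b \<Longrightarrow> is_manifold (base Y a)" "hom m a b \<Longrightarrow> is_manifold (base Y b)"
  using hom_Obj base_manifold by blast+

lemma bmap_pts: "hom m a b \<Longrightarrow> x \<in> pts (base Y a) \<Longrightarrow> bmap Y m x \<in> pts (base Y b)"
  using smooth_map_pts[OF hom_manifold bmap_smooth] by blast

lemma bmap_ext: "hom m a b \<Longrightarrow> bmap Y m \<in> extensional (pts (base Y a))"
  using bmap_smooth by (simp add: smooth_map_def)

lemma bmap_eqI:
  "hom m a b \<Longrightarrow> hom n a c \<Longrightarrow> (\<And>x. x \<in> pts (base Y a) \<Longrightarrow> bmap Y m x = bmap Y n x) \<Longrightarrow> bmap Y m = bmap Y n"
  using extensionalityI[OF bmap_ext bmap_ext] by blast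

lemma pullback_ex:
  "a \<in> Obj Y \<Longrightarrow> is_manifold M \<Longrightarrow> smooth_map M (base Y a) F \<Longrightarrow> \<exists>b m. hom m b a \<and> base Y b = M \<and> bmap Y m = F"
  using fib unfolding fibred_in_groupoids_def by blast

lemma lift_ex1:
  assumes "hom m b a" "hom n c a" "smooth_map (base Y c) (base Y b) F"
    and "\<And>x. x \<in> pts (base Y c) \<Longrightarrow> bmap Y m (F x) = bmap Y n x"
  shows "\<exists>!k. hom k c b \<and> bmap Y k = F \<and> m \<cdot> k = n"
proof -
  have "compose (pts (base Y c)) (bmap Y m) F = bmap Y n"
    by (rule extensionalityI[OF compose_extensional bmap_ext[OF assms(2)]]) (simp add: compose_def assms(4))
  then show ?thesis using fib assms(1-3) unfolding fibred_in_groupoids_def by blast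
qed

lemma lift_ex:
  assumes "hom m b a" "hom n c a" "smooth_map (base Y c) (base Y b) F"
    and "\<And>x. x \<in> pts (base Y c) \<Longrightarrow> bmap Y m (F x) = bmap Y n x"
  obtains k where "hom k c b" "bmap Y k = F" "m \<cdot> k = n"
  using lift_ex1[OF assms] by blast

text \<open>All arrows are cartesian, hence left cancellable among arrows over the same base map.
  Equalities of arrows are usually proved this way.\<close>

lemma cartesian_cancel:
  assumes "hom m b a" "hom k c b" "hom k' c b" "bmap Y k = bmap Y k'" "m \<cdot> k = m \<cdot> k'"
  shows "k = k'"
proof -
  have "\<exists>!l. hom l c b \<and> bmap Y l = bmap Y k \<and> m \<cdot> l = m \<cdot> k"
    by (rule lift_ex1[OF assms(1) comp_hom[OF assms(2,1)] bmap_smooth[OF assms(2)]])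
      (simp add: bmap_comp_apply[OF assms(2,1)])
  then show ?thesis using assms by metis
qed

text \<open>Arrows over an identity are invertible, so the fibres are groupoids: the inverse is the
  lift of the identity through \<open>m\<close>.\<close>

lemma inverse_ex:
  assumes m: "hom m b a" and eq: "base Y b = base Y a" "bmap Y m = incl (pts (base Y a))"
  obtains k where "hom k a b" "bmap Y k = incl (pts (base Y a))" "m \<cdot> k = idn Y a" "k \<cdot> m = idn Y b"
proof -
  have a: "a \<in> Obj Y" and b: "b \<in> Obj Y" using hom_Obj[OF m] by auto
  have "smooth_map (base Y a) (base Y b) (incl (pts (base Y a)))"
    using smooth_map_id[OF base_manifold[OF a]] eq by simp
  then obtain k where k: "hom k a b" "bmap Y k = incl (pts (base Y a))" "m \<cdot> k = idn Y a"
    by (rule lift_ex[OF m idn_hom[OF a]]) (simp add: eq bmap_idn[OF a] incl_def)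
  have "k \<cdot> m = idn Y b"
  proof (rule cartesian_cancel[OF m comp_hom[OF m k(1)] idn_hom[OF b]])
    show "bmap Y (k \<cdot> m) = bmap Y (idn Y b)"
      by (rule bmap_eqI[OF comp_hom[OF m k(1)] idn_hom[OF b]])
        (simp add: bmap_comp_apply[OF m k(1)] k(2) eq bmap_idn[OF b] incl_def)
    show "m \<cdot> k \<cdot> m = m \<cdot> idn Y b" using assoc[OF m k(1) m] k(3) idn_comp[OF m] comp_idn[OF m] by simp
  qed
  then show thesis using that k by blast
qed


subsection \<open>Points\<close>

lemma point_Obj: "p \<in> point_objects Y \<Longrightarrow> p \<in> Obj Y" and point_base: "p \<in> point_objects Y \<Longrightarrow> base Y p = pt"
  by (auto simp: point_objects_def)

lemma foot_pts: "p \<in> point_objects Y \<Longrightarrow> hom \<gamma> p c \<Longrightarrow> foot Y \<gamma> \<in> pts (base Y c)"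
  unfolding foot_def by (rule bmap_pts) (auto simp: point_base)

lemma foot_comp: "p \<in> point_objects Y \<Longrightarrow> hom \<gamma> p c \<Longrightarrow> hom m c a \<Longrightarrow> foot Y (m \<cdot> \<gamma>) = bmap Y m (foot Y \<gamma>)"
  unfolding foot_def by (rule bmap_comp_apply) (auto simp: point_base)

lemma point_bmap:
  assumes "q \<in> point_objects Y" "p \<in> point_objects Y" "hom h q p"
  shows "bmap Y h = incl (pts pt)"
proof (rule extensionalityI)
  show "bmap Y h \<in> extensional {\<lambda>_. 0}" using bmap_ext[OF assms(3)] by (simp add: point_base[OF assms(1)])
  show "incl (pts pt) \<in> extensional {\<lambda>_. 0}" by (simp add: incl_def)
  show "bmap Y h x = incl (pts pt) x" if "x \<in> {\<lambda>_. 0}" for x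
    using bmap_pts[OF assms(3), of x] that by (simp add: point_base assms incl_def)
qed

lemma foot_precomp:
  assumes "q \<in> point_objects Y" "p \<in> point_objects Y" "hom h q p" "hom \<theta> p a"
  shows "foot Y (\<theta> \<cdot> h) = foot Y \<theta>"
  unfolding foot_def using bmap_comp_apply[OF assms(3,4), of "\<lambda>_. 0"] point_bmap[OF assms(1-3)]
  by (simp add: point_base assms incl_def)

lemma point_inverse:
  assumes "q \<in> point_objects Y" "p \<in> point_objects Y" "hom h q p"
  obtains k where "hom k p q" "h \<cdot> k = idn Y p" "k \<cdot> h = idn Y q"
  by (rule inverse_ex[OF assms(3)]) (use point_base point_bmap assms in auto)

lemma bmap_point_eq:
  assumes "p \<in> point_objects Y" "hom \<gamma> p c" "hom \<gamma>' p c'" "foot Y \<gamma> = foot Y \<gamma>'"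
  shows "bmap Y \<gamma> = bmap Y \<gamma>'"
  by (rule bmap_eqI[OF assms(2,3)]) (use assms in \<open>simp add: point_base foot_def\<close>)

text \<open>The manifold \<open>pt\<close> has a single point, so the feet determine the base maps,
  and \<open>cartesian_cancel\<close> applies.\<close>

lemma point_arrow_eq:
  assumes "p \<in> point_objects Y" "hom \<gamma> p c" "hom \<gamma>' p c" "foot Y \<gamma> = foot Y \<gamma>'" "hom m c a" "m \<cdot> \<gamma> = m \<cdot> \<gamma>'"
  shows "\<gamma> = \<gamma>'"
  by (rule cartesian_cancel[OF assms(5,2,3) bmap_point_eq[OF assms(1-4)] assms(6)])

lemma point_ex:
  assumes "c \<in> Obj Y" "x \<in> pts (base Y c)"
  obtains p \<gamma> where "p \<in> point_objects Y" "hom \<gamma> p c" "foot Y \<gamma> = x"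
proof -
  obtain p \<gamma> where "hom \<gamma> p c" "base Y p = pt" "bmap Y \<gamma> = (\<lambda>z\<in>{\<lambda>_. 0}. x)"
    using pullback_ex[OF assms(1) is_manifold_pt smooth_map_pt[OF base_manifold[OF assms(1)] assms(2)]] by blast
  then show thesis using that[of p \<gamma>] hom_Obj by (auto simp: point_objects_def foot_def)
qed

lemma point_lift:
  assumes p: "p \<in> point_objects Y" and m: "hom m b a" and \<theta>: "hom \<theta> p a" and x: "x \<in> pts (base Y b)" "bmap Y m x = foot Y \<theta>"
  obtains \<gamma> where "hom \<gamma> p b" "m \<cdot> \<gamma> = \<theta>" "foot Y \<gamma> = x"
proof -
  have "smooth_map (base Y p) (base Y b) (\<lambda>z\<in>{\<lambda>_. 0}. x)"
    using smooth_map_pt[OF hom_manifold(1)[OF m] x(1)] point_base[OF p] by simp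
  then obtain \<gamma> where "hom \<gamma> p b" "bmap Y \<gamma> = (\<lambda>z\<in>{\<lambda>_. 0}. x)" "m \<cdot> \<gamma> = \<theta>"
    by (rule lift_ex[OF m \<theta>]) (use x point_base[OF p] in \<open>simp add: foot_def\<close>)
  then show thesis using that[of \<gamma>] by (simp add: foot_def)
qed

lemma Aut_iff: "p \<in> point_objects Y \<Longrightarrow> h \<in> Aut Y p \<longleftrightarrow> hom h p p"
  using point_bmap[of p p h] by (auto simp: Aut_def point_base)

lemma iso_class_self: "p \<in> point_objects Y \<Longrightarrow> p \<in> iso_class Y p"
  unfolding iso_class_def using idn_hom point_Obj by blast


subsection \<open>Fibre products and etale objects\<close>

lemma fibre_product_hom: "fibre_product Y a b c \<alpha> \<beta> \<Longrightarrow> hom \<alpha> c a \<and> hom \<beta> c b"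
  by (simp add: fibre_product_def)

lemma fibre_product_ex1: "fibre_product Y a b c \<alpha> \<beta> \<Longrightarrow> hom m w a \<Longrightarrow> hom n w b \<Longrightarrow>
    \<exists>!k. hom k w c \<and> \<alpha> \<cdot> k = m \<and> \<beta> \<cdot> k = n"
  by (simp add: fibre_product_def)

lemma fibre_product_lift:
  assumes "fibre_product Y a b c \<alpha> \<beta>" "hom m w a" "hom n w b"
  obtains k where "hom k w c" "\<alpha> \<cdot> k = m" "\<beta> \<cdot> k = n"
  using fibre_product_ex1[OF assms] by blast

lemma fibre_product_unique:
  assumes f: "fibre_product Y a b c \<alpha> \<beta>" and k: "hom k w c" "hom k' w c" "\<alpha> \<cdot> k = \<alpha> \<cdot> k'" "\<beta> \<cdot> k = \<beta> \<cdot> k'"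
  shows "k = k'"
  using fibre_product_ex1[OF f comp_hom[OF k(1)] comp_hom[OF k(1)]] fibre_product_hom[OF f] k by metis

lemma fibre_product_swap: "fibre_product Y a b c \<alpha> \<beta> \<Longrightarrow> fibre_product Y b a c \<beta> \<alpha>"
  unfolding fibre_product_def by (intro conjI allI impI) (blast, blast, metis)

lemma etale_fibre_product:
  assumes "representable_with etale_map Y a" "b \<in> Obj Y"
  obtains c \<alpha> \<beta> where "fibre_product Y a b c \<alpha> \<beta>" "etale_map (base Y c) (base Y b) (bmap Y \<beta>)"
  using assms unfolding representable_with_def by blast

lemma dmap_comp:
  assumes "hom m a b" "hom n b c" "K \<in> charts (base Y a)" "x \<in> cdom K" "L \<in> charts (base Y b)" "bmap Y m x \<in> cdom L"
    "Q \<in> charts (base Y c)" "bmap Y n (bmap Y m x) \<in> cdom Q"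
  shows "dmap K Q (bmap Y (n \<cdot> m)) x v = dmap L Q (bmap Y n) (bmap Y m x) (dmap K L (bmap Y m) x v)"
  unfolding bmap_comp[OF assms(1,2)]
  by (rule dmap_compose[OF hom_manifold(1)[OF assms(1)] hom_manifold[OF assms(2)] bmap_smooth[OF assms(1)] bmap_smooth[OF assms(2)] assms(3-8)])

lemma dmap_idn:
  assumes "a \<in> Obj Y" "K \<in> charts (base Y a)" "x \<in> cdom K" "v \<in> Rn (cdim K)"
  shows "dmap K K (bmap Y (idn Y a)) x v = v"
  by (rule dmap_ident[OF base_manifold[OF assms(1)] assms(2) openin_cdom[OF base_manifold[OF assms(1)] assms(2)] assms(3) order_refl _ assms(4)])
    (use cdom_pts[OF base_manifold[OF assms(1)] assms(2)] in \<open>simp add: bmap_idn[OF assms(1)] incl_def\<close>)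

text \<open>Representability provides some fibre product with an etale projection. Any other one is
  related to it by inverse isomorphisms \<open>k\<close> and \<open>l\<close> from the universal
  properties, and their derivatives are inverse to each other.\<close>

lemma etale_projection_bij:
  assumes a: "representable_with etale_map Y a" and f: "fibre_product Y a b c \<alpha> \<beta>"
    and L: "L \<in> charts (base Y c)" "x \<in> cdom L" and K: "K \<in> charts (base Y b)" "bmap Y \<beta> x \<in> cdom K"
  shows "bij_betw (dmap L K (bmap Y \<beta>) x) (Rn (cdim L)) (Rn (cdim K))"
proof -
  have \<alpha>: "hom \<alpha> c a" and \<beta>: "hom \<beta> c b" using fibre_product_hom[OF f] by auto
  obtain c1 \<alpha>1 \<beta>1 where f1: "fibre_product Y a b c1 \<alpha>1 \<beta>1" and et: "etale_map (base Y c1) (base Y b) (bmap Y \<beta>1)"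
    using etale_fibre_product[OF a hom_Obj(2)[OF \<beta>]] by blast
  have \<alpha>1: "hom \<alpha>1 c1 a" and \<beta>1: "hom \<beta>1 c1 b" using fibre_product_hom[OF f1] by auto
  obtain k where k: "hom k c c1" "\<alpha>1 \<cdot> k = \<alpha>" "\<beta>1 \<cdot> k = \<beta>" by (rule fibre_product_lift[OF f1 \<alpha> \<beta>])
  obtain l where l: "hom l c1 c" "\<alpha> \<cdot> l = \<alpha>1" "\<beta> \<cdot> l = \<beta>1" by (rule fibre_product_lift[OF f \<alpha>1 \<beta>1])
  have lk: "l \<cdot> k = idn Y c"
    by (rule fibre_product_unique[OF f comp_hom[OF k(1) l(1)] idn_hom[OF hom_Obj(1)[OF \<alpha>]]])
      (use assoc[OF k(1) l(1) \<alpha>] assoc[OF k(1) l(1) \<beta>] k l comp_idn[OF \<alpha>] comp_idn[OF \<beta>] in auto)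
  have kl: "k \<cdot> l = idn Y c1"
    by (rule fibre_product_unique[OF f1 comp_hom[OF l(1) k(1)] idn_hom[OF hom_Obj(1)[OF \<alpha>1]]])
      (use assoc[OF l(1) k(1) \<alpha>1] assoc[OF l(1) k(1) \<beta>1] k l comp_idn[OF \<alpha>1] comp_idn[OF \<beta>1] in auto)
  define y where "y = bmap Y k x"
  have x: "x \<in> pts (base Y c)" using cdom_pts[OF hom_manifold(1)[OF \<alpha>] L(1)] L(2) by blast
  have y: "y \<in> pts (base Y c1)" unfolding y_def by (rule bmap_pts[OF k(1) x])
  obtain L1 where L1: "L1 \<in> charts (base Y c1)" "y \<in> cdom L1" using chart_at[OF hom_manifold(1)[OF \<alpha>1] y] by blast
  have ly: "bmap Y l y = x"
    using bmap_comp_apply[OF k(1) l(1) x] lk bmap_idn[OF hom_Obj(1)[OF \<alpha>]] x by (simp add: y_def incl_def)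
  have b1: "bmap Y \<beta>1 y = bmap Y \<beta> x"
    using bmap_comp_apply[OF k(1) \<beta>1 x] k(3) by (simp add: y_def)
  have 1: "dmap L1 L (bmap Y l) y (dmap L L1 (bmap Y k) x v) = v" if "v \<in> Rn (cdim L)" for v
    using dmap_comp[OF k(1) l(1) L L1[unfolded y_def] L(1)] ly lk dmap_idn[OF hom_Obj(1)[OF \<alpha>] L that] L(2)
    by (simp add: y_def)
  have 2: "dmap L L1 (bmap Y k) x (dmap L1 L (bmap Y l) y v) = v" if "v \<in> Rn (cdim L1)" for v
    using dmap_comp[OF l(1) k(1) L1 L(1)] ly kl dmap_idn[OF hom_Obj(1)[OF \<alpha>1] L1 that] L L1
    by (simp add: y_def)
  have "bij_betw (dmap L L1 (bmap Y k) x) (Rn (cdim L)) (Rn (cdim L1))"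
    by (rule bij_betw_byWitness[where f' = "dmap L1 L (bmap Y l) y"]) (use 1 2 dmap_Rn in auto)
  moreover have "bij_betw (dmap L1 K (bmap Y \<beta>1) y) (Rn (cdim L1)) (Rn (cdim K))"
    by (rule etale_dmap_bij[OF hom_manifold[OF \<beta>1] et L1 K(1)]) (simp add: b1 K)
  ultimately have "bij_betw (dmap L1 K (bmap Y \<beta>1) y \<circ> dmap L L1 (bmap Y k) x) (Rn (cdim L)) (Rn (cdim K))"
    by (rule bij_betw_trans)
  moreover have "dmap L1 K (bmap Y \<beta>1) y \<circ> dmap L L1 (bmap Y k) x = dmap L K (bmap Y \<beta>) x"
    using dmap_comp[OF k(1) \<beta>1 L L1[unfolded y_def] K(1)] k(3) b1 K(2) by (auto simp: y_def)
  ultimately show ?thesis by simp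
qed


subsection \<open>Comparison of etale charts\<close>

definition transition_rel :: "'o \<Rightarrow> 'o \<Rightarrow> 'm \<Rightarrow> chart \<Rightarrow> 'o \<Rightarrow> 'm \<Rightarrow> chart \<Rightarrow> vec \<Rightarrow> vec \<Rightarrow> bool"
  where "transition_rel p a \<theta> K a' \<theta>' K' v w \<longleftrightarrow> (\<exists>e m n \<gamma> L z. hom m e a \<and> hom n e a' \<and> hom \<gamma> p e \<and>
    m \<cdot> \<gamma> = \<theta> \<and> n \<cdot> \<gamma> = \<theta>' \<and> L \<in> charts (base Y e) \<and> foot Y \<gamma> \<in> cdom L \<and> z \<in> Rn (cdim L) \<and>
    dmap L K (bmap Y m) (foot Y \<gamma>) z = v \<and> dmap L K' (bmap Y n) (foot Y \<gamma>) z = w)"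

definition transition :: "'o \<Rightarrow> 'o \<Rightarrow> 'm \<Rightarrow> chart \<Rightarrow> 'o \<Rightarrow> 'm \<Rightarrow> chart \<Rightarrow> vec \<Rightarrow> vec"
  where "transition p a \<theta> K a' \<theta>' K' v = (THE w. transition_rel p a \<theta> K a' \<theta>' K' v w)"

lemma etale_chartD:
  assumes "etale_chart_at Y p a \<theta> K"
  shows "p \<in> point_objects Y" "representable_with etale_map Y a" "hom \<theta> p a" "K \<in> charts (base Y a)" "foot Y \<theta> \<in> cdom K"
  using assms by (auto simp: etale_chart_at_def)

text \<open>Every span factors through the fibre product, and by the chain rule its witness is
  pushed forward to the universal span. Hence the relation is already decided there.\<close>

lemma transition_rel_universal:
  assumes A: "etale_chart_at Y p a \<theta> K" and A': "etale_chart_at Y p a' \<theta>' K'" and f: "fibre_product Y a a' c \<alpha> \<beta>"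
    and \<gamma>: "hom \<gamma> p c" "\<alpha> \<cdot> \<gamma> = \<theta>" "\<beta> \<cdot> \<gamma> = \<theta>'" and L: "L \<in> charts (base Y c)" "foot Y \<gamma> \<in> cdom L"
  shows "transition_rel p a \<theta> K a' \<theta>' K' v w \<longleftrightarrow>
    (\<exists>z\<in>Rn (cdim L). dmap L K (bmap Y \<alpha>) (foot Y \<gamma>) z = v \<and> dmap L K' (bmap Y \<beta>) (foot Y \<gamma>) z = w)" (is "?L \<longleftrightarrow> ?R")
proof
  note p = etale_chartD(1)[OF A]
  have \<alpha>: "hom \<alpha> c a" and \<beta>: "hom \<beta> c a'" using fibre_product_hom[OF f] by auto
  show "?R \<Longrightarrow> ?L" unfolding transition_rel_def using \<alpha> \<beta> \<gamma> L by blast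
  assume ?L
  then obtain e m n \<delta> Q z where m: "hom m e a" and n: "hom n e a'" and \<delta>: "hom \<delta> p e" "m \<cdot> \<delta> = \<theta>" "n \<cdot> \<delta> = \<theta>'"
    and Q: "Q \<in> charts (base Y e)" "foot Y \<delta> \<in> cdom Q" and z: "z \<in> Rn (cdim Q)"
    "dmap Q K (bmap Y m) (foot Y \<delta>) z = v" "dmap Q K' (bmap Y n) (foot Y \<delta>) z = w"
    unfolding transition_rel_def by blast
  obtain k where k: "hom k e c" "\<alpha> \<cdot> k = m" "\<beta> \<cdot> k = n" by (rule fibre_product_lift[OF f m n])
  have "k \<cdot> \<delta> = \<gamma>"
    by (rule fibre_product_unique[OF f comp_hom[OF \<delta>(1) k(1)] \<gamma>(1)])
      (use assoc[OF \<delta>(1) k(1) \<alpha>] assoc[OF \<delta>(1) k(1) \<beta>] k \<gamma> \<delta> in auto)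
  then have ft: "bmap Y k (foot Y \<delta>) = foot Y \<gamma>" using foot_comp[OF p \<delta>(1) k(1)] by simp
  have fa: "bmap Y \<alpha> (foot Y \<gamma>) = foot Y \<theta>" and fb: "bmap Y \<beta> (foot Y \<gamma>) = foot Y \<theta>'"
    using foot_comp[OF p \<gamma>(1) \<alpha>] foot_comp[OF p \<gamma>(1) \<beta>] \<gamma> by auto
  let ?z = "dmap Q L (bmap Y k) (foot Y \<delta>) z"
  have "dmap L K (bmap Y \<alpha>) (foot Y \<gamma>) ?z = v"
    using dmap_comp[OF k(1) \<alpha> Q L(1) _ etale_chartD(4)[OF A], of z] ft fa L(2) etale_chartD(5)[OF A] z k(2) by simp
  moreover have "dmap L K' (bmap Y \<beta>) (foot Y \<gamma>) ?z = w"
    using dmap_comp[OF k(1) \<beta> Q L(1) _ etale_chartD(4)[OF A'], of z] ft fb L(2) etale_chartD(5)[OF A'] z k(3) by simp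
  ultimately show ?R using dmap_Rn by blast
qed

lemma etale_charts_span:
  assumes A: "etale_chart_at Y p a \<theta> K" and A': "etale_chart_at Y p a' \<theta>' K'"
  obtains c \<alpha> \<beta> \<gamma> L where "fibre_product Y a a' c \<alpha> \<beta>" "hom \<gamma> p c" "\<alpha> \<cdot> \<gamma> = \<theta>" "\<beta> \<cdot> \<gamma> = \<theta>'"
    "L \<in> charts (base Y c)" "foot Y \<gamma> \<in> cdom L" "hom \<alpha> c a" "hom \<beta> c a'"
    "bmap Y \<alpha> (foot Y \<gamma>) = foot Y \<theta>" "bmap Y \<beta> (foot Y \<gamma>) = foot Y \<theta>'"
    "bij_betw (dmap L K (bmap Y \<alpha>) (foot Y \<gamma>)) (Rn (cdim L)) (Rn (cdim K))"
    "bij_betw (dmap L K' (bmap Y \<beta>) (foot Y \<gamma>)) (Rn (cdim L)) (Rn (cdim K'))"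
proof -
  note p = etale_chartD(1)[OF A]
  obtain c \<alpha> \<beta> where f: "fibre_product Y a a' c \<alpha> \<beta>"
    using etale_fibre_product[OF etale_chartD(2)[OF A] hom_Obj(2)[OF etale_chartD(3)[OF A']]] by blast
  have \<alpha>: "hom \<alpha> c a" and \<beta>: "hom \<beta> c a'" using fibre_product_hom[OF f] by auto
  obtain \<gamma> where \<gamma>: "hom \<gamma> p c" "\<alpha> \<cdot> \<gamma> = \<theta>" "\<beta> \<cdot> \<gamma> = \<theta>'"
    by (rule fibre_product_lift[OF f etale_chartD(3)[OF A] etale_chartD(3)[OF A']])
  obtain L where L: "L \<in> charts (base Y c)" "foot Y \<gamma> \<in> cdom L"
    using chart_at[OF hom_manifold(1)[OF \<alpha>] foot_pts[OF p \<gamma>(1)]] by blast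
  have fa: "bmap Y \<alpha> (foot Y \<gamma>) = foot Y \<theta>" and fb: "bmap Y \<beta> (foot Y \<gamma>) = foot Y \<theta>'"
    using foot_comp[OF p \<gamma>(1) \<alpha>] foot_comp[OF p \<gamma>(1) \<beta>] \<gamma> by auto
  show thesis
    by (rule that[OF f \<gamma> L \<alpha> \<beta> fa fb])
      (intro etale_projection_bij[OF etale_chartD(2)[OF A'] fibre_product_swap[OF f] L etale_chartD(4)[OF A]]
         etale_projection_bij[OF etale_chartD(2)[OF A] f L etale_chartD(4)[OF A']];
       simp add: fa fb etale_chartD[OF A] etale_chartD[OF A'])+
qed

text \<open>On the universal span both projections have bijective derivatives \<open>da\<close> and
  \<open>db\<close>, so the relation is the graph of \<open>db\<close> after the inverse of
  \<open>da\<close>.\<close>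

lemma transition_props:
  assumes A: "etale_chart_at Y p a \<theta> K" and A': "etale_chart_at Y p a' \<theta>' K'"
  defines "T \<equiv> transition p a \<theta> K a' \<theta>' K'"
  shows "transition_rel p a \<theta> K a' \<theta>' K' v w \<longleftrightarrow> v \<in> Rn (cdim K) \<and> w = T v"
    and "bij_betw T (Rn (cdim K)) (Rn (cdim K'))"
    and "linear_on_set (Rn (cdim K)) T"
proof -
  obtain c \<alpha> \<beta> \<gamma> L where f: "fibre_product Y a a' c \<alpha> \<beta>" and \<gamma>: "hom \<gamma> p c" "\<alpha> \<cdot> \<gamma> = \<theta>" "\<beta> \<cdot> \<gamma> = \<theta>'"
    and L: "L \<in> charts (base Y c)" "foot Y \<gamma> \<in> cdom L"
    and bija: "bij_betw (dmap L K (bmap Y \<alpha>) (foot Y \<gamma>)) (Rn (cdim L)) (Rn (cdim K))"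
    and bijb: "bij_betw (dmap L K' (bmap Y \<beta>) (foot Y \<gamma>)) (Rn (cdim L)) (Rn (cdim K'))"
    by (rule etale_charts_span[OF A A']) blast
  note U = transition_rel_universal[OF A A' f \<gamma> L]
  define da where "da = dmap L K (bmap Y \<alpha>) (foot Y \<gamma>)"
  define db where "db = dmap L K' (bmap Y \<beta>) (foot Y \<gamma>)"
  have iff: "transition_rel p a \<theta> K a' \<theta>' K' v w \<longleftrightarrow> v \<in> Rn (cdim K) \<and> w = db (inv_into (Rn (cdim L)) da v)" for v w
    unfolding U da_def[symmetric] db_def[symmetric] using bija[folded da_def]
    by (auto simp: bij_betw_def f_inv_into_f inv_into_into intro!: bexI[of _ "inv_into (Rn (cdim L)) da v"])
  have T: "T v = db (inv_into (Rn (cdim L)) da v)" if "v \<in> Rn (cdim K)" for v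
    unfolding T_def transition_def by (rule the_equality) (use iff that in auto)
  show 1: "transition_rel p a \<theta> K a' \<theta>' K' v w \<longleftrightarrow> v \<in> Rn (cdim K) \<and> w = T v" for v w
    unfolding iff using T by auto
  have "bij_betw (db \<circ> inv_into (Rn (cdim L)) da) (Rn (cdim K)) (Rn (cdim K'))"
    by (rule bij_betw_trans[OF bij_betw_inv_into[OF bija[folded da_def]] bijb[folded db_def]])
  then show "bij_betw T (Rn (cdim K)) (Rn (cdim K'))"
    by (rule bij_betw_cong[THEN iffD1, rotated]) (simp add: T)
  show "linear_on_set (Rn (cdim K)) T"
    unfolding linear_on_set_def
  proof (intro ballI allI)
    fix v w r s assume "v \<in> Rn (cdim K)" "w \<in> Rn (cdim K)"
    then obtain x y where x: "x \<in> Rn (cdim L)" "v = da x" and y: "y \<in> Rn (cdim L)" "w = da y"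
      using bij_betw_preimage[OF bija[folded da_def]] by blast
    have Td: "T (da z) = db z" if "z \<in> Rn (cdim L)" for z
      using 1[of "da z" "db z"] U[of "da z" "db z"] that by (auto simp: da_def db_def)
    have "(\<lambda>i. r * x i + s * y i) \<in> Rn (cdim L)" using x y by (simp add: Rn_iff)
    from Td[OF this] show "T (\<lambda>i. r * v i + s * w i) = (\<lambda>i. r * T v i + s * T w i)"
      unfolding x(2) y(2) Td[OF x(1)] Td[OF y(1)] unfolding da_def db_def dmap_linear .
  qed
qed

lemmas transition_iff = transition_props(1)
lemmas transition_bij = transition_props(2)
lemmas transition_linear = transition_props(3)

lemma transition_span:
  assumes "etale_chart_at Y p a \<theta> K" "etale_chart_at Y p a' \<theta>' K'"
    and "hom m e a" "hom n e a'" "hom \<gamma> p e" "m \<cdot> \<gamma> = \<theta>" "n \<cdot> \<gamma> = \<theta>'" "L \<in> charts (base Y e)" "foot Y \<gamma> \<in> cdom L" "z \<in> Rn (cdim L)"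
  shows "transition p a \<theta> K a' \<theta>' K' (dmap L K (bmap Y m) (foot Y \<gamma>) z) = dmap L K' (bmap Y n) (foot Y \<gamma>) z"
proof -
  have "transition_rel p a \<theta> K a' \<theta>' K' (dmap L K (bmap Y m) (foot Y \<gamma>) z) (dmap L K' (bmap Y n) (foot Y \<gamma>) z)"
    unfolding transition_rel_def using assms(3-) by blast
  then show ?thesis using transition_iff[OF assms(1,2)] by simp
qed

lemma transition_in: "etale_chart_at Y p a \<theta> K \<Longrightarrow> etale_chart_at Y p a' \<theta>' K' \<Longrightarrow> v \<in> Rn (cdim K) \<Longrightarrow>
    transition p a \<theta> K a' \<theta>' K' v \<in> Rn (cdim K')"
  using transition_bij bij_betwE by blast

text \<open>The fibre product of \<open>a3\<close> with the apex of a span between \<open>a1\<close>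
  and \<open>a2\<close> maps to all three objects. A vector on it computes the three transitions
  simultaneously.\<close>

lemma transition_trans:
  assumes A1: "etale_chart_at Y p a1 \<theta>1 K1" and A2: "etale_chart_at Y p a2 \<theta>2 K2" and A3: "etale_chart_at Y p a3 \<theta>3 K3"
    and v: "v \<in> Rn (cdim K1)"
  shows "transition p a2 \<theta>2 K2 a3 \<theta>3 K3 (transition p a1 \<theta>1 K1 a2 \<theta>2 K2 v) = transition p a1 \<theta>1 K1 a3 \<theta>3 K3 v"
proof -
  note p = etale_chartD(1)[OF A1]
  obtain c \<alpha> \<beta> \<gamma> L where \<gamma>: "hom \<gamma> p c" "\<alpha> \<cdot> \<gamma> = \<theta>1" "\<beta> \<cdot> \<gamma> = \<theta>2"
    and L: "L \<in> charts (base Y c)" "foot Y \<gamma> \<in> cdom L" and \<alpha>: "hom \<alpha> c a1" and \<beta>: "hom \<beta> c a2"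
    and ft: "bmap Y \<alpha> (foot Y \<gamma>) = foot Y \<theta>1" "bmap Y \<beta> (foot Y \<gamma>) = foot Y \<theta>2"
    and bija: "bij_betw (dmap L K1 (bmap Y \<alpha>) (foot Y \<gamma>)) (Rn (cdim L)) (Rn (cdim K1))"
    by (rule etale_charts_span[OF A1 A2]) blast
  obtain d \<mu> \<nu> where g: "fibre_product Y a3 c d \<mu> \<nu>"
    using etale_fibre_product[OF etale_chartD(2)[OF A3] hom_Obj(1)[OF \<alpha>]] by blast
  have \<mu>: "hom \<mu> d a3" and \<nu>: "hom \<nu> d c" using fibre_product_hom[OF g] by auto
  obtain \<delta> where \<delta>: "hom \<delta> p d" "\<mu> \<cdot> \<delta> = \<theta>3" "\<nu> \<cdot> \<delta> = \<gamma>"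
    by (rule fibre_product_lift[OF g etale_chartD(3)[OF A3] \<gamma>(1)])
  obtain Q where Q: "Q \<in> charts (base Y d)" "foot Y \<delta> \<in> cdom Q"
    using chart_at[OF hom_manifold(1)[OF \<mu>] foot_pts[OF p \<delta>(1)]] by blast
  have fn: "bmap Y \<nu> (foot Y \<delta>) = foot Y \<gamma>" using foot_comp[OF p \<delta>(1) \<nu>] \<delta> by simp
  have bijn: "bij_betw (dmap Q L (bmap Y \<nu>) (foot Y \<delta>)) (Rn (cdim Q)) (Rn (cdim L))"
    by (rule etale_projection_bij[OF etale_chartD(2)[OF A3] g Q L(1)]) (simp add: fn L)
  obtain y where y: "y \<in> Rn (cdim L)" "v = dmap L K1 (bmap Y \<alpha>) (foot Y \<gamma>) y"
    using bij_betw_preimage[OF bija v] by blast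
  obtain z where z: "z \<in> Rn (cdim Q)" "v = dmap L K1 (bmap Y \<alpha>) (foot Y \<gamma>) (dmap Q L (bmap Y \<nu>) (foot Y \<delta>) z)"
    using bij_betw_preimage[OF bijn y(1)] y(2) by blast
  have d1: "v = dmap Q K1 (bmap Y (\<alpha> \<cdot> \<nu>)) (foot Y \<delta>) z"
    using dmap_comp[OF \<nu> \<alpha> Q L(1) _ etale_chartD(4)[OF A1], of z] z fn ft L etale_chartD(5)[OF A1] by simp
  have e1: "(\<alpha> \<cdot> \<nu>) \<cdot> \<delta> = \<theta>1" "(\<beta> \<cdot> \<nu>) \<cdot> \<delta> = \<theta>2"
    using assoc[OF \<delta>(1) \<nu> \<alpha>] assoc[OF \<delta>(1) \<nu> \<beta>] \<delta> \<gamma> by auto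
  have "transition p a1 \<theta>1 K1 a2 \<theta>2 K2 v = dmap Q K2 (bmap Y (\<beta> \<cdot> \<nu>)) (foot Y \<delta>) z"
    unfolding d1 by (rule transition_span[OF A1 A2 comp_hom[OF \<nu> \<alpha>] comp_hom[OF \<nu> \<beta>] \<delta>(1) e1 Q z(1)])
  moreover have "transition p a2 \<theta>2 K2 a3 \<theta>3 K3 (dmap Q K2 (bmap Y (\<beta> \<cdot> \<nu>)) (foot Y \<delta>) z) = dmap Q K3 (bmap Y \<mu>) (foot Y \<delta>) z"
    by (rule transition_span[OF A2 A3 comp_hom[OF \<nu> \<beta>] \<mu> \<delta>(1) e1(2) \<delta>(2) Q z(1)])
  moreover have "transition p a1 \<theta>1 K1 a3 \<theta>3 K3 v = dmap Q K3 (bmap Y \<mu>) (foot Y \<delta>) z"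
    unfolding d1 by (rule transition_span[OF A1 A3 comp_hom[OF \<nu> \<alpha>] \<mu> \<delta>(1) e1(1) \<delta>(2) Q z(1)])
  ultimately show ?thesis by simp
qed

lemma transition_refl:
  assumes A: "etale_chart_at Y p a \<theta> K" and v: "v \<in> Rn (cdim K)"
  shows "transition p a \<theta> K a \<theta> K v = v"
proof -
  note D = etale_chartD[OF A]
  have i: "hom (idn Y a) a a" by (rule idn_hom[OF hom_Obj(2)[OF D(3)]])
  have "transition p a \<theta> K a \<theta> K (dmap K K (bmap Y (idn Y a)) (foot Y \<theta>) v) = dmap K K (bmap Y (idn Y a)) (foot Y \<theta>) v"
    by (rule transition_span[OF A A i i D(3) idn_comp[OF D(3)] idn_comp[OF D(3)] D(4,5) v])
  then show ?thesis using dmap_idn[OF hom_Obj(2)[OF D(3)] D(4,5) v] by simp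
qed

lemma etale_chart_precomp:
  assumes "etale_chart_at Y p a \<theta> K" "q \<in> point_objects Y" "hom h q p"
  shows "etale_chart_at Y q a (\<theta> \<cdot> h) K"
  using etale_chartD[OF assms(1)] comp_hom[OF assms(3)] assms foot_precomp[OF assms(2) _ assms(3)]
  by (simp add: etale_chart_at_def)

lemma transition_rel_precomp:
  assumes \<theta>: "hom \<theta> p a" and \<theta>': "hom \<theta>' p a'" and q: "q \<in> point_objects Y" "p \<in> point_objects Y" and h: "hom h q p"
    and T: "transition_rel p a \<theta> K a' \<theta>' K' v w"
  shows "transition_rel q a (\<theta> \<cdot> h) K a' (\<theta>' \<cdot> h) K' v w"
proof -
  from T obtain e m n \<gamma> L z where s: "hom m e a" "hom n e a'" "hom \<gamma> p e" "m \<cdot> \<gamma> = \<theta>" "n \<cdot> \<gamma> = \<theta>'"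
    "L \<in> charts (base Y e)" "foot Y \<gamma> \<in> cdom L" "z \<in> Rn (cdim L)"
    "dmap L K (bmap Y m) (foot Y \<gamma>) z = v" "dmap L K' (bmap Y n) (foot Y \<gamma>) z = w"
    unfolding transition_rel_def by blast
  have "m \<cdot> (\<gamma> \<cdot> h) = \<theta> \<cdot> h" "n \<cdot> (\<gamma> \<cdot> h) = \<theta>' \<cdot> h"
    using assoc[OF h s(3) s(1)] assoc[OF h s(3) s(2)] s by auto
  moreover have "foot Y (\<gamma> \<cdot> h) = foot Y \<gamma>" by (rule foot_precomp[OF q h s(3)])
  moreover have "hom (\<gamma> \<cdot> h) q e" by (rule comp_hom[OF h s(3)])
  ultimately show ?thesis unfolding transition_rel_def using s by metis
qed

text \<open>Precomposing both frames with \<open>h\<close> only replaces \<open>\<gamma>\<close> by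
  \<open>\<gamma> \<cdot> h\<close> in a span and leaves the feet unchanged; the inverse of
  \<open>h\<close> leads back.\<close>

lemma transition_precomp:
  assumes A: "etale_chart_at Y p a \<theta> K" and A': "etale_chart_at Y p a' \<theta>' K'" and q: "q \<in> point_objects Y" and h: "hom h q p"
  shows "transition q a (\<theta> \<cdot> h) K a' (\<theta>' \<cdot> h) K' = transition p a \<theta> K a' \<theta>' K'"
proof -
  note p = etale_chartD(1)[OF A]
  note \<theta> = etale_chartD(3)[OF A] and \<theta>' = etale_chartD(3)[OF A']
  obtain k where k: "hom k p q" "h \<cdot> k = idn Y p" by (rule point_inverse[OF q p h])
  have hk: "(\<theta> \<cdot> h) \<cdot> k = \<theta>" "(\<theta>' \<cdot> h) \<cdot> k = \<theta>'"
    using assoc[OF k(1) h \<theta>] assoc[OF k(1) h \<theta>'] k(2) comp_idn[OF \<theta>] comp_idn[OF \<theta>'] by auto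
  have "transition_rel q a (\<theta> \<cdot> h) K a' (\<theta>' \<cdot> h) K' v w \<longleftrightarrow> transition_rel p a \<theta> K a' \<theta>' K' v w" for v w
    using transition_rel_precomp[OF \<theta> \<theta>' q p h] transition_rel_precomp[OF comp_hom[OF h \<theta>] comp_hom[OF h \<theta>'] p q k(1)]
    unfolding hk by blast
  then have "transition_rel q a (\<theta> \<cdot> h) K a' (\<theta>' \<cdot> h) K' = transition_rel p a \<theta> K a' \<theta>' K'" by blast
  then show ?thesis unfolding transition_def by simp
qed

text \<open>The action is the transition between the frames \<open>\<theta>\<close> and
  \<open>\<theta> \<cdot> h\<close> of one and the same chart. Linearity, composition and
  equivariance thereby become instances of facts on transitions.\<close>

lemma tangent_action_eq:
  assumes A: "etale_chart_at Y p a \<theta> K" and h: "hom h p p"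
  shows "tangent_action Y a \<theta> K h = transition p a \<theta> K a (\<theta> \<cdot> h) K"
proof
  fix v
  note D = etale_chartD[OF A]
  have A': "etale_chart_at Y p a (\<theta> \<cdot> h) K" by (rule etale_chart_precomp[OF A D(1) h])
  have "(\<exists>c \<alpha> \<beta> \<gamma> L z. fibre_product Y a a c \<alpha> \<beta> \<and> hom \<gamma> p c \<and> \<alpha> \<cdot> \<gamma> = \<theta> \<and> \<beta> \<cdot> \<gamma> = \<theta> \<cdot> h \<and>
    L \<in> charts (base Y c) \<and> foot Y \<gamma> \<in> cdom L \<and> z \<in> Rn (cdim L) \<and>
    dmap L K (bmap Y \<alpha>) (foot Y \<gamma>) z = v \<and> dmap L K (bmap Y \<beta>) (foot Y \<gamma>) z = w) \<longleftrightarrow>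
    transition_rel p a \<theta> K a (\<theta> \<cdot> h) K v w" (is "?P \<longleftrightarrow> ?Q") for w
  proof
    assume ?P then show ?Q unfolding transition_rel_def using fibre_product_hom by blast
  next
    assume Q: ?Q
    obtain c \<alpha> \<beta> \<gamma> L where f: "fibre_product Y a a c \<alpha> \<beta>" and \<gamma>: "hom \<gamma> p c" "\<alpha> \<cdot> \<gamma> = \<theta>" "\<beta> \<cdot> \<gamma> = \<theta> \<cdot> h"
      and L: "L \<in> charts (base Y c)" "foot Y \<gamma> \<in> cdom L"
      by (rule etale_charts_span[OF A A']) blast
    from Q transition_rel_universal[OF A A' f \<gamma> L] obtain z where
      "z \<in> Rn (cdim L)" "dmap L K (bmap Y \<alpha>) (foot Y \<gamma>) z = v" "dmap L K (bmap Y \<beta>) (foot Y \<gamma>) z = w" by blast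
    then show ?P using f \<gamma> L by blast
  qed
  then show "tangent_action Y a \<theta> K h v = transition p a \<theta> K a (\<theta> \<cdot> h) K v"
    unfolding tangent_action_def transition_def hom_dom[OF D(3)] by presburger
qed

lemma tangent_action_in:
  "etale_chart_at Y p a \<theta> K \<Longrightarrow> hom h p p \<Longrightarrow> v \<in> Rn (cdim K) \<Longrightarrow> tangent_action Y a \<theta> K h v \<in> Rn (cdim K)"
  using tangent_action_eq transition_in etale_chart_precomp etale_chartD(1) by metis

lemma tangent_action_linear:
  "etale_chart_at Y p a \<theta> K \<Longrightarrow> hom h p p \<Longrightarrow> linear_on_set (Rn (cdim K)) (tangent_action Y a \<theta> K h)"
  using tangent_action_eq transition_linear etale_chart_precomp etale_chartD(1) by metis

text \<open>By \<open>transition_precomp\<close> the action of \<open>h\<close> is also the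
  transition from \<open>\<theta> \<cdot> k\<close> to
  \<open>(\<theta> \<cdot> h) \<cdot> k\<close>, so that it can be chained after the action of
  \<open>k\<close>, which ends at \<open>\<theta> \<cdot> k\<close>.\<close>

lemma tangent_action_comp:
  assumes A: "etale_chart_at Y p a \<theta> K" and h: "hom h p p" and k: "hom k p p" and v: "v \<in> Rn (cdim K)"
  shows "tangent_action Y a \<theta> K (h \<cdot> k) v = tangent_action Y a \<theta> K h (tangent_action Y a \<theta> K k v)"
proof -
  note D = etale_chartD[OF A]
  have Ah: "etale_chart_at Y p a (\<theta> \<cdot> h) K" and Ak: "etale_chart_at Y p a (\<theta> \<cdot> k) K"
    and Ahk: "etale_chart_at Y p a ((\<theta> \<cdot> h) \<cdot> k) K"
    using etale_chart_precomp[OF A D(1)] etale_chart_precomp[OF _ D(1) k] h k by blast+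
  have e: "\<theta> \<cdot> (h \<cdot> k) = (\<theta> \<cdot> h) \<cdot> k" by (rule assoc[OF k h D(3)])
  show ?thesis
    unfolding tangent_action_eq[OF A h] tangent_action_eq[OF A k] tangent_action_eq[OF A comp_hom[OF k h]] e
      transition_precomp[OF A Ah D(1) k, symmetric]
    by (rule transition_trans[OF A Ak Ahk v, symmetric])
qed

lemma tangent_action_idn:
  assumes A: "etale_chart_at Y p a \<theta> K" and v: "v \<in> Rn (cdim K)"
  shows "tangent_action Y a \<theta> K (idn Y p) v = v"
  using tangent_action_eq[OF A idn_hom[OF point_Obj[OF etale_chartD(1)[OF A]]]] transition_refl[OF A v] comp_idn[OF etale_chartD(3)[OF A]] by simp

lemma transition_equivariant:
  assumes A: "etale_chart_at Y p a \<theta> K" and A': "etale_chart_at Y p a' \<theta>' K'" and h: "hom h p p" and v: "v \<in> Rn (cdim K)"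
  shows "transition p a \<theta> K a' \<theta>' K' (tangent_action Y a \<theta> K h v) = tangent_action Y a' \<theta>' K' h (transition p a \<theta> K a' \<theta>' K' v)"
proof -
  note p = etale_chartD(1)[OF A]
  have Ah: "etale_chart_at Y p a (\<theta> \<cdot> h) K" and Ah': "etale_chart_at Y p a' (\<theta>' \<cdot> h) K'"
    using etale_chart_precomp[OF A p h] etale_chart_precomp[OF A' p h] by blast+
  have "transition p a \<theta> K a' \<theta>' K' (tangent_action Y a \<theta> K h v) = transition p a \<theta> K a' (\<theta>' \<cdot> h) K' v"
    unfolding tangent_action_eq[OF A h] transition_precomp[OF A A' p h, symmetric]
    by (rule transition_trans[OF A Ah Ah' v])
  also have "\<dots> = tangent_action Y a' \<theta>' K' h (transition p a \<theta> K a' \<theta>' K' v)"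
    unfolding tangent_action_eq[OF A' h] by (rule transition_trans[OF A A' Ah' v, symmetric])
  finally show ?thesis .
qed


subsection \<open>Derivatives of functions in etale charts\<close>

context
  fixes f assumes f: "stack_function Y f"
begin

lemma stack_function_smooth: "a \<in> Obj Y \<Longrightarrow> smooth_real (base Y a) (f a)"
  using f by (simp add: stack_function_def)

lemma stack_function_arrow: "hom m a b \<Longrightarrow> x \<in> pts (base Y a) \<Longrightarrow> f a x = f b (bmap Y m x)"
  using f by (auto simp: stack_function_def in_hom_def)

lemma dfun_arrow:
  assumes m: "hom m a b" and K: "K \<in> charts (base Y a)" "x \<in> cdom K" and L: "L \<in> charts (base Y b)" "bmap Y m x \<in> cdom L"
  shows "dfun K (f a) x v = dfun L (f b) (bmap Y m x) (dmap K L (bmap Y m) x v)"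
  by (rule dfun_pullback[OF hom_manifold[OF m] bmap_smooth[OF m] stack_function_smooth[OF hom_Obj(2)[OF m]] K L stack_function_arrow[OF m]])

lemma hessian_arrow:
  assumes m: "hom m a b" and K: "K \<in> charts (base Y a)" "x \<in> cdom K" and L: "L \<in> charts (base Y b)" "bmap Y m x \<in> cdom L"
    and "diff_vanishes L (f b) (bmap Y m x)"
  shows "hessian K (f a) x v w = hessian L (f b) (bmap Y m x) (dmap K L (bmap Y m) x v) (dmap K L (bmap Y m) x w)"
  by (rule hessian_pullback[OF hom_manifold[OF m] bmap_smooth[OF m] stack_function_smooth[OF hom_Obj(2)[OF m]] K L stack_function_arrow[OF m] assms(6)])

lemma diff_vanishes_arrow:
  assumes "hom m a b" "K \<in> charts (base Y a)" "x \<in> cdom K" "L \<in> charts (base Y b)" "bmap Y m x \<in> cdom L"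
    and "diff_vanishes L (f b) (bmap Y m x)"
  shows "diff_vanishes K (f a) x"
  using assms(6) dfun_arrow[OF assms(1-5)] dmap_Rn unfolding diff_vanishes_iff by simp

text \<open>Both sides are derivatives of the single function \<open>f c\<close> at the apex
  \<open>c\<close> of a span, evaluated at common preimages of the vectors.\<close>

lemma transition_dfun:
  assumes A: "etale_chart_at Y p a \<theta> K" and A': "etale_chart_at Y p a' \<theta>' K'" and v: "v \<in> Rn (cdim K)"
  shows "dfun K (f a) (foot Y \<theta>) v = dfun K' (f a') (foot Y \<theta>') (transition p a \<theta> K a' \<theta>' K' v)"
    and "diff_vanishes K (f a) (foot Y \<theta>) \<Longrightarrow> diff_vanishes K' (f a') (foot Y \<theta>') \<Longrightarrow> w \<in> Rn (cdim K) \<Longrightarrow>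
      hessian K (f a) (foot Y \<theta>) v w = hessian K' (f a') (foot Y \<theta>') (transition p a \<theta> K a' \<theta>' K' v) (transition p a \<theta> K a' \<theta>' K' w)"
proof -
  obtain c \<alpha> \<beta> \<gamma> L where \<gamma>: "hom \<gamma> p c" "\<alpha> \<cdot> \<gamma> = \<theta>" "\<beta> \<cdot> \<gamma> = \<theta>'"
    and L: "L \<in> charts (base Y c)" "foot Y \<gamma> \<in> cdom L" and \<alpha>: "hom \<alpha> c a" and \<beta>: "hom \<beta> c a'"
    and ft: "bmap Y \<alpha> (foot Y \<gamma>) = foot Y \<theta>" "bmap Y \<beta> (foot Y \<gamma>) = foot Y \<theta>'"
    and bija: "bij_betw (dmap L K (bmap Y \<alpha>) (foot Y \<gamma>)) (Rn (cdim L)) (Rn (cdim K))"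
    by (rule etale_charts_span[OF A A']) blast
  have pre: "\<exists>z\<in>Rn (cdim L). v = dmap L K (bmap Y \<alpha>) (foot Y \<gamma>) z \<and>
      transition p a \<theta> K a' \<theta>' K' v = dmap L K' (bmap Y \<beta>) (foot Y \<gamma>) z" if "v \<in> Rn (cdim K)" for v
  proof -
    obtain z where z: "z \<in> Rn (cdim L)" "v = dmap L K (bmap Y \<alpha>) (foot Y \<gamma>) z"
      using bij_betw_preimage[OF bija \<open>v \<in> Rn (cdim K)\<close>] by blast
    then show ?thesis using transition_span[OF A A' \<alpha> \<beta> \<gamma> L z(1)] by blast
  qed
  note fa = ft(1)[symmetric] and fb = ft(2)[symmetric]
  have Ka: "K \<in> charts (base Y a)" "bmap Y \<alpha> (foot Y \<gamma>) \<in> cdom K" and Kb: "K' \<in> charts (base Y a')" "bmap Y \<beta> (foot Y \<gamma>) \<in> cdom K'"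
    using etale_chartD[OF A] etale_chartD[OF A'] ft by auto
  obtain z where z: "z \<in> Rn (cdim L)" "v = dmap L K (bmap Y \<alpha>) (foot Y \<gamma>) z"
    "transition p a \<theta> K a' \<theta>' K' v = dmap L K' (bmap Y \<beta>) (foot Y \<gamma>) z" using pre[OF v] by blast
  show "dfun K (f a) (foot Y \<theta>) v = dfun K' (f a') (foot Y \<theta>') (transition p a \<theta> K a' \<theta>' K' v)"
    unfolding z(2,3)[symmetric, symmetric] z(3)[unfolded z(2)] fa fb dfun_arrow[OF \<alpha> L Ka, symmetric] dfun_arrow[OF \<beta> L Kb, symmetric] ..
  assume d: "diff_vanishes K (f a) (foot Y \<theta>)" "diff_vanishes K' (f a') (foot Y \<theta>')" and w: "w \<in> Rn (cdim K)"
  obtain y where y: "y \<in> Rn (cdim L)" "w = dmap L K (bmap Y \<alpha>) (foot Y \<gamma>) y"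
    "transition p a \<theta> K a' \<theta>' K' w = dmap L K' (bmap Y \<beta>) (foot Y \<gamma>) y" using pre[OF w] by blast
  have "hessian L (f c) (foot Y \<gamma>) z y = hessian K (f a) (foot Y \<theta>) v w"
    using hessian_arrow[OF \<alpha> L Ka, of z y] d ft z y by simp
  moreover have "hessian L (f c) (foot Y \<gamma>) z y = hessian K' (f a') (foot Y \<theta>') (transition p a \<theta> K a' \<theta>' K' v) (transition p a \<theta> K a' \<theta>' K' w)"
    using hessian_arrow[OF \<beta> L Kb, of z y] d ft z y by simp
  ultimately show "hessian K (f a) (foot Y \<theta>) v w = hessian K' (f a') (foot Y \<theta>') (transition p a \<theta> K a' \<theta>' K' v) (transition p a \<theta> K a' \<theta>' K' w)"
    by simp
qed

lemma diff_vanishes_independent: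
  assumes A: "etale_chart_at Y p a \<theta> K" and A': "etale_chart_at Y p a' \<theta>' K'"
  shows "diff_vanishes K (f a) (foot Y \<theta>) \<longleftrightarrow> diff_vanishes K' (f a') (foot Y \<theta>')"
proof -
  have "diff_vanishes K (f a) (foot Y \<theta>)"
    if A: "etale_chart_at Y p a \<theta> K" and A': "etale_chart_at Y p a' \<theta>' K'" and d: "diff_vanishes K' (f a') (foot Y \<theta>')"
    for a \<theta> K a' \<theta>' K'
    using d transition_dfun(1)[OF A A'] transition_in[OF A A'] unfolding diff_vanishes_iff by simp
  then show ?thesis using A A' by blast
qed

lemma critical_at_iff:
  assumes A: "etale_chart_at Y p a \<theta> K"
  shows "critical_at Y f p \<longleftrightarrow> diff_vanishes K (f a) (foot Y \<theta>)"
  unfolding critical_at_def using diff_vanishes_independent[OF A] A by blast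

lemma critical_at_iso:
  assumes q: "q \<in> point_objects Y" and p: "p \<in> point_objects Y" and h: "hom h q p"
  shows "critical_at Y f p \<Longrightarrow> critical_at Y f q"
  unfolding critical_at_def using etale_chart_precomp[OF _ q h] foot_precomp[OF q p h] etale_chartD(3) by metis

lemma critical_points_iff:
  assumes p: "p \<in> point_objects Y"
  shows "iso_class Y p \<in> critical_points Y f \<longleftrightarrow> critical_at Y f p"
proof
  assume "iso_class Y p \<in> critical_points Y f"
  then obtain q where q: "q \<in> iso_class Y p" "critical_at Y f q" by (auto simp: critical_points_def)
  then obtain m where m: "q \<in> point_objects Y" "hom m q p" by (auto simp: iso_class_def)
  obtain k where "hom k p q" by (rule point_inverse[OF m(1) p m(2)])
  then show "critical_at Y f p" using critical_at_iso[OF p m(1)] q(2) by blast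
next
  assume "critical_at Y f p"
  then show "iso_class Y p \<in> critical_points Y f"
    using iso_class_self[OF p] p by (auto simp: critical_points_def points_def)
qed

lemma tangent_action_dfun:
  assumes A: "etale_chart_at Y p a \<theta> K" and h: "hom h p p" and v: "v \<in> Rn (cdim K)"
  shows "dfun K (f a) (foot Y \<theta>) (tangent_action Y a \<theta> K h v) = dfun K (f a) (foot Y \<theta>) v"
    and "diff_vanishes K (f a) (foot Y \<theta>) \<Longrightarrow> w \<in> Rn (cdim K) \<Longrightarrow>
      hessian K (f a) (foot Y \<theta>) (tangent_action Y a \<theta> K h v) (tangent_action Y a \<theta> K h w) = hessian K (f a) (foot Y \<theta>) v w"
proof -
  note D = etale_chartD[OF A]
  have A': "etale_chart_at Y p a (\<theta> \<cdot> h) K" by (rule etale_chart_precomp[OF A D(1) h])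
  have ft: "foot Y (\<theta> \<cdot> h) = foot Y \<theta>" by (rule foot_precomp[OF D(1,1) h D(3)])
  show "dfun K (f a) (foot Y \<theta>) (tangent_action Y a \<theta> K h v) = dfun K (f a) (foot Y \<theta>) v"
    using transition_dfun(1)[OF A A' v] tangent_action_eq[OF A h] ft by simp
  show "diff_vanishes K (f a) (foot Y \<theta>) \<Longrightarrow> w \<in> Rn (cdim K) \<Longrightarrow>
      hessian K (f a) (foot Y \<theta>) (tangent_action Y a \<theta> K h v) (tangent_action Y a \<theta> K h w) = hessian K (f a) (foot Y \<theta>) v w"
    using transition_dfun(2)[OF A A' v] tangent_action_eq[OF A h] ft by simp
qed

end

end


section \<open>The inertia category\<close>

lemma inertia_simps:
  "base (inertia X) (a, \<phi>) = base X a" "bmap (inertia X) (\<phi>, l, \<psi>) = bmap X l"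
  "idn (inertia X) (a, \<phi>) = (\<phi>, idn X a, \<phi>)" "cmp (inertia X) (\<phi>', l', \<psi>') (\<phi>, l, \<psi>) = (\<phi>, cmp X l' l, \<psi>')"
  "(a, \<phi>) \<in> Obj (inertia X) \<longleftrightarrow> a \<in> Obj X \<and> \<phi> \<in> Aut X a"
  by (auto simp: inertia_def)

lemma in_hom_inertia:
  "in_hom (inertia X) m (a, \<phi>) (b, \<psi>) \<longleftrightarrow>
    (\<exists>l. m = (\<phi>, l, \<psi>) \<and> in_hom X l a b \<and> \<phi> \<in> Aut X a \<and> \<psi> \<in> Aut X b \<and> cmp X l \<phi> = cmp X \<psi> l)"
  by (cases m) (auto simp: in_hom_def inertia_def)

lemma foot_inertia: "foot (inertia X) (\<phi>, l, \<psi>) = foot X l"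
  by (simp add: foot_def inertia_simps)

lemma (in fibred) Aut_hom: "\<phi> \<in> Aut Y a \<Longrightarrow> hom \<phi> a a"
  by (simp add: Aut_def)

lemma (in fibred) Aut_bmap: "\<phi> \<in> Aut Y a \<Longrightarrow> x \<in> pts (base Y a) \<Longrightarrow> bmap Y \<phi> x = x"
  by (simp add: Aut_def incl_def)

text \<open>Automorphisms lie over identities, so both sides lie over \<open>bmap Y k\<close> and
  can be compared after composition with \<open>m\<close>. This makes lifts in \<open>Y\<close>
  compatible with the automorphisms in the inertia category.\<close>

lemma (in fibred) intertwine_lift:
  assumes m: "hom m b a" and k: "hom k c b" and \<phi>: "\<phi> \<in> Aut Y a" and \<psi>: "\<psi> \<in> Aut Y b" and \<omega>: "\<omega> \<in> Aut Y c"
    and m\<psi>: "m \<cdot> \<psi> = \<phi> \<cdot> m" and mk: "(m \<cdot> k) \<cdot> \<omega> = \<phi> \<cdot> (m \<cdot> k)"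
  shows "k \<cdot> \<omega> = \<psi> \<cdot> k"
proof (rule cartesian_cancel[OF m])
  note h = Aut_hom[OF \<phi>] Aut_hom[OF \<psi>] Aut_hom[OF \<omega>]
  show k\<omega>: "hom (k \<cdot> \<omega>) c b" and \<psi>k: "hom (\<psi> \<cdot> k) c b" using comp_hom h k by blast+
  show "bmap Y (k \<cdot> \<omega>) = bmap Y (\<psi> \<cdot> k)"
    by (rule bmap_eqI[OF k\<omega> \<psi>k])
      (simp add: bmap_comp_apply[OF h(3) k] bmap_comp_apply[OF k h(2)] Aut_bmap[OF \<omega>] Aut_bmap[OF \<psi>] bmap_pts[OF k])
  show "m \<cdot> k \<cdot> \<omega> = m \<cdot> \<psi> \<cdot> k"
    using assoc[OF h(3) k m] assoc[OF k h(2) m] assoc[OF k m h(1)] m\<psi> mk by simp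
qed

lemma (in fibred) Aut_pullback:
  assumes m: "hom m b a" and \<phi>: "\<phi> \<in> Aut Y a"
  obtains \<psi> where "\<psi> \<in> Aut Y b" "m \<cdot> \<psi> = \<phi> \<cdot> m"
proof -
  have b: "b \<in> Obj Y" using hom_Obj[OF m] by blast
  obtain \<psi> where \<psi>: "hom \<psi> b b" "bmap Y \<psi> = incl (pts (base Y b))" "m \<cdot> \<psi> = \<phi> \<cdot> m"
  proof (rule lift_ex[OF m comp_hom[OF m Aut_hom[OF \<phi>]] smooth_map_id[OF base_manifold[OF b]]])
    show "bmap Y m (incl (pts (base Y b)) x) = bmap Y (\<phi> \<cdot> m) x" if "x \<in> pts (base Y b)" for x
      using that bmap_comp_apply[OF m Aut_hom[OF \<phi>] that] Aut_bmap[OF \<phi>] bmap_pts[OF m that] by (simp add: incl_def)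
  qed
  then show thesis using that by (simp add: Aut_def)
qed

text \<open>Makes every result on fibred categories, in particular those on
  \<open>transition\<close>, available for the inertia category. Lifts are those of
  \<open>X\<close>, and \<open>intertwine_lift\<close> shows that they respect the
  automorphisms.\<close>

lemma fibred_inertia:
  assumes "fibred_in_groupoids X"
  shows "fibred_in_groupoids (inertia X)"
proof -
  interpret X: fibred X by unfold_locales (rule assms)
  have "category_over_manifolds (inertia X)"
    unfolding category_over_manifolds_def
  proof (intro conjI ballI allI impI)
    fix m assume "m \<in> Arr (inertia X)"
    then show "dom (inertia X) m \<in> Obj (inertia X)" "cod (inertia X) m \<in> Obj (inertia X)"
      using X.cat by (auto simp: inertia_def category_over_manifolds_def)
  next
    fix a assume "a \<in> Obj (inertia X)"
    then show "in_hom (inertia X) (idn (inertia X) a) a a"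
      using X.idn_hom X.comp_idn[OF X.Aut_hom] X.idn_comp[OF X.Aut_hom]
      by (cases a) (auto simp: inertia_simps in_hom_inertia)
  next
    fix m n a b c assume h: "in_hom (inertia X) m a b \<and> in_hom (inertia X) n b c"
    obtain a' \<phi> b' \<psi> c' \<omega> where abc: "a = (a', \<phi>)" "b = (b', \<psi>)" "c = (c', \<omega>)" by (cases a, cases b, cases c)
    from h obtain l l' where l: "m = (\<phi>, l, \<psi>)" "X.hom l a' b'" "\<phi> \<in> Aut X a'" "\<psi> \<in> Aut X b'" "cmp X l \<phi> = cmp X \<psi> l"
      and l': "n = (\<psi>, l', \<omega>)" "X.hom l' b' c'" "\<omega> \<in> Aut X c'" "cmp X l' \<psi> = cmp X \<omega> l'"
      unfolding abc in_hom_inertia by blast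
    note A = X.Aut_hom[OF l(3)] X.Aut_hom[OF l(4)] X.Aut_hom[OF l'(3)]
    have "cmp X (cmp X l' l) \<phi> = cmp X \<omega> (cmp X l' l)"
      using X.assoc[OF A(1) l(2) l'(2)] X.assoc[OF l(2) A(2) l'(2)] X.assoc[OF l(2) l'(2) A(3)] l l' by simp
    then show "in_hom (inertia X) (cmp (inertia X) n m) a c"
      unfolding abc in_hom_inertia using l l' X.comp_hom by (auto simp: inertia_simps)
  next
    fix m a b assume "in_hom (inertia X) m a b"
    then show "cmp (inertia X) m (idn (inertia X) a) = m" "cmp (inertia X) (idn (inertia X) b) m = m"
      using X.comp_idn X.idn_comp by (cases a, cases b, auto simp: in_hom_inertia inertia_simps)+
  next
    fix k m n a b c d assume "in_hom (inertia X) k a b \<and> in_hom (inertia X) m b c \<and> in_hom (inertia X) n c d"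
    then show "cmp (inertia X) n (cmp (inertia X) m k) = cmp (inertia X) (cmp (inertia X) n m) k"
      using X.assoc by (cases a, cases b, cases c, cases d) (auto simp: in_hom_inertia inertia_simps)
  next
    fix a assume "a \<in> Obj (inertia X)"
    then show "is_manifold (base (inertia X) a)" "bmap (inertia X) (idn (inertia X) a) = incl (pts (base (inertia X) a))"
      using X.base_manifold X.bmap_idn by (cases a, auto simp: inertia_simps)+
  next
    fix m a b assume "in_hom (inertia X) m a b"
    then show "smooth_map (base (inertia X) a) (base (inertia X) b) (bmap (inertia X) m)"
      using X.bmap_smooth by (cases a, cases b) (auto simp: in_hom_inertia inertia_simps)
  next
    fix m n a b c assume "in_hom (inertia X) m a b \<and> in_hom (inertia X) n b c"
    then show "bmap (inertia X) (cmp (inertia X) n m) = compose (pts (base (inertia X) a)) (bmap (inertia X) n) (bmap (inertia X) m)"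
      using X.bmap_comp by (cases a, cases b, cases c) (auto simp: in_hom_inertia inertia_simps)
  qed
  moreover have "\<exists>b m. in_hom (inertia X) m b a \<and> base (inertia X) b = M \<and> bmap (inertia X) m = F"
    if a: "a \<in> Obj (inertia X)" and M: "is_manifold M" and F: "smooth_map M (base (inertia X) a) F" for a M F
  proof -
    obtain a' \<phi> where a': "a = (a', \<phi>)" "a' \<in> Obj X" "\<phi> \<in> Aut X a'" using a by (cases a) (auto simp: inertia_simps)
    obtain b m where m: "X.hom m b a'" "base X b = M" "bmap X m = F"
      using X.pullback_ex[OF a'(2) M, of F] F unfolding a'(1) inertia_simps by blast
    obtain \<psi> where "\<psi> \<in> Aut X b" "cmp X m \<psi> = cmp X \<phi> m" by (rule X.Aut_pullback[OF m(1) a'(3)])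
    then have "in_hom (inertia X) (\<psi>, m, \<phi>) (b, \<psi>) a \<and> base (inertia X) (b, \<psi>) = M \<and> bmap (inertia X) (\<psi>, m, \<phi>) = F"
      using m a' by (auto simp: in_hom_inertia inertia_simps)
    then show ?thesis by blast
  qed
  moreover have "\<exists>!k. in_hom (inertia X) k c b \<and> bmap (inertia X) k = F \<and> cmp (inertia X) m k = n"
    if m: "in_hom (inertia X) m b a" and n: "in_hom (inertia X) n c a"
      and F: "smooth_map (base (inertia X) c) (base (inertia X) b) F"
        "compose (pts (base (inertia X) c)) (bmap (inertia X) m) F = bmap (inertia X) n" for a b c m n F
  proof -
    obtain a' \<phi> b' \<psi> c' \<omega> where abc: "a = (a', \<phi>)" "b = (b', \<psi>)" "c = (c', \<omega>)" by (cases a, cases b, cases c)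
    from m n obtain l l' where l: "m = (\<psi>, l, \<phi>)" "X.hom l b' a'" "\<psi> \<in> Aut X b'" "\<phi> \<in> Aut X a'" "cmp X l \<psi> = cmp X \<phi> l"
      and l': "n = (\<omega>, l', \<phi>)" "X.hom l' c' a'" "\<omega> \<in> Aut X c'" "cmp X l' \<omega> = cmp X \<phi> l'"
      unfolding abc in_hom_inertia by blast
    have "\<exists>!k. X.hom k c' b' \<and> bmap X k = F \<and> cmp X l k = l'"
      using F assms l(2) l'(2) unfolding fibred_in_groupoids_def by (simp add: abc l(1) l'(1) inertia_simps)
    then obtain k where k: "X.hom k c' b'" "bmap X k = F" "cmp X l k = l'"
      and u: "\<And>k'. X.hom k' c' b' \<Longrightarrow> bmap X k' = F \<Longrightarrow> cmp X l k' = l' \<Longrightarrow> k' = k" by metis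
    have "cmp X k \<omega> = cmp X \<psi> k"
      by (rule X.intertwine_lift[OF l(2) k(1) l(4) l(3) l'(3) l(5)]) (use k(3) l'(4) in simp)
    then have "in_hom (inertia X) (\<omega>, k, \<psi>) c b"
      unfolding abc in_hom_inertia using k(1) l(3) l'(3) by blast
    moreover have "bmap (inertia X) (\<omega>, k, \<psi>) = F" "cmp (inertia X) m (\<omega>, k, \<psi>) = n"
      using k by (simp_all add: l(1) l'(1) inertia_simps)
    moreover have "k' = (\<omega>, k, \<psi>)"
      if "in_hom (inertia X) k' c b" "bmap (inertia X) k' = F" "cmp (inertia X) m k' = n" for k'
    proof -
      from that(1) obtain j where j: "k' = (\<omega>, j, \<psi>)" "X.hom j c' b'" unfolding abc in_hom_inertia by blast
      then show ?thesis using u[OF j(2)] that(2,3) by (simp add: l(1) l'(1) inertia_simps)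
    qed
    ultimately show ?thesis by blast
  qed
  ultimately show ?thesis unfolding fibred_in_groupoids_def by blast
qed

section \<open>Linearisation of finite order germs\<close>

lemma linear_on_setD:
  "linear_on_set V T \<Longrightarrow> v \<in> V \<Longrightarrow> w \<in> V \<Longrightarrow> T (\<lambda>i. r * v i + s * w i) = (\<lambda>i. r * T v i + s * T w i)"
  by (simp add: linear_on_set_def)

lemma Rn_lin: "v \<in> Rn n \<Longrightarrow> w \<in> Rn n \<Longrightarrow> (\<lambda>i. r * v i + s * w i) \<in> Rn n"
  by (simp add: Rn_iff)

lemma linear_zero: "linear_on_set V T \<Longrightarrow> v \<in> V \<Longrightarrow> T (\<lambda>_. 0) = (\<lambda>_. 0)"
  using linear_on_setD[of V T v v 0 0] by simp

definition unit_vec :: "nat \<Rightarrow> vec"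
  where "unit_vec j = (\<lambda>i. if i = j then 1 else 0)"

lemma unit_vec_Rn: "j < n \<Longrightarrow> unit_vec j \<in> Rn n"
  by (simp add: unit_vec_def Rn_iff)

lemma linear_matrix:
  assumes T: "linear_on_set (Rn n) T" and v: "v \<in> Rn n"
  shows "T v i = (\<Sum>j<n. T (unit_vec j) i * v j)"
proof -
  have "T (\<lambda>l. if l < k then v l else 0) i = (\<Sum>j<k. T (unit_vec j) i * v j)" if "k \<le> n" for k
    using that
  proof (induction k)
    case 0
    show ?case using linear_zero[OF T Rn_zero] by simp
  next
    case (Suc k)
    have "(\<lambda>l. if l < Suc k then v l else 0) = (\<lambda>l. 1 * (if l < k then v l else 0) + v k * unit_vec k l)"
      by (auto simp: unit_vec_def less_Suc_eq)
    moreover have "T (\<lambda>l. 1 * (if l < k then v l else 0) + v k * unit_vec k l) =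
       (\<lambda>i. 1 * T (\<lambda>l. if l < k then v l else 0) i + v k * T (unit_vec k) i)"
      by (rule linear_on_setD[OF T]) (use Suc.prems in \<open>auto simp: Rn_iff unit_vec_def\<close>)
    ultimately have "T (\<lambda>l. if l < Suc k then v l else 0) = (\<lambda>i. 1 * T (\<lambda>l. if l < k then v l else 0) i + v k * T (unit_vec k) i)"
      by simp
    then show ?case using Suc by simp
  qed
  from this[of n] have "T (\<lambda>l. if l < n then v l else 0) i = (\<Sum>j<n. T (unit_vec j) i * v j)" by simp
  moreover have "(\<lambda>l. if l < n then v l else 0) = v" using v by (auto simp: Rn_iff)
  ultimately show ?thesis by simp
qed

lemma linear_average:
  assumes T: "linear_on_set (Rn n) T" and v: "\<And>k. k \<in> I \<Longrightarrow> v k \<in> Rn n" and I: "finite I"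
  shows "T (\<lambda>i. (\<Sum>k\<in>I. v k i) / c) = (\<lambda>i. (\<Sum>k\<in>I. T (v k) i) / c)"
  using I v
proof (induction I rule: finite_induct)
  case empty
  show ?case using linear_zero[OF T Rn_zero] by simp
next
  case (insert k I)
  have "(\<lambda>i. (\<Sum>k\<in>insert k I. v k i) / c) = (\<lambda>i. inverse c * v k i + 1 * ((\<Sum>k\<in>I. v k i) / c))"
    using insert.hyps by (simp add: divide_inverse algebra_simps)
  moreover have "T (\<lambda>i. inverse c * v k i + 1 * ((\<Sum>k\<in>I. v k i) / c)) = (\<lambda>i. inverse c * T (v k) i + 1 * T (\<lambda>i. (\<Sum>k\<in>I. v k i) / c) i)"
    by (rule linear_on_setD[OF T]) (use insert.prems in \<open>auto simp: Rn_iff intro!: sum.neutral\<close>)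
  moreover have "T (\<lambda>i. (\<Sum>k\<in>I. v k i) / c) = (\<lambda>i. (\<Sum>k\<in>I. T (v k) i) / c)" using insert by simp
  ultimately show ?case using insert.hyps by (simp add: divide_inverse algebra_simps)
qed

lemma lin_subspaceD:
  "lin_subspace n V \<Longrightarrow> v \<in> V \<Longrightarrow> w \<in> V \<Longrightarrow> (\<lambda>i. r * v i + s * w i) \<in> V"
  by (simp add: lin_subspace_def)

lemma lin_subspace_Rn: "lin_subspace n V \<Longrightarrow> v \<in> V \<Longrightarrow> v \<in> Rn n"
  by (auto simp: lin_subspace_def)

lemma lin_subspace_zero: "lin_subspace n V \<Longrightarrow> (\<lambda>_. 0) \<in> V"
  by (simp add: lin_subspace_def)

text \<open>Gaussian elimination by induction on \<open>n\<close>: either all last coordinates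
  vanish, or one vector with last coordinate 1 is split off as a further basis vector. The
  coordinate map \<open>Q\<close> is linear on all of \<open>Rn n\<close>, not only on
  \<open>V\<close>; later it defines a retraction on an open set.\<close>

lemma subspace_coordinates:
  assumes "lin_subspace n V"
  obtains m P Q where "linear_on_set (Rn m) P" "linear_on_set (Rn n) Q"
    "\<And>y. y \<in> Rn m \<Longrightarrow> P y \<in> V \<and> Q (P y) = y" "\<And>x. x \<in> Rn n \<Longrightarrow> Q x \<in> Rn m" "\<And>x. x \<in> V \<Longrightarrow> P (Q x) = x"
proof -
  have "\<exists>m P Q. linear_on_set (Rn m) P \<and> linear_on_set (Rn n) Q \<and>
    (\<forall>y\<in>Rn m. P y \<in> V \<and> Q (P y) = y) \<and> (\<forall>x\<in>Rn n. Q x \<in> Rn m) \<and> (\<forall>x\<in>V. P (Q x) = x)"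
    using assms
  proof (induction n arbitrary: V)
    case 0
    then have "V = {\<lambda>_. 0}" by (auto simp: lin_subspace_def Rn_0)
    then show ?case
      by (intro exI[of _ "0::nat"] exI[of _ "\<lambda>v. v"] conjI) (auto simp: linear_on_set_def Rn_0)
  next
    case (Suc n)
    define V' where "V' = {v \<in> V. v n = 0}"
    have V'R: "V' \<subseteq> Rn n"
    proof
      fix v assume v: "v \<in> V'"
      then have "v \<in> Rn (Suc n)" "v n = 0" using lin_subspace_Rn[OF Suc.prems] by (auto simp: V'_def)
      then show "v \<in> Rn n" by (auto simp: Rn_iff) (metis Suc_leI le_neq_implies_less)
    qed
    have "lin_subspace n V'"
      unfolding lin_subspace_def using V'R lin_subspaceD[OF Suc.prems] lin_subspace_zero[OF Suc.prems]
      by (auto simp: V'_def)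
    from Suc.IH[OF this] obtain m P Q where P: "linear_on_set (Rn m) P" and Q: "linear_on_set (Rn n) Q"
      and PQ: "\<And>y. y \<in> Rn m \<Longrightarrow> P y \<in> V' \<and> Q (P y) = y" "\<And>x. x \<in> Rn n \<Longrightarrow> Q x \<in> Rn m" "\<And>x. x \<in> V' \<Longrightarrow> P (Q x) = x"
      by blast
    show ?case
    proof (cases "V = V'")
      case True
      define cut where "cut x = (\<lambda>i. if i < n then x i else 0)" for x :: vec
      have cutR: "cut x \<in> Rn n" for x by (simp add: cut_def Rn_iff)
      have cut_id: "cut x = x" if "x \<in> Rn n" for x using that by (auto simp: cut_def Rn_iff)
      have cut_lin: "cut (\<lambda>i. r * v i + s * w i) = (\<lambda>i. r * cut v i + s * cut w i)" for r s v w
        by (auto simp: cut_def)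
      show ?thesis
      proof (rule exI[of _ m], rule exI[of _ P], rule exI[of _ "\<lambda>x. Q (cut x)"], intro conjI ballI)
        show "linear_on_set (Rn (Suc n)) (\<lambda>x. Q (cut x))"
          unfolding linear_on_set_def cut_lin using linear_on_setD[OF Q cutR cutR] by simp
      qed (use P PQ V'R True cut_id cutR in \<open>auto simp: subset_iff\<close>)
    next
      case False
      then obtain w0 where w0: "w0 \<in> V" "w0 n \<noteq> 0" by (auto simp: V'_def)
      \<comment> \<open>Scales \<open>w0\<close> to last coordinate 1; the vanishing second summand
        gives the shape of a linear combination in \<open>lin_subspaceD\<close>.\<close>
      define w where "w = (\<lambda>i. inverse (w0 n) * w0 i + 0 * w0 i)"
      have w: "w \<in> V" "w n = 1" using lin_subspaceD[OF Suc.prems w0(1) w0(1), of "inverse (w0 n)" 0] w0(2) by (auto simp: w_def)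
      define cut where "cut y = (\<lambda>i. if i < m then y i else 0)" for y :: vec
      \<comment> \<open>Subtracts the multiple of \<open>w\<close> that kills the last coordinate.
        Truncation at \<open>n\<close> keeps the result in \<open>Rn n\<close> for arguments outside
        \<open>V\<close> too.\<close>
      define proj where "proj x = (\<lambda>i. if i < n then x i - x n * w i else 0)" for x :: vec
      define P' where "P' y = (\<lambda>i. 1 * P (cut y) i + y m * w i)" for y
      define Q' where "Q' x = (\<lambda>j. if j < m then Q (proj x) j else if j = m then x n else 0)" for x
      have cutR: "cut y \<in> Rn m" for y by (simp add: cut_def Rn_iff)
      have projR: "proj x \<in> Rn n" for x by (simp add: proj_def Rn_iff)
      have cut_lin: "cut (\<lambda>i. r * v i + s * w i) = (\<lambda>i. r * cut v i + s * cut w i)" for r s v w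
        by (auto simp: cut_def)
      have proj_lin: "proj (\<lambda>i. r * v i + s * w i) = (\<lambda>i. r * proj v i + s * proj w i)" for r s v w
        by (auto simp: proj_def algebra_simps)
      have projV: "proj x = (\<lambda>i. 1 * x i + (- x n) * w i)" if "x \<in> V" for x
      proof
        fix i
        have R: "x \<in> Rn (Suc n)" "w \<in> Rn (Suc n)" using lin_subspace_Rn[OF Suc.prems] that w(1) by auto
        consider "i < n" | "i = n" | "Suc n \<le> i" by linarith
        then show "proj x i = 1 * x i + (- x n) * w i"
          by cases (use R w(2) in \<open>auto simp: proj_def Rn_iff\<close>)
      qed
      have projV': "proj x \<in> V'" if "x \<in> V" for x
        using lin_subspaceD[OF Suc.prems that w(1), of 1 "- x n"] w(2) unfolding projV[OF that] V'_def by simp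
      have P'V: "P' y \<in> V" for y
        unfolding P'_def by (rule lin_subspaceD[OF Suc.prems _ w(1)]) (use PQ(1)[OF cutR] V'_def in blast)
      have Q'P': "Q' (P' y) = y" if y: "y \<in> Rn (Suc m)" for y
      proof -
        have Pn: "P (cut y) n = 0" using PQ(1)[OF cutR[of y]] by (simp add: V'_def)
        have Pc: "P (cut y) \<in> Rn n" using PQ(1)[OF cutR[of y]] V'R by blast
        have n: "P' y n = y m" using Pn w(2) by (simp add: P'_def)
        have "proj (P' y) = P (cut y)"
          unfolding proj_def n using Pc by (auto simp: P'_def Rn_iff)
        then have "Q (proj (P' y)) = cut y" using PQ(1)[OF cutR] by simp
        then show ?thesis using y n by (auto simp: Q'_def cut_def Rn_iff fun_eq_iff)
      qed
      have P'Q': "P' (Q' x) = x" if x: "x \<in> V" for x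
      proof -
        have "cut (Q' x) = Q (proj x)" using PQ(2)[OF projR[of x]] by (auto simp: cut_def Q'_def Rn_iff)
        then have "P (cut (Q' x)) = proj x" using PQ(3)[OF projV'[OF x]] by simp
        then show ?thesis unfolding P'_def projV[OF x] by (simp add: Q'_def)
      qed
      show ?thesis
      proof (rule exI[of _ "Suc m"], rule exI[of _ P'], rule exI[of _ Q'], intro conjI ballI)
        show "linear_on_set (Rn (Suc m)) P'"
          unfolding linear_on_set_def P'_def cut_lin using linear_on_setD[OF P cutR cutR] by (simp add: algebra_simps)
        show "linear_on_set (Rn (Suc n)) Q'"
          unfolding linear_on_set_def Q'_def proj_lin using linear_on_setD[OF Q projR projR] by (auto simp: algebra_simps)
      qed (use P'V Q'P' P'Q' in \<open>auto simp: Q'_def Rn_iff\<close>)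
    qed
  qed
  then show thesis using that by blast
qed

lemma smooth_sum:
  assumes "openin (Euclidean_space n) S" "\<And>j. j \<in> I \<Longrightarrow> smooth_fun_on n S (G j)"
  shows "smooth_fun_on n S (\<lambda>x. \<Sum>j\<in>I. G j x)"
  using assms Ck_sum[OF assms(1), of I _ G] by (simp add: smooth_fun_on_iff open_Rn_subset)

lemma smooth_mult:
  assumes "openin (Euclidean_space n) S" "smooth_fun_on n S G" "smooth_fun_on n S H"
  shows "smooth_fun_on n S (\<lambda>x. G x * H x)"
  using assms Ck_mult[OF assms(1)] by (simp add: smooth_fun_on_iff open_Rn_subset)

lemma smooth_add:
  assumes "openin (Euclidean_space n) S" "smooth_fun_on n S G" "smooth_fun_on n S H"
  shows "smooth_fun_on n S (\<lambda>x. G x + H x)"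
  using assms Ck_add[OF assms(1)] by (simp add: smooth_fun_on_iff open_Rn_subset)

lemma smooth_const: "openin (Euclidean_space n) S \<Longrightarrow> smooth_fun_on n S (\<lambda>_. c)"
  by (simp add: smooth_fun_on_iff open_Rn_subset Ck_const)

lemma smooth_linear:
  assumes S: "openin (Euclidean_space m) S" and T: "linear_on_set (Rn n) T"
    and F: "\<And>x. x \<in> S \<Longrightarrow> F x \<in> Rn n" "\<And>j. j < n \<Longrightarrow> smooth_fun_on m S (\<lambda>x. F x j)"
  shows "smooth_fun_on m S (\<lambda>x. T (F x) i)"
proof -
  have "smooth_fun_on m S (\<lambda>x. \<Sum>j<n. T (unit_vec j) i * F x j)"
    by (intro smooth_sum[OF S] smooth_mult[OF S] smooth_const[OF S] F) auto
  then show ?thesis by (rule smooth_cong[OF S, THEN iffD1, rotated]) (simp add: linear_matrix[OF T F(1)])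
qed

lemma pdiff_linear:
  assumes S: "openin (Euclidean_space m) S" and x: "x \<in> S" and j: "j < m" and T: "linear_on_set (Rn n) T"
    and F: "\<And>x. x \<in> S \<Longrightarrow> F x \<in> Rn n" "\<And>l. l < n \<Longrightarrow> smooth_fun_on m S (\<lambda>x. F x l)"
  shows "pdiff j (\<lambda>x. T (F x) i) x = (\<Sum>l<n. T (unit_vec l) i * pdiff j (\<lambda>x. F x l) x)"
proof -
  have "pdiff j (\<lambda>x. T (F x) i) x = pdiff j (\<lambda>x. \<Sum>l<n. T (unit_vec l) i * F x l) x"
    by (rule pdiff_cong[OF S x j]) (use linear_matrix[OF T F(1)] in blast)
  also have "\<dots> = (\<Sum>l<n. T (unit_vec l) i * pdiff j (\<lambda>x. F x l) x)"
  proof (rule pdiff_eq, rule DERIV_sum, rule DERIV_cmult)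
    fix l assume "l \<in> {..<n}"
    then have "(\<lambda>t. F (x(j := t)) l) differentiable (at (x j))"
      using Ck_differentiable[OF smooth_Ck[OF S F(2)] j x] by simp
    then show "((\<lambda>t. F (x(j := t)) l) has_real_derivative pdiff j (\<lambda>x. F x l) x) (at (x j))"
      by (rule pdiff_has_derivative[where G = "\<lambda>x. F x l"])
  qed
  finally show ?thesis .
qed

text \<open>Bochner's argument: averaging the maps \<open>\<rho>\<^sup>-\<^sup>k s\<^sup>k\<close> conjugates the germ \<open>s\<close> to its derivative \<open>\<rho>\<close>,
  so that the fixed points of \<open>s\<close> are the image of those of \<open>\<rho>\<close>. Here \<open>s k\<close> and \<open>\<rho> k\<close> stand for the
  \<open>k\<close>-th iterates.\<close>

locale finite_order_germ =
  fixes n N :: nat and D :: "vec set" and x0 :: vec and s :: "nat \<Rightarrow> vec \<Rightarrow> vec" and \<rho> :: "nat \<Rightarrow> vec \<Rightarrow> vec"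
  assumes N: "0 < N" and D: "openin (Euclidean_space n) D" and x0: "x0 \<in> D"
    and sR: "\<And>k x. k \<le> N \<Longrightarrow> x \<in> D \<Longrightarrow> s k x \<in> Rn n"
    and s: "\<And>k i. k \<le> N \<Longrightarrow> i < n \<Longrightarrow> smooth_fun_on n D (\<lambda>x. s k x i)"
    and s0: "\<And>x. x \<in> D \<Longrightarrow> s 0 x = x" and sN: "\<And>x. x \<in> D \<Longrightarrow> s N x = x" and sx0: "\<And>k. k \<le> N \<Longrightarrow> s k x0 = x0"
    and sS: "\<And>k x. k < N \<Longrightarrow> x \<in> D \<Longrightarrow> s 1 x \<in> D \<Longrightarrow> s k (s 1 x) = s (Suc k) x"
    and \<rho>: "\<And>k. k \<le> N \<Longrightarrow> linear_on_set (Rn n) (\<rho> k)" and \<rho>R: "\<And>k v. k \<le> N \<Longrightarrow> v \<in> Rn n \<Longrightarrow> \<rho> k v \<in> Rn n"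
    and \<rho>add: "\<And>k l v. k + l \<le> N \<Longrightarrow> v \<in> Rn n \<Longrightarrow> \<rho> (k + l) v = \<rho> k (\<rho> l v)"
    and \<rho>0: "\<And>v. v \<in> Rn n \<Longrightarrow> \<rho> 0 v = v" and \<rho>N: "\<And>v. v \<in> Rn n \<Longrightarrow> \<rho> N v = v"
    and ds: "\<And>k i v. k \<le> N \<Longrightarrow> i < n \<Longrightarrow> v \<in> Rn n \<Longrightarrow> (\<Sum>j<n. pdiff j (\<lambda>x. s k x i) x0 * v j) = \<rho> k v i"
begin

lemma N1: "1 \<le> N" using N by simp

lemma x0R: "x0 \<in> Rn n" using x0 open_Rn_subset[OF D] by blast

text \<open>\<open>\<rho> (N - k)\<close> is the inverse of \<open>\<rho> k\<close>, because
  \<open>\<rho> N\<close> is the identity; so the average is formed without negative powers.\<close>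

definition \<psi> :: "vec \<Rightarrow> vec"
  where "\<psi> x = (\<lambda>i. x0 i + (\<Sum>k<N. \<rho> (N - k) (\<lambda>i. s k x i - x0 i) i) / N)"

lemma diffR: "k \<le> N \<Longrightarrow> x \<in> D \<Longrightarrow> (\<lambda>i. s k x i - x0 i) \<in> Rn n"
  using sR[of k x] x0R by (simp add: Rn_iff)

lemma diff_smooth: "k \<le> N \<Longrightarrow> j < n \<Longrightarrow> smooth_fun_on n D (\<lambda>x. s k x j - x0 j)"
proof -
  assume kj: "k \<le> N" "j < n"
  have "smooth_fun_on n D (\<lambda>x. s k x j + - x0 j)"
    by (intro smooth_add[OF D] smooth_const[OF D] s kj)
  then show ?thesis by simp
qed

lemma \<psi>R: "x \<in> D \<Longrightarrow> \<psi> x \<in> Rn n"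
  using \<rho>R[OF _ diffR[OF less_imp_le]] x0R by (simp add: \<psi>_def Rn_iff)

lemma \<psi>_smooth: "i < n \<Longrightarrow> smooth_fun_on n D (\<lambda>x. \<psi> x i)"
  unfolding \<psi>_def divide_inverse
  by (intro smooth_add[OF D] smooth_mult[OF D] smooth_const[OF D] smooth_sum[OF D] smooth_linear[OF D \<rho> diffR diff_smooth]) auto

lemma \<psi>_x0: "\<psi> x0 = x0"
proof -
  have "\<rho> (N - k) (\<lambda>i. s k x0 i - x0 i) = (\<lambda>_. 0)" if "k < N" for k
    using linear_zero[OF \<rho>[of "N - k"] Rn_zero] sx0[of k] that by simp
  then show ?thesis by (simp add: \<psi>_def)
qed

text \<open>Each of the \<open>N\<close> summands already has derivative
  \<open>\<rho> (N - k)\<close> after \<open>\<rho> k\<close>, the identity, and so has their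
  mean.\<close>

lemma \<psi>_derivative:
  assumes ij: "i < n" "j < n"
  shows "pdiff j (\<lambda>x. \<psi> x i) x0 = (if i = j then 1 else 0)"
proof -
  have lin: "pdiff j (\<lambda>x. \<rho> (N - k) (\<lambda>i. s k x i - x0 i) i) x0 = (if i = j then 1 else 0)" if k: "k < N" for k
  proof -
    have "pdiff j (\<lambda>x. \<rho> (N - k) (\<lambda>i. s k x i - x0 i) i) x0 =
        (\<Sum>l<n. \<rho> (N - k) (unit_vec l) i * pdiff j (\<lambda>x. s k x l - x0 l) x0)"
      by (rule pdiff_linear[OF D x0 ij(2) \<rho> diffR diff_smooth]) (use k in auto)
    also have "\<dots> = (\<Sum>l<n. \<rho> (N - k) (unit_vec l) i * \<rho> k (unit_vec j) l)"
    proof (rule sum.cong[OF refl])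
      fix l assume "l \<in> {..<n}"
      then have l: "l < n" by simp
      have "((\<lambda>t. s k (x0(j := t)) l - x0 l) has_real_derivative pdiff j (\<lambda>x. s k x l) x0 - 0) (at (x0 j))"
        by (intro DERIV_diff DERIV_const pdiff_has_derivative[where G = "\<lambda>x. s k x l"]
            Ck_differentiable[OF smooth_Ck[OF D s] ij(2) x0]) (use k l in auto)
      then have "pdiff j (\<lambda>x. s k x l - x0 l) x0 = pdiff j (\<lambda>x. s k x l) x0"
        using pdiff_eq[where G = "\<lambda>x. s k x l - x0 l"] by simp
      also have "\<dots> = (\<Sum>m<n. pdiff m (\<lambda>x. s k x l) x0 * unit_vec j m)"
        using ij by (simp add: unit_vec_def if_distrib[of "\<lambda>c. _ * c"] cong: if_cong)
      also have "\<dots> = \<rho> k (unit_vec j) l" by (rule ds) (use k l ij unit_vec_Rn in auto)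
      finally show "\<rho> (N - k) (unit_vec l) i * pdiff j (\<lambda>x. s k x l - x0 l) x0 = \<rho> (N - k) (unit_vec l) i * \<rho> k (unit_vec j) l"
        by simp
    qed
    also have "\<dots> = \<rho> (N - k) (\<rho> k (unit_vec j)) i"
      by (rule linear_matrix[symmetric, OF \<rho> \<rho>R]) (use k ij unit_vec_Rn in auto)
    also have "\<dots> = unit_vec j i"
      using \<rho>add[of "N - k" k "unit_vec j"] \<rho>N k unit_vec_Rn[OF ij(2)] by simp
    finally show ?thesis by (simp add: unit_vec_def)
  qed
  have "((\<lambda>t. x0 i + (\<Sum>k<N. \<rho> (N - k) (\<lambda>i. s k (x0(j := t)) i - x0 i) i) / N) has_real_derivative
      0 + (\<Sum>k<N. pdiff j (\<lambda>x. \<rho> (N - k) (\<lambda>i. s k x i - x0 i) i) x0) / N) (at (x0 j))"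
  proof (intro DERIV_add DERIV_const DERIV_cdivide DERIV_sum)
    fix k assume "k \<in> {..<N}"
    then have k: "k \<le> N" "N - k \<le> N" by auto
    have "smooth_fun_on n D (\<lambda>x. \<rho> (N - k) (\<lambda>i. s k x i - x0 i) i)"
      by (rule smooth_linear[OF D \<rho>[OF k(2)] diffR[OF k(1)] diff_smooth[OF k(1)]])
    from Ck_differentiable[OF smooth_Ck[OF D this] ij(2) x0]
    show "((\<lambda>t. \<rho> (N - k) (\<lambda>i. s k (x0(j := t)) i - x0 i) i) has_real_derivative
       pdiff j (\<lambda>x. \<rho> (N - k) (\<lambda>i. s k x i - x0 i) i) x0) (at (x0 j))"
      by (rule pdiff_has_derivative[where G = "\<lambda>x. \<rho> (N - k) (\<lambda>i. s k x i - x0 i) i"])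
  qed
  from pdiff_eq[where G = "\<lambda>x. \<psi> x i", unfolded \<psi>_def, OF this]
  have "pdiff j (\<lambda>x. \<psi> x i) x0 = (\<Sum>k<N. pdiff j (\<lambda>x. \<rho> (N - k) (\<lambda>i. s k x i - x0 i) i) x0) / N"
    unfolding \<psi>_def by simp
  also have "\<dots> = (if i = j then 1 else 0)" using lin N by simp
  finally show ?thesis .
qed

text \<open>Applying \<open>\<rho> 1\<close> shifts the summands of the average cyclically;
  \<open>aN\<close> closes the cycle.\<close>

lemma \<psi>_equivariant:
  assumes x: "x \<in> D" "s 1 x \<in> D"
  shows "(\<lambda>i. \<psi> (s 1 x) i - x0 i) = \<rho> 1 (\<lambda>i. \<psi> x i - x0 i)"
proof -
  define a where "a k = \<rho> (N - k) (\<lambda>i. s k x i - x0 i)" for k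
  have aN: "a N = a 0"
    using \<rho>0[OF diffR[of N x]] \<rho>N[OF diffR[of 0 x]] x sN[OF x(1)] s0[OF x(1)] by (simp add: a_def)
  have aR: "a k \<in> Rn n" if "k \<le> N" for k unfolding a_def by (rule \<rho>R[OF _ diffR[OF that x(1)]]) simp
  have "\<rho> 1 (\<lambda>i. \<psi> x i - x0 i) = \<rho> 1 (\<lambda>i. (\<Sum>k<N. a k i) / N)" by (simp add: \<psi>_def a_def)
  also have "\<dots> = (\<lambda>i. (\<Sum>k<N. \<rho> 1 (a k) i) / N)"
    by (rule linear_average[OF \<rho>[OF N1]]) (use aR in auto)
  also have "\<dots> = (\<lambda>i. (\<Sum>k<N. \<rho> 1 (a (Suc k)) i) / N)"
  proof
    fix i
    have "(\<Sum>k<N. \<rho> 1 (a (Suc k)) i) + \<rho> 1 (a 0) i = (\<Sum>k<N. \<rho> 1 (a k) i) + \<rho> 1 (a N) i"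
      using sum.lessThan_Suc_shift[of "\<lambda>k. \<rho> 1 (a k) i" N] sum.lessThan_Suc[of "\<lambda>k. \<rho> 1 (a k) i" N] by simp
    then show "(\<Sum>k<N. \<rho> 1 (a k) i) / N = (\<Sum>k<N. \<rho> 1 (a (Suc k)) i) / N" using aN by simp
  qed
  also have "\<dots> = (\<lambda>i. (\<Sum>k<N. \<rho> (N - k) (\<lambda>i. s k (s 1 x) i - x0 i) i) / N)"
  proof (intro ext arg_cong[where f = "\<lambda>t. t / _"] sum.cong refl)
    fix i k assume "k \<in> {..<N}"
    then have k: "k < N" by simp
    have "\<rho> 1 (a (Suc k)) = \<rho> (1 + (N - Suc k)) (\<lambda>i. s (Suc k) x i - x0 i)"
      unfolding a_def by (rule \<rho>add[symmetric, OF _ diffR[OF _ x(1)]]) (use k in auto)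
    moreover have "1 + (N - Suc k) = N - k" using k by simp
    ultimately show "\<rho> 1 (a (Suc k)) i = \<rho> (N - k) (\<lambda>i. s k (s 1 x) i - x0 i) i"
      using sS[OF k x] by simp
  qed
  also have "\<dots> = (\<lambda>i. \<psi> (s 1 x) i - x0 i)" by (simp add: \<psi>_def)
  finally show ?thesis by simp
qed

text \<open>In the coordinate \<open>\<psi>\<close> the fixed points form the affine space
  \<open>x0 + E\<close>, where \<open>E\<close> consists of the fixed vectors of
  \<open>\<rho> 1\<close>. The map \<open>\<iota>\<close> parametrises it, and \<open>r\<close>
  reads off the parameter. That \<open>r\<close> is smooth on the open set \<open>U\<close> serves
  to show smoothness of maps into the fixed locus.\<close>

lemma fixed_points_submanifold:
  obtains m B U \<iota> r P where "openin (Euclidean_space m) B" "(\<lambda>_. 0) \<in> B" "openin (Euclidean_space n) U" "U \<subseteq> D" "x0 \<in> U"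
    "\<And>y. y \<in> B \<Longrightarrow> \<iota> y \<in> U \<and> s 1 (\<iota> y) = \<iota> y \<and> r (\<iota> y) = y"
    "\<And>x. x \<in> U \<Longrightarrow> s 1 x = x \<Longrightarrow> r x \<in> B \<and> \<iota> (r x) = x"
    "\<And>i. i < n \<Longrightarrow> smooth_fun_on m B (\<lambda>y. \<iota> y i)" "\<And>j. j < m \<Longrightarrow> smooth_fun_on n U (\<lambda>x. r x j)"
    "\<And>x. x \<in> U \<Longrightarrow> r x \<in> Rn m" "\<iota> (\<lambda>_. 0) = x0"
    "\<And>i y. i < n \<Longrightarrow> y \<in> Rn m \<Longrightarrow> (\<Sum>j<m. pdiff j (\<lambda>z. \<iota> z i) (\<lambda>_. 0) * y j) = P y i"
    "bij_betw P (Rn m) {v \<in> Rn n. \<rho> 1 v = v}"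
proof -
  obtain S T G where S: "openin (Euclidean_space n) S" "x0 \<in> S" "S \<subseteq> D" and T: "openin (Euclidean_space n) T"
    and \<psi>G: "\<And>x. x \<in> S \<Longrightarrow> \<psi> x \<in> T \<and> G (\<psi> x) = x" and G\<psi>: "\<And>z. z \<in> T \<Longrightarrow> G z \<in> S \<and> \<psi> (G z) = z"
    and G: "\<And>i. i < n \<Longrightarrow> smooth_fun_on n T (\<lambda>z. G z i)"
    using local_inverse[OF D x0 \<psi>R \<psi>_smooth \<psi>_derivative] by blast
  \<comment> \<open>Both \<open>x\<close> and \<open>s 1 x\<close> must lie where
    \<open>\<psi>\<close> is injective, in order to conclude \<open>s 1 x = x\<close> from an
    equality of their images.\<close>
  define U where "U = {x \<in> S. s 1 x \<in> S}"
  have sm1: "smooth_fun_on n S (\<lambda>x. s 1 x i)" if "i < n" for i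
    by (rule smooth_subset[OF D S(3) s[OF N1 that]])
  have U: "openin (Euclidean_space n) U"
    unfolding U_def by (rule openin_preimage_Rn[OF S(1) S(1) smooth_continuous[OF S(1) sm1]]) (use sR[OF N1] S in auto)
  have US: "U \<subseteq> S" by (auto simp: U_def)
  have x0U: "x0 \<in> U" using S sx0[OF N1] by (simp add: U_def)
  define E where "E = {v \<in> Rn n. \<rho> 1 v = v}"
  have "lin_subspace n E"
    unfolding lin_subspace_def E_def using linear_on_setD[OF \<rho>[OF N1]] linear_zero[OF \<rho>[OF N1] Rn_zero] Rn_lin by auto
  then obtain m P Q where P: "linear_on_set (Rn m) P" and Q: "linear_on_set (Rn n) Q"
    and PQ: "\<And>y. y \<in> Rn m \<Longrightarrow> P y \<in> E \<and> Q (P y) = y" "\<And>x. x \<in> Rn n \<Longrightarrow> Q x \<in> Rn m" "\<And>x. x \<in> E \<Longrightarrow> P (Q x) = x"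
    by (rule subspace_coordinates) blast
  have ER: "E \<subseteq> Rn n" by (auto simp: E_def)
  have P0: "P (\<lambda>_. 0) = (\<lambda>_. 0)" by (rule linear_zero[OF P Rn_zero])
  define c where "c y = (\<lambda>i. x0 i + P y i)" for y
  have cR: "c y \<in> Rn n" if "y \<in> Rn m" for y using PQ(1)[OF that] ER x0R by (auto simp: c_def Rn_iff)
  have c0: "c (\<lambda>_. 0) = x0" by (simp add: c_def P0)
  have RmO: "openin (Euclidean_space m) (Rn m)" by (rule openin_topspace)
  have c_smooth: "smooth_fun_on m (Rn m) (\<lambda>y. c y i)" for i
    unfolding c_def by (intro smooth_add[OF RmO] smooth_const[OF RmO] smooth_linear[OF RmO P] smooth_coord[OF RmO])
  define B0 where "B0 = {y \<in> Rn m. c y \<in> T}"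
  have B0: "openin (Euclidean_space m) B0"
    unfolding B0_def by (rule openin_preimage_Rn[OF RmO T smooth_continuous[OF RmO c_smooth] cR])
  define \<iota> where "\<iota> y = G (c y)" for y
  have c_smooth0: "smooth_fun_on m B0 (\<lambda>y. c y i)" for i
    by (rule smooth_subset[OF RmO _ c_smooth]) (auto simp: B0_def)
  have \<iota>_smooth0: "smooth_fun_on m B0 (\<lambda>y. \<iota> y i)" if "i < n" for i
    unfolding \<iota>_def by (rule smooth_compose[OF B0 T _ c_smooth0 G[OF that]]) (simp add: B0_def)
  have GR: "G z \<in> Rn n" if "z \<in> T" for z using G\<psi>[OF that] open_Rn_subset[OF S(1)] by blast
  define B where "B = {y \<in> B0. \<iota> y \<in> U}"
  have B: "openin (Euclidean_space m) B"
    unfolding B_def by (rule openin_preimage_Rn[OF B0 U smooth_continuous[OF B0 \<iota>_smooth0]]) (auto simp: \<iota>_def B0_def GR)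
  have x0T: "x0 \<in> T" and Gx0: "G x0 = x0" using \<psi>G[OF S(2)] \<psi>_x0 by auto
  have \<iota>0: "\<iota> (\<lambda>_. 0) = x0" by (simp add: \<iota>_def c0 Gx0)
  have B0': "(\<lambda>_. 0) \<in> B" using \<iota>0 x0U x0T c0 by (simp add: B_def B0_def)
  define r where "r x = Q (\<lambda>i. \<psi> x i - x0 i)" for x
  have \<psi>dR: "(\<lambda>i. \<psi> x i - x0 i) \<in> Rn n" if "x \<in> D" for x using \<psi>R[OF that] x0R by (simp add: Rn_iff)
  have equiv: "(\<lambda>i. \<psi> (s 1 x) i - x0 i) = \<rho> 1 (\<lambda>i. \<psi> x i - x0 i)" if "x \<in> U" for x
    by (rule \<psi>_equivariant) (use that S in \<open>auto simp: U_def\<close>)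
  show thesis
  proof (rule that[of m B U \<iota> r P])
    fix y assume y: "y \<in> B"
    then have yR: "y \<in> Rn m" and cT: "c y \<in> T" and \<iota>U: "\<iota> y \<in> U" by (auto simp: B_def B0_def)
    have \<psi>\<iota>: "\<psi> (\<iota> y) = c y" using G\<psi>[OF cT] by (simp add: \<iota>_def)
    have "(\<lambda>i. \<psi> (s 1 (\<iota> y)) i - x0 i) = \<rho> 1 (P y)" using equiv[OF \<iota>U] by (simp add: \<psi>\<iota> c_def)
    also have "\<dots> = P y" using PQ(1)[OF yR] by (simp add: E_def)
    finally have "\<psi> (s 1 (\<iota> y)) = c y" by (auto simp: c_def fun_eq_iff algebra_simps)
    then have "\<psi> (s 1 (\<iota> y)) = \<psi> (\<iota> y)" using \<psi>\<iota> by simp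
    then have "s 1 (\<iota> y) = \<iota> y" using \<psi>G \<iota>U unfolding U_def by (metis (no_types, lifting) mem_Collect_eq)
    moreover have "r (\<iota> y) = y" using PQ(1)[OF yR] by (simp add: r_def \<psi>\<iota> c_def)
    ultimately show "\<iota> y \<in> U \<and> s 1 (\<iota> y) = \<iota> y \<and> r (\<iota> y) = y" using \<iota>U by blast
  next
    fix x assume x: "x \<in> U" "s 1 x = x"
    have xD: "x \<in> D" using x US S by blast
    have "(\<lambda>i. \<psi> x i - x0 i) \<in> E" using equiv[OF x(1)] x(2) \<psi>dR[OF xD] by (simp add: E_def)
    then have "P (r x) = (\<lambda>i. \<psi> x i - x0 i)" using PQ(3) by (simp add: r_def)
    then have "c (r x) = \<psi> x" by (simp add: c_def)
    then show "r x \<in> B \<and> \<iota> (r x) = x"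
      using \<psi>G[of x] x US PQ(2)[OF \<psi>dR[OF xD]] unfolding B_def B0_def \<iota>_def by (auto simp: r_def)
  next
    show "smooth_fun_on m B (\<lambda>y. \<iota> y i)" if "i < n" for i
      by (rule smooth_subset[OF B0 _ \<iota>_smooth0[OF that]]) (auto simp: B_def)
    show "smooth_fun_on n U (\<lambda>x. r x j)" for j
      unfolding r_def
    proof (rule smooth_linear[OF U Q])
      show "(\<lambda>i. \<psi> x i - x0 i) \<in> Rn n" if "x \<in> U" for x using \<psi>dR that US S by blast
      show "smooth_fun_on n U (\<lambda>x. \<psi> x j - x0 j)" if "j < n" for j
        using smooth_subset[OF D _ smooth_add[OF D \<psi>_smooth[OF that] smooth_const[OF D, of "- x0 j"]], of U] US S by auto
    qed
    show "r x \<in> Rn m" if "x \<in> U" for x unfolding r_def using PQ(2) \<psi>dR that US S by blast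
    show "(\<Sum>j<m. pdiff j (\<lambda>z. \<iota> z i) (\<lambda>_. 0) * y j) = P y i" if i: "i < n" and y: "y \<in> Rn m" for i y
    proof -
      \<comment> \<open>\<open>G\<close> inverts \<open>\<psi>\<close>, whose derivative at
        \<open>x0\<close> is the identity.\<close>
      have dG: "pdiff l (\<lambda>z. G z i) x0 = (if i = l then 1 else 0)" if l: "l < n" for l
      proof -
        have "pdiff l (\<lambda>z. \<psi> (G z) i) x0 = (\<Sum>a<n. pdiff a (\<lambda>x. \<psi> x i) (G x0) * pdiff l (\<lambda>z. G z a) x0)"
          by (rule pdiff_compose[OF T D _ smooth_Ck[OF T G] smooth_Ck[OF D \<psi>_smooth[OF i]] x0T l]) (use G\<psi> S in blast)+
        also have "\<dots> = (\<Sum>a<n. (if i = a then 1 else 0) * pdiff l (\<lambda>z. G z a) x0)"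
          using \<psi>_derivative[OF i] unfolding Gx0 by (intro sum.cong) auto
        also have "\<dots> = pdiff l (\<lambda>z. G z i) x0" using i by (simp add: if_distrib[of "\<lambda>c. c * _"] cong: if_cong)
        also have "pdiff l (\<lambda>z. \<psi> (G z) i) x0 = pdiff l (\<lambda>z. z i) x0"
          by (rule pdiff_cong[OF T x0T l]) (use G\<psi> in auto)
        finally show ?thesis by (simp add: pdiff_coord)
      qed
      have dc: "pdiff j (\<lambda>z. c z l) (\<lambda>_. 0) = P (unit_vec j) l" if "j < m" for j l
      proof -
        have "((\<lambda>t. x0 l + P ((\<lambda>_. 0)(j := t)) l) has_real_derivative 0 + P (unit_vec j) l) (at 0)"
        proof (intro DERIV_add DERIV_const)
          have "P ((\<lambda>_. 0)(j := t)) l = P (unit_vec j) l * t" for t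
          proof -
            have "P ((\<lambda>_. 0)(j := t)) l = (\<Sum>a<m. P (unit_vec a) l * (if a = j then t else 0))"
              by (subst linear_matrix[OF P]) (use that in \<open>auto simp: Rn_iff intro!: sum.cong\<close>)
            then show ?thesis using that by (simp add: if_distrib[of "\<lambda>c. _ * c"] cong: if_cong)
          qed
          then show "((\<lambda>t. P ((\<lambda>_. 0)(j := t)) l) has_real_derivative P (unit_vec j) l) (at 0)"
            by (auto intro!: derivative_eq_intros)
        qed
        then show ?thesis using pdiff_eq[where G = "\<lambda>z. c z l" and y = "\<lambda>_. 0" and j = j] unfolding c_def by simp
      qed
      have d\<iota>: "pdiff j (\<lambda>z. \<iota> z i) (\<lambda>_. 0) = P (unit_vec j) i" if j: "j < m" for j
      proof -
        have "pdiff j (\<lambda>z. G (c z) i) (\<lambda>_. 0) = (\<Sum>l<n. pdiff l (\<lambda>z. G z i) (c (\<lambda>_. 0)) * pdiff j (\<lambda>z. c z l) (\<lambda>_. 0))"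
          by (rule pdiff_compose[OF B0 T _ smooth_Ck[OF B0 c_smooth0] smooth_Ck[OF T G[OF i]] _ j])
            (use B0' in \<open>auto simp: B0_def B_def\<close>)
        also have "\<dots> = (\<Sum>l<n. (if i = l then 1 else 0) * P (unit_vec j) l)"
          using dG dc[OF j] unfolding c0 by (intro sum.cong) auto
        also have "\<dots> = P (unit_vec j) i" using i by (simp add: if_distrib[of "\<lambda>c. c * _"] cong: if_cong)
        finally show ?thesis by (simp add: \<iota>_def)
      qed
      show ?thesis unfolding linear_matrix[OF P y] using d\<iota> by (intro sum.cong) auto
    qed
    show "bij_betw P (Rn m) {v \<in> Rn n. \<rho> 1 v = v}"
      unfolding E_def[symmetric] by (rule bij_betw_byWitness[where f' = Q]) (use PQ ER in auto)
  qed (use B B0' U US S x0U \<iota>0 in auto)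
qed

end

section \<open>Isotropy groups and their germs\<close>

lemma dmap_cong:
  assumes M: "is_manifold M" and K: "K \<in> charts M" and W: "openin (mtop M) W" "x \<in> W" "W \<subseteq> cdom K"
    and F: "\<And>y. y \<in> W \<Longrightarrow> F y = G y"
  shows "dmap K L F x v = dmap K L G x v"
proof -
  have o: "openin (Euclidean_space (cdim K)) (cmap K ` W)" by (rule chart_image_open[OF M W(1) K W(3)])
  have "pdiff j (\<lambda>y. cmap L (F (cinv K y)) i) (cmap K x) = pdiff j (\<lambda>y. cmap L (G (cinv K y)) i) (cmap K x)" if "j < cdim K" for i j
    by (rule pdiff_cong[OF o _ that]) (use W cinv_cmap[OF M K] F in \<open>auto simp: subset_iff\<close>)
  then show ?thesis unfolding dmap_def by (intro ext) simp
qed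

lemma dmap_restrict:
  assumes M: "is_manifold M" and K: "K \<in> charts M" "x \<in> cdom K" and S: "openin (mtop M) S" "x \<in> S"
  shows "dmap (chart_restrict K S) L F x v = dmap K L F x v"
proof -
  have oc: "openin (mtop M) (cdom K \<inter> S)" by (rule openin_Int[OF openin_cdom[OF M K(1)] S(1)])
  have o: "openin (Euclidean_space (cdim K)) (cmap K ` (cdom K \<inter> S))" by (rule chart_image_open[OF M oc K(1)]) auto
  have "pdiff j (\<lambda>y. cmap L (F (inv_into (cdom K \<inter> S) (cmap K) y)) i) (cmap K x) = pdiff j (\<lambda>y. cmap L (F (cinv K y)) i) (cmap K x)"
    if "j < cdim K" for i j
    by (rule pdiff_cong[OF o _ that]) (use K S cinv_restrict[OF M K(1), of "cdom K \<inter> S"] in auto)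
  then show ?thesis unfolding dmap_def by (intro ext) simp
qed

context fibred
begin

text \<open>Surjectivity after base change to \<open>p\<close> gives a point \<open>q\<close> of the
  fibre product. It maps to \<open>p\<close> by an invertible arrow, whose inverse turns the
  projection to \<open>a\<close> into a frame at \<open>p\<close>.\<close>

lemma etale_chart_ex:
  assumes et: "representable_with etale_map Y a" and sj: "representable_with surjective Y a" and p: "p \<in> point_objects Y"
  obtains \<theta> K where "etale_chart_at Y p a \<theta> K"
proof -
  obtain c \<alpha> \<beta> where f: "fibre_product Y a p c \<alpha> \<beta>" and s: "surjective (base Y c) (base Y p) (bmap Y \<beta>)"
    using sj point_Obj[OF p] unfolding representable_with_def by blast
  have \<alpha>: "hom \<alpha> c a" and \<beta>: "hom \<beta> c p" using fibre_product_hom[OF f] by auto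
  obtain x where x: "x \<in> pts (base Y c)" using s point_base[OF p] by (force simp: surjective_def)
  obtain q \<gamma> where q: "q \<in> point_objects Y" "hom \<gamma> q c" by (rule point_ex[OF hom_Obj(1)[OF \<alpha>] x])
  obtain k where k: "hom k p q" by (rule point_inverse[OF q(1) p comp_hom[OF q(2) \<beta>]])
  have \<theta>: "hom (\<alpha> \<cdot> \<gamma> \<cdot> k) p a" by (rule comp_hom[OF comp_hom[OF k q(2)] \<alpha>])
  obtain K where "K \<in> charts (base Y a)" "foot Y (\<alpha> \<cdot> \<gamma> \<cdot> k) \<in> cdom K"
    using chart_at[OF hom_manifold(2)[OF \<alpha>] foot_pts[OF p \<theta>]] by blast
  then show thesis using that[of "\<alpha> \<cdot> \<gamma> \<cdot> k" K] p et \<theta> by (simp add: etale_chart_at_def)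
qed

lemma etale_imp_representable_submersion:
  "representable_with etale_map Y a \<Longrightarrow> representable_with submersion Y a"
  unfolding representable_with_def using etale_imp_submersion[OF base_manifold base_manifold] fibre_product_hom hom_Obj by meson

text \<open>Automorphisms correspond injectively to points of \<open>U \<times>\<^sub>X U\<close>
  over \<open>(u, u)\<close>. This fibre is compact by properness, and \<open>\<beta>\<close> is
  constant on it but locally injective, so finitely many open sets cover it, each containing at most
  one of its points.\<close>

lemma finite_Aut:
  assumes pd: "proper_diagonal Y" and A: "etale_chart_at Y p a \<theta> K"
  shows "finite (Aut Y p)"
proof -
  note D = etale_chartD[OF A]
  obtain c \<alpha> \<beta> where f: "fibre_product Y a a c \<alpha> \<beta>" and et: "etale_map (base Y c) (base Y a) (bmap Y \<beta>)"
    using etale_fibre_product[OF D(2) hom_Obj(2)[OF D(3)]] by blast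
  have \<alpha>: "hom \<alpha> c a" and \<beta>: "hom \<beta> c a" using fibre_product_hom[OF f] by auto
  define u where "u = foot Y \<theta>"
  define C where "C = {x \<in> pts (base Y c). bmap Y \<alpha> x = u \<and> bmap Y \<beta> x = u}"
  have u: "u \<in> pts (base Y a)" unfolding u_def by (rule foot_pts[OF D(1,3)])
  have "proper_map (mtop (base Y c)) (prod_topology (mtop (base Y a)) (mtop (base Y a))) (\<lambda>x. (bmap Y \<alpha> x, bmap Y \<beta> x))"
    using pd f etale_imp_representable_submersion[OF D(2)] unfolding proper_diagonal_def by blast
  moreover have "(u, u) \<in> topspace (prod_topology (mtop (base Y a)) (mtop (base Y a)))"
    using u topspace_mtop[OF hom_manifold(2)[OF \<alpha>]] by simp
  ultimately have "compactin (mtop (base Y c)) {x \<in> topspace (mtop (base Y c)). (bmap Y \<alpha> x, bmap Y \<beta> x) = (u, u)}"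
    unfolding proper_map_def by blast
  then have comp: "compactin (mtop (base Y c)) C"
    unfolding C_def using topspace_mtop[OF hom_manifold(1)[OF \<alpha>]] by simp
  define \<S> where "\<S> = {S. openin (mtop (base Y c)) S \<and> inj_on (bmap Y \<beta>) S}"
  have "C \<subseteq> \<Union>\<S>" using etale_locally_inj[OF et] unfolding \<S>_def C_def by blast
  then obtain \<F> where \<F>: "finite \<F>" "\<F> \<subseteq> \<S>" "C \<subseteq> \<Union>\<F>"
    using comp unfolding compactin_def \<S>_def by (metis (no_types, lifting) mem_Collect_eq)
  have "finite (S \<inter> C)" if "S \<in> \<F>" for S
  proof (rule finite_imageD[of "bmap Y \<beta>"])
    show "finite (bmap Y \<beta> ` (S \<inter> C))" by (rule finite_subset[of _ "{u}"]) (auto simp: C_def)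
    show "inj_on (bmap Y \<beta>) (S \<inter> C)" using \<F>(2) that by (auto simp: \<S>_def intro: inj_on_subset)
  qed
  then have "finite (\<Union>S\<in>\<F>. S \<inter> C)" using \<F>(1) by blast
  moreover have "C \<subseteq> (\<Union>S\<in>\<F>. S \<inter> C)" using \<F>(3) by blast
  ultimately have finC: "finite C" by (rule finite_subset[rotated])
  have "\<exists>\<gamma>. hom \<gamma> p c \<and> \<alpha> \<cdot> \<gamma> = \<theta> \<and> \<beta> \<cdot> \<gamma> = \<theta> \<cdot> h" if "h \<in> Aut Y p" for h
    using fibre_product_lift[OF f D(3) comp_hom[OF Aut_hom[OF that] D(3)]] by metis
  then obtain \<gamma> where \<gamma>: "\<And>h. h \<in> Aut Y p \<Longrightarrow> hom (\<gamma> h) p c" "\<And>h. h \<in> Aut Y p \<Longrightarrow> \<alpha> \<cdot> \<gamma> h = \<theta>"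
    "\<And>h. h \<in> Aut Y p \<Longrightarrow> \<beta> \<cdot> \<gamma> h = \<theta> \<cdot> h" by metis
  show ?thesis
  proof (rule inj_on_finite[OF _ _ finC, of "\<lambda>h. foot Y (\<gamma> h)"])
    show "inj_on (\<lambda>h. foot Y (\<gamma> h)) (Aut Y p)"
    proof (rule inj_onI)
      fix h k assume h: "h \<in> Aut Y p" and k: "k \<in> Aut Y p" and e: "foot Y (\<gamma> h) = foot Y (\<gamma> k)"
      have "\<gamma> h = \<gamma> k" by (rule point_arrow_eq[OF D(1) \<gamma>(1)[OF h] \<gamma>(1)[OF k] e \<alpha>]) (simp add: \<gamma> h k)
      then have "\<theta> \<cdot> h = \<theta> \<cdot> k" using \<gamma>(3)[OF h] \<gamma>(3)[OF k] by simp
      then show "h = k"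
        using cartesian_cancel[OF D(3) Aut_hom[OF h] Aut_hom[OF k]] h k by (simp add: Aut_def)
    qed
    show "(\<lambda>h. foot Y (\<gamma> h)) ` Aut Y p \<subseteq> C"
    proof
      fix x assume "x \<in> (\<lambda>h. foot Y (\<gamma> h)) ` Aut Y p"
      then obtain h where h: "h \<in> Aut Y p" "x = foot Y (\<gamma> h)" by blast
      show "x \<in> C"
        using foot_pts[OF D(1) \<gamma>(1)[OF h(1)]] foot_comp[OF D(1) \<gamma>(1)[OF h(1)] \<alpha>] foot_comp[OF D(1) \<gamma>(1)[OF h(1)] \<beta>]
          \<gamma>(2,3)[OF h(1)] foot_precomp[OF D(1,1) Aut_hom[OF h(1)] D(3)]
        by (simp add: C_def h(2) u_def)
    qed
  qed
qed

section \<open>Powers of an automorphism\<close>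

abbreviation gpow :: "'o \<Rightarrow> 'm \<Rightarrow> nat \<Rightarrow> 'm"
  where "gpow p g k \<equiv> (cmp Y g ^^ k) (idn Y p)"

lemma gpow_hom: "hom g p p \<Longrightarrow> hom (gpow p g k) p p"
  by (induction k) (auto intro: comp_hom idn_hom hom_Obj)

lemma gpow_add: "hom g p p \<Longrightarrow> gpow p g (k + l) = gpow p g k \<cdot> gpow p g l"
  by (induction k) (auto simp: idn_comp[OF gpow_hom] assoc[OF gpow_hom gpow_hom])

lemma gpow_1: "hom g p p \<Longrightarrow> gpow p g 1 = g"
  by (simp add: comp_idn)

text \<open>By the pigeonhole principle two powers agree, and the smaller one cancels on the
  left.\<close>

lemma finite_order:
  assumes p: "p \<in> point_objects Y" and fin: "finite (Aut Y p)" and g: "hom g p p"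
  obtains N where "0 < N" "gpow p g N = idn Y p"
proof -
  have "range (gpow p g) \<subseteq> Aut Y p" using gpow_hom[OF g] Aut_iff[OF p] by blast
  then have "finite (range (gpow p g))" using fin finite_subset by blast
  then have "\<not> inj (gpow p g)" using finite_imageD[of "gpow p g" UNIV] infinite_UNIV_nat by blast
  then obtain i j where ij: "i < j" "gpow p g i = gpow p g j"
    unfolding inj_on_def by (metis linorder_neqE_nat)
  define N where "N = j - i"
  have e: "gpow p g i \<cdot> gpow p g N = gpow p g i \<cdot> idn Y p"
    using ij gpow_add[OF g, of i N] comp_idn[OF gpow_hom[OF g]] by (simp add: N_def)
  have "gpow p g N = idn Y p"
    by (rule cartesian_cancel[OF gpow_hom[OF g] gpow_hom[OF g] idn_hom[OF point_Obj[OF p]] _ e])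
      (simp add: point_bmap[OF p p gpow_hom[OF g]] point_bmap[OF p p idn_hom[OF point_Obj[OF p]]])
  then show thesis using that[of N] ij by (simp add: N_def)
qed

lemma tangent_action_gpow_add:
  "etale_chart_at Y p a \<theta> K \<Longrightarrow> hom g p p \<Longrightarrow> v \<in> Rn (cdim K) \<Longrightarrow>
    tangent_action Y a \<theta> K (gpow p g (k + l)) v = tangent_action Y a \<theta> K (gpow p g k) (tangent_action Y a \<theta> K (gpow p g l) v)"
  unfolding gpow_add by (rule tangent_action_comp) (auto intro: gpow_hom)

end

text \<open>Near the foot \<open>u\<close> of \<open>\<theta>\<close> the automorphism \<open>g\<close> extends to a local section \<open>t\<close> of the etale source map
  \<open>\<beta>\<close> of the groupoid \<open>r\<close>, and so acts on a neighbourhood \<open>V\<close> of \<open>u\<close> by \<open>\<sigma>\<close>, the target map after the section.\<close>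

locale isotropy_germ = fibred Y for Y :: "('o, 'm) fibcat" +
  fixes p b :: 'o and \<theta> :: 'm and K :: chart and g :: 'm and N :: nat
    and r :: 'o and \<alpha> \<beta> \<gamma> :: 'm and S V :: "point set" and e :: 'o and i t :: 'm
  assumes A: "etale_chart_at Y p b \<theta> K" and g: "hom g p p" and N: "0 < N" "gpow p g N = idn Y p"
    and f: "fibre_product Y b b r \<alpha> \<beta>" and et: "etale_map (base Y r) (base Y b) (bmap Y \<beta>)"
    and S: "openin (mtop (base Y r)) S" "inj_on (bmap Y \<beta>) S" and V: "openin (mtop (base Y b)) V"
    and \<gamma>: "hom \<gamma> p r" "\<alpha> \<cdot> \<gamma> = \<theta> \<cdot> g" "\<beta> \<cdot> \<gamma> = \<theta>" "foot Y \<gamma> \<in> S"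
    and i: "hom i e b" "base Y e = open_sub (base Y b) V" "bmap Y i = incl V"
    and t: "hom t e r" "\<beta> \<cdot> t = i" "\<And>x. x \<in> V \<Longrightarrow> bmap Y t x \<in> S" and SV: "bmap Y \<beta> ` S \<subseteq> V"

text \<open>An etale map has smooth local inverses. The one of \<open>\<beta>\<close> through the
  foot of \<open>\<gamma>\<close> is a map of manifolds; the cartesian property lifts it to an arrow
  \<open>t\<close> of the category.\<close>

lemma (in fibred) isotropy_germ_ex:
  assumes A: "etale_chart_at Y p b \<theta> K" and g: "hom g p p" and N: "0 < N" "gpow p g N = idn Y p"
  obtains r \<alpha> \<beta> \<gamma> S V e i t where "isotropy_germ Y p b \<theta> K g N r \<alpha> \<beta> \<gamma> S V e i t"
proof -
  note D = etale_chartD[OF A]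
  have b: "b \<in> Obj Y" by (rule hom_Obj(2)[OF D(3)])
  obtain r \<alpha> \<beta> where f: "fibre_product Y b b r \<alpha> \<beta>" and et: "etale_map (base Y r) (base Y b) (bmap Y \<beta>)"
    using etale_fibre_product[OF D(2) b] by blast
  have \<alpha>: "hom \<alpha> r b" and \<beta>: "hom \<beta> r b" using fibre_product_hom[OF f] by auto
  note mr = hom_manifold(1)[OF \<beta>] and mb = hom_manifold(2)[OF \<beta>]
  \<comment> \<open>The legs exchange roles in comparison with \<open>tangent_action\<close>: here
    \<open>\<beta>\<close> is the source, because representability makes the second projection
    etale.\<close>
  obtain \<gamma> where \<gamma>: "hom \<gamma> p r" "\<alpha> \<cdot> \<gamma> = \<theta> \<cdot> g" "\<beta> \<cdot> \<gamma> = \<theta>"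
    by (rule fibre_product_lift[OF f comp_hom[OF g D(3)] D(3)])
  obtain S where S: "foot Y \<gamma> \<in> S" "openin (mtop (base Y r)) S" "openin (mtop (base Y b)) (bmap Y \<beta> ` S)" "inj_on (bmap Y \<beta>) S"
    and I: "smooth_map (open_sub (base Y b) (bmap Y \<beta> ` S)) (open_sub (base Y r) S) (restrict (inv_into S (bmap Y \<beta>)) (bmap Y \<beta> ` S))"
    using et foot_pts[OF D(1) \<gamma>(1)] unfolding etale_map_def by blast
  define V where "V = bmap Y \<beta> ` S"
  have V: "openin (mtop (base Y b)) V" using S(3) by (simp add: V_def)
  note mV = is_manifold_open_sub[OF mb V]
  define \<tau> where "\<tau> = compose V (incl S) (restrict (inv_into S (bmap Y \<beta>)) V)"
  have \<tau>: "smooth_map (open_sub (base Y b) V) (base Y r) \<tau>"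
    using smooth_map_compose[OF mV is_manifold_open_sub[OF mr S(2)] mr I[folded V_def] smooth_map_incl[OF mr S(2)]]
    by (simp add: \<tau>_def)
  have \<tau>S: "\<tau> x \<in> S \<and> bmap Y \<beta> (\<tau> x) = x" if "x \<in> V" for x
    using that inv_into_into[of x "bmap Y \<beta>" S] f_inv_into_f[of x "bmap Y \<beta>" S] by (simp add: \<tau>_def compose_def incl_def V_def)
  obtain e i where i: "hom i e b" "base Y e = open_sub (base Y b) V" "bmap Y i = incl V"
    using pullback_ex[OF b mV smooth_map_incl[OF mb V]] by blast
  obtain t where t: "hom t e r" "bmap Y t = \<tau>" "\<beta> \<cdot> t = i"
    by (rule lift_ex[OF \<beta> i(1) \<tau>[folded i(2)]]) (use \<tau>S in \<open>simp add: i incl_def\<close>)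
  have "isotropy_germ Y p b \<theta> K g N r \<alpha> \<beta> \<gamma> S V e i t"
    by unfold_locales (use A g N f et S V \<gamma> i t \<tau>S in \<open>auto simp: V_def\<close>)
  then show thesis by (rule that)
qed

context isotropy_germ
begin

lemmas D = etale_chartD[OF A]

lemma \<alpha>: "hom \<alpha> r b" and \<beta>: "hom \<beta> r b"
  using fibre_product_hom[OF f] by auto

lemma mb: "is_manifold (base Y b)" and mr: "is_manifold (base Y r)"
  using hom_manifold[OF \<alpha>] by auto

definition \<sigma> :: "point \<Rightarrow> point" where "\<sigma> = bmap Y (\<alpha> \<cdot> t)"

abbreviation "u \<equiv> foot Y \<theta>"

lemma \<beta>_t: "x \<in> V \<Longrightarrow> bmap Y \<beta> (bmap Y t x) = x"
  using bmap_comp_apply[OF t(1) \<beta>, of x] t(2) i by (simp add: incl_def)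

lemma t_\<beta>: "y \<in> S \<Longrightarrow> bmap Y t (bmap Y \<beta> y) = y"
  using \<beta>_t[of "bmap Y \<beta> y"] t(3)[of "bmap Y \<beta> y"] S(2) SV by (auto simp: inj_on_def)

lemma \<sigma>_eq: "x \<in> V \<Longrightarrow> \<sigma> x = bmap Y \<alpha> (bmap Y t x)"
  unfolding \<sigma>_def by (rule bmap_comp_apply[OF t(1) \<alpha>]) (simp add: i)

lemma foot_\<gamma>: "bmap Y \<beta> (foot Y \<gamma>) = u"
  using foot_comp[OF D(1) \<gamma>(1) \<beta>] \<gamma>(3) by simp

lemma u_V: "u \<in> V" using foot_\<gamma> \<gamma>(4) SV by auto

lemma foot_g: "hom h p p \<Longrightarrow> foot Y (\<theta> \<cdot> h) = u"
  by (rule foot_precomp[OF D(1,1) _ D(3)])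

text \<open>Ties the germ to \<open>g\<close>: the lift \<open>\<theta>0\<close> of the frame
  \<open>\<theta>\<close> to the domain of the section is carried by \<open>t\<close> to
  \<open>\<gamma>\<close>, and so by \<open>\<alpha> \<cdot> t\<close> to
  \<open>\<theta> \<cdot> g\<close>.\<close>

lemma base_point:
  obtains \<theta>0 where "hom \<theta>0 p e" "i \<cdot> \<theta>0 = \<theta>" "foot Y \<theta>0 = u" "t \<cdot> \<theta>0 = \<gamma>" "(\<alpha> \<cdot> t) \<cdot> \<theta>0 = \<theta> \<cdot> g"
proof -
  obtain \<theta>0 where \<theta>0: "hom \<theta>0 p e" "i \<cdot> \<theta>0 = \<theta>" "foot Y \<theta>0 = u"
    by (rule point_lift[OF D(1) i(1) D(3), of u]) (use u_V in \<open>auto simp: i incl_def\<close>)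
  have "t \<cdot> \<theta>0 = \<gamma>"
  proof (rule point_arrow_eq[OF D(1) comp_hom[OF \<theta>0(1) t(1)] \<gamma>(1) _ \<beta>])
    show "foot Y (t \<cdot> \<theta>0) = foot Y \<gamma>"
      using foot_comp[OF D(1) \<theta>0(1) t(1)] \<theta>0(3) t_\<beta>[OF \<gamma>(4)] foot_\<gamma> by simp
    show "\<beta> \<cdot> t \<cdot> \<theta>0 = \<beta> \<cdot> \<gamma>" using assoc[OF \<theta>0(1) t(1) \<beta>] t(2) \<theta>0(2) \<gamma>(3) by simp
  qed
  then show thesis using that \<theta>0 assoc[OF \<theta>0(1) t(1) \<alpha>] \<gamma>(2) by simp
qed

text \<open>A span over a neighbourhood \<open>W\<close> of \<open>u\<close>, whose legs cover the
  inclusion and the iterate \<open>\<sigma> ^^ k\<close>, with a frame \<open>c\<close> that both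
  legs carry to frames at \<open>p\<close> differing by the power of \<open>g\<close>. It keeps the
  iterate a germ of arrows of the category, not merely of maps.\<close>

definition iterate_data where
  "iterate_data k W e' j n c \<longleftrightarrow> openin (mtop (base Y b)) W \<and> u \<in> W \<and> hom j e' b \<and>
    base Y e' = open_sub (base Y b) W \<and> bmap Y j = incl W \<and> hom n e' b \<and> hom c p e' \<and>
    j \<cdot> c = \<theta> \<and> n \<cdot> c = \<theta> \<cdot> gpow p g k \<and> foot Y c = u \<and>
    (\<forall>x\<in>W. bmap Y n x = (\<sigma> ^^ k) x \<and> (\<forall>l<k. (\<sigma> ^^ l) x \<in> V))"

text \<open>The span for \<open>k\<close> is restricted to the points that land in \<open>V\<close>;
  its second leg then lifts through the inclusion \<open>i\<close> and is followed by
  \<open>\<alpha> \<cdot> t\<close>. The lifted frame is \<open>\<theta>0\<close> times the power of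
  \<open>g\<close>, because the two agree after \<open>i\<close>.\<close>

lemma iterate_ex: "\<exists>W e' j n c. iterate_data k W e' j n c"
proof (induction k)
  case 0
  obtain \<theta>0 where \<theta>0: "hom \<theta>0 p e" "i \<cdot> \<theta>0 = \<theta>" "foot Y \<theta>0 = u" by (rule base_point)
  have "iterate_data 0 V e i i \<theta>0"
    unfolding iterate_data_def using V u_V i \<theta>0 comp_idn[OF D(3)] by (simp add: incl_def)
  then show ?case by blast
next
  case (Suc k)
  obtain \<theta>0 where \<theta>0: "hom \<theta>0 p e" "i \<cdot> \<theta>0 = \<theta>" "foot Y \<theta>0 = u" "(\<alpha> \<cdot> t) \<cdot> \<theta>0 = \<theta> \<cdot> g" by (rule base_point)
  from Suc obtain W e' j n c where W: "openin (mtop (base Y b)) W" "u \<in> W" and j: "hom j e' b" "base Y e' = open_sub (base Y b) W" "bmap Y j = incl W"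
    and n: "hom n e' b" and c: "hom c p e'" "j \<cdot> c = \<theta>" "n \<cdot> c = \<theta> \<cdot> gpow p g k" "foot Y c = u"
    and nx: "\<And>x. x \<in> W \<Longrightarrow> bmap Y n x = (\<sigma> ^^ k) x \<and> (\<forall>l<k. (\<sigma> ^^ l) x \<in> V)"
    unfolding iterate_data_def by blast
  note gk = gpow_hom[OF g, of k]
  define W' where "W' = {x \<in> pts (base Y e'). bmap Y n x \<in> V}"
  note me' = hom_manifold(1)[OF n]
  have oW': "openin (mtop (base Y e')) W'" unfolding W'_def by (rule smooth_map_preimage_open[OF me' bmap_smooth[OF n] V])
  have W'W: "W' \<subseteq> W" by (auto simp: W'_def j)
  have oW'b: "openin (mtop (base Y b)) W'" using oW' openin_open_sub[OF mb W(1)] by (simp add: j)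
  have nu: "bmap Y n u = u" using foot_comp[OF D(1) c(1) n] c foot_g[OF gk] by simp
  have uW': "u \<in> W'" using W(2) nu u_V by (simp add: W'_def j)
  obtain e'' k' where k': "hom k' e'' e'" "base Y e'' = open_sub (base Y e') W'" "bmap Y k' = incl W'"
    using pullback_ex[OF hom_Obj(1)[OF n] is_manifold_open_sub[OF me' oW'] smooth_map_incl[OF me' oW']] by blast
  have be'': "base Y e'' = open_sub (base Y b) W'" using k'(2) j(2) open_sub_open_sub[OF W'W] by simp
  have nk: "hom (n \<cdot> k') e'' b" by (rule comp_hom[OF k'(1) n])
  have nkx: "bmap Y (n \<cdot> k') x = bmap Y n x" if "x \<in> W'" for x
    using bmap_comp_apply[OF k'(1) n, of x] that k' by (simp add: incl_def)
  have "smooth_map (base Y e'') (base Y e) (bmap Y (n \<cdot> k'))"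
    unfolding i(2) by (rule smooth_map_into_open[OF mb V hom_manifold(1)[OF nk] bmap_smooth[OF nk]])
      (use nkx in \<open>auto simp: be'' W'_def\<close>)
  then obtain l where l: "hom l e'' e" "bmap Y l = bmap Y (n \<cdot> k')" "i \<cdot> l = n \<cdot> k'"
    by (rule lift_ex[OF i(1) nk]) (use nkx in \<open>auto simp: be'' i incl_def W'_def\<close>)
  obtain c' where c': "hom c' p e''" "k' \<cdot> c' = c" "foot Y c' = u"
    by (rule point_lift[OF D(1) k'(1) c(1), of u]) (use uW' c in \<open>auto simp: be'' k' incl_def\<close>)
  have lc: "l \<cdot> c' = \<theta>0 \<cdot> gpow p g k"
  proof (rule point_arrow_eq[OF D(1) comp_hom[OF c'(1) l(1)] comp_hom[OF gk \<theta>0(1)] _ i(1)])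
    show "foot Y (l \<cdot> c') = foot Y (\<theta>0 \<cdot> gpow p g k)"
      using foot_comp[OF D(1) c'(1) l(1)] c'(3) l(2) nkx[OF uW'] nu foot_precomp[OF D(1,1) gk \<theta>0(1)] \<theta>0(3) by simp
    show "i \<cdot> l \<cdot> c' = i \<cdot> \<theta>0 \<cdot> gpow p g k"
      using assoc[OF c'(1) l(1) i(1)] l(3) assoc[OF c'(1) k'(1) n] c'(2) c(3) assoc[OF gk \<theta>0(1) i(1)] \<theta>0(2) by simp
  qed
  have at: "hom (\<alpha> \<cdot> t) e b" by (rule comp_hom[OF t(1) \<alpha>])
  have "((\<alpha> \<cdot> t) \<cdot> l) \<cdot> c' = \<theta> \<cdot> gpow p g (Suc k)"
    using assoc[OF c'(1) l(1) at] lc assoc[OF gk \<theta>0(1) at] \<theta>0(4) assoc[OF gk g D(3)] by simp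
  moreover have "(j \<cdot> k') \<cdot> c' = \<theta>" using assoc[OF c'(1) k'(1) j(1)] c'(2) c(2) by simp
  moreover have "bmap Y (j \<cdot> k') = incl W'"
  proof (rule extensionalityI[OF bmap_ext[OF comp_hom[OF k'(1) j(1)]]])
    show "incl W' \<in> extensional (pts (base Y e''))" by (simp add: be'' incl_def)
    show "bmap Y (j \<cdot> k') x = incl W' x" if "x \<in> pts (base Y e'')" for x
      using that bmap_comp_apply[OF k'(1) j(1) that] W'W by (auto simp: be'' k' j incl_def)
  qed
  moreover have "\<forall>x\<in>W'. bmap Y ((\<alpha> \<cdot> t) \<cdot> l) x = (\<sigma> ^^ Suc k) x \<and> (\<forall>l<Suc k. (\<sigma> ^^ l) x \<in> V)"
  proof
    fix x assume x: "x \<in> W'"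
    have "bmap Y ((\<alpha> \<cdot> t) \<cdot> l) x = \<sigma> (bmap Y l x)"
      unfolding \<sigma>_def by (rule bmap_comp_apply[OF l(1) at]) (use x be'' in simp)
    moreover have "bmap Y l x = (\<sigma> ^^ k) x" using l(2) nkx[OF x] nx x W'W by auto
    moreover have "(\<sigma> ^^ k) x \<in> V" using nx x W'W by (auto simp: W'_def)
    ultimately show "bmap Y ((\<alpha> \<cdot> t) \<cdot> l) x = (\<sigma> ^^ Suc k) x \<and> (\<forall>l<Suc k. (\<sigma> ^^ l) x \<in> V)"
      using nx x W'W by (auto simp: less_Suc_eq)
  qed
  ultimately have "iterate_data (Suc k) W' e'' (j \<cdot> k') ((\<alpha> \<cdot> t) \<cdot> l) c'"
    unfolding iterate_data_def using oW'b uW' be'' comp_hom[OF k'(1) j(1)] comp_hom[OF l(1) at] c' by blast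
  then show ?case by blast
qed

text \<open>The graph of \<open>\<sigma>\<^sup>N\<close> and the unit section are two sections of \<open>\<beta>\<close> through the same point of \<open>r\<close>.\<close>

lemma iterate_N: "\<exists>W. openin (mtop (base Y b)) W \<and> u \<in> W \<and> (\<forall>x\<in>W. (\<sigma> ^^ N) x = x)"
proof -
  obtain W e' j n c where W: "openin (mtop (base Y b)) W" "u \<in> W" and j: "hom j e' b" "base Y e' = open_sub (base Y b) W" "bmap Y j = incl W"
    and n: "hom n e' b" and c: "hom c p e'" "j \<cdot> c = \<theta>" "n \<cdot> c = \<theta> \<cdot> gpow p g N" "foot Y c = u"
    and nx: "\<And>x. x \<in> W \<Longrightarrow> bmap Y n x = (\<sigma> ^^ N) x"
    using iterate_ex[of N] unfolding iterate_data_def by blast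
  have nc: "n \<cdot> c = \<theta>" using c(3) N(2) comp_idn[OF D(3)] by simp
  obtain k1 where k1: "hom k1 e' r" "\<alpha> \<cdot> k1 = n" "\<beta> \<cdot> k1 = j" by (rule fibre_product_lift[OF f n j(1)])
  obtain k2 where k2: "hom k2 e' r" "\<alpha> \<cdot> k2 = j" "\<beta> \<cdot> k2 = j" by (rule fibre_product_lift[OF f j(1) j(1)])
  have "k1 \<cdot> c = k2 \<cdot> c"
    by (rule fibre_product_unique[OF f comp_hom[OF c(1) k1(1)] comp_hom[OF c(1) k2(1)]])
      (use assoc[OF c(1) k1(1) \<alpha>] assoc[OF c(1) k1(1) \<beta>] assoc[OF c(1) k2(1) \<alpha>] assoc[OF c(1) k2(1) \<beta>] k1 k2 nc c(2) in auto)
  then have k12: "bmap Y k1 u = bmap Y k2 u"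
    using foot_comp[OF D(1) c(1) k1(1)] foot_comp[OF D(1) c(1) k2(1)] c(4) by simp
  have "bmap Y k1 u \<in> pts (base Y r)" by (rule bmap_pts[OF k1(1)]) (simp add: j W)
  then obtain S2 where S2: "openin (mtop (base Y r)) S2" "bmap Y k1 u \<in> S2" "inj_on (bmap Y \<beta>) S2"
    by (rule etale_locally_inj[OF et])
  note me' = hom_manifold(1)[OF n]
  define W2 where "W2 = {x \<in> pts (base Y e'). bmap Y k1 x \<in> S2} \<inter> {x \<in> pts (base Y e'). bmap Y k2 x \<in> S2}"
  have "openin (mtop (base Y e')) W2"
    unfolding W2_def by (intro openin_Int smooth_map_preimage_open[OF me' bmap_smooth S2(1)] k1(1) k2(1))
  then have "openin (mtop (base Y b)) W2" using openin_open_sub[OF mb W(1)] by (simp add: j)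
  moreover have "u \<in> W2" using W(2) S2(2) k12 by (simp add: W2_def j)
  moreover have "(\<sigma> ^^ N) x = x" if x: "x \<in> W2" for x
  proof -
    have xW: "x \<in> W" and xe: "x \<in> pts (base Y e')" using x by (auto simp: W2_def j)
    have "bmap Y \<beta> (bmap Y k1 x) = bmap Y \<beta> (bmap Y k2 x)"
      using bmap_comp_apply[OF k1(1) \<beta> xe] bmap_comp_apply[OF k2(1) \<beta> xe] k1(3) k2(3) by simp
    then have "bmap Y k1 x = bmap Y k2 x" using S2(3) x by (auto simp: W2_def inj_on_def)
    then have "bmap Y n x = bmap Y j x"
      using bmap_comp_apply[OF k1(1) \<alpha> xe] bmap_comp_apply[OF k2(1) \<alpha> xe] k1(2) k2(2) by simp
    then show ?thesis using nx[OF xW] xW by (simp add: j incl_def)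
  qed
  ultimately show ?thesis by blast
qed

text \<open>The conditions that \<open>finite_order_germ\<close> imposes on the iterate
  \<open>k\<close>, expressed on the manifold.\<close>

definition good_nbhd where
  "good_nbhd k W \<longleftrightarrow> openin (mtop (base Y b)) W \<and> u \<in> W \<and> W \<subseteq> cdom K \<and> (\<forall>x\<in>W. (\<sigma> ^^ k) x \<in> cdom K) \<and>
    (\<forall>l<cdim K. smooth_fun_on (cdim K) (cmap K ` W) (\<lambda>y. cmap K ((\<sigma> ^^ k) (cinv K y)) l)) \<and>
    (\<forall>v\<in>Rn (cdim K). dmap K K (\<sigma> ^^ k) u v = tangent_action Y b \<theta> K (gpow p g k) v) \<and> (\<sigma> ^^ k) u = u"

text \<open>The span of \<open>iterate_data\<close> computes the transition from
  \<open>\<theta>\<close> to \<open>\<theta> \<cdot> gpow p g k\<close>, which is the tangent action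
  of the power. Its first leg is an inclusion, so the derivative of the second leg alone is this
  action.\<close>

lemma good_nbhd_ex: "\<exists>W. good_nbhd k W"
proof -
  obtain W e' j n c where W: "openin (mtop (base Y b)) W" "u \<in> W" and j: "hom j e' b" "base Y e' = open_sub (base Y b) W" "bmap Y j = incl W"
    and n: "hom n e' b" and c: "hom c p e'" "j \<cdot> c = \<theta>" "n \<cdot> c = \<theta> \<cdot> gpow p g k" "foot Y c = u"
    and nx: "\<And>x. x \<in> W \<Longrightarrow> bmap Y n x = (\<sigma> ^^ k) x"
    using iterate_ex[of k] unfolding iterate_data_def by blast
  note gk = gpow_hom[OF g, of k]
  note me' = hom_manifold(1)[OF n]
  define K' where "K' = chart_restrict K W"
  have K': "K' \<in> charts (base Y e')" "u \<in> cdom K'" using D(4,5) W(2) by (auto simp: K'_def j)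
  have nu: "bmap Y n u = u" using foot_comp[OF D(1) c(1) n] c foot_g[OF gk] by simp
  obtain W1 where W1: "openin (mtop (base Y e')) W1" "u \<in> W1" "W1 \<subseteq> cdom K'" "bmap Y n ` W1 \<subseteq> cdom K"
    using smooth_map_nbhd[OF me' mb bmap_smooth[OF n] K' openin_cdom[OF mb D(4)]] nu D(5) by metis
  have oW1: "openin (mtop (base Y b)) W1" using W1(1) openin_open_sub[OF mb W(1)] by (simp add: j)
  have W1K: "W1 \<subseteq> cdom K \<inter> W" using W1(3) by (simp add: K'_def)
  have o: "openin (Euclidean_space (cdim K)) (cmap K ` W1)" by (rule chart_image_open[OF mb oW1 D(4)]) (use W1K in auto)
  have nx1: "bmap Y n x = (\<sigma> ^^ k) x" if "x \<in> W1" for x using nx that W1K by blast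
  have "smooth_fun_on (cdim K) (cmap K ` W1) (\<lambda>y. cmap K ((\<sigma> ^^ k) (cinv K y)) l)" if l: "l < cdim K" for l
  proof -
    have "smooth_fun_on (cdim K') (cmap K' ` W1) (\<lambda>y. cmap K (bmap Y n (cinv K' y)) l)"
      by (rule smooth_map_coord[OF me' mb bmap_smooth[OF n] K'(1) D(4) W1(3,4) l])
    then have "smooth_fun_on (cdim K) (cmap K ` W1) (\<lambda>y. cmap K (bmap Y n (inv_into (cdom K \<inter> W) (cmap K) y)) l)"
      by (simp add: K'_def)
    then show ?thesis
    proof (rule smooth_cong[OF o, THEN iffD1, rotated])
      fix y assume y: "y \<in> cmap K ` W1"
      then obtain x where x: "x \<in> W1" "y = cmap K x" by blast
      have "inv_into (cdom K \<inter> W) (cmap K) y = cinv K y" by (rule cinv_restrict[OF mb D(4)]) (use y W1K in auto)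
      moreover have "cinv K y = x" using x W1K cinv_cmap[OF mb D(4)] by auto
      ultimately show "cmap K (bmap Y n (inv_into (cdom K \<inter> W) (cmap K) y)) l = cmap K ((\<sigma> ^^ k) (cinv K y)) l"
        using nx1[OF x(1)] by simp
    qed
  qed
  moreover have "dmap K K (\<sigma> ^^ k) u v = tangent_action Y b \<theta> K (gpow p g k) v" if v: "v \<in> Rn (cdim K)" for v
  proof -
    have A': "etale_chart_at Y p b (\<theta> \<cdot> gpow p g k) K" by (rule etale_chart_precomp[OF A D(1) gk])
    have "transition p b \<theta> K b (\<theta> \<cdot> gpow p g k) K (dmap K' K (bmap Y j) (foot Y c) v) = dmap K' K (bmap Y n) (foot Y c) v"
      by (rule transition_span[OF A A' j(1) n c(1-3) K'(1)]) (use K' c(4) v in \<open>auto simp: K'_def\<close>)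
    moreover have "dmap K' K (bmap Y j) u v = v"
    proof -
      have "dmap K' K (bmap Y j) u v = dmap K K (bmap Y j) u v"
        unfolding K'_def by (rule dmap_restrict[OF mb D(4,5) W])
      also have "\<dots> = v"
        by (rule dmap_ident[OF mb D(4) oW1 W1(2) _ _ v]) (use W1K in \<open>auto simp: j incl_def\<close>)
      finally show ?thesis .
    qed
    moreover have "dmap K' K (bmap Y n) u v = dmap K K (\<sigma> ^^ k) u v"
    proof -
      have "dmap K' K (bmap Y n) u v = dmap K K (bmap Y n) u v"
        unfolding K'_def by (rule dmap_restrict[OF mb D(4,5) W])
      also have "\<dots> = dmap K K (\<sigma> ^^ k) u v"
        by (rule dmap_cong[OF mb D(4) oW1 W1(2) _ nx1]) (use W1K in auto)
      finally show ?thesis .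
    qed
    ultimately show ?thesis using tangent_action_eq[OF A gk] c(4) by simp
  qed
  moreover have "(\<sigma> ^^ k) x \<in> cdom K" if "x \<in> W1" for x using nx1[OF that] W1(4) that by (metis image_subset_iff)
  moreover have "(\<sigma> ^^ k) u = u" using nx1[OF W1(2)] nu by simp
  ultimately have "good_nbhd k W1" unfolding good_nbhd_def using oW1 W1(2) W1K by blast
  then show ?thesis by blast
qed

text \<open>\<open>fixed_points_submanifold\<close>, applied in the coordinates \<open>K\<close> and
  carried back to the manifold. The derivative of \<open>\<iota>\<close> at the origin is retained,
  since it will identify the tangent space of the inertia stack.\<close>

lemma fixed_locus_chart:
  obtains m B U \<iota> \<pi> P where "openin (Euclidean_space m) B" "(\<lambda>_. 0) \<in> B" "openin (mtop (base Y b)) U" "U \<subseteq> V" "U \<subseteq> cdom K"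
    "smooth_map (euclidean_manifold m B) (base Y b) \<iota>" "\<And>y. y \<in> B \<Longrightarrow> \<iota> y \<in> U \<and> \<sigma> (\<iota> y) = \<iota> y \<and> \<pi> (\<iota> y) = y"
    "\<And>x. x \<in> U \<Longrightarrow> \<sigma> x = x \<Longrightarrow> \<pi> x \<in> B \<and> \<iota> (\<pi> x) = x" "\<And>j. j < m \<Longrightarrow> smooth_fun_on (cdim K) (cmap K ` U) (\<lambda>y. \<pi> (cinv K y) j)"
    "\<iota> (\<lambda>_. 0) = u" "\<And>y. y \<in> Rn m \<Longrightarrow> dmap \<lparr>cdim = m, cdom = B, cmap = (\<lambda>x. x)\<rparr> K \<iota> (\<lambda>_. 0) y = P y"
    "bij_betw P (Rn m) {v \<in> Rn (cdim K). tangent_action Y b \<theta> K g v = v}"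
proof -
  define n where "n = cdim K"
  obtain W2 where W2: "openin (mtop (base Y b)) W2" "u \<in> W2" "\<And>x. x \<in> W2 \<Longrightarrow> (\<sigma> ^^ N) x = x" using iterate_N by blast
  obtain G where G: "\<And>k. good_nbhd k (G k)" using good_nbhd_ex by metis
  \<comment> \<open>Finitely many conditions at once: the section is defined, the iterate
    \<open>N\<close> is the identity, and all iterates up to \<open>N\<close> are good.\<close>
  define W where "W = V \<inter> W2 \<inter> (\<Inter>k\<in>{..N}. G k)"
  have oW: "openin (mtop (base Y b)) W"
    unfolding W_def using G by (intro openin_Int V W2 openin_INT2) (auto simp: good_nbhd_def)
  have uW: "u \<in> W" using u_V W2(2) G by (auto simp: W_def good_nbhd_def)
  have WG: "W \<subseteq> G k" if "k \<le> N" for k using that by (auto simp: W_def)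
  have WK: "W \<subseteq> cdom K" using WG[of 0] G[of 0] by (auto simp: good_nbhd_def)
  have \<sigma>K: "(\<sigma> ^^ k) x \<in> cdom K" if "x \<in> W" "k \<le> N" for x k using G[of k] WG[OF that(2)] that(1) by (auto simp: good_nbhd_def)
  have gu: "(\<sigma> ^^ k) u = u" for k using G[of k] by (simp add: good_nbhd_def)
  define Dm where "Dm = cmap K ` W"
  define s where "s k = (\<lambda>y. cmap K ((\<sigma> ^^ k) (cinv K y)))" for k
  define \<rho> where "\<rho> k = tangent_action Y b \<theta> K (gpow p g k)" for k
  have oD: "openin (Euclidean_space n) Dm" unfolding Dm_def n_def by (rule chart_image_open[OF mb oW D(4) WK])
  note cc = cinv_cmap[OF mb D(4)]
  have sW: "s k (cmap K w) = cmap K ((\<sigma> ^^ k) w)" if "w \<in> W" for k w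
    using cc[of w] WK that by (auto simp: s_def)
  have gk: "hom (gpow p g k) p p" for k by (rule gpow_hom[OF g])
  interpret F: finite_order_germ n N Dm "cmap K u" s \<rho>
  proof
    show "cmap K u \<in> Dm" using uW by (simp add: Dm_def)
    show "s k x \<in> Rn n" if "k \<le> N" "x \<in> Dm" for k x
      using that sW \<sigma>K cmap_Rn[OF mb D(4)] by (auto simp: Dm_def n_def)
    show "smooth_fun_on n Dm (\<lambda>x. s k x l)" if "k \<le> N" "l < n" for k l
    proof (rule smooth_subset)
      show "openin (Euclidean_space n) (cmap K ` G k)" unfolding n_def by (rule chart_image_open[OF mb _ D(4)]) (use G[of k] in \<open>auto simp: good_nbhd_def\<close>)
      show "Dm \<subseteq> cmap K ` G k" using WG[OF that(1)] by (auto simp: Dm_def)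
      show "smooth_fun_on n (cmap K ` G k) (\<lambda>x. s k x l)" using G[of k] that(2) by (simp add: good_nbhd_def n_def s_def)
    qed
    show "s 0 x = x" if "x \<in> Dm" for x using that sW by (auto simp: Dm_def)
    show "s N x = x" if "x \<in> Dm" for x using that sW W2(3) by (auto simp: Dm_def W_def)
    show "s k (cmap K u) = cmap K u" for k using sW[OF uW] gu by simp
    show "s k (s 1 x) = s (Suc k) x" if k: "k < N" and x: "x \<in> Dm" "s 1 x \<in> Dm" for k x
    proof -
      obtain w where w: "w \<in> W" "x = cmap K w" using x(1) by (auto simp: Dm_def)
      have "\<sigma> w \<in> cdom K" using \<sigma>K[OF w(1), of 1] N(1) by simp
      then have "s k (s 1 x) = cmap K ((\<sigma> ^^ k) (\<sigma> w))" using sW[OF w(1), of 1] cc[of "\<sigma> w"] by (simp add: w(2) s_def)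
      then show ?thesis using sW[OF w(1), of "Suc k"] by (simp add: w(2) funpow_swap1)
    qed
    show "linear_on_set (Rn n) (\<rho> k)" for k unfolding \<rho>_def n_def by (rule tangent_action_linear[OF A gk])
    show "\<rho> k v \<in> Rn n" if "v \<in> Rn n" for k v using that unfolding \<rho>_def n_def by (rule tangent_action_in[OF A gk])
    show "\<rho> (k + l) v = \<rho> k (\<rho> l v)" if "v \<in> Rn n" for k l v
      using that unfolding \<rho>_def n_def by (rule tangent_action_gpow_add[OF A g])
    show "\<rho> 0 v = v" if "v \<in> Rn n" for v using tangent_action_idn[OF A] that by (simp add: \<rho>_def n_def)
    show "\<rho> N v = v" if "v \<in> Rn n" for v using tangent_action_idn[OF A] that N(2) by (simp add: \<rho>_def n_def)
    show "(\<Sum>j<n. pdiff j (\<lambda>x. s k x l) (cmap K u) * v j) = \<rho> k v l" if "l < n" "v \<in> Rn n" for k l v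
    proof -
      have "dmap K K (\<sigma> ^^ k) u v = \<rho> k v" using G[of k] that(2) by (simp add: good_nbhd_def n_def \<rho>_def)
      then have "dmap K K (\<sigma> ^^ k) u v l = \<rho> k v l" by simp
      then show ?thesis using that(1) by (simp add: dmap_def n_def s_def)
    qed
  qed (use N oD in auto)
  obtain m B U0 \<iota> \<pi> P where B: "openin (Euclidean_space m) B" "(\<lambda>_. 0) \<in> B" and U0: "openin (Euclidean_space n) U0" "U0 \<subseteq> Dm" "cmap K u \<in> U0"
    and \<iota>: "\<And>y. y \<in> B \<Longrightarrow> \<iota> y \<in> U0 \<and> s 1 (\<iota> y) = \<iota> y \<and> \<pi> (\<iota> y) = y"
    and \<pi>: "\<And>x. x \<in> U0 \<Longrightarrow> s 1 x = x \<Longrightarrow> \<pi> x \<in> B \<and> \<iota> (\<pi> x) = x"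
    and sm: "\<And>i. i < n \<Longrightarrow> smooth_fun_on m B (\<lambda>y. \<iota> y i)" "\<And>j. j < m \<Longrightarrow> smooth_fun_on n U0 (\<lambda>x. \<pi> x j)"
    and "\<And>x. x \<in> U0 \<Longrightarrow> \<pi> x \<in> Rn m" and \<iota>0: "\<iota> (\<lambda>_. 0) = cmap K u"
    and dP: "\<And>i y. i < n \<Longrightarrow> y \<in> Rn m \<Longrightarrow> (\<Sum>j<m. pdiff j (\<lambda>z. \<iota> z i) (\<lambda>_. 0) * y j) = P y i"
    and P: "bij_betw P (Rn m) {v \<in> Rn n. \<rho> 1 v = v}"
    by (rule F.fixed_points_submanifold, rule that, assumption+)
  define U where "U = {w \<in> W. cmap K w \<in> U0}"
  have KU: "cmap K ` U = U0" using U0(2) by (auto simp: U_def Dm_def)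
  have UK: "U \<subseteq> cdom K" using WK by (auto simp: U_def)
  have oU: "openin (mtop (base Y b)) U" using openin_from_chart[OF mb D(4) UK] KU U0(1) by (simp add: n_def)
  have cU: "cinv K y \<in> U \<and> cmap K (cinv K y) = y" if "y \<in> U0" for y
  proof -
    obtain w where "w \<in> U" "y = cmap K w" using \<open>y \<in> U0\<close> KU by blast
    then show ?thesis using cc[of w] UK by auto
  qed
  have s1: "s 1 (cmap K w) = cmap K w \<longleftrightarrow> \<sigma> w = w" if "w \<in> W" for w
    using sW[OF that, of 1] \<sigma>K[OF that, of 1] N(1) WK that chart_inj[OF mb D(4)] by (auto simp: inj_on_def)
  let ?KB = "\<lparr>cdim = m, cdom = B, cmap = (\<lambda>x. x)\<rparr>"
  define \<iota>' where "\<iota>' = (\<lambda>y\<in>B. cinv K (\<iota> y))"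
  have K\<iota>': "cmap K (\<iota>' y) = \<iota> y" if "y \<in> B" for y using cU \<iota> that by (simp add: \<iota>'_def)
  have \<iota>'U: "\<iota>' y \<in> U" if "y \<in> B" for y using cU \<iota> that by (simp add: \<iota>'_def)
  have KB: "?KB \<in> charts (euclidean_manifold m B)" by (simp add: euclidean_manifold_def)
  have smB: "smooth_fun_on m B (\<lambda>y. cmap K (\<iota>' (inv_into B (\<lambda>x. x) y)) j)" if "j < n" for j
    by (rule smooth_cong[OF B(1), THEN iffD1, OF _ sm(1)[OF that]]) (simp add: inv_into_ident K\<iota>')
  show thesis
  proof (rule that[of m B U \<iota>' "\<lambda>x. \<pi> (cmap K x)" P])
    show "U \<subseteq> V" by (auto simp: U_def W_def)
    show "smooth_map (euclidean_manifold m B) (base Y b) \<iota>'"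
    proof (rule smooth_mapI[OF is_manifold_euclidean[OF B(1)] mb])
      show "\<iota>' \<in> extensional (pts (euclidean_manifold m B))" by (simp add: \<iota>'_def euclidean_manifold_def)
      fix x assume "x \<in> pts (euclidean_manifold m B)"
      then have "x \<in> B" by (simp add: euclidean_manifold_def)
      then have "openin (mtop (euclidean_manifold m B)) B \<and> x \<in> B \<and> B \<subseteq> cdom ?KB \<and> \<iota>' ` B \<subseteq> cdom K \<and>
          (\<forall>i<cdim K. smooth_fun_on (cdim ?KB) (cmap ?KB ` B) (\<lambda>y. cmap K (\<iota>' (cinv ?KB y)) i))"
        using openin_euclidean_manifold[OF B(1)] B(1) \<iota>'U UK smB by (auto simp: n_def)
      then show "\<exists>K\<in>charts (euclidean_manifold m B). \<exists>L\<in>charts (base Y b). \<exists>W. openin (mtop (euclidean_manifold m B)) W \<and> x \<in> W \<and>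
          W \<subseteq> cdom K \<and> \<iota>' ` W \<subseteq> cdom L \<and> (\<forall>i<cdim L. smooth_fun_on (cdim K) (cmap K ` W) (\<lambda>y. cmap L (\<iota>' (cinv K y)) i))"
        using KB D(4) by blast
    qed
    show "\<iota>' y \<in> U \<and> \<sigma> (\<iota>' y) = \<iota>' y \<and> \<pi> (cmap K (\<iota>' y)) = y" if "y \<in> B" for y
      using \<iota>'U[OF that] K\<iota>'[OF that] \<iota>[OF that] s1[of "\<iota>' y"] by (auto simp: U_def)
    show "\<pi> (cmap K x) \<in> B \<and> \<iota>' (\<pi> (cmap K x)) = x" if "x \<in> U" "\<sigma> x = x" for x
      using \<pi>[of "cmap K x"] that s1[of x] cc[of x] UK by (auto simp: U_def \<iota>'_def)
    show "smooth_fun_on (cdim K) (cmap K ` U) (\<lambda>y. \<pi> (cmap K (cinv K y)) j)" if "j < m" for j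
      unfolding KU using smooth_cong[OF U0(1), THEN iffD1, OF _ sm(2)[OF that], of "\<lambda>y. \<pi> (cmap K (cinv K y)) j"] cU by (simp add: n_def)
    show "\<iota>' (\<lambda>_. 0) = u" using B(2) \<iota>0 cc[OF D(5)] by (simp add: \<iota>'_def)
    show "dmap ?KB K \<iota>' (\<lambda>_. 0) y = P y" if y: "y \<in> Rn m" for y
    proof
      fix l
      show "dmap ?KB K \<iota>' (\<lambda>_. 0) y l = P y l"
      proof (cases "l < n")
        case True
        have "pdiff j (\<lambda>y. cmap K (\<iota>' (inv_into B (\<lambda>x. x) y)) l) (\<lambda>_. 0) = pdiff j (\<lambda>y. \<iota> y l) (\<lambda>_. 0)" if "j < m" for j
          by (rule pdiff_cong[OF B(1,2) that]) (simp add: inv_into_ident K\<iota>')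
        then show ?thesis using dP[OF True y] True by (simp add: dmap_def n_def)
      next
        case False
        have "P y \<in> Rn n" using P y bij_betwE by blast
        then show ?thesis using False by (simp add: dmap_def n_def Rn_iff)
      qed
    qed
    show "bij_betw P (Rn m) {v \<in> Rn (cdim K). tangent_action Y b \<theta> K g v = v}"
      using P gpow_1[OF g] by (simp add: \<rho>_def n_def)
  qed (use B oU UK in auto)
qed

end

section \<open>Etale charts of the inertia category\<close>

text \<open>On the fixed locus source and target of the section \<open>t\<close> coincide, so the
  arrows of the groupoid in \<open>t\<close> become an automorphism of the restricted object. The
  fixed locus parametrises the part of the inertia stack near \<open>(p, g)\<close>, and
  \<open>j\<close> covers its inclusion, with the fixed vectors as image of the derivative.\<close>

lemma (in isotropy_germ) inertia_chart:
  obtains q \<phi> \<theta>q KB j where "etale_chart_at (inertia Y) (p, g) (q, \<phi>) (g, \<theta>q, \<phi>) KB" "hom j q b" "j \<cdot> \<theta>q = \<theta>"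
    "bij_betw (dmap KB K (bmap Y j) (foot Y \<theta>q)) (Rn (cdim KB)) {v \<in> Rn (cdim K). tangent_action Y b \<theta> K g v = v}"
proof -
  obtain m B U \<iota> \<pi> P where B: "openin (Euclidean_space m) B" "(\<lambda>_. 0) \<in> B" and U: "openin (mtop (base Y b)) U" "U \<subseteq> V" "U \<subseteq> cdom K"
    and \<iota>: "smooth_map (euclidean_manifold m B) (base Y b) \<iota>" "\<And>y. y \<in> B \<Longrightarrow> \<iota> y \<in> U \<and> \<sigma> (\<iota> y) = \<iota> y \<and> \<pi> (\<iota> y) = y"
    and \<pi>: "\<And>x. x \<in> U \<Longrightarrow> \<sigma> x = x \<Longrightarrow> \<pi> x \<in> B \<and> \<iota> (\<pi> x) = x" "\<And>j. j < m \<Longrightarrow> smooth_fun_on (cdim K) (cmap K ` U) (\<lambda>y. \<pi> (cinv K y) j)"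
    and \<iota>0: "\<iota> (\<lambda>_. 0) = u"
    and dP: "\<And>y. y \<in> Rn m \<Longrightarrow> dmap \<lparr>cdim = m, cdom = B, cmap = (\<lambda>x. x)\<rparr> K \<iota> (\<lambda>_. 0) y = P y"
    and P: "bij_betw P (Rn m) {v \<in> Rn (cdim K). tangent_action Y b \<theta> K g v = v}"
    by (rule fixed_locus_chart, rule that, assumption+)
  define MB where "MB = euclidean_manifold m B"
  define KB where "KB = \<lparr>cdim = m, cdom = B, cmap = (\<lambda>x::vec. x)\<rparr>"
  have mMB: "is_manifold MB" unfolding MB_def by (rule is_manifold_euclidean[OF B(1)])
  have KB: "KB \<in> charts MB" "pts MB = B" by (auto simp: MB_def KB_def euclidean_manifold_def)
  interpret I: fibred "inertia Y" by unfold_locales (rule fibred_inertia[OF fib])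

  text \<open>The object over the fixed locus, with the automorphism \<open>\<phi>\<close> given by the section \<open>t\<close>.\<close>

  have "smooth_map MB (base Y e) \<iota>"
    unfolding i(2) MB_def by (rule smooth_map_into_open[OF mb V is_manifold_euclidean[OF B(1)] \<iota>(1)])
      (use \<iota>(2) U(2) in \<open>auto simp: euclidean_manifold_def\<close>)
  then obtain q \<kappa> where \<kappa>: "hom \<kappa> q e" "base Y q = MB" "bmap Y \<kappa> = \<iota>"
    using pullback_ex[OF hom_Obj(1)[OF t(1)] mMB] by blast
  define j where "j = i \<cdot> \<kappa>"
  define a where "a = (\<alpha> \<cdot> t) \<cdot> \<kappa>"
  have at: "hom (\<alpha> \<cdot> t) e b" by (rule comp_hom[OF t(1) \<alpha>])
  have tk: "hom (t \<cdot> \<kappa>) q r" by (rule comp_hom[OF \<kappa>(1) t(1)])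
  have j: "hom j q b" unfolding j_def by (rule comp_hom[OF \<kappa>(1) i(1)])
  have a: "hom a q b" unfolding a_def by (rule comp_hom[OF \<kappa>(1) at])
  have ptsq: "pts (base Y q) = B" using \<kappa>(2) KB(2) by simp
  have jx: "bmap Y j y = \<iota> y" if "y \<in> B" for y
    using bmap_comp_apply[OF \<kappa>(1) i(1), of y] that \<iota>(2)[OF that] U(2) by (auto simp: j_def ptsq \<kappa>(3) i(3) incl_def)
  have ax: "bmap Y a y = \<iota> y" if "y \<in> B" for y
    using bmap_comp_apply[OF \<kappa>(1) at, of y] that \<iota>(2)[OF that] by (simp add: a_def ptsq \<kappa>(3) \<sigma>_def)
  have \<beta>tk: "\<beta> \<cdot> t \<cdot> \<kappa> = j" using assoc[OF \<kappa>(1) t(1) \<beta>] t(2) by (simp add: j_def)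
  have \<alpha>tk: "\<alpha> \<cdot> t \<cdot> \<kappa> = a" using assoc[OF \<kappa>(1) t(1) \<alpha>] by (simp add: a_def)
  have tkx: "bmap Y (t \<cdot> \<kappa>) y = bmap Y t (\<iota> y)" if "y \<in> B" for y
    using bmap_comp_apply[OF \<kappa>(1) t(1), of y] that by (simp add: ptsq \<kappa>(3))
  have q: "q \<in> Obj Y" by (rule hom_Obj(1)[OF j])
  obtain \<phi> where \<phi>: "hom \<phi> q q" "bmap Y \<phi> = incl (pts (base Y q))" "j \<cdot> \<phi> = a"
    by (rule lift_ex[OF j a smooth_map_id[OF base_manifold[OF q]]]) (use jx ax in \<open>simp add: ptsq incl_def\<close>)
  have \<phi>A: "\<phi> \<in> Aut Y q" using \<phi> by (simp add: Aut_def)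

  obtain \<theta>0 where \<theta>0: "hom \<theta>0 p e" "i \<cdot> \<theta>0 = \<theta>" "foot Y \<theta>0 = u" "(\<alpha> \<cdot> t) \<cdot> \<theta>0 = \<theta> \<cdot> g" by (rule base_point)
  obtain \<theta>q where \<theta>q: "hom \<theta>q p q" "\<kappa> \<cdot> \<theta>q = \<theta>0" "foot Y \<theta>q = (\<lambda>_. 0)"
    by (rule point_lift[OF D(1) \<kappa>(1) \<theta>0(1), of "\<lambda>_. 0"]) (use B(2) in \<open>auto simp: ptsq \<kappa>(3) \<iota>0 \<theta>0(3)\<close>)
  have j\<theta>: "j \<cdot> \<theta>q = \<theta>" using assoc[OF \<theta>q(1) \<kappa>(1) i(1)] \<theta>q(2) \<theta>0(2) by (simp add: j_def)
  have a\<theta>: "a \<cdot> \<theta>q = \<theta> \<cdot> g" using assoc[OF \<theta>q(1) \<kappa>(1) at] \<theta>q(2) \<theta>0(4) by (simp add: a_def)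
  \<comment> \<open>This is the compatibility that makes \<open>\<theta>q\<close> an arrow from
    \<open>(p, g)\<close> to \<open>(q, \<phi>)\<close> in the inertia category.\<close>
  have twist: "\<theta>q \<cdot> g = \<phi> \<cdot> \<theta>q"
  proof (rule point_arrow_eq[OF D(1) comp_hom[OF g \<theta>q(1)] comp_hom[OF \<theta>q(1) \<phi>(1)] _ j])
    show "foot Y (\<theta>q \<cdot> g) = foot Y (\<phi> \<cdot> \<theta>q)"
      using foot_precomp[OF D(1,1) g \<theta>q(1)] foot_comp[OF D(1) \<theta>q(1) \<phi>(1)] \<theta>q(3) B(2) by (simp add: \<phi>(2) ptsq incl_def)
    show "j \<cdot> \<theta>q \<cdot> g = j \<cdot> \<phi> \<cdot> \<theta>q"
      using assoc[OF g \<theta>q(1) j] assoc[OF \<theta>q(1) \<phi>(1) j] j\<theta> a\<theta> \<phi>(3) by simp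
  qed
  have gA: "g \<in> Aut Y p" using Aut_iff[OF D(1)] g by blast

  text \<open>The base change of \<open>(q, \<phi>)\<close> along \<open>(d, \<omega>)\<close> is the open part of \<open>b \<times> d\<close> over \<open>Y\<close> on which the
    arrow of the groupoid \<open>r\<close> obtained by conjugating \<open>\<omega>\<close> lies in the section \<open>t\<close>.\<close>

  have "\<exists>c A' B'. fibre_product (inertia Y) (q, \<phi>) d c A' B' \<and> etale_map (base (inertia Y) c) (base (inertia Y) d) (bmap (inertia Y) B')"
    if dO: "d \<in> Obj (inertia Y)" for d
  proof -
    obtain d0 \<omega> where d: "d = (d0, \<omega>)" "d0 \<in> Obj Y" "\<omega> \<in> Aut Y d0" using dO by (cases d) (auto simp: inertia_simps)
    obtain P0 \<mu> \<nu> where fp: "fibre_product Y b d0 P0 \<mu> \<nu>" and etn: "etale_map (base Y P0) (base Y d0) (bmap Y \<nu>)"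
      using etale_fibre_product[OF D(2) d(2)] by blast
    have \<mu>: "hom \<mu> P0 b" and \<nu>: "hom \<nu> P0 d0" using fibre_product_hom[OF fp] by auto
    note mP = hom_manifold(1)[OF \<mu>]
    note \<omega>h = Aut_hom[OF d(3)]
    obtain \<phi>P where \<phi>P: "\<phi>P \<in> Aut Y P0" "\<nu> \<cdot> \<phi>P = \<omega> \<cdot> \<nu>" by (rule Aut_pullback[OF \<nu> d(3)])
    note \<phi>Ph = Aut_hom[OF \<phi>P(1)]
    have \<mu>\<phi>: "hom (\<mu> \<cdot> \<phi>P) P0 b" by (rule comp_hom[OF \<phi>Ph \<mu>])
    obtain \<xi> where \<xi>: "hom \<xi> P0 r" "\<alpha> \<cdot> \<xi> = \<mu> \<cdot> \<phi>P" "\<beta> \<cdot> \<xi> = \<mu>" by (rule fibre_product_lift[OF f \<mu>\<phi> \<mu>])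
    define W where "W = {x \<in> pts (base Y P0). bmap Y \<xi> x \<in> S} \<inter> {x \<in> pts (base Y P0). bmap Y \<mu> x \<in> U}"
    have oW: "openin (mtop (base Y P0)) W"
      unfolding W_def
      by (rule openin_Int[OF smooth_map_preimage_open[OF mP bmap_smooth[OF \<xi>(1)] S(1)] smooth_map_preimage_open[OF mP bmap_smooth[OF \<mu>] U(1)]])
    have WP: "x \<in> pts (base Y P0)" if "x \<in> W" for x using that by (simp add: W_def)
    have \<xi>W: "bmap Y \<xi> x = bmap Y t (bmap Y \<mu> x)" if "x \<in> W" for x
      using t_\<beta>[of "bmap Y \<xi> x"] bmap_comp_apply[OF \<xi>(1) \<beta> WP[OF that]] \<xi>(3) that by (simp add: W_def)
    \<comment> \<open>On \<open>W\<close> the arrow \<open>\<xi>\<close> lies in the section, so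
      \<open>\<sigma>\<close> can be computed by \<open>\<alpha>\<close> from it; the outcome
      involves \<open>\<phi>P\<close>, which lies over the identity.\<close>
    have \<sigma>\<mu>: "\<sigma> (bmap Y \<mu> x) = bmap Y \<mu> x" if "x \<in> W" for x
    proof -
      have "bmap Y \<mu> x \<in> V" using that U(2) by (auto simp: W_def)
      then have "\<sigma> (bmap Y \<mu> x) = bmap Y \<alpha> (bmap Y \<xi> x)" by (simp add: \<sigma>_eq \<xi>W[OF that])
      also have "\<dots> = bmap Y \<mu> (bmap Y \<phi>P x)"
        using bmap_comp_apply[OF \<xi>(1) \<alpha> WP[OF that]] \<xi>(2) bmap_comp_apply[OF \<phi>Ph \<mu> WP[OF that]] by simp
      finally show ?thesis using Aut_bmap[OF \<phi>P(1) WP[OF that]] by simp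
    qed
    have \<pi>\<mu>: "\<pi> (bmap Y \<mu> x) \<in> B \<and> \<iota> (\<pi> (bmap Y \<mu> x)) = bmap Y \<mu> x" if "x \<in> W" for x
      using \<pi>(1)[OF _ \<sigma>\<mu>[OF that]] that by (simp add: W_def)
    note mW = is_manifold_open_sub[OF mP oW]
    obtain ob io where io: "hom io ob P0" "base Y ob = open_sub (base Y P0) W" "bmap Y io = incl W"
      using pullback_ex[OF hom_Obj(1)[OF \<mu>] mW smooth_map_incl[OF mP oW]] by blast
    have ptso: "pts (base Y ob) = W" by (simp add: io(2))
    have iox: "bmap Y io x = x" if "x \<in> W" for x using that by (simp add: io(3) incl_def)
    note mo = hom_manifold(1)[OF io(1)]
    have \<mu>io: "hom (\<mu> \<cdot> io) ob b" by (rule comp_hom[OF io(1) \<mu>])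
    have \<mu>iox: "bmap Y (\<mu> \<cdot> io) x = bmap Y \<mu> x" if "x \<in> W" for x
      using bmap_comp_apply[OF io(1) \<mu>, of x] iox[OF that] that by (simp add: ptso)
    have \<xi>io: "hom (\<xi> \<cdot> io) ob r" by (rule comp_hom[OF io(1) \<xi>(1)])
    have \<xi>iox: "bmap Y (\<xi> \<cdot> io) x = bmap Y \<xi> x" if "x \<in> W" for x
      using bmap_comp_apply[OF io(1) \<xi>(1), of x] iox[OF that] that by (simp add: ptso)

    \<comment> \<open>The parameter of the point \<open>bmap Y \<mu> x\<close> of the fixed locus.
      Smoothness follows because \<open>\<pi>\<close> is smooth on the open set \<open>U\<close>,
      not only along the locus.\<close>
    define \<Lambda> where "\<Lambda> = (\<lambda>x\<in>W. \<pi> (bmap Y \<mu> x))"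
    have "smooth_map (base Y ob) MB \<Lambda>"
    proof (rule smooth_mapI[OF mo mMB])
      show "\<Lambda> \<in> extensional (pts (base Y ob))" by (simp add: \<Lambda>_def ptso)
      fix x assume x: "x \<in> pts (base Y ob)"
      obtain L where L: "L \<in> charts (base Y ob)" "x \<in> cdom L" using chart_at[OF mo x] by blast
      have "bmap Y (\<mu> \<cdot> io) x \<in> U" using x \<mu>iox[of x] by (auto simp: ptso W_def)
      then obtain W1 where W1: "openin (mtop (base Y ob)) W1" "x \<in> W1" "W1 \<subseteq> cdom L" "bmap Y (\<mu> \<cdot> io) ` W1 \<subseteq> U"
        by (rule smooth_map_nbhd[OF mo mb bmap_smooth[OF \<mu>io] L U(1)])
      have W1W: "W1 \<subseteq> W" using open_pts[OF mo W1(1)] by (simp add: ptso)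
      have o1: "openin (Euclidean_space (cdim L)) (cmap L ` W1)" by (rule chart_image_open[OF mo W1(1) L(1) W1(3)])
      have oU: "openin (Euclidean_space (cdim K)) (cmap K ` U)" by (rule chart_image_open[OF mb U(1) D(4) U(3)])
      note cL = cinv_cmap[OF mo L(1)] and cK = cinv_cmap[OF mb D(4)]
      have "smooth_fun_on (cdim L) (cmap L ` W1) (\<lambda>y. cmap KB (\<Lambda> (cinv L y)) l)" if l: "l < m" for l
      proof -
        have "smooth_fun_on (cdim L) (cmap L ` W1) (\<lambda>y. \<pi> (cinv K (cmap K (bmap Y (\<mu> \<cdot> io) (cinv L y)))) l)"
        proof (rule smooth_compose[OF o1 oU, where F = "\<lambda>y. cmap K (bmap Y (\<mu> \<cdot> io) (cinv L y))" and G = "\<lambda>z. \<pi> (cinv K z) l"])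
          show "cmap K (bmap Y (\<mu> \<cdot> io) (cinv L y)) \<in> cmap K ` U" if "y \<in> cmap L ` W1" for y
            using that cL W1(3,4) by (fastforce simp: subset_iff)
          show "smooth_fun_on (cdim L) (cmap L ` W1) (\<lambda>y. cmap K (bmap Y (\<mu> \<cdot> io) (cinv L y)) l)" if "l < cdim K" for l
            by (rule smooth_map_coord[OF mo mb bmap_smooth[OF \<mu>io] L(1) D(4) W1(3) _ that]) (use W1(4) U(3) in auto)
        qed (rule \<pi>(2)[OF l])
        then show ?thesis
        proof (rule smooth_cong[OF o1, THEN iffD1, rotated])
          fix y assume "y \<in> cmap L ` W1"
          then obtain z where z: "z \<in> W1" "y = cmap L z" by blast
          have "cinv L y = z" using z cL W1(3) by auto
          moreover have "z \<in> W" using z W1W by blast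
          moreover have "bmap Y (\<mu> \<cdot> io) z \<in> cdom K" using z W1(4) U(3) by blast
          ultimately show "\<pi> (cinv K (cmap K (bmap Y (\<mu> \<cdot> io) (cinv L y)))) l = cmap KB (\<Lambda> (cinv L y)) l"
            using cK \<mu>iox by (simp add: KB_def \<Lambda>_def)
        qed
      qed
      moreover have "\<Lambda> ` W1 \<subseteq> cdom KB" using \<pi>\<mu> W1W by (auto simp: KB_def \<Lambda>_def)
      ultimately show "\<exists>K\<in>charts (base Y ob). \<exists>L\<in>charts MB. \<exists>W. openin (mtop (base Y ob)) W \<and> x \<in> W \<and> W \<subseteq> cdom K \<and> \<Lambda> ` W \<subseteq> cdom L \<and>
          (\<forall>i<cdim L. smooth_fun_on (cdim K) (cmap K ` W) (\<lambda>y. cmap L (\<Lambda> (cinv K y)) i))"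
        using L(1) KB(1) W1(1-3) by (intro bexI[of _ L] bexI[of _ KB] exI[of _ W1]) (auto simp: KB_def)
    qed
    then have sm\<Lambda>: "smooth_map (base Y ob) (base Y q) \<Lambda>" by (simp add: \<kappa>(2))
    \<comment> \<open>Lifting through the arrow \<open>t \<cdot> \<kappa>\<close> to
      \<open>r\<close> fixes two composites at once: \<open>\<beta>\<close> yields
      \<open>j \<cdot> l\<close> and \<open>\<alpha>\<close> yields
      \<open>a \<cdot> l\<close>.\<close>
    obtain l where l: "hom l ob q" "bmap Y l = \<Lambda>" "(t \<cdot> \<kappa>) \<cdot> l = \<xi> \<cdot> io"
    proof (rule lift_ex[OF tk \<xi>io sm\<Lambda>])
      fix x assume "x \<in> pts (base Y ob)"
      then have x: "x \<in> W" by (simp add: ptso)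
      show "bmap Y (t \<cdot> \<kappa>) (\<Lambda> x) = bmap Y (\<xi> \<cdot> io) x"
        using tkx[of "\<Lambda> x"] \<pi>\<mu>[OF x] \<xi>iox[OF x] \<xi>W[OF x] x by (simp add: \<Lambda>_def)
    qed
    have jl: "j \<cdot> l = \<mu> \<cdot> io"
      using assoc[OF l(1) tk \<beta>] \<beta>tk l(3) assoc[OF io(1) \<xi>(1) \<beta>] \<xi>(3) by simp
    have al: "a \<cdot> l = \<mu> \<cdot> \<phi>P \<cdot> io"
      using assoc[OF l(1) tk \<alpha>] \<alpha>tk l(3) assoc[OF io(1) \<xi>(1) \<alpha>] \<xi>(2) assoc[OF io(1) \<phi>Ph \<mu>] by simp
    obtain \<phi>o where \<phi>o: "\<phi>o \<in> Aut Y ob" "io \<cdot> \<phi>o = \<phi>P \<cdot> io" by (rule Aut_pullback[OF io(1) \<phi>P(1)])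
    note \<phi>oh = Aut_hom[OF \<phi>o(1)]
    have l\<phi>: "l \<cdot> \<phi>o = \<phi> \<cdot> l"
    proof (rule cartesian_cancel[OF j comp_hom[OF \<phi>oh l(1)] comp_hom[OF l(1) \<phi>(1)]])
      show "bmap Y (l \<cdot> \<phi>o) = bmap Y (\<phi> \<cdot> l)"
        by (rule bmap_eqI[OF comp_hom[OF \<phi>oh l(1)] comp_hom[OF l(1) \<phi>(1)]])
          (simp add: bmap_comp_apply[OF \<phi>oh l(1)] bmap_comp_apply[OF l(1) \<phi>(1)] Aut_bmap[OF \<phi>o(1)] Aut_bmap[OF \<phi>A] bmap_pts[OF l(1)])
      show "j \<cdot> l \<cdot> \<phi>o = j \<cdot> \<phi> \<cdot> l"
        using assoc[OF \<phi>oh l(1) j] jl assoc[OF \<phi>oh io(1) \<mu>] \<phi>o(2) assoc[OF l(1) \<phi>(1) j] \<phi>(3) al by simp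
    qed
    have \<nu>io: "hom (\<nu> \<cdot> io) ob d0" by (rule comp_hom[OF io(1) \<nu>])
    have \<nu>\<phi>: "(\<nu> \<cdot> io) \<cdot> \<phi>o = \<omega> \<cdot> (\<nu> \<cdot> io)"
      using assoc[OF \<phi>oh io(1) \<nu>] \<phi>o(2) assoc[OF io(1) \<phi>Ph \<nu>] \<phi>P(2) assoc[OF io(1) \<nu> \<omega>h] by simp
    have "fibre_product (inertia Y) (q, \<phi>) (d0, \<omega>) (ob, \<phi>o) (\<phi>o, l, \<phi>) (\<phi>o, \<nu> \<cdot> io, \<omega>)"
      unfolding fibre_product_def
    proof (intro conjI allI impI)
      show "in_hom (inertia Y) (\<phi>o, l, \<phi>) (ob, \<phi>o) (q, \<phi>)" using l(1) \<phi>o(1) \<phi>A l\<phi> by (simp add: in_hom_inertia)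
      show "in_hom (inertia Y) (\<phi>o, \<nu> \<cdot> io, \<omega>) (ob, \<phi>o) (d0, \<omega>)" using \<nu>io \<phi>o(1) d(3) \<nu>\<phi> by (simp add: in_hom_inertia)
      fix w' M' N'
      assume "in_hom (inertia Y) M' w' (q, \<phi>) \<and> in_hom (inertia Y) N' w' (d0, \<omega>)"
      moreover obtain w \<eta> where w': "w' = (w, \<eta>)" by (cases w')
      ultimately obtain m' n' where m': "M' = (\<eta>, m', \<phi>)" "hom m' w q" "\<eta> \<in> Aut Y w" "m' \<cdot> \<eta> = \<phi> \<cdot> m'"
        and n': "N' = (\<eta>, n', \<omega>)" "hom n' w d0" "n' \<cdot> \<eta> = \<omega> \<cdot> n'"
        by (auto simp: in_hom_inertia)
      note \<eta>h = Aut_hom[OF m'(3)]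
      obtain k where k: "hom k w P0" "\<mu> \<cdot> k = j \<cdot> m'" "\<nu> \<cdot> k = n'"
        by (rule fibre_product_lift[OF fp comp_hom[OF m'(2) j] n'(2)])
      have k\<eta>: "k \<cdot> \<eta> = \<phi>P \<cdot> k"
        by (rule intertwine_lift[OF \<nu> k(1) d(3) \<phi>P(1) m'(3) \<phi>P(2)]) (use k(3) n'(3) in simp)
      \<comment> \<open>The legs over \<open>\<beta>\<close> agree by the choice of
        \<open>k\<close>; over \<open>\<alpha>\<close> they agree exactly because \<open>m'\<close>
        and \<open>k\<close> intertwine the automorphisms. This forces every competing span to land
        in \<open>W\<close>.\<close>
      have \<xi>k: "\<xi> \<cdot> k = (t \<cdot> \<kappa>) \<cdot> m'"
      proof (rule fibre_product_unique[OF f comp_hom[OF k(1) \<xi>(1)] comp_hom[OF m'(2) tk]])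
        show "\<beta> \<cdot> \<xi> \<cdot> k = \<beta> \<cdot> (t \<cdot> \<kappa>) \<cdot> m'"
          using assoc[OF k(1) \<xi>(1) \<beta>] \<xi>(3) k(2) assoc[OF m'(2) tk \<beta>] \<beta>tk by simp
        have "\<alpha> \<cdot> \<xi> \<cdot> k = \<mu> \<cdot> \<phi>P \<cdot> k" using assoc[OF k(1) \<xi>(1) \<alpha>] \<xi>(2) assoc[OF k(1) \<phi>Ph \<mu>] by simp
        also have "\<dots> = (j \<cdot> m') \<cdot> \<eta>" using k\<eta> assoc[OF \<eta>h k(1) \<mu>] k(2) by simp
        also have "\<dots> = j \<cdot> \<phi> \<cdot> m'" using assoc[OF \<eta>h m'(2) j] m'(4) by simp
        also have "\<dots> = a \<cdot> m'" using assoc[OF m'(2) \<phi>(1) j] \<phi>(3) by simp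
        finally show "\<alpha> \<cdot> \<xi> \<cdot> k = \<alpha> \<cdot> (t \<cdot> \<kappa>) \<cdot> m'" using assoc[OF m'(2) tk \<alpha>] \<alpha>tk by simp
      qed
      have kx: "bmap Y k x \<in> W \<and> bmap Y \<mu> (bmap Y k x) = \<iota> (bmap Y m' x) \<and> bmap Y m' x \<in> B" if x: "x \<in> pts (base Y w)" for x
      proof -
        have y: "bmap Y m' x \<in> B" using bmap_pts[OF m'(2) x] by (simp add: ptsq)
        have 1: "bmap Y \<mu> (bmap Y k x) = \<iota> (bmap Y m' x)"
          using bmap_comp_apply[OF k(1) \<mu> x] k(2) bmap_comp_apply[OF m'(2) j x] jx[OF y] by simp
        have "bmap Y \<xi> (bmap Y k x) = bmap Y t (\<iota> (bmap Y m' x))"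
          using bmap_comp_apply[OF k(1) \<xi>(1) x] \<xi>k bmap_comp_apply[OF m'(2) tk x] tkx[OF y] by simp
        then have "bmap Y \<xi> (bmap Y k x) \<in> S" using t(3) \<iota>(2)[OF y] U(2) by auto
        then show ?thesis using 1 \<iota>(2)[OF y] bmap_pts[OF k(1) x] y by (simp add: W_def)
      qed
      have "smooth_map (base Y w) (base Y ob) (bmap Y k)"
        unfolding io(2) by (rule smooth_map_into_open[OF mP oW hom_manifold(1)[OF k(1)] bmap_smooth[OF k(1)]]) (use kx in auto)
      then obtain h where h: "hom h w ob" "bmap Y h = bmap Y k" "io \<cdot> h = k"
        by (rule lift_ex[OF io(1) k(1)]) (use kx iox in auto)
      have lh: "l \<cdot> h = m'"
      proof (rule cartesian_cancel[OF tk comp_hom[OF h(1) l(1)] m'(2)])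
        show "bmap Y (l \<cdot> h) = bmap Y m'"
        proof (rule bmap_eqI[OF comp_hom[OF h(1) l(1)] m'(2)])
          fix x assume x: "x \<in> pts (base Y w)"
          show "bmap Y (l \<cdot> h) x = bmap Y m' x"
            using bmap_comp_apply[OF h(1) l(1) x] h(2) l(2) kx[OF x] \<iota>(2)[of "bmap Y m' x"] by (simp add: \<Lambda>_def)
        qed
        show "(t \<cdot> \<kappa>) \<cdot> l \<cdot> h = (t \<cdot> \<kappa>) \<cdot> m'"
          using assoc[OF h(1) l(1) tk] l(3) assoc[OF h(1) io(1) \<xi>(1)] h(3) \<xi>k by simp
      qed
      have nh: "(\<nu> \<cdot> io) \<cdot> h = n'" using assoc[OF h(1) io(1) \<nu>] h(3) k(3) by simp
      have h\<eta>: "h \<cdot> \<eta> = \<phi>o \<cdot> h"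
        by (rule intertwine_lift[OF io(1) h(1) \<phi>P(1) \<phi>o(1) m'(3) \<phi>o(2)]) (use h(3) k\<eta> in simp)
      show "\<exists>!k. in_hom (inertia Y) k w' (ob, \<phi>o) \<and> cmp (inertia Y) (\<phi>o, l, \<phi>) k = M' \<and> cmp (inertia Y) (\<phi>o, \<nu> \<cdot> io, \<omega>) k = N'"
      proof (rule ex1I[of _ "(\<eta>, h, \<phi>o)"])
        show "in_hom (inertia Y) (\<eta>, h, \<phi>o) w' (ob, \<phi>o) \<and> cmp (inertia Y) (\<phi>o, l, \<phi>) (\<eta>, h, \<phi>o) = M' \<and>
            cmp (inertia Y) (\<phi>o, \<nu> \<cdot> io, \<omega>) (\<eta>, h, \<phi>o) = N'"
          using h(1) m'(3) \<phi>o(1) h\<eta> lh nh by (simp add: w' in_hom_inertia inertia_simps m'(1) n'(1))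
        fix H assume H: "in_hom (inertia Y) H w' (ob, \<phi>o) \<and> cmp (inertia Y) (\<phi>o, l, \<phi>) H = M' \<and> cmp (inertia Y) (\<phi>o, \<nu> \<cdot> io, \<omega>) H = N'"
        then obtain h' where h': "H = (\<eta>, h', \<phi>o)" "hom h' w ob" by (auto simp: w' in_hom_inertia)
        have lh': "l \<cdot> h' = m'" and nh': "(\<nu> \<cdot> io) \<cdot> h' = n'" using H by (auto simp: h'(1) inertia_simps m'(1) n'(1))
        have "io \<cdot> h' = k"
        proof (rule fibre_product_unique[OF fp comp_hom[OF h'(2) io(1)] k(1)])
          show "\<mu> \<cdot> io \<cdot> h' = \<mu> \<cdot> k" using assoc[OF h'(2) io(1) \<mu>] jl assoc[OF h'(2) l(1) j] lh' k(2) by simp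
          show "\<nu> \<cdot> io \<cdot> h' = \<nu> \<cdot> k" using assoc[OF h'(2) io(1) \<nu>] nh' k(3) by simp
        qed
        moreover have "bmap Y h' = bmap Y h"
        proof (rule bmap_eqI[OF h'(2) h(1)])
          fix x assume x: "x \<in> pts (base Y w)"
          have "bmap Y h' x \<in> W" using bmap_pts[OF h'(2) x] by (simp add: ptso)
          then show "bmap Y h' x = bmap Y h x"
            using bmap_comp_apply[OF h'(2) io(1) x] \<open>io \<cdot> h' = k\<close> h(2) iox by simp
        qed
        ultimately have "h' = h" using cartesian_cancel[OF io(1) h'(2) h(1)] h(3) by simp
        then show "H = (\<eta>, h, \<phi>o)" using h'(1) by simp
      qed
    qed
    moreover have "etale_map (base (inertia Y) (ob, \<phi>o)) (base (inertia Y) (d0, \<omega>)) (bmap (inertia Y) (\<phi>o, \<nu> \<cdot> io, \<omega>))"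
    proof -
      have "bmap Y (\<nu> \<cdot> io) = restrict (bmap Y \<nu>) W"
      proof (rule extensionalityI[OF bmap_ext[OF \<nu>io]])
        show "restrict (bmap Y \<nu>) W \<in> extensional (pts (base Y ob))" by (simp add: ptso)
        show "bmap Y (\<nu> \<cdot> io) x = restrict (bmap Y \<nu>) W x" if "x \<in> pts (base Y ob)" for x
          using bmap_comp_apply[OF io(1) \<nu> that] that iox by (simp add: ptso)
      qed
      then show ?thesis
        unfolding inertia_simps io(2) using etale_restrict[OF mP hom_manifold(2)[OF \<nu>] etn oW] by simp
    qed
    ultimately show ?thesis unfolding d(1) by blast
  qed
  moreover have "(q, \<phi>) \<in> Obj (inertia Y)" using q \<phi>A by (simp add: inertia_simps)
  ultimately have "representable_with etale_map (inertia Y) (q, \<phi>)"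
    unfolding representable_with_def by blast
  moreover have "in_hom (inertia Y) (g, \<theta>q, \<phi>) (p, g) (q, \<phi>)"
    using \<theta>q(1) gA \<phi>A twist by (simp add: in_hom_inertia)
  moreover have "(p, g) \<in> point_objects (inertia Y)"
    using D(1) gA by (simp add: point_objects_def inertia_simps)
  moreover have "KB \<in> charts (base (inertia Y) (q, \<phi>))" "foot (inertia Y) (g, \<theta>q, \<phi>) \<in> cdom KB"
    using KB(1) B(2) \<theta>q(3) by (simp_all add: inertia_simps \<kappa>(2) foot_inertia KB_def)
  ultimately have "etale_chart_at (inertia Y) (p, g) (q, \<phi>) (g, \<theta>q, \<phi>) KB"
    by (simp add: etale_chart_at_def)
  moreover have "bij_betw (dmap KB K (bmap Y j) (foot Y \<theta>q)) (Rn (cdim KB)) {v \<in> Rn (cdim K). tangent_action Y b \<theta> K g v = v}"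
  proof (rule bij_betw_cong[THEN iffD1])
    show "bij_betw P (Rn (cdim KB)) {v \<in> Rn (cdim K). tangent_action Y b \<theta> K g v = v}" using P by (simp add: KB_def)
    fix y assume "y \<in> Rn (cdim KB)"
    have oB: "openin (mtop MB) B" unfolding MB_def using openin_euclidean_manifold[OF B(1)] B(1) by simp
    have "dmap KB K (bmap Y j) (\<lambda>_. 0) y = dmap KB K \<iota> (\<lambda>_. 0) y"
      by (rule dmap_cong[OF mMB KB(1) oB B(2) _ jx]) (auto simp: KB_def)
    then show "P y = dmap KB K (bmap Y j) (foot Y \<theta>q) y"
      using dP[folded KB_def, of y] \<open>y \<in> Rn (cdim KB)\<close> \<theta>q(3) by (simp add: KB_def)
  qed
  ultimately show thesis using that j j\<theta> by blast
qed

section \<open>Invariant splittings\<close>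

text \<open>Elimination on the target dimension: if the last coordinate of \<open>T\<close> is not
  identically zero, some unit vector \<open>j\<close> has a nonzero value there. Using it to cancel
  the last coordinate costs one dimension on either side.\<close>

lemma linear_injective_dim:
  assumes "linear_on_set (Rn k) T" "T ` Rn k \<subseteq> Rn m" "inj_on T (Rn k)"
  shows "k \<le> m"
  using assms
proof (induction m arbitrary: k T)
  case 0
  show ?case
  proof (rule ccontr)
    assume "\<not> k \<le> 0"
    then have "unit_vec 0 \<in> Rn k" by (intro unit_vec_Rn) simp
    moreover have "T (unit_vec 0) = T (\<lambda>_. 0)"
      using 0(2) \<open>unit_vec 0 \<in> Rn k\<close> by (auto simp: Rn_0 image_subset_iff)
    ultimately have "unit_vec 0 = (\<lambda>_. 0)" using 0(3) by (auto simp: inj_on_def)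
    then show False by (simp add: unit_vec_def fun_eq_iff) (metis zero_neq_one)
  qed
next
  case (Suc m)
  note lin = linear_on_setD[OF Suc.prems(1)]
  show ?case
  proof (cases "\<forall>x\<in>Rn k. T x m = 0")
    case True
    have "T ` Rn k \<subseteq> Rn m"
    proof
      fix y assume "y \<in> T ` Rn k"
      then have "y \<in> Rn (Suc m)" "y m = 0" using Suc.prems(2) True by auto
      then show "y \<in> Rn m" by (auto simp: Rn_iff) (metis Suc_leI le_neq_implies_less)
    qed
    from Suc.IH[OF Suc.prems(1) this Suc.prems(3)] show ?thesis by simp
  next
    case False
    have "\<exists>j<k. T (unit_vec j) m \<noteq> 0"
    proof (rule ccontr)
      assume "\<not> (\<exists>j<k. T (unit_vec j) m \<noteq> 0)"
      then have "T x m = 0" if "x \<in> Rn k" for x using linear_matrix[OF Suc.prems(1) that, of m] by simp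
      then show False using False by blast
    qed
    then obtain j where j: "j < k" "T (unit_vec j) m \<noteq> 0" by blast
    define c where "c = T (unit_vec j) m"
    obtain k' where k': "k = Suc k'" using j(1) by (cases k) auto
    define ins where "ins y = (\<lambda>i. if i < j then y i else if i = j then 0 else y (i - 1))" for y :: vec
    \<comment> \<open>Inserts a zero at position \<open>j\<close> and then corrects by a multiple of
      the \<open>j\<close>-th unit vector so that the last coordinate of the image vanishes.\<close>
    define S where "S y = (\<lambda>i. 1 * ins y i + (- T (ins y) m / c) * unit_vec j i)" for y
    have insR: "ins y \<in> Rn k" if "y \<in> Rn k'" for y using that j k' by (auto simp: ins_def Rn_iff)
    have SR: "S y \<in> Rn k" if "y \<in> Rn k'" for y
      unfolding S_def by (rule Rn_lin[OF insR[OF that] unit_vec_Rn[OF j(1)]])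
    have ins_lin: "ins (\<lambda>i. r * v i + s * w i) = (\<lambda>i. r * ins v i + s * ins w i)" for r s v w by (auto simp: ins_def)
    have TS: "T (S y) = (\<lambda>i. 1 * T (ins y) i + (- T (ins y) m / c) * T (unit_vec j) i)" if "y \<in> Rn k'" for y
      unfolding S_def by (rule lin[OF insR[OF that] unit_vec_Rn[OF j(1)]])
    have "k' \<le> m"
    proof (rule Suc.IH)
      show "linear_on_set (Rn k') (\<lambda>y. T (S y))"
        unfolding linear_on_set_def
      proof (intro ballI allI)
        fix v w r s assume v: "v \<in> Rn k'" and w: "w \<in> Rn k'"
        have 1: "(\<lambda>i. r * v i + s * w i) \<in> Rn k'" by (rule Rn_lin[OF v w])
        show "T (S (\<lambda>i. r * v i + s * w i)) = (\<lambda>i. r * T (S v) i + s * T (S w) i)"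
          unfolding TS[OF 1] TS[OF v] TS[OF w] ins_lin lin[OF insR[OF v] insR[OF w]]
          by (auto simp: algebra_simps add_divide_distrib diff_divide_distrib)
      qed
      show "(\<lambda>y. T (S y)) ` Rn k' \<subseteq> Rn m"
      proof
        fix x assume "x \<in> (\<lambda>y. T (S y)) ` Rn k'"
        then obtain y where y: "y \<in> Rn k'" "x = T (S y)" by blast
        have "x \<in> Rn (Suc m)" using Suc.prems(2) SR[OF y(1)] y(2) by blast
        moreover have "x m = 0" using j(2) by (simp add: y(2) TS[OF y(1)] c_def)
        ultimately show "x \<in> Rn m" by (auto simp: Rn_iff) (metis Suc_leI le_neq_implies_less)
      qed
      show "inj_on (\<lambda>y. T (S y)) (Rn k')"
      proof (rule inj_onI)
        fix v w assume v: "v \<in> Rn k'" and w: "w \<in> Rn k'" and "T (S v) = T (S w)"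
        then have e: "S v = S w" using Suc.prems(3) SR by (auto simp: inj_on_def)
        show "v = w"
        proof
          fix i
          show "v i = w i"
          proof (cases "i < j")
            case True
            then show ?thesis using fun_cong[OF e, of i] by (simp add: S_def ins_def unit_vec_def)
          next
            case False
            then show ?thesis using fun_cong[OF e, of "Suc i"] by (simp add: S_def ins_def unit_vec_def)
          qed
        qed
      qed
    qed
    then show ?thesis using k' by simp
  qed
qed

text \<open>A vector \<open>w\<close> outside the image could be adjoined as one more independent
  direction. This would give an injective linear map from dimension \<open>Suc m\<close> to
  dimension \<open>m\<close>.\<close>

lemma linear_injective_surj:
  assumes V: "lin_subspace n V" and T: "linear_on_set V T" "T ` V \<subseteq> V" "inj_on T V"
  shows "T ` V = V"
proof
  show "V \<subseteq> T ` V"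
  proof (rule ccontr)
    assume "\<not> V \<subseteq> T ` V"
    then obtain w where w: "w \<in> V" "w \<notin> T ` V" by blast
    obtain m P Q where P: "linear_on_set (Rn m) P" and Q: "linear_on_set (Rn n) Q"
      and PQ: "\<And>y. y \<in> Rn m \<Longrightarrow> P y \<in> V \<and> Q (P y) = y" "\<And>x. x \<in> Rn n \<Longrightarrow> Q x \<in> Rn m" "\<And>x. x \<in> V \<Longrightarrow> P (Q x) = x"
      by (rule subspace_coordinates[OF V]) blast
    note VR = lin_subspace_Rn[OF V]
    define cut where "cut y = (\<lambda>i. if i < m then y i else 0)" for y :: vec
    have cutR: "cut y \<in> Rn m" for y by (simp add: cut_def Rn_iff)
    have cut_lin: "cut (\<lambda>i. r * v i + s * w i) = (\<lambda>i. r * cut v i + s * cut w i)" for r s v w by (auto simp: cut_def)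
    define S where "S y = (\<lambda>i. 1 * T (P (cut y)) i + y m * w i)" for y
    have TP: "T (P (cut y)) \<in> V" for y using PQ(1)[OF cutR] T(2) by blast
    have SV: "S y \<in> V" for y unfolding S_def by (rule lin_subspaceD[OF V TP w(1)])
    have "Suc m \<le> m"
    proof (rule linear_injective_dim)
      show "linear_on_set (Rn (Suc m)) (\<lambda>y. Q (S y))"
        unfolding linear_on_set_def
      proof (intro ballI allI)
        fix v v' r s
        have "T (P (cut (\<lambda>i. r * v i + s * v' i))) = (\<lambda>i. r * T (P (cut v)) i + s * T (P (cut v')) i)"
          unfolding cut_lin linear_on_setD[OF P cutR cutR] by (rule linear_on_setD[OF T(1)]) (use PQ(1)[OF cutR] in blast)+
        then have "S (\<lambda>i. r * v i + s * v' i) = (\<lambda>i. r * S v i + s * S v' i)"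
          by (simp add: S_def algebra_simps)
        then show "Q (S (\<lambda>i. r * v i + s * v' i)) = (\<lambda>i. r * Q (S v) i + s * Q (S v') i)"
          using linear_on_setD[OF Q VR[OF SV] VR[OF SV]] by simp
      qed
      show "(\<lambda>y. Q (S y)) ` Rn (Suc m) \<subseteq> Rn m" using PQ(2) VR[OF SV] by blast
      show "inj_on (\<lambda>y. Q (S y)) (Rn (Suc m))"
      proof (rule inj_onI)
        fix v v' assume v: "v \<in> Rn (Suc m)" "v' \<in> Rn (Suc m)" and "Q (S v) = Q (S v')"
        then have e: "S v = S v'" using PQ(3)[OF SV] by metis
        have em: "v m = v' m"
        proof (rule ccontr)
          assume ne: "v m \<noteq> v' m"
          define d where "d = v' m - v m"
          have d: "d \<noteq> 0" using ne by (simp add: d_def)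
          have "w = (\<lambda>i. (1 / d) * T (P (cut v)) i + (- 1 / d) * T (P (cut v')) i)"
          proof
            fix i
            have "T (P (cut v)) i - T (P (cut v')) i = d * w i" using fun_cong[OF e, of i] by (simp add: S_def d_def algebra_simps)
            then show "w i = (1 / d) * T (P (cut v)) i + (- 1 / d) * T (P (cut v')) i" using d by (simp add: field_simps)
          qed
          also have "\<dots> = T (\<lambda>i. (1 / d) * P (cut v) i + (- 1 / d) * P (cut v') i)"
            by (rule linear_on_setD[OF T(1), symmetric]) (use PQ(1)[OF cutR] in blast)+
          finally have "w \<in> T ` V" using lin_subspaceD[OF V, of "P (cut v)" "P (cut v')"] PQ(1)[OF cutR] by blast
          then show False using w by blast
        qed
        then have "T (P (cut v)) = T (P (cut v'))" using e by (simp add: S_def fun_eq_iff)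
        then have "P (cut v) = P (cut v')" using T(3) PQ(1)[OF cutR] by (metis inj_onD)
        then have "cut v = cut v'" using PQ(1)[OF cutR] by metis
        then show "v = v'" using em v by (auto simp: cut_def Rn_iff fun_eq_iff less_Suc_eq) (metis not_less_eq_eq linorder_not_less less_Suc_eq)
      qed
    qed
    then show False by simp
  qed
qed (rule T(2))

definition bilinear_form :: "nat \<Rightarrow> (vec \<Rightarrow> vec \<Rightarrow> real) \<Rightarrow> bool"
  where "bilinear_form n F \<longleftrightarrow> (\<forall>u\<in>Rn n. \<forall>v\<in>Rn n. \<forall>w\<in>Rn n. \<forall>r s.
    F (\<lambda>i. r * v i + s * w i) u = r * F v u + s * F w u \<and> F u (\<lambda>i. r * v i + s * w i) = r * F u v + s * F u w)"

lemma bilinear_formD: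
  assumes "bilinear_form n F" "v \<in> Rn n" "w \<in> Rn n" "u \<in> Rn n"
  shows "F (\<lambda>i. r * v i + s * w i) u = r * F v u + s * F w u" "F u (\<lambda>i. r * v i + s * w i) = r * F u v + s * F u w"
  using assms unfolding bilinear_form_def by blast+

lemma bilinear_matrix:
  assumes F: "bilinear_form n F" and v: "v \<in> Rn n" and w: "w \<in> Rn n"
  shows "F v w = (\<Sum>i<n. \<Sum>j<n. F (unit_vec i) (unit_vec j) * v i * w j)"
proof -
  have 1: "F v w = (\<Sum>j<n. F v (unit_vec j) * w j)" if "v \<in> Rn n" for v
    \<comment> \<open>A scalar function is regarded as a constant vector, so that
      \<open>linear_matrix\<close> applies to linear forms.\<close>
    using linear_matrix[of n "\<lambda>w _. F v w" w] w bilinear_formD(2)[OF F _ _ that] by (simp add: linear_on_set_def)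
  have 2: "F v (unit_vec j) = (\<Sum>i<n. F (unit_vec i) (unit_vec j) * v i)" if "j < n" for j
    using linear_matrix[of n "\<lambda>v _. F v (unit_vec j)" v] v bilinear_formD(1)[OF F _ _ unit_vec_Rn[OF that]] by (simp add: linear_on_set_def)
  have "F v w = (\<Sum>j<n. \<Sum>i<n. F (unit_vec i) (unit_vec j) * v i * w j)"
    unfolding 1[OF v] using 2 by (intro sum.cong refl) (simp add: sum_distrib_right)
  then show ?thesis by (subst sum.swap)
qed

lemma bilinear_continuous:
  assumes F: "bilinear_form n F"
  shows "continuous_on (Rn n) (\<lambda>v. F v v)" "u \<in> Rn n \<Longrightarrow> continuous_on (Rn n) (\<lambda>v. F u v)"
proof -
  have "continuous_on (Rn n) (\<lambda>v. \<Sum>i<n. \<Sum>j<n. F (unit_vec i) (unit_vec j) * v i * v j)" by (intro continuous_intros)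
  then show "continuous_on (Rn n) (\<lambda>v. F v v)"
    by (rule continuous_on_cong[THEN iffD1, rotated 2]) (use bilinear_matrix[OF F] in auto)
  have "continuous_on (Rn n) (\<lambda>v. \<Sum>i<n. \<Sum>j<n. F (unit_vec i) (unit_vec j) * u i * v j)" by (intro continuous_intros)
  then show "u \<in> Rn n \<Longrightarrow> continuous_on (Rn n) (\<lambda>v. F u v)"
    by (rule continuous_on_cong[THEN iffD1, rotated 2]) (use bilinear_matrix[OF F] in auto)
qed

lemma bilinear_zero: "bilinear_form n F \<Longrightarrow> u \<in> Rn n \<Longrightarrow> F (\<lambda>_. 0) u = 0 \<and> F u (\<lambda>_. 0) = 0"
  using bilinear_formD[of n F u u u 0 0] by simp

text \<open>The degenerate case of Cauchy-Schwarz: along the line \<open>w + t w'\<close> the form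
  is a quadratic polynomial in \<open>t\<close> without constant term, which stays nonnegative only
  if its linear term vanishes.\<close>

lemma semidefinite_kernel:
  assumes F: "bilinear_form n F" and sym: "\<And>v w. v \<in> Rn n \<Longrightarrow> w \<in> Rn n \<Longrightarrow> F v w = F w v"
    and W: "lin_subspace n W" and pos: "\<And>w. w \<in> W \<Longrightarrow> 0 \<le> F w w" and w: "w \<in> W" "F w w = 0" and w': "w' \<in> W"
  shows "F w w' = 0"
proof (rule ccontr)
  assume ne: "F w w' \<noteq> 0"
  note R = lin_subspace_Rn[OF W w(1)] lin_subspace_Rn[OF W w']
  have exp: "F (\<lambda>i. 1 * w i + t * w' i) (\<lambda>i. 1 * w i + t * w' i) = 2 * t * F w w' + t * t * F w' w'" for t
    using bilinear_formD[OF F R Rn_lin[OF R], of 1 t 1 t] bilinear_formD[OF F R R(1), of 1 t] bilinear_formD[OF F R R(2), of 1 t]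
      sym[OF R] w(2) by (simp add: algebra_simps)
  have nn: "0 \<le> 2 * t * F w w' + t * t * F w' w'" for t
    using pos[OF lin_subspaceD[OF W w(1) w', of 1 t]] exp[of t] by simp
  define a where "a = F w w'"
  \<comment> \<open>The added 1 makes \<open>b\<close> positive even if \<open>w'\<close> is
    isotropic; inserting \<open>t = - a / b\<close> then gives a negative value.\<close>
  define b where "b = F w' w' + 1"
  have b: "b > 0" using pos[OF w'] by (simp add: b_def)
  have "0 \<le> 2 * (- a / b) * a + (- a / b) * (- a / b) * (b - 1)" using nn[of "- a / b"] by (simp add: a_def b_def)
  also have "\<dots> = - (a * a / b) - a * a / (b * b)" using b by (simp add: field_simps)
  also have "\<dots> < 0" using ne b by (simp add: a_def[symmetric]) (smt (verit, best) divide_pos_pos mult_pos_pos not_real_square_gt_zero)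
  finally show False by simp
qed

text \<open>An invariant nondegenerate form \<open>H\<close> together with an auxiliary invariant
  inner product \<open>B\<close>. That \<open>B\<close> dominates the standard inner product bounds
  its unit sphere, which makes eigenvectors available by compactness.\<close>

locale invariant_form =
  fixes n :: nat and G :: "'g set" and \<rho> :: "'g \<Rightarrow> vec \<Rightarrow> vec" and H B :: "vec \<Rightarrow> vec \<Rightarrow> real"
  assumes H: "bilinear_form n H" and Hsym: "\<And>v w. v \<in> Rn n \<Longrightarrow> w \<in> Rn n \<Longrightarrow> H v w = H w v"
    and nondeg: "\<not> singular_form n H"
    and B: "bilinear_form n B" and Bsym: "\<And>v w. v \<in> Rn n \<Longrightarrow> w \<in> Rn n \<Longrightarrow> B v w = B w v"
    and Bpos: "\<And>w. w \<in> Rn n \<Longrightarrow> (\<Sum>i<n. w i * w i) \<le> B w w"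
    and \<rho>R: "\<And>h v. h \<in> G \<Longrightarrow> v \<in> Rn n \<Longrightarrow> \<rho> h v \<in> Rn n" and \<rho>: "\<And>h. h \<in> G \<Longrightarrow> linear_on_set (Rn n) (\<rho> h)"
    and Hinv: "\<And>h v w. h \<in> G \<Longrightarrow> v \<in> Rn n \<Longrightarrow> w \<in> Rn n \<Longrightarrow> H (\<rho> h v) (\<rho> h w) = H v w"
    and Binv: "\<And>h v w. h \<in> G \<Longrightarrow> v \<in> Rn n \<Longrightarrow> w \<in> Rn n \<Longrightarrow> B (\<rho> h v) (\<rho> h w) = B v w"
    and \<rho>inv: "\<And>h. h \<in> G \<Longrightarrow> \<exists>h'\<in>G. \<forall>v\<in>Rn n. \<rho> h (\<rho> h' v) = v"
begin

lemma B_pos: "w \<in> Rn n \<Longrightarrow> w \<noteq> (\<lambda>_. 0) \<Longrightarrow> 0 < B w w"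
proof -
  assume w: "w \<in> Rn n" "w \<noteq> (\<lambda>_. 0)"
  obtain i where i: "w i \<noteq> 0" using w(2) by auto
  then have "i < n" using w(1) by (metis Rn_iff linorder_not_less)
  then have "w i * w i \<le> (\<Sum>i<n. w i * w i)" by (intro member_le_sum) auto
  moreover have "0 < w i * w i" using i by (simp add: zero_less_mult_iff) linarith
  ultimately show "0 < B w w" using Bpos[OF w(1)] by linarith
qed

definition positive_part :: "vec set \<Rightarrow> bool"
  where "positive_part V \<longleftrightarrow> lin_subspace n V \<and> (\<forall>h\<in>G. \<rho> h ` V \<subseteq> V) \<and> (\<forall>v\<in>V. v \<noteq> (\<lambda>_. 0) \<longrightarrow> 0 < H v v)"

text \<open>Orthogonality refers to the indefinite form \<open>H\<close>, not to the inner product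
  \<open>B\<close>.\<close>

definition orth :: "vec set \<Rightarrow> vec set"
  where "orth V = {w \<in> Rn n. \<forall>v\<in>V. H v w = 0}"

lemma orth_subspace: "V \<subseteq> Rn n \<Longrightarrow> lin_subspace n (orth V)"
  unfolding lin_subspace_def orth_def using bilinear_formD(2)[OF H] bilinear_zero[OF H] Rn_lin by (auto simp: subset_iff)

lemma orth_invariant:
  assumes V: "positive_part V" and h: "h \<in> G"
  shows "\<rho> h ` orth V \<subseteq> orth V"
proof
  fix x assume "x \<in> \<rho> h ` orth V"
  then obtain w where w: "w \<in> orth V" "x = \<rho> h w" by blast
  obtain h' where h': "h' \<in> G" "\<forall>v\<in>Rn n. \<rho> h (\<rho> h' v) = v" using \<rho>inv[OF h] by blast
  have VR: "v \<in> Rn n" if "v \<in> V" for v using V lin_subspace_Rn that by (auto simp: positive_part_def)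
  have wR: "w \<in> Rn n" using w by (simp add: orth_def)
  have "H v x = 0" if v: "v \<in> V" for v
  proof -
    have v': "\<rho> h' v \<in> V" using V h'(1) v by (auto simp: positive_part_def)
    have "H v x = H (\<rho> h (\<rho> h' v)) (\<rho> h w)" using h'(2) VR[OF v] w(2) by simp
    also have "\<dots> = H (\<rho> h' v) w" by (rule Hinv[OF h VR[OF v'] wR])
    finally show ?thesis using w(1) v' by (simp add: orth_def)
  qed
  then show "x \<in> orth V" using \<rho>R[OF h wR] w(2) by (simp add: orth_def)
qed

text \<open>\<open>H\<close> is definite on \<open>V\<close>, so its Gram map
  \<open>y \<mapsto> A (P y)\<close> is injective and therefore surjective. Hence some vector of
  \<open>V\<close> pairs with \<open>V\<close> in the same way as \<open>x\<close>.\<close>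

lemma orth_decomposition:
  assumes V: "positive_part V" and x: "x \<in> Rn n"
  shows "\<exists>v\<in>V. (\<lambda>i. 1 * x i + (-1) * v i) \<in> orth V"
proof -
  have Vs: "lin_subspace n V" and Vp: "\<And>v. v \<in> V \<Longrightarrow> v \<noteq> (\<lambda>_. 0) \<Longrightarrow> 0 < H v v" using V by (auto simp: positive_part_def)
  obtain m P Q where P: "linear_on_set (Rn m) P" and Q: "linear_on_set (Rn n) Q"
    and PQ: "\<And>y. y \<in> Rn m \<Longrightarrow> P y \<in> V \<and> Q (P y) = y" "\<And>x. x \<in> Rn n \<Longrightarrow> Q x \<in> Rn m" "\<And>x. x \<in> V \<Longrightarrow> P (Q x) = x"
    by (rule subspace_coordinates[OF Vs]) blast
  have PR: "P y \<in> Rn n" if "y \<in> Rn m" for y using PQ(1)[OF that] lin_subspace_Rn[OF Vs] by blast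
  define A where "A x = (\<lambda>j. if j < m then H (P (unit_vec j)) x else 0)" for x
  have AR: "A x \<in> Rn m" for x by (simp add: A_def Rn_iff)
  have A_lin: "A (\<lambda>i. r * v i + s * w i) = (\<lambda>i. r * A v i + s * A w i)" if "v \<in> Rn n" "w \<in> Rn n" for r s v w
    using bilinear_formD(2)[OF H that PR[OF unit_vec_Rn]] by (auto simp: A_def)
  have A_test: "H (P y) x = (\<Sum>j<m. A x j * y j)" if y: "y \<in> Rn m" and x: "x \<in> Rn n" for x y
  proof -
    have "linear_on_set (Rn m) (\<lambda>y _. H (P y) x)"
      using bilinear_formD(1)[OF H PR PR x] linear_on_setD[OF P] by (simp add: linear_on_set_def)
    from linear_matrix[OF this y] show ?thesis by (auto simp: A_def intro: sum.cong)
  qed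
  have "(\<lambda>y. A (P y)) ` Rn m = Rn m"
  proof (rule linear_injective_surj)
    show "lin_subspace m (Rn m)" using Rn_lin by (simp add: lin_subspace_def)
    show "linear_on_set (Rn m) (\<lambda>y. A (P y))"
      unfolding linear_on_set_def using linear_on_setD[OF P] A_lin[OF PR PR] by simp
    show "inj_on (\<lambda>y. A (P y)) (Rn m)"
    proof (rule inj_onI)
      fix v w assume v: "v \<in> Rn m" and w: "w \<in> Rn m" and e: "A (P v) = A (P w)"
      define d where "d = (\<lambda>i. 1 * v i + (-1) * w i)"
      have d: "d \<in> Rn m" unfolding d_def by (rule Rn_lin[OF v w])
      have Pd: "P d = (\<lambda>i. 1 * P v i + (-1) * P w i)" unfolding d_def by (rule linear_on_setD[OF P v w])
      have "A (P d) = (\<lambda>_. 0)" unfolding Pd A_lin[OF PR[OF v] PR[OF w]] e by simp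
      then have "H (P d) (P d) = 0" using A_test[OF d PR[OF d]] by simp
      then have "P d = (\<lambda>_. 0)" using Vp PQ(1)[OF d] by (metis less_irrefl)
      then have "d = Q (\<lambda>_. 0)" using PQ(1)[OF d] by metis
      then have "d = (\<lambda>_. 0)" using linear_zero[OF Q Rn_zero] by simp
      then show "v = w" by (simp add: d_def fun_eq_iff)
    qed
  qed (use AR in auto)
  then obtain y where y: "y \<in> Rn m" "A (P y) = A x" using AR by (metis imageE)
  show ?thesis
  proof (rule bexI[of _ "P y"])
    have "H v (\<lambda>i. 1 * x i + (-1) * P y i) = 0" if v: "v \<in> V" for v
    proof -
      have vR: "v \<in> Rn n" by (rule lin_subspace_Rn[OF Vs v])
      have "H v x = H v (P y)"
        using A_test[OF PQ(2)[OF vR] x] A_test[OF PQ(2)[OF vR] PR[OF y(1)]] PQ(3)[OF v] y(2) by simp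
      then show ?thesis using bilinear_formD(2)[OF H x PR[OF y(1)] vR, of 1 "-1"] by simp
    qed
    then show "(\<lambda>i. 1 * x i + (-1) * P y i) \<in> orth V" using Rn_lin[OF x PR[OF y(1)], of 1 "-1"] by (simp add: orth_def)
  qed (use PQ(1)[OF y(1)] in blast)
qed

text \<open>The eigenspace of the largest eigenvalue of \<open>H\<close> with respect to \<open>B\<close> on the complement enlarges a
  positive part as long as that eigenvalue is positive.\<close>

lemma positive_part_extend:
  assumes V: "positive_part V" and x: "x \<in> orth V" "0 < H x x"
  obtains V' w where "positive_part V'" "V \<subseteq> V'" "w \<in> V'" "w \<notin> V"
proof -
  have Vs: "lin_subspace n V" and Vp: "\<And>v. v \<in> V \<Longrightarrow> v \<noteq> (\<lambda>_. 0) \<Longrightarrow> 0 < H v v"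
    and Vi: "\<And>h v. h \<in> G \<Longrightarrow> v \<in> V \<Longrightarrow> \<rho> h v \<in> V" using V by (auto simp: positive_part_def)
  note VR = lin_subspace_Rn[OF Vs]
  define W where "W = orth V"
  have Ws: "lin_subspace n W" unfolding W_def by (rule orth_subspace) (use VR in blast)
  note WR = lin_subspace_Rn[OF Ws]
  have WV: "H v w = 0" if "v \<in> V" "w \<in> W" for v w using that by (simp add: W_def orth_def)
  define C where "C = {w \<in> W. B w w = 1}"
  have "compact C"
  proof -
    have cl: "closed {w \<in> Rn n. F w = c}" if "continuous_on (Rn n) F" for F :: "vec \<Rightarrow> real" and c
    proof -
      have "closed (Rn n)" using closedin_Euclidean_space_iff[of n "Rn n"] closedin_topspace by blast
      then have "closed (Rn n \<inter> F -` {c})" using that continuous_closed_preimage closed_singleton by blast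
      moreover have "Rn n \<inter> F -` {c} = {w \<in> Rn n. F w = c}" by auto
      ultimately show ?thesis by simp
    qed
    have "C = {w \<in> Rn n. \<forall>i<n. \<bar>w i - 0\<bar> \<le> 1} \<inter> ({w \<in> Rn n. B w w = 1} \<inter> (\<Inter>v\<in>V. {w \<in> Rn n. H v w = 0}))"
    proof -
      have "\<bar>w i\<bar> \<le> 1" if "w \<in> Rn n" "B w w = 1" "i < n" for w i
      proof -
        have "w i * w i \<le> (\<Sum>i<n. w i * w i)" using that(3) by (intro member_le_sum) auto
        then have "w i * w i \<le> 1" using Bpos[OF that(1)] that(2) by simp
        then show ?thesis by (simp add: abs_square_le_1[unfolded power2_eq_square])
      qed
      then show ?thesis by (auto simp: C_def W_def orth_def)
    qed
    moreover have "closed ({w \<in> Rn n. B w w = 1} \<inter> (\<Inter>v\<in>V. {w \<in> Rn n. H v w = 0}))"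
      by (intro closed_Int closed_INT ballI cl bilinear_continuous[OF B] bilinear_continuous[OF H] VR)
    ultimately show ?thesis using compact_Int_closed[OF compact_closed_box[of n "\<lambda>_. 0" 1]] by simp
  qed
  have scale: "\<exists>c. c \<noteq> 0 \<and> (\<lambda>i. c * w i + 0 * w i) \<in> C \<and> H w w = H (\<lambda>i. c * w i + 0 * w i) (\<lambda>i. c * w i + 0 * w i) * B w w"
    if w: "w \<in> W" "w \<noteq> (\<lambda>_. 0)" for w
  proof -
    have b: "0 < B w w" by (rule B_pos[OF WR[OF w(1)] w(2)])
    define c where "c = 1 / sqrt (B w w)"
    have cc: "c * c * B w w = 1" using b by (simp add: c_def)
    note R = WR[OF w(1)]
    have F: "F (\<lambda>i. c * w i + 0 * w i) (\<lambda>i. c * w i + 0 * w i) = c * c * F w w" if "bilinear_form n F" for F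
      using bilinear_formD[OF that R R Rn_lin[OF R R], of c 0 c 0] bilinear_formD[OF that R R R, of c 0] by simp
    have "(\<lambda>i. c * w i + 0 * w i) \<in> C" using lin_subspaceD[OF Ws w(1) w(1), of c 0] F[OF B] cc by (simp add: C_def)
    moreover have "H w w = H (\<lambda>i. c * w i + 0 * w i) (\<lambda>i. c * w i + 0 * w i) * B w w"
      unfolding F[OF H] using cc by (simp add: algebra_simps)
    moreover have "c \<noteq> 0" using b by (simp add: c_def)
    ultimately show ?thesis by blast
  qed
  have xne: "x \<noteq> (\<lambda>_. 0)" using x(2) bilinear_zero[OF H Rn_zero] by auto
  have "C \<noteq> {}" using scale[OF x(1)[folded W_def] xne] by blast
  moreover have "continuous_on C (\<lambda>w. H w w)"
    by (rule continuous_on_subset[OF bilinear_continuous(1)[OF H]]) (use WR in \<open>auto simp: C_def\<close>)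
  ultimately obtain w0 where w0: "w0 \<in> C" "\<And>w. w \<in> C \<Longrightarrow> H w w \<le> H w0 w0"
    using continuous_attains_sup[OF \<open>compact C\<close>] by blast
  define l where "l = H w0 w0"
  have le: "H w w \<le> l * B w w" if "w \<in> W" for w
  proof (cases "w = (\<lambda>_. 0)")
    case True
    then show ?thesis using bilinear_zero[OF H Rn_zero] bilinear_zero[OF B Rn_zero] by simp
  next
    case False
    obtain c where c: "(\<lambda>i. c * w i + 0 * w i) \<in> C" "H w w = H (\<lambda>i. c * w i + 0 * w i) (\<lambda>i. c * w i + 0 * w i) * B w w"
      using scale[OF \<open>w \<in> W\<close> False] by blast
    have "0 \<le> B w w" using B_pos[OF WR[OF \<open>w \<in> W\<close>] False] by simp
    from mult_right_mono[OF w0(2)[OF c(1)] this] show ?thesis using c(2) by (simp only: l_def)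
  qed
  have l: "0 < l"
    using le[OF x(1)[folded W_def]] x(2) B_pos[OF WR[OF x(1)[folded W_def]] xne] by (smt (verit) mult_nonpos_nonneg)
  have w0W: "w0 \<in> W" and w0B: "B w0 w0 = 1" using w0(1) by (auto simp: C_def)
  \<comment> \<open>\<open>l * B - H\<close> is semidefinite on \<open>W\<close> by maximality and
    vanishes at \<open>w0\<close>; \<open>semidefinite_kernel\<close> replaces the Lagrange
    multiplier.\<close>
  have w0_eigen: "l * B w0 w - H w0 w = 0" if "w \<in> W" for w
  proof (rule semidefinite_kernel[of n "\<lambda>v w. l * B v w - H v w" W])
    show "bilinear_form n (\<lambda>v w. l * B v w - H v w)"
      unfolding bilinear_form_def using bilinear_formD[OF B] bilinear_formD[OF H] by (simp add: algebra_simps)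
  qed (use Ws le w0W w0B that Hsym Bsym in \<open>auto simp: l_def\<close>)
  \<comment> \<open>The full eigenspace of the largest eigenvalue is taken: the group need not
    preserve the line of \<open>w0\<close>, but it preserves both forms.\<close>
  define E where "E = {w \<in> W. \<forall>w'\<in>W. H w w' = l * B w w'}"
  have Es: "lin_subspace n E"
    unfolding lin_subspace_def E_def
    using WR lin_subspaceD[OF Ws] lin_subspace_zero[OF Ws] bilinear_formD(1)[OF H WR WR WR] bilinear_formD(1)[OF B WR WR WR]
      bilinear_zero[OF H WR] bilinear_zero[OF B WR] by (auto simp: algebra_simps)
  have EW: "w \<in> W" if "w \<in> E" for w using that by (simp add: E_def)
  have Ei: "\<rho> h w \<in> E" if h: "h \<in> G" and w: "w \<in> E" for h w
  proof -
    obtain h' where h': "h' \<in> G" "\<forall>v\<in>Rn n. \<rho> h (\<rho> h' v) = v" using \<rho>inv[OF h] by blast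
    have Wi: "\<rho> k v \<in> W" if "k \<in> G" "v \<in> W" for k v using orth_invariant[OF V that(1)] that(2) by (auto simp: W_def)
    have "H (\<rho> h w) w' = l * B (\<rho> h w) w'" if w': "w' \<in> W" for w'
    proof -
      have e: "w' = \<rho> h (\<rho> h' w')" using h'(2) WR[OF w'] by simp
      note R = WR[OF EW[OF w]] WR[OF Wi[OF h'(1) w']]
      have "H (\<rho> h w) w' = H w (\<rho> h' w')" using Hinv[OF h R] e by simp
      also have "\<dots> = l * B w (\<rho> h' w')" using w Wi[OF h'(1) w'] by (simp add: E_def)
      also have "\<dots> = l * B (\<rho> h w) w'" using Binv[OF h R] e by simp
      finally show ?thesis .
    qed
    then show ?thesis using Wi[OF h EW[OF w]] by (simp add: E_def)
  qed
  define V' where "V' = {u. \<exists>v\<in>V. \<exists>w\<in>E. u = (\<lambda>i. 1 * v i + 1 * w i)}"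
  have sumI: "(\<lambda>i. 1 * v i + 1 * w i) \<in> V'" if "v \<in> V" "w \<in> E" for v w using that by (auto simp: V'_def)
  show thesis
  proof (rule that[of V' w0])
    show "positive_part V'"
      unfolding positive_part_def
    proof (intro conjI ballI impI)
      show "lin_subspace n V'"
        unfolding lin_subspace_def
      proof (intro conjI ballI allI)
        show "V' \<subseteq> Rn n" using Rn_lin[OF VR WR[OF EW], of _ _ 1 1] by (auto simp: V'_def)
        show "(\<lambda>_. 0) \<in> V'" using sumI[OF lin_subspace_zero[OF Vs] lin_subspace_zero[OF Es]] by simp
        fix a b r s assume "a \<in> V'" "b \<in> V'"
        then obtain v w v' w' where v: "v \<in> V" "w \<in> E" "a = (\<lambda>i. 1 * v i + 1 * w i)" "v' \<in> V" "w' \<in> E" "b = (\<lambda>i. 1 * v' i + 1 * w' i)"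
          by (auto simp: V'_def)
        have "(\<lambda>i. r * a i + s * b i) = (\<lambda>i. 1 * (r * v i + s * v' i) + 1 * (r * w i + s * w' i))"
          by (simp add: v algebra_simps)
        then show "(\<lambda>i. r * a i + s * b i) \<in> V'"
          using sumI[OF lin_subspaceD[OF Vs v(1,4), of r s] lin_subspaceD[OF Es v(2,5), of r s]] by simp
      qed
      show "\<rho> h ` V' \<subseteq> V'" if h: "h \<in> G" for h
      proof
        fix y assume "y \<in> \<rho> h ` V'"
        then obtain v w where v: "v \<in> V" "w \<in> E" "y = \<rho> h (\<lambda>i. 1 * v i + 1 * w i)" by (auto simp: V'_def)
        have "y = (\<lambda>i. 1 * \<rho> h v i + 1 * \<rho> h w i)" unfolding v(3) by (rule linear_on_setD[OF \<rho>[OF h] VR[OF v(1)] WR[OF EW[OF v(2)]]])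
        then show "y \<in> V'" using sumI[OF Vi[OF h v(1)] Ei[OF h v(2)]] by simp
      qed
      fix u assume u: "u \<in> V'" "u \<noteq> (\<lambda>_. 0)"
      then obtain v w where v: "v \<in> V" "w \<in> E" "u = (\<lambda>i. 1 * v i + 1 * w i)" by (auto simp: V'_def)
      note R = VR[OF v(1)] WR[OF EW[OF v(2)]]
      have "H u u = H v v + 2 * H v w + H w w"
        unfolding v(3) using bilinear_formD[OF H R Rn_lin[OF R], of 1 1 1 1] bilinear_formD[OF H R R(1), of 1 1] bilinear_formD[OF H R R(2), of 1 1]
          Hsym[OF R] by simp
      then have e: "H u u = H v v + l * B w w" using WV[OF v(1) EW[OF v(2)]] v(2) EW[OF v(2)] by (simp add: E_def)
      have "0 \<le> H v v" using Vp[OF v(1)] bilinear_zero[OF H Rn_zero] by (cases "v = (\<lambda>_. 0)") auto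
      moreover have "0 \<le> l * B w w" using B_pos[OF R(2)] l bilinear_zero[OF B Rn_zero] by (cases "w = (\<lambda>_. 0)") auto
      moreover have "v \<noteq> (\<lambda>_. 0) \<or> w \<noteq> (\<lambda>_. 0)" using u(2) v(3) by auto
      moreover have "0 < H v v" if "v \<noteq> (\<lambda>_. 0)" using Vp[OF v(1) that] .
      moreover have "0 < l * B w w" if "w \<noteq> (\<lambda>_. 0)" using B_pos[OF R(2) that] l by simp
      ultimately show "0 < H u u" unfolding e by linarith
    qed
    show "V \<subseteq> V'" using sumI[OF _ lin_subspace_zero[OF Es]] by fastforce
    have w0E: "w0 \<in> E" using w0W w0_eigen by (simp add: E_def)
    show "w0 \<in> V'" using sumI[OF lin_subspace_zero[OF Vs] w0E] by simp
    show "w0 \<notin> V"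
    proof
      assume "w0 \<in> V"
      then have "H w0 w0 = 0" using WV w0W by blast
      then show False using l by (simp add: l_def)
    qed
  qed
qed

text \<open>In an invariant positive subspace of maximal dimension no extension is possible, so
  \<open>H\<close> is nonpositive on the orthogonal complement. Nondegeneracy makes it negative
  definite there.\<close>

lemma invariant_splitting_ex: "\<exists>Vp Vm. invariant_splitting G \<rho> n H Vp Vm"
proof -
  \<comment> \<open>Dimension at least \<open>k\<close> is expressed by an injective linear map from
    \<open>Rn k\<close>, whence the bound by \<open>n\<close>.\<close>
  define D where "D k \<longleftrightarrow> (\<exists>V P. positive_part V \<and> linear_on_set (Rn k) P \<and> P ` Rn k \<subseteq> V \<and> inj_on P (Rn k))" for k
  have bound: "k \<le> n" if Dk: "D k" for k
  proof -
    obtain V P where V: "positive_part V" "linear_on_set (Rn k) P" "P ` Rn k \<subseteq> V" "inj_on P (Rn k)" using Dk by (auto simp: D_def)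
    then have "P ` Rn k \<subseteq> Rn n" using lin_subspace_Rn by (auto simp: positive_part_def)
    then show ?thesis using linear_injective_dim V by blast
  qed
  have "D 0"
  proof -
    have "\<rho> h (\<lambda>_. 0) = (\<lambda>_. 0)" if "h \<in> G" for h by (rule linear_zero[OF \<rho>[OF that] Rn_zero])
    then have "positive_part {\<lambda>_. 0}" by (auto simp: positive_part_def lin_subspace_def)
    then show ?thesis unfolding D_def by (intro exI[of _ "{\<lambda>_. 0}"] exI[of _ "\<lambda>v. v"]) (auto simp: Rn_0 linear_on_set_def)
  qed
  moreover have "\<forall>k. D k \<longrightarrow> k \<le> n" using bound by simp
  ultimately have "\<exists>k. D k \<and> (\<forall>l. D l \<longrightarrow> l \<le> k)" by (rule Nat.ex_has_greatest_nat)
  then obtain k where k: "D k" "\<And>l. D l \<Longrightarrow> l \<le> k" by blast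
  obtain V P where V: "positive_part V" and P: "linear_on_set (Rn k) P" "P ` Rn k \<subseteq> V" "inj_on P (Rn k)" using k(1) by (auto simp: D_def)
  have Vs: "lin_subspace n V" and Vp: "\<And>v. v \<in> V \<Longrightarrow> v \<noteq> (\<lambda>_. 0) \<Longrightarrow> 0 < H v v"
    and Vi: "\<And>h. h \<in> G \<Longrightarrow> \<rho> h ` V \<subseteq> V" using V by (auto simp: positive_part_def)
  note VR = lin_subspace_Rn[OF Vs]
  have Ws: "lin_subspace n (orth V)" by (rule orth_subspace) (use VR in blast)
  note WR = lin_subspace_Rn[OF Ws]
  have neg: "H x x \<le> 0" if x: "x \<in> orth V" for x
  proof (rule ccontr)
    assume "\<not> H x x \<le> 0"
    then have "0 < H x x" by simp
    then obtain V' w where V': "positive_part V'" "V \<subseteq> V'" "w \<in> V'" "w \<notin> V"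
      by (rule positive_part_extend[OF V x])
    have V's: "lin_subspace n V'" using V'(1) by (simp add: positive_part_def)
    define cut where "cut y = (\<lambda>i. if i < k then y i else 0)" for y :: vec
    have cutR: "cut y \<in> Rn k" for y by (simp add: cut_def Rn_iff)
    have cut_lin: "cut (\<lambda>i. r * v i + s * w i) = (\<lambda>i. r * cut v i + s * cut w i)" for r s v w by (auto simp: cut_def)
    define S where "S y = (\<lambda>i. 1 * P (cut y) i + y k * w i)" for y
    have PV: "P (cut y) \<in> V" for y using P(2) cutR by blast
    have "D (Suc k)"
      unfolding D_def
    proof (intro exI conjI)
      show "positive_part V'" by (rule V'(1))
      show "linear_on_set (Rn (Suc k)) S"
        unfolding linear_on_set_def S_def cut_lin linear_on_setD[OF P(1) cutR cutR] by (auto simp: algebra_simps)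
      show "S ` Rn (Suc k) \<subseteq> V'" using lin_subspaceD[OF V's _ V'(3), of _ 1] PV V'(2) unfolding S_def by blast
      show "inj_on S (Rn (Suc k))"
      proof (rule inj_onI)
        fix v v' assume v: "v \<in> Rn (Suc k)" "v' \<in> Rn (Suc k)" and e: "S v = S v'"
        have em: "v k = v' k"
        proof (rule ccontr)
          assume ne: "v k \<noteq> v' k"
          define d where "d = v' k - v k"
          have d: "d \<noteq> 0" using ne by (simp add: d_def)
          have "w = (\<lambda>i. (1 / d) * P (cut v) i + (- 1 / d) * P (cut v') i)"
          proof
            fix i
            have "P (cut v) i - P (cut v') i = d * w i" using fun_cong[OF e, of i] by (simp add: S_def d_def algebra_simps)
            then show "w i = (1 / d) * P (cut v) i + (- 1 / d) * P (cut v') i" using d by (simp add: field_simps)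
          qed
          then show False using lin_subspaceD[OF Vs PV PV] V'(4) by metis
        qed
        then have "P (cut v) = P (cut v')" using e by (simp add: S_def fun_eq_iff)
        then have "cut v = cut v'" using P(3) cutR by (metis inj_onD)
        show "v = v'"
        proof
          fix i
          consider "i < k" | "i = k" | "Suc k \<le> i" by linarith
          then show "v i = v' i"
            by cases (use fun_cong[OF \<open>cut v = cut v'\<close>, of i] em v in \<open>auto simp: cut_def Rn_iff\<close>)
        qed
      qed
    qed
    then show False using k(2) by fastforce
  qed
  \<comment> \<open>An isotropic vector of the complement is orthogonal to the complement by
    semidefiniteness and to \<open>V\<close> by definition, hence to everything.\<close>
  have negdef: "H w w < 0" if w: "w \<in> orth V" "w \<noteq> (\<lambda>_. 0)" for w
  proof (rule ccontr)
    assume "\<not> H w w < 0"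
    then have w00: "H w w = 0" using neg[OF w(1)] by simp
    have orthw: "- H w w' = 0" if "w' \<in> orth V" for w'
      by (rule semidefinite_kernel[of n "\<lambda>v w. - H v w" "orth V"])
        (use H Hsym Ws neg w00 w(1) that in \<open>auto simp: bilinear_form_def\<close>)
    have "H w y = 0" if y: "y \<in> Rn n" for y
    proof -
      obtain v where v: "v \<in> V" "(\<lambda>i. 1 * y i + (-1) * v i) \<in> orth V" using orth_decomposition[OF V y] by blast
      have "H w v = 0" using w(1) v(1) Hsym[OF WR[OF w(1)] VR[OF v(1)]] by (simp add: orth_def)
      then show ?thesis using orthw[OF v(2)] bilinear_formD(2)[OF H y VR[OF v(1)] WR[OF w(1)], of 1 "-1"] by simp
    qed
    then show False using nondeg w WR unfolding singular_form_def by blast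
  qed
  have "invariant_splitting G \<rho> n H V (orth V)"
    unfolding invariant_splitting_def
  proof (intro conjI ballI impI)
    fix x assume x: "x \<in> Rn n"
    obtain v where v: "v \<in> V" "(\<lambda>i. 1 * x i + (-1) * v i) \<in> orth V" using orth_decomposition[OF V x] by blast
    show "\<exists>!(a, b). a \<in> V \<and> b \<in> orth V \<and> x = (\<lambda>i. a i + b i)"
    proof (rule ex1I[of _ "(v, \<lambda>i. 1 * x i + (-1) * v i)"])
      show "case (v, \<lambda>i. 1 * x i + (-1) * v i) of (a, b) \<Rightarrow> a \<in> V \<and> b \<in> orth V \<and> x = (\<lambda>i. a i + b i)" using v by simp
      fix ab assume "case ab of (a, b) \<Rightarrow> a \<in> V \<and> b \<in> orth V \<and> x = (\<lambda>i. a i + b i)"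
      then obtain a b where ab: "ab = (a, b)" "a \<in> V" "b \<in> orth V" "x = (\<lambda>i. a i + b i)" by (cases ab) auto
      define d where "d = (\<lambda>i. 1 * a i + (-1) * v i)"
      have dV: "d \<in> V" unfolding d_def by (rule lin_subspaceD[OF Vs ab(2) v(1)])
      have "d = (\<lambda>i. 1 * (1 * x i + (-1) * v i) + (-1) * b i)" by (simp add: d_def ab(4))
      then have "d \<in> orth V" using lin_subspaceD[OF Ws v(2) ab(3)] by metis
      then have "H d d = 0" using dV by (simp add: orth_def)
      then have "d = (\<lambda>_. 0)" using Vp[OF dV] by force
      then have "a = v" by (simp add: d_def fun_eq_iff)
      then show "ab = (v, \<lambda>i. 1 * x i + (-1) * v i)" using ab by simp
    qed
  qed (use Vs Ws Vp Vi negdef orth_invariant[OF V] in auto)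
  then show ?thesis by blast
qed

end

lemma invariant_splitting_uminus:
  assumes "invariant_splitting G \<rho> n H Vp Vm"
  shows "invariant_splitting G \<rho> n (\<lambda>v w. - H v w) Vm Vp"
proof -
  have "\<exists>!(x, y). x \<in> Vm \<and> y \<in> Vp \<and> v = (\<lambda>i. x i + y i)" if v: "v \<in> Rn n" for v
  proof -
    have "\<exists>!(x, y). x \<in> Vp \<and> y \<in> Vm \<and> v = (\<lambda>i. x i + y i)" using assms v by (simp add: invariant_splitting_def)
    then obtain x y where xy: "x \<in> Vp" "y \<in> Vm" "v = (\<lambda>i. x i + y i)"
      and u: "\<And>x' y'. x' \<in> Vp \<Longrightarrow> y' \<in> Vm \<Longrightarrow> v = (\<lambda>i. x' i + y' i) \<Longrightarrow> (x', y') = (x, y)"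
      by (auto elim!: ex1E)
    show ?thesis
    proof (rule ex1I[of _ "(y, x)"])
      show "case (y, x) of (x, y) \<Rightarrow> x \<in> Vm \<and> y \<in> Vp \<and> v = (\<lambda>i. x i + y i)" using xy by (simp add: add.commute)
      fix z assume "case z of (x, y) \<Rightarrow> x \<in> Vm \<and> y \<in> Vp \<and> v = (\<lambda>i. x i + y i)"
      then show "z = (y, x)" using u[of "snd z" "fst z"] by (cases z) (simp add: add.commute)
    qed
  qed
  then show ?thesis using assms by (auto simp: invariant_splitting_def)
qed

section \<open>Comparison of representations\<close>

lemma rep_iso_iff: "rep_iso G (V, \<rho>) (W, \<sigma>) \<longleftrightarrow>
    (\<exists>T. linear_on_set V T \<and> bij_betw T V W \<and> (\<forall>h\<in>G. \<forall>v\<in>V. T (\<rho> h v) = \<sigma> h (T v)))"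
  by (simp add: rep_iso_def)

lemma rep_iso_refl: "rep_iso G R R"
  by (cases R) (auto simp: rep_iso_iff linear_on_set_def intro!: exI[of _ "\<lambda>v. v"] bij_betw_id[unfolded id_def])

lemma rep_iso_trans:
  assumes "rep_iso G R S" "rep_iso G S U"
  shows "rep_iso G R U"
proof -
  obtain V \<rho> W \<sigma> Z \<tau> where R: "R = (V, \<rho>)" "S = (W, \<sigma>)" "U = (Z, \<tau>)" by (cases R, cases S, cases U)
  obtain T where T: "linear_on_set V T" "bij_betw T V W" "\<And>h v. h \<in> G \<Longrightarrow> v \<in> V \<Longrightarrow> T (\<rho> h v) = \<sigma> h (T v)"
    using assms(1) by (auto simp: R rep_iso_iff)
  obtain T' where T': "linear_on_set W T'" "bij_betw T' W Z" "\<And>h v. h \<in> G \<Longrightarrow> v \<in> W \<Longrightarrow> T' (\<sigma> h v) = \<tau> h (T' v)"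
    using assms(2) by (auto simp: R rep_iso_iff)
  have TW: "T v \<in> W" if "v \<in> V" for v using T(2) that by (rule bij_betwE[rule_format])
  have "linear_on_set V (T' \<circ> T)"
    unfolding linear_on_set_def o_def using linear_on_setD[OF T(1)] linear_on_setD[OF T'(1) TW TW] by simp
  moreover have "bij_betw (T' \<circ> T) V Z" by (rule bij_betw_trans[OF T(2) T'(2)])
  ultimately show ?thesis unfolding R rep_iso_iff using T(3) T'(3) TW by (intro exI[of _ "T' \<circ> T"]) simp
qed

text \<open>The inverse is linear because combinations of vectors of \<open>V\<close> stay in
  \<open>V\<close>, and equivariant because \<open>V\<close> is invariant.\<close>

lemma rep_iso_sym:
  assumes iso: "rep_iso G (V, \<rho>) (W, \<sigma>)" and V: "lin_subspace n V" and inv: "\<And>h v. h \<in> G \<Longrightarrow> v \<in> V \<Longrightarrow> \<rho> h v \<in> V"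
  shows "rep_iso G (W, \<sigma>) (V, \<rho>)"
proof -
  obtain T where T: "linear_on_set V T" "bij_betw T V W" "\<And>h v. h \<in> G \<Longrightarrow> v \<in> V \<Longrightarrow> T (\<rho> h v) = \<sigma> h (T v)"
    using iso by (auto simp: rep_iso_iff)
  define S where "S = inv_into V T"
  have S: "S w \<in> V \<and> T (S w) = w" if "w \<in> W" for w
    using that T(2) by (auto simp: S_def bij_betw_def inv_into_into f_inv_into_f)
  have ST: "S (T v) = v" if "v \<in> V" for v using that T(2) by (simp add: S_def bij_betw_def)
  have "linear_on_set W S"
    unfolding linear_on_set_def
  proof (intro ballI allI)
    fix v w r s assume v: "v \<in> W" and w: "w \<in> W"
    have "(\<lambda>i. r * v i + s * w i) = T (\<lambda>i. r * S v i + s * S w i)"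
      using linear_on_setD[OF T(1), of "S v" "S w" r s] S[OF v] S[OF w] by simp
    then show "S (\<lambda>i. r * v i + s * w i) = (\<lambda>i. r * S v i + s * S w i)"
      using ST[OF lin_subspaceD[OF V]] S[OF v] S[OF w] by simp
  qed
  moreover have "bij_betw S W V" unfolding S_def by (rule bij_betw_inv_into[OF T(2)])
  moreover have "S (\<sigma> h w) = \<rho> h (S w)" if "h \<in> G" "w \<in> W" for h w
    using T(3)[OF that(1), of "S w"] S[OF that(2)] ST[OF inv[OF that(1)], of "S w"] by simp
  ultimately show ?thesis unfolding rep_iso_iff by blast
qed

lemma linear_inj_onI:
  assumes V: "lin_subspace n V" and T: "linear_on_set V T" and ker: "\<And>v. v \<in> V \<Longrightarrow> T v = (\<lambda>_. 0) \<Longrightarrow> v = (\<lambda>_. 0)"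
  shows "inj_on T V"
proof (rule inj_onI)
  fix v w assume v: "v \<in> V" and w: "w \<in> V" and e: "T v = T w"
  define d where "d = (\<lambda>i. 1 * v i + (-1) * w i)"
  have "d \<in> V" unfolding d_def by (rule lin_subspaceD[OF V v w])
  moreover have "T d = (\<lambda>_. 0)" unfolding d_def linear_on_setD[OF T v w] e by simp
  ultimately have "d = (\<lambda>_. 0)" by (rule ker)
  then show "v = w" by (simp add: d_def fun_eq_iff)
qed

lemma splitting_unique:
  assumes A: "invariant_splitting G \<rho> n H Vp Vm" and a: "a \<in> Vp" "a' \<in> Vp" and b: "b \<in> Vm" "b' \<in> Vm"
    and e: "(\<lambda>i. a i + b i) = (\<lambda>i. a' i + b' i)"
  shows "a = a' \<and> b = b'"
proof -
  have V: "lin_subspace n Vp" "lin_subspace n Vm" using A by (auto simp: invariant_splitting_def)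
  have "(\<lambda>i. a i + b i) \<in> Rn n"
    using Rn_lin[OF lin_subspace_Rn[OF V(1) a(1)] lin_subspace_Rn[OF V(2) b(1)], of 1 1] by simp
  then have "\<exists>!(x, y). x \<in> Vp \<and> y \<in> Vm \<and> (\<lambda>i. a i + b i) = (\<lambda>i. x i + y i)"
    using A by (simp add: invariant_splitting_def)
  then have "(a, b) = (a', b')" using a b e by (elim ex1E) (metis (mono_tags, lifting) case_prodI)
  then show ?thesis by simp
qed

text \<open>The projection onto \<open>Vm\<close> along \<open>Vp\<close>. Uniqueness of the
  decomposition makes it linear and equivariant.\<close>

lemma splitting_projection:
  assumes A: "invariant_splitting G \<rho> n H Vp Vm" and lin: "\<And>h. h \<in> G \<Longrightarrow> linear_on_set (Rn n) (\<rho> h)"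
  obtains pr where "linear_on_set (Rn n) pr" "\<And>x. x \<in> Rn n \<Longrightarrow> pr x \<in> Vm \<and> (\<exists>a\<in>Vp. x = (\<lambda>i. a i + pr x i))"
    "\<And>h x. h \<in> G \<Longrightarrow> x \<in> Rn n \<Longrightarrow> pr (\<rho> h x) = \<rho> h (pr x)"
proof -
  have Vp: "lin_subspace n Vp" and Vm: "lin_subspace n Vm" and inv: "\<And>h v. h \<in> G \<Longrightarrow> v \<in> Vp \<Longrightarrow> \<rho> h v \<in> Vp"
    "\<And>h v. h \<in> G \<Longrightarrow> v \<in> Vm \<Longrightarrow> \<rho> h v \<in> Vm"
    using A by (auto simp: invariant_splitting_def image_subset_iff)
  have "\<exists>b. b \<in> Vm \<and> (\<exists>a\<in>Vp. x = (\<lambda>i. a i + b i))" if "x \<in> Rn n" for x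
  proof -
    have "\<exists>!(a, b). a \<in> Vp \<and> b \<in> Vm \<and> x = (\<lambda>i. a i + b i)" using A that by (simp add: invariant_splitting_def)
    then show ?thesis by (auto elim!: ex1E)
  qed
  then obtain pr where pr: "\<And>x. x \<in> Rn n \<Longrightarrow> pr x \<in> Vm \<and> (\<exists>a\<in>Vp. x = (\<lambda>i. a i + pr x i))" by metis
  have prI: "pr x = b" if "a \<in> Vp" "b \<in> Vm" "x = (\<lambda>i. a i + b i)" "x \<in> Rn n" for a b x
    using pr[OF that(4)] splitting_unique[OF A, of _ a "pr x" b] that by metis
  show thesis
  proof (rule that[of pr])
    show "linear_on_set (Rn n) pr"
      unfolding linear_on_set_def
    proof (intro ballI allI)
      fix v w r s assume v: "v \<in> Rn n" and w: "w \<in> Rn n"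
      obtain a b where a: "a \<in> Vp" "v = (\<lambda>i. a i + pr v i)" and b: "b \<in> Vp" "w = (\<lambda>i. b i + pr w i)" using pr[OF v] pr[OF w] by blast
      show "pr (\<lambda>i. r * v i + s * w i) = (\<lambda>i. r * pr v i + s * pr w i)"
      proof (rule prI[OF lin_subspaceD[OF Vp a(1) b(1)] lin_subspaceD[OF Vm] _ Rn_lin[OF v w]])
        show "(\<lambda>i. r * v i + s * w i) = (\<lambda>i. r * a i + s * b i + (r * pr v i + s * pr w i))"
          by (subst a(2), subst b(2)) (simp add: algebra_simps)
      qed (use pr v w in auto)
    qed
    show "pr x \<in> Vm \<and> (\<exists>a\<in>Vp. x = (\<lambda>i. a i + pr x i))" if "x \<in> Rn n" for x by (rule pr[OF that])
    fix h x assume h: "h \<in> G" and x: "x \<in> Rn n"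
    obtain a where a: "a \<in> Vp" "x = (\<lambda>i. 1 * a i + 1 * pr x i)" using pr[OF x] by auto
    have "\<rho> h x = (\<lambda>i. 1 * \<rho> h a i + 1 * \<rho> h (pr x) i)"
      using linear_on_setD[OF lin[OF h] lin_subspace_Rn[OF Vp a(1)] lin_subspace_Rn[OF Vm], of "pr x" 1 1] pr[OF x] a(2) by metis
    then have e: "\<rho> h x = (\<lambda>i. \<rho> h a i + \<rho> h (pr x) i)" by simp
    have "\<rho> h x \<in> Rn n"
      unfolding e using Rn_lin[OF lin_subspace_Rn[OF Vp inv(1)[OF h a(1)]] lin_subspace_Rn[OF Vm inv(2)[OF h]], of "pr x" 1 1] pr[OF x] by simp
    then show "pr (\<rho> h x) = \<rho> h (pr x)" using prI[OF inv(1)[OF h a(1)] inv(2)[OF h] e] pr[OF x] by blast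
  qed
qed

text \<open>\<open>J\<close> identifies a representation of \<open>G'\<close> with the fixed points of \<open>g\<close> in a representation of \<open>G\<close>.\<close>

locale fixed_point_comparison =
  fixes G :: "'g set" and \<rho> and n :: nat and H :: "vec \<Rightarrow> vec \<Rightarrow> real" and g :: 'g
    and G' :: "'k set" and \<rho>' and n' :: nat and H' :: "vec \<Rightarrow> vec \<Rightarrow> real" and \<tau> :: "'k \<Rightarrow> 'g" and J :: "vec \<Rightarrow> vec"
  assumes \<tau>: "\<And>h. h \<in> G' \<Longrightarrow> \<tau> h \<in> G" and g: "g \<in> G"
    and \<rho>: "\<And>h. h \<in> G \<Longrightarrow> linear_on_set (Rn n) (\<rho> h)" and \<rho>': "\<And>h. h \<in> G' \<Longrightarrow> linear_on_set (Rn n') (\<rho>' h)"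
    and \<rho>'R: "\<And>h v. h \<in> G' \<Longrightarrow> v \<in> Rn n' \<Longrightarrow> \<rho>' h v \<in> Rn n'"
    and J: "linear_on_set (Rn n') J" "bij_betw J (Rn n') {v \<in> Rn n. \<rho> g v = v}"
    and Jeq: "\<And>h v. h \<in> G' \<Longrightarrow> v \<in> Rn n' \<Longrightarrow> J (\<rho>' h v) = \<rho> (\<tau> h) (J v)"
    and HJ: "\<And>v. v \<in> Rn n' \<Longrightarrow> H' v v = H (J v) (J v)"
begin

abbreviation "E \<equiv> {v \<in> Rn n. \<rho> g v = v}"

lemma JE: "v \<in> Rn n' \<Longrightarrow> J v \<in> Rn n \<and> \<rho> g (J v) = J v"
  using J(2) bij_betwE by blast

lemma J_inj: "v \<in> Rn n' \<Longrightarrow> w \<in> Rn n' \<Longrightarrow> J v = J w \<Longrightarrow> v = w"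
  using J(2) by (auto simp: bij_betw_def inj_on_def)

lemma J_zero: "J (\<lambda>_. 0) = (\<lambda>_. 0)"
  by (rule linear_zero[OF J(1) Rn_zero])

lemma J_eq_zero: "v \<in> Rn n' \<Longrightarrow> J v = (\<lambda>_. 0) \<Longrightarrow> v = (\<lambda>_. 0)"
  using J_inj[of v "\<lambda>_. 0"] J_zero by simp

lemma J_preimage: "w \<in> E \<Longrightarrow> \<exists>v\<in>Rn n'. w = J v"
  by (rule bij_betw_preimage[OF J(2)])

text \<open>Sylvester's law of inertia for the fixed vectors: projecting a negative space along a
  positive one is injective, since a vector of the kernel would be both positive and negative.
  Injections in both directions force the equivariant map \<open>T\<close> to be bijective.\<close>

lemma negative_part_iso:
  assumes A: "invariant_splitting G \<rho> n H Vp Vm" and A': "invariant_splitting G' \<rho>' n' H' Vp' Vm'"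
  shows "rep_iso G' (Vm', \<rho>') ({v \<in> Vm. \<rho> g v = v}, \<lambda>h. \<rho> (\<tau> h))"
proof -
  have Vm: "lin_subspace n Vm" and Vp: "lin_subspace n Vp" and Vm': "lin_subspace n' Vm'" and Vp': "lin_subspace n' Vp'"
    and pos: "\<And>v. v \<in> Vp \<Longrightarrow> v \<noteq> (\<lambda>_. 0) \<Longrightarrow> 0 < H v v" and neg: "\<And>v. v \<in> Vm \<Longrightarrow> v \<noteq> (\<lambda>_. 0) \<Longrightarrow> H v v < 0"
    and pos': "\<And>v. v \<in> Vp' \<Longrightarrow> v \<noteq> (\<lambda>_. 0) \<Longrightarrow> 0 < H' v v" and neg': "\<And>v. v \<in> Vm' \<Longrightarrow> v \<noteq> (\<lambda>_. 0) \<Longrightarrow> H' v v < 0"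
    using A A' by (auto simp: invariant_splitting_def)
  obtain pr where pr: "linear_on_set (Rn n) pr" "\<And>x. x \<in> Rn n \<Longrightarrow> pr x \<in> Vm \<and> (\<exists>a\<in>Vp. x = (\<lambda>i. a i + pr x i))"
    "\<And>h x. h \<in> G \<Longrightarrow> x \<in> Rn n \<Longrightarrow> pr (\<rho> h x) = \<rho> h (pr x)" by (rule splitting_projection[OF A \<rho>], assumption, rule that, assumption+)
  obtain pr' where pr': "linear_on_set (Rn n') pr'" "\<And>x. x \<in> Rn n' \<Longrightarrow> pr' x \<in> Vm' \<and> (\<exists>a\<in>Vp'. x = (\<lambda>i. a i + pr' x i))"
    by (rule splitting_projection[OF A' \<rho>'], assumption, rule that, assumption+)
  define F where "F = {v \<in> Vm. \<rho> g v = v}"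
  have FR: "v \<in> Rn n" if "v \<in> F" for v using lin_subspace_Rn[OF Vm] that by (simp add: F_def)
  have FE: "v \<in> E" if "v \<in> F" for v using FR[OF that] that by (simp add: F_def)
  have Fs: "lin_subspace n F"
    unfolding lin_subspace_def using FR lin_subspaceD[OF Vm] lin_subspace_zero[OF Vm] linear_on_setD[OF \<rho>[OF g]] linear_zero[OF \<rho>[OF g] Rn_zero]
    by (auto simp: F_def)
  note VmR' = lin_subspace_Rn[OF Vm']
  define T where "T v = pr (J v)" for v
  have TF: "T v \<in> F" if "v \<in> Rn n'" for v
    using pr(2)[of "J v"] pr(3)[OF g, of "J v"] JE[OF that] by (simp add: T_def F_def)
  have T_lin: "linear_on_set (Rn n') T"
    unfolding linear_on_set_def T_def using linear_on_setD[OF J(1)] linear_on_setD[OF pr(1)] JE by simp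
  define Ji where "Ji = inv_into (Rn n') J"
  have Ji: "Ji w \<in> Rn n' \<and> J (Ji w) = w" if "w \<in> E" for w
    using that J(2) unfolding Ji_def bij_betw_def by (metis f_inv_into_f inv_into_into)
  have JiJ: "Ji (J v) = v" if "v \<in> Rn n'" for v using Ji[of "J v"] JE[OF that] J_inj that by auto
  \<comment> \<open>\<open>S\<close> is not the inverse of \<open>T\<close>; it only bounds
    dimensions, so nothing is asked of it beyond linearity and injectivity.\<close>
  define S where "S w = pr' (Ji w)" for w
  have S_lin: "linear_on_set F S"
    unfolding linear_on_set_def
  proof (intro ballI allI)
    fix v w r s assume v: "v \<in> F" and w: "w \<in> F"
    note jv = Ji[OF FE[OF v]] and jw = Ji[OF FE[OF w]]
    have "(\<lambda>i. r * v i + s * w i) = J (\<lambda>i. r * Ji v i + s * Ji w i)"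
      using linear_on_setD[OF J(1), of "Ji v" "Ji w" r s] jv jw by simp
    then have "Ji (\<lambda>i. r * v i + s * w i) = (\<lambda>i. r * Ji v i + s * Ji w i)"
      using JiJ[OF Rn_lin] jv jw by simp
    then show "S (\<lambda>i. r * v i + s * w i) = (\<lambda>i. r * S v i + s * S w i)"
      using linear_on_setD[OF pr'(1)] jv jw by (simp add: S_def)
  qed
  have SV: "S w \<in> Vm'" if "w \<in> F" for w using pr'(2) Ji[OF FE[OF that]] by (simp add: S_def)
  have T_inj: "inj_on T Vm'"
  proof (rule linear_inj_onI[OF Vm'])
    show "linear_on_set Vm' T" using T_lin VmR' by (simp add: linear_on_set_def)
    fix v assume v: "v \<in> Vm'" and "T v = (\<lambda>_. 0)"
    then obtain a where a: "a \<in> Vp" "J v = a" using pr(2)[of "J v"] JE[OF VmR'[OF v]] by (auto simp: T_def)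
    show "v = (\<lambda>_. 0)"
    proof (rule ccontr)
      assume ne: "v \<noteq> (\<lambda>_. 0)"
      then have "J v \<noteq> (\<lambda>_. 0)" using J_eq_zero[OF VmR'[OF v]] by blast
      then show False using pos[of "J v"] a neg'[OF v ne] HJ[OF VmR'[OF v]] by simp
    qed
  qed
  have S_inj: "inj_on S F"
  proof (rule linear_inj_onI[OF Fs S_lin])
    fix w assume w: "w \<in> F" and "S w = (\<lambda>_. 0)"
    then obtain a where a: "a \<in> Vp'" "Ji w = a" using pr'(2)[of "Ji w"] Ji[OF FE[OF w]] by (auto simp: S_def)
    show "w = (\<lambda>_. 0)"
    proof (rule ccontr)
      assume ne: "w \<noteq> (\<lambda>_. 0)"
      then have "Ji w \<noteq> (\<lambda>_. 0)" using Ji[OF FE[OF w]] J_zero by metis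
      then have "0 < H' (Ji w) (Ji w)" using pos'[of "Ji w"] a by simp
      moreover have "H w w < 0" using neg[OF _ ne] w by (simp add: F_def)
      ultimately show False using HJ[of "Ji w"] Ji[OF FE[OF w]] by simp
    qed
  qed
  have "(\<lambda>v. S (T v)) ` Vm' = Vm'"
  proof (rule linear_injective_surj[OF Vm'])
    show "linear_on_set Vm' (\<lambda>v. S (T v))"
      unfolding linear_on_set_def using linear_on_setD[OF T_lin VmR' VmR'] linear_on_setD[OF S_lin TF[OF VmR'] TF[OF VmR']] by simp
    show "inj_on (\<lambda>v. S (T v)) Vm'"
      using T_inj S_inj TF[OF VmR'] by (simp add: inj_on_def)
  qed (use SV TF VmR' in auto)
  then have "F \<subseteq> T ` Vm'"
  proof (intro subsetI)
    fix w assume eq: "(\<lambda>v. S (T v)) ` Vm' = Vm'" and w: "w \<in> F"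
    then obtain v where v: "v \<in> Vm'" "S w = S (T v)" using SV[OF w] by (metis imageE)
    then have "w = T v" using S_inj w TF[OF VmR'[OF v(1)]] by (auto simp: inj_on_def)
    then show "w \<in> T ` Vm'" using v(1) by blast
  qed
  then have "bij_betw T Vm' F" unfolding bij_betw_def using T_inj TF VmR' by auto
  moreover have "linear_on_set Vm' T" using T_lin VmR' by (simp add: linear_on_set_def)
  moreover have "T (\<rho>' h v) = \<rho> (\<tau> h) (T v)" if "h \<in> G'" "v \<in> Vm'" for h v
    using Jeq[OF that(1) VmR'[OF that(2)]] pr(3)[OF \<tau>[OF that(1)], of "J v"] JE[OF VmR'[OF that(2)]] by (simp add: T_def)
  ultimately show ?thesis unfolding rep_iso_iff F_def by blast
qed

text \<open>The equivariant projection sends a fixed vector to a fixed vector, so both of its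
  components are fixed and lie in the image of \<open>J\<close>.\<close>

lemma transport_splitting:
  assumes A: "invariant_splitting G \<rho> n H Vp Vm"
  shows "invariant_splitting G' \<rho>' n' H' {v \<in> Rn n'. J v \<in> Vp} {v \<in> Rn n'. J v \<in> Vm}"
proof -
  have V: "lin_subspace n Vp" "lin_subspace n Vm" and inv: "\<And>h. h \<in> G \<Longrightarrow> \<rho> h ` Vp \<subseteq> Vp \<and> \<rho> h ` Vm \<subseteq> Vm"
    and pos: "\<And>v. v \<in> Vp \<Longrightarrow> v \<noteq> (\<lambda>_. 0) \<Longrightarrow> 0 < H v v" and neg: "\<And>v. v \<in> Vm \<Longrightarrow> v \<noteq> (\<lambda>_. 0) \<Longrightarrow> H v v < 0"
    using A by (auto simp: invariant_splitting_def)
  have sub: "lin_subspace n' {v \<in> Rn n'. J v \<in> V}" if "lin_subspace n V" for V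
    unfolding lin_subspace_def using lin_subspaceD[OF that] lin_subspace_zero[OF that] linear_on_setD[OF J(1)] J_zero Rn_lin by auto
  have "\<exists>!(x, y). x \<in> {v \<in> Rn n'. J v \<in> Vp} \<and> y \<in> {v \<in> Rn n'. J v \<in> Vm} \<and> v = (\<lambda>i. x i + y i)" if v: "v \<in> Rn n'" for v
  proof -
    have Jadd: "J (\<lambda>i. x i + y i) = (\<lambda>i. J x i + J y i)" if "x \<in> Rn n'" "y \<in> Rn n'" for x y
      using linear_on_setD[OF J(1) that, of 1 1] by simp
    obtain pr where pr: "\<And>x. x \<in> Rn n \<Longrightarrow> pr x \<in> Vm \<and> (\<exists>a\<in>Vp. x = (\<lambda>i. a i + pr x i))"
      "\<And>h x. h \<in> G \<Longrightarrow> x \<in> Rn n \<Longrightarrow> pr (\<rho> h x) = \<rho> h (pr x)" by (rule splitting_projection[OF A \<rho>], assumption, rule that, assumption+)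
    define b where "b = pr (J v)"
    obtain a where a: "a \<in> Vp" "J v = (\<lambda>i. a i + b i)" and b: "b \<in> Vm" using pr(1)[of "J v"] JE[OF v] by (auto simp: b_def)
    have bg: "\<rho> g b = b" using pr(2)[OF g, of "J v"] JE[OF v] by (simp add: b_def)
    note R = lin_subspace_Rn[OF V(1) a(1)] lin_subspace_Rn[OF V(2) b]
    have "(\<lambda>i. \<rho> g a i + \<rho> g b i) = (\<lambda>i. a i + b i)"
      using linear_on_setD[OF \<rho>[OF g] R, of 1 1] JE[OF v] a(2) by simp
    then have ag: "\<rho> g a = a" using bg by (simp add: fun_eq_iff)
    obtain a' where a': "a' \<in> Rn n'" "a = J a'" using J_preimage[of a] R(1) ag by blast
    obtain b' where b': "b' \<in> Rn n'" "b = J b'" using J_preimage[of b] R(2) bg by blast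
    have R': "(\<lambda>i. a' i + b' i) \<in> Rn n'" using Rn_lin[OF a'(1) b'(1), of 1 1] by simp
    have "v = (\<lambda>i. a' i + b' i)"
      by (rule J_inj[OF v R']) (simp add: Jadd[OF a'(1) b'(1)] a(2) a'(2) b'(2))
    moreover have "z = (a', b')" if cz: "case z of (x, y) \<Rightarrow> x \<in> {v \<in> Rn n'. J v \<in> Vp} \<and> y \<in> {v \<in> Rn n'. J v \<in> Vm} \<and> v = (\<lambda>i. x i + y i)" for z
    proof -
      obtain x y where z: "z = (x, y)" "x \<in> Rn n'" "J x \<in> Vp" "y \<in> Rn n'" "J y \<in> Vm" "v = (\<lambda>i. x i + y i)" using cz by (cases z) auto
      have "(\<lambda>i. J x i + J y i) = (\<lambda>i. a i + b i)" using Jadd[OF z(2,4)] z(6) a(2) by simp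
      then have "J x = J a' \<and> J y = J b'"
        using splitting_unique[OF A z(3) a(1) z(5) b] a'(2) b'(2) by simp
      then show ?thesis using J_inj z a' b' by blast
    qed
    ultimately show ?thesis using a' b' a b by (intro ex1I[of _ "(a', b')"]) auto
  qed
  then show ?thesis
    unfolding invariant_splitting_def
  proof (intro conjI ballI impI)
    fix h assume h: "h \<in> G'"
    have "J (\<rho>' h v) \<in> V" if "\<rho> (\<tau> h) ` V \<subseteq> V" "v \<in> Rn n'" "J v \<in> V" for v V using Jeq[OF h that(2)] that by auto
    then show "\<rho>' h ` {v \<in> Rn n'. J v \<in> Vp} \<subseteq> {v \<in> Rn n'. J v \<in> Vp}" "\<rho>' h ` {v \<in> Rn n'. J v \<in> Vm} \<subseteq> {v \<in> Rn n'. J v \<in> Vm}"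
      using inv[OF \<tau>[OF h]] \<rho>'R[OF h] by auto
  next
    fix v assume "v \<in> {v \<in> Rn n'. J v \<in> Vp}" "v \<noteq> (\<lambda>_. 0)"
    then show "0 < H' v v" using pos[of "J v"] J_eq_zero[of v] HJ[of v] by auto
  next
    fix v assume "v \<in> {v \<in> Rn n'. J v \<in> Vm}" "v \<noteq> (\<lambda>_. 0)"
    then show "H' v v < 0" using neg[of "J v"] J_eq_zero[of v] HJ[of v] by auto
  qed (use sub[OF V(1)] sub[OF V(2)] in auto)
qed

end

lemma rep_iso_fixed:
  assumes iso: "rep_iso G (V, \<rho>) (W, \<sigma>)" and g: "g \<in> G" and \<tau>: "\<And>h. h \<in> G' \<Longrightarrow> \<tau> h \<in> G" and inv: "\<And>v. v \<in> V \<Longrightarrow> \<rho> g v \<in> V"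
  shows "rep_iso G' ({v \<in> V. \<rho> g v = v}, \<lambda>h. \<rho> (\<tau> h)) ({v \<in> W. \<sigma> g v = v}, \<lambda>h. \<sigma> (\<tau> h))"
proof -
  obtain T where T: "linear_on_set V T" "bij_betw T V W" "\<And>h v. h \<in> G \<Longrightarrow> v \<in> V \<Longrightarrow> T (\<rho> h v) = \<sigma> h (T v)"
    using iso by (auto simp: rep_iso_iff)
  have fixed: "\<sigma> g (T v) = T v \<longleftrightarrow> \<rho> g v = v" if "v \<in> V" for v
    unfolding T(3)[OF g that, symmetric] by (rule inj_on_eq_iff[OF bij_betw_imp_inj_on[OF T(2)] inv[OF that] that])
  have "bij_betw T {v \<in> V. \<rho> g v = v} {v \<in> W. \<sigma> g v = v}"
    using T(2) fixed by (auto simp: bij_betw_def inj_on_def)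
  moreover have "linear_on_set {v \<in> V. \<rho> g v = v} T" using T(1) by (simp add: linear_on_set_def)
  ultimately show ?thesis unfolding rep_iso_iff using T(3) \<tau> by (intro exI[of _ T]) simp
qed


section \<open>Critical points on the inertia stack\<close>

lemma Aut_inertia: "h \<in> Aut (inertia X) (p, g) \<Longrightarrow> \<exists>l. h = (g, l, g) \<and> l \<in> Aut X p \<and> g \<in> Aut X p"
  by (cases h) (auto simp: Aut_def in_hom_inertia inertia_simps)

lemma stack_function_inertia:
  assumes "stack_function X f"
  shows "stack_function (inertia X) (f \<circ> ev_obj)"
  using assms unfolding stack_function_def by (auto simp: inertia_def ev_obj_def)

context fibred
begin

lemma point_objects_inertia: "(p, g) \<in> point_objects (inertia Y) \<longleftrightarrow> p \<in> point_objects Y \<and> g \<in> Aut Y p"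
  by (auto simp: point_objects_def inertia_simps)

text \<open>\<open>J\<close> is the derivative of \<open>\<epsilon>\<close> at \<open>(p, g)\<close>.\<close>

lemma tangent_inertia:
  assumes pd: "proper_diagonal Y" and A: "etale_chart_at Y p b \<theta> K" and gA: "g \<in> Aut Y p"
  obtains a0 \<theta>0 K0 where "etale_chart_at (inertia Y) (p, g) a0 \<theta>0 K0"
    "\<And>a' \<theta>' K'. etale_chart_at (inertia Y) (p, g) a' \<theta>' K' \<Longrightarrow> \<exists>J. linear_on_set (Rn (cdim K')) J \<and>
      bij_betw J (Rn (cdim K')) {v \<in> Rn (cdim K). tangent_action Y b \<theta> K g v = v} \<and>
      (\<forall>h\<in>Aut (inertia Y) (p, g). \<forall>v\<in>Rn (cdim K'). J (tangent_action (inertia Y) a' \<theta>' K' h v) = tangent_action Y b \<theta> K (ev_arr h) (J v)) \<and>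
      (\<forall>f. stack_function Y f \<longrightarrow>
        (\<forall>v\<in>Rn (cdim K'). dfun K' ((f \<circ> ev_obj) a') (foot (inertia Y) \<theta>') v = dfun K (f b) (foot Y \<theta>) (J v)) \<and>
        (diff_vanishes K (f b) (foot Y \<theta>) \<longrightarrow> (\<forall>v\<in>Rn (cdim K'). \<forall>w\<in>Rn (cdim K').
          hessian K' ((f \<circ> ev_obj) a') (foot (inertia Y) \<theta>') v w = hessian K (f b) (foot Y \<theta>) (J v) (J w))))"
proof -
  interpret I: fibred "inertia Y" by unfold_locales (rule fibred_inertia[OF fib])
  note D = etale_chartD[OF A]
  have g: "hom g p p" by (rule Aut_hom[OF gA])
  obtain N where N: "0 < N" "gpow p g N = idn Y p" by (rule finite_order[OF D(1) finite_Aut[OF pd A] g])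
  obtain r \<alpha> \<beta> \<gamma> S V e i t where "isotropy_germ Y p b \<theta> K g N r \<alpha> \<beta> \<gamma> S V e i t"
    by (rule isotropy_germ_ex[OF A g N])
  then interpret G: isotropy_germ Y p b \<theta> K g N r \<alpha> \<beta> \<gamma> S V e i t .
  obtain q \<phi> \<theta>q KB j where C: "etale_chart_at (inertia Y) (p, g) (q, \<phi>) (g, \<theta>q, \<phi>) KB" and j: "hom j q b" "j \<cdot> \<theta>q = \<theta>"
    and bij: "bij_betw (dmap KB K (bmap Y j) (foot Y \<theta>q)) (Rn (cdim KB)) {v \<in> Rn (cdim K). tangent_action Y b \<theta> K g v = v}"
    by (rule G.inertia_chart)
  note DC = I.etale_chartD[OF C]
  have \<theta>q: "hom \<theta>q p q" using DC(3) by (simp add: in_hom_inertia)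
  have KB: "KB \<in> charts (base Y q)" "foot Y \<theta>q \<in> cdom KB" using DC(4,5) by (simp_all add: inertia_simps foot_inertia)
  have ft: "bmap Y j (foot Y \<theta>q) = foot Y \<theta>" using foot_comp[OF D(1) \<theta>q j(1)] j(2) by simp
  define J0 where "J0 = dmap KB K (bmap Y j) (foot Y \<theta>q)"
  \<comment> \<open>The action upstairs is computed on a span in the inertia category. Forgetting
    the automorphisms and composing with \<open>j\<close> gives a span in \<open>Y\<close>, which
    computes the action of the underlying automorphism \<open>l\<close>.\<close>
  have equivariant: "J0 (tangent_action (inertia Y) (q, \<phi>) (g, \<theta>q, \<phi>) KB h v) = tangent_action Y b \<theta> K (ev_arr h) (J0 v)"
    if h: "h \<in> Aut (inertia Y) (p, g)" and v: "v \<in> Rn (cdim KB)" for h v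
  proof -
    obtain l where l: "h = (g, l, g)" "l \<in> Aut Y p" using Aut_inertia[OF h] by blast
    have lh: "hom l p p" by (rule Aut_hom[OF l(2)])
    have hh: "I.hom h (p, g) (p, g)" by (rule I.Aut_hom[OF h])
    let ?\<theta> = "(g, \<theta>q, \<phi>)"
    have C': "etale_chart_at (inertia Y) (p, g) (q, \<phi>) (cmp (inertia Y) ?\<theta> h) KB" by (rule I.etale_chart_precomp[OF C DC(1) hh])
    obtain c m n \<delta> L where \<delta>: "I.hom \<delta> (p, g) c" "cmp (inertia Y) m \<delta> = ?\<theta>" "cmp (inertia Y) n \<delta> = cmp (inertia Y) ?\<theta> h"
      and L: "L \<in> charts (base (inertia Y) c)" "foot (inertia Y) \<delta> \<in> cdom L" and m: "I.hom m c (q, \<phi>)" and n: "I.hom n c (q, \<phi>)"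
      and bijm: "bij_betw (dmap L KB (bmap (inertia Y) m) (foot (inertia Y) \<delta>)) (Rn (cdim L)) (Rn (cdim KB))"
      by (rule I.etale_charts_span[OF C C']) blast
    obtain z where z: "z \<in> Rn (cdim L)" "v = dmap L KB (bmap (inertia Y) m) (foot (inertia Y) \<delta>) z"
      using bij_betw_preimage[OF bijm v] by blast
    have T: "tangent_action (inertia Y) (q, \<phi>) ?\<theta> KB h v = dmap L KB (bmap (inertia Y) n) (foot (inertia Y) \<delta>) z"
      unfolding I.tangent_action_eq[OF C hh] z(2) by (rule I.transition_span[OF C C' m n \<delta> L z(1)])
    obtain c0 \<psi> where c: "c = (c0, \<psi>)" by (cases c)
    obtain m0 where m0: "m = (\<psi>, m0, \<phi>)" "hom m0 c0 q" using m by (auto simp: c in_hom_inertia)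
    obtain n0 where n0: "n = (\<psi>, n0, \<phi>)" "hom n0 c0 q" using n by (auto simp: c in_hom_inertia)
    obtain \<delta>0 where \<delta>0: "\<delta> = (g, \<delta>0, \<psi>)" "hom \<delta>0 p c0" using \<delta>(1) by (auto simp: c in_hom_inertia)
    have md: "m0 \<cdot> \<delta>0 = \<theta>q" and nd: "n0 \<cdot> \<delta>0 = \<theta>q \<cdot> l" using \<delta>(2,3) by (simp_all add: m0(1) n0(1) \<delta>0(1) l(1) inertia_simps)
    have L0: "L \<in> charts (base Y c0)" "foot Y \<delta>0 \<in> cdom L" using L by (simp_all add: c \<delta>0(1) inertia_simps foot_inertia)
    have fm: "bmap Y m0 (foot Y \<delta>0) = foot Y \<theta>q" using foot_comp[OF D(1) \<delta>0(2) m0(2)] md by simp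
    have fn: "bmap Y n0 (foot Y \<delta>0) = foot Y \<theta>q"
      using foot_comp[OF D(1) \<delta>0(2) n0(2)] nd foot_precomp[OF D(1,1) lh \<theta>q] by simp
    have A': "etale_chart_at Y p b (\<theta> \<cdot> l) K" by (rule etale_chart_precomp[OF A D(1) lh])
    have jm: "(j \<cdot> m0) \<cdot> \<delta>0 = \<theta>" using assoc[OF \<delta>0(2) m0(2) j(1)] md j(2) by simp
    have jn: "(j \<cdot> n0) \<cdot> \<delta>0 = \<theta> \<cdot> l" using assoc[OF \<delta>0(2) n0(2) j(1)] nd j(2) assoc[OF lh \<theta>q j(1)] by simp
    have "transition p b \<theta> K b (\<theta> \<cdot> l) K (dmap L K (bmap Y (j \<cdot> m0)) (foot Y \<delta>0) z) = dmap L K (bmap Y (j \<cdot> n0)) (foot Y \<delta>0) z"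
      by (rule transition_span[OF A A' comp_hom[OF m0(2) j(1)] comp_hom[OF n0(2) j(1)] \<delta>0(2) jm jn L0 z(1)])
    moreover have "dmap L K (bmap Y (j \<cdot> m0)) (foot Y \<delta>0) z = J0 v"
      using dmap_comp[OF m0(2) j(1) L0 KB(1) _ D(4), of z] fm KB(2) ft D(5)
      by (simp add: J0_def z(2) m0(1) \<delta>0(1) inertia_simps foot_inertia)
    moreover have "dmap L K (bmap Y (j \<cdot> n0)) (foot Y \<delta>0) z = J0 (tangent_action (inertia Y) (q, \<phi>) ?\<theta> KB h v)"
      using dmap_comp[OF n0(2) j(1) L0 KB(1) _ D(4), of z] fn KB(2) ft D(5)
      by (simp add: J0_def T n0(1) \<delta>0(1) inertia_simps foot_inertia)
    moreover have "ev_arr h = l" by (simp add: l(1) ev_arr_def)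
    ultimately show ?thesis by (simp add: tangent_action_eq[OF A lh])
  qed
  show thesis
  proof (rule that[OF C])
    fix a' \<theta>' K' assume A': "etale_chart_at (inertia Y) (p, g) a' \<theta>' K'"
    \<comment> \<open>An arbitrary chart at \<open>(p, g)\<close> reaches the fixed locus through
      its transition to the constructed chart.\<close>
    define T where "T = I.transition (p, g) a' \<theta>' K' (q, \<phi>) (g, \<theta>q, \<phi>) KB"
    have TR: "T v \<in> Rn (cdim KB)" if "v \<in> Rn (cdim K')" for v unfolding T_def by (rule I.transition_in[OF A' C that])
    have T_lin: "linear_on_set (Rn (cdim K')) T" unfolding T_def by (rule I.transition_linear[OF A' C])
    have T_bij: "bij_betw T (Rn (cdim K')) (Rn (cdim KB))" unfolding T_def by (rule I.transition_bij[OF A' C])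
    define J where "J = J0 \<circ> T"
    have "linear_on_set (Rn (cdim K')) J"
      unfolding linear_on_set_def J_def J0_def o_def using linear_on_setD[OF T_lin] dmap_linear by simp
    moreover have "bij_betw J (Rn (cdim K')) {v \<in> Rn (cdim K). tangent_action Y b \<theta> K g v = v}"
      unfolding J_def by (rule bij_betw_trans[OF T_bij bij[folded J0_def]])
    moreover have "J (tangent_action (inertia Y) a' \<theta>' K' h v) = tangent_action Y b \<theta> K (ev_arr h) (J v)"
      if "h \<in> Aut (inertia Y) (p, g)" "v \<in> Rn (cdim K')" for h v
      using I.transition_equivariant[OF A' C I.Aut_hom[OF that(1)] that(2)] equivariant[OF that(1) TR[OF that(2)]]
      by (simp add: J_def T_def)
    moreover have "(\<forall>v\<in>Rn (cdim K'). dfun K' ((f \<circ> ev_obj) a') (foot (inertia Y) \<theta>') v = dfun K (f b) (foot Y \<theta>) (J v)) \<and>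
        (diff_vanishes K (f b) (foot Y \<theta>) \<longrightarrow> (\<forall>v\<in>Rn (cdim K'). \<forall>w\<in>Rn (cdim K').
          hessian K' ((f \<circ> ev_obj) a') (foot (inertia Y) \<theta>') v w = hessian K (f b) (foot Y \<theta>) (J v) (J w)))"
      if f: "stack_function Y f" for f
    proof -
      note F = stack_function_inertia[OF f]
      have fq: "(f \<circ> ev_obj) (q, \<phi>) = f q" "foot (inertia Y) (g, \<theta>q, \<phi>) = foot Y \<theta>q" by (simp_all add: ev_obj_def foot_inertia)
      have Kj: "bmap Y j (foot Y \<theta>q) \<in> cdom K" using ft D(5) by simp
      have df: "dfun K' ((f \<circ> ev_obj) a') (foot (inertia Y) \<theta>') v = dfun K (f b) (foot Y \<theta>) (J v)" if "v \<in> Rn (cdim K')" for v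
        using I.transition_dfun(1)[OF F A' C that] dfun_arrow[OF f j(1) KB D(4) Kj, of "T v"] unfolding fq by (simp add: J_def J0_def T_def ft)
      moreover have "hessian K' ((f \<circ> ev_obj) a') (foot (inertia Y) \<theta>') v w = hessian K (f b) (foot Y \<theta>) (J v) (J w)"
        if dv: "diff_vanishes K (f b) (foot Y \<theta>)" and v: "v \<in> Rn (cdim K')" and w: "w \<in> Rn (cdim K')" for v w
      proof -
        have dv1: "diff_vanishes KB (f q) (foot Y \<theta>q)"
          by (rule diff_vanishes_arrow[OF f j(1) KB D(4) Kj]) (simp add: ft dv)
        have dv2: "diff_vanishes K' ((f \<circ> ev_obj) a') (foot (inertia Y) \<theta>')"
          using I.diff_vanishes_independent[OF F A' C] dv1 unfolding fq by simp
        have "hessian K' ((f \<circ> ev_obj) a') (foot (inertia Y) \<theta>') v w = hessian KB (f q) (foot Y \<theta>q) (T v) (T w)"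
          using I.transition_dfun(2)[OF F A' C v dv2 _ w] dv1 unfolding fq T_def by simp
        also have "\<dots> = hessian K (f b) (foot Y \<theta>) (J v) (J w)"
          using hessian_arrow[OF f j(1) KB D(4) Kj, of "T v" "T w"] dv ft by (simp add: J_def J0_def)
        finally show ?thesis .
      qed
      ultimately show ?thesis by blast
    qed
    ultimately show "\<exists>J. linear_on_set (Rn (cdim K')) J \<and>
      bij_betw J (Rn (cdim K')) {v \<in> Rn (cdim K). tangent_action Y b \<theta> K g v = v} \<and>
      (\<forall>h\<in>Aut (inertia Y) (p, g). \<forall>v\<in>Rn (cdim K'). J (tangent_action (inertia Y) a' \<theta>' K' h v) = tangent_action Y b \<theta> K (ev_arr h) (J v)) \<and>
      (\<forall>f. stack_function Y f \<longrightarrow>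
        (\<forall>v\<in>Rn (cdim K'). dfun K' ((f \<circ> ev_obj) a') (foot (inertia Y) \<theta>') v = dfun K (f b) (foot Y \<theta>) (J v)) \<and>
        (diff_vanishes K (f b) (foot Y \<theta>) \<longrightarrow> (\<forall>v\<in>Rn (cdim K'). \<forall>w\<in>Rn (cdim K').
          hessian K' ((f \<circ> ev_obj) a') (foot (inertia Y) \<theta>') v w = hessian K (f b) (foot Y \<theta>) (J v) (J w))))"
      by blast
  qed
qed

text \<open>The sum of \<open>w\<close> over the powers of \<open>g\<close> is fixed, and the
  invariant form \<open>L\<close> takes the value \<open>N * L w\<close> on it.\<close>

lemma linear_vanishes_of_fixed_points:
  fixes L :: "vec \<Rightarrow> real"
  assumes pd: "proper_diagonal Y" and A: "etale_chart_at Y p b \<theta> K" and g: "hom g p p"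
    and lin: "\<And>r s v v'. v \<in> Rn (cdim K) \<Longrightarrow> v' \<in> Rn (cdim K) \<Longrightarrow> L (\<lambda>i. r * v i + s * v' i) = r * L v + s * L v'"
    and inv: "\<And>k v. v \<in> Rn (cdim K) \<Longrightarrow> L (tangent_action Y b \<theta> K (gpow p g k) v) = L v"
    and zero: "\<And>v. v \<in> Rn (cdim K) \<Longrightarrow> tangent_action Y b \<theta> K g v = v \<Longrightarrow> L v = 0" and w: "w \<in> Rn (cdim K)"
  shows "L w = 0"
proof -
  note D = etale_chartD[OF A]
  obtain N where N: "0 < N" "gpow p g N = idn Y p" by (rule finite_order[OF D(1) finite_Aut[OF pd A] g])
  define a where "a k = tangent_action Y b \<theta> K (gpow p g k) w" for k
  have aR: "a k \<in> Rn (cdim K)" for k unfolding a_def by (rule tangent_action_in[OF A gpow_hom[OF g] w])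
  have aS: "tangent_action Y b \<theta> K g (a k) = a (Suc k)" for k
    using tangent_action_gpow_add[OF A g w, of 1 k] gpow_1[OF g] by (simp add: a_def)
  have aN: "a N = a 0" using N(2) by (simp add: a_def)
  \<comment> \<open>The orbit sum itself suffices; the division by 1 only matches
    \<open>linear_average\<close>.\<close>
  define w' where "w' = (\<lambda>i. (\<Sum>k<N. a k i) / 1)"
  have "tangent_action Y b \<theta> K g w' = (\<lambda>i. (\<Sum>k<N. tangent_action Y b \<theta> K g (a k) i) / 1)"
    unfolding w'_def by (rule linear_average[OF tangent_action_linear[OF A g] aR]) simp
  also have "\<dots> = w'"
  proof
    fix i
    have "(\<Sum>k<N. a (Suc k) i) + a 0 i = (\<Sum>k<N. a k i) + a N i"
      using sum.lessThan_Suc_shift[of "\<lambda>k. a k i" N] sum.lessThan_Suc[of "\<lambda>k. a k i" N] by simp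
    then show "(\<Sum>k<N. tangent_action Y b \<theta> K g (a k) i) / 1 = w' i" by (simp add: aS aN w'_def)
  qed
  finally have fixed: "tangent_action Y b \<theta> K g w' = w'" .
  have "linear_on_set (Rn (cdim K)) (\<lambda>v _. L v)" using lin by (simp add: linear_on_set_def)
  from linear_average[OF this aR, where I = "{..<N}" and c = 1] have "L w' = (\<Sum>k<N. L (a k))" unfolding w'_def by (simp add: fun_eq_iff)
  also have "\<dots> = (\<Sum>k<N. L w)" unfolding a_def inv[OF w] ..
  also have "L w' = 0" using aR by (intro zero[OF _ fixed]) (simp add: w'_def Rn_iff)
  finally show "L w = 0" using N(1) by simp
qed

end

text \<open>The positive part for \<open>H\<close> is the negative part for \<open>- H\<close>; with \<open>s = \<plusminus> 1\<close> both indices are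
  treated at once.\<close>

definition signed_index :: "real \<Rightarrow> ('o, 'm) fibcat \<Rightarrow> ('o \<Rightarrow> point \<Rightarrow> real) \<Rightarrow> 'o \<Rightarrow> 'm rep set"
  where "signed_index s X f p = {R. \<exists>a \<theta> K Vp Vm.
    etale_chart_at X p a \<theta> K \<and> diff_vanishes K (f a) (foot X \<theta>) \<and>
    invariant_splitting (Aut X p) (tangent_action X a \<theta> K) (cdim K)
      (\<lambda>v w. s * hessian K (f a) (foot X \<theta>) v w) Vp Vm \<and>
    rep_iso (Aut X p) (Vm, tangent_action X a \<theta> K) R}"

lemma index_signed: "index X f p = signed_index 1 X f p"
  by (simp add: index_def signed_index_def)

lemma invariant_splitting_uminus_iff:
  "invariant_splitting G \<rho> n (\<lambda>v w. - H v w) Vp Vm \<longleftrightarrow> invariant_splitting G \<rho> n H Vm Vp"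
  using invariant_splitting_uminus[of G \<rho> n H Vm Vp] invariant_splitting_uminus[of G \<rho> n "\<lambda>v w. - H v w" Vp Vm] by auto

lemma coindex_signed: "coindex X f p = signed_index (-1) X f p"
  unfolding coindex_def signed_index_def by (simp add: invariant_splitting_uminus_iff) blast

section \<open>Criticality, Hessians and indices over the inertia stack\<close>

context fibred
begin

context
  fixes f p b \<theta> K g
  assumes pd: "proper_diagonal Y" and f: "stack_function Y f" and A: "etale_chart_at Y p b \<theta> K" and gA: "g \<in> Aut Y p"
begin

lemma critical_at_inertia: "critical_at (inertia Y) (f \<circ> ev_obj) (p, g) \<longleftrightarrow> critical_at Y f p"
proof -
  interpret I: fibred "inertia Y" by unfold_locales (rule fibred_inertia[OF fib])
  have g: "hom g p p" by (rule Aut_hom[OF gA])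
  let ?E = "{v \<in> Rn (cdim K). tangent_action Y b \<theta> K g v = v}" and ?d = "dfun K (f b) (foot Y \<theta>)"
  obtain a0 \<theta>0 K0 J where A0: "etale_chart_at (inertia Y) (p, g) a0 \<theta>0 K0" and J: "bij_betw J (Rn (cdim K0)) ?E"
    and dJ: "\<And>v. v \<in> Rn (cdim K0) \<Longrightarrow> dfun K0 ((f \<circ> ev_obj) a0) (foot (inertia Y) \<theta>0) v = ?d (J v)"
    by (rule tangent_inertia[OF pd A gA]) (use f in meson)
  have "critical_at (inertia Y) (f \<circ> ev_obj) (p, g) \<longleftrightarrow> (\<forall>v\<in>Rn (cdim K0). ?d (J v) = 0)"
    unfolding I.critical_at_iff[OF stack_function_inertia[OF f] A0] diff_vanishes_iff using dJ by simp
  also have "\<dots> \<longleftrightarrow> (\<forall>v\<in>?E. ?d v = 0)" unfolding bij_betw_imp_surj_on[OF J, symmetric] by simp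
  also have "\<dots> \<longleftrightarrow> (\<forall>v\<in>Rn (cdim K). ?d v = 0)"
  proof
    assume E: "\<forall>v\<in>?E. ?d v = 0"
    show "\<forall>v\<in>Rn (cdim K). ?d v = 0"
    proof
      fix w assume w: "w \<in> Rn (cdim K)"
      show "?d w = 0"
        by (rule linear_vanishes_of_fixed_points[where L = "?d", OF pd A g dfun_linear _ _ w])
          (use E tangent_action_dfun(1)[OF f A gpow_hom[OF g]] in simp_all)
    qed
  qed auto
  also have "\<dots> \<longleftrightarrow> critical_at Y f p" unfolding critical_at_iff[OF f A] diff_vanishes_iff ..
  finally show ?thesis .
qed

context
  fixes a' \<theta>' K'
  assumes dv: "diff_vanishes K (f b) (foot Y \<theta>)" and A': "etale_chart_at (inertia Y) (p, g) a' \<theta>' K'"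
begin

lemma singular_form_inertia:
  assumes "singular_form (cdim K') (hessian K' ((f \<circ> ev_obj) a') (foot (inertia Y) \<theta>'))"
  shows "singular_form (cdim K) (hessian K (f b) (foot Y \<theta>))"
proof -
  have g: "hom g p p" by (rule Aut_hom[OF gA])
  let ?E = "{v \<in> Rn (cdim K). tangent_action Y b \<theta> K g v = v}" and ?H = "hessian K (f b) (foot Y \<theta>)"
    and ?H' = "hessian K' ((f \<circ> ev_obj) a') (foot (inertia Y) \<theta>')"
  obtain J where J: "linear_on_set (Rn (cdim K')) J" "bij_betw J (Rn (cdim K')) ?E"
    and HJ: "\<forall>v\<in>Rn (cdim K'). \<forall>w\<in>Rn (cdim K'). ?H' v w = ?H (J v) (J w)"
    by (rule tangent_inertia[OF pd A gA]) (use f dv A' in meson)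
  obtain v where v: "v \<in> Rn (cdim K')" "v \<noteq> (\<lambda>_. 0)" "\<forall>w\<in>Rn (cdim K'). ?H' v w = 0"
    using assms by (auto simp: singular_form_def)
  have Jv: "J v \<in> ?E" using J(2) v(1) bij_betwE by blast
  have "J v \<noteq> (\<lambda>_. 0)"
    using inj_on_eq_iff[OF bij_betw_imp_inj_on[OF J(2)] v(1) Rn_zero] linear_zero[OF J(1) v(1)] v(2) by simp
  moreover have "?H (J v) w = 0" if w: "w \<in> Rn (cdim K)" for w
  proof -
    \<comment> \<open>All powers of \<open>g\<close> fix \<open>J v\<close>, so invariance of the
      Hessian in both arguments becomes invariance of the linear form
      \<open>?H (J v)\<close>.\<close>
    have fixed: "tangent_action Y b \<theta> K (gpow p g k) (J v) = J v" for k
    proof (induction k)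
      case 0
      then show ?case using tangent_action_idn[OF A] Jv by simp
    next
      case (Suc k)
      then show ?case using tangent_action_comp[OF A g gpow_hom[OF g]] Jv by simp
    qed
    show ?thesis
    proof (rule linear_vanishes_of_fixed_points[OF pd A g hessian_linear_right _ _ w])
      fix k u assume "u \<in> Rn (cdim K)"
      then show "?H (J v) (tangent_action Y b \<theta> K (gpow p g k) u) = ?H (J v) u"
        using tangent_action_dfun(2)[OF f A gpow_hom[OF g] _ dv, of "J v" u k] Jv fixed[of k] by simp
    next
      fix u assume "u \<in> Rn (cdim K)" "tangent_action Y b \<theta> K g u = u"
      then obtain z where "z \<in> Rn (cdim K')" "u = J z" using bij_betw_preimage[OF J(2), of u] by blast
      then show "?H (J v) u = 0" using v(1,3) HJ by auto
    qed
  qed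
  ultimately show ?thesis using Jv unfolding singular_form_def by blast
qed

lemma fixed_point_comparison_inertia:
  obtains J where "fixed_point_comparison (Aut Y p) (tangent_action Y b \<theta> K) (cdim K) (\<lambda>v w. s * hessian K (f b) (foot Y \<theta>) v w) g
    (Aut (inertia Y) (p, g)) (tangent_action (inertia Y) a' \<theta>' K') (cdim K')
    (\<lambda>v w. s * hessian K' ((f \<circ> ev_obj) a') (foot (inertia Y) \<theta>') v w) ev_arr J"
proof -
  interpret I: fibred "inertia Y" by unfold_locales (rule fibred_inertia[OF fib])
  let ?E = "{v \<in> Rn (cdim K). tangent_action Y b \<theta> K g v = v}" and ?H = "hessian K (f b) (foot Y \<theta>)"
    and ?H' = "hessian K' ((f \<circ> ev_obj) a') (foot (inertia Y) \<theta>')"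
  obtain J where J: "linear_on_set (Rn (cdim K')) J" "bij_betw J (Rn (cdim K')) ?E"
    and Jeq: "\<forall>h\<in>Aut (inertia Y) (p, g). \<forall>v\<in>Rn (cdim K').
      J (tangent_action (inertia Y) a' \<theta>' K' h v) = tangent_action Y b \<theta> K (ev_arr h) (J v)"
    and HJ: "\<forall>v\<in>Rn (cdim K'). \<forall>w\<in>Rn (cdim K'). ?H' v w = ?H (J v) (J w)"
    by (rule tangent_inertia[OF pd A gA]) (use f dv A' in meson)
  have "ev_arr h \<in> Aut Y p" if "h \<in> Aut (inertia Y) (p, g)" for h
    using Aut_inertia[OF that] by (auto simp: ev_arr_def)
  then show thesis
    by (intro that[of J], unfold_locales)
      (use gA J Jeq HJ tangent_action_linear[OF A Aut_hom] I.tangent_action_linear[OF A' I.Aut_hom] I.tangent_action_in[OF A' I.Aut_hom] in auto)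
qed

end

text \<open>Finiteness of \<open>Aut Y p\<close> permits averaging the standard inner product over
  the group, which supplies the auxiliary form of \<open>invariant_form\<close>.\<close>

lemma invariant_splitting_hessian:
  assumes dv: "diff_vanishes K (f b) (foot Y \<theta>)" and nd: "\<not> singular_form (cdim K) (hessian K (f b) (foot Y \<theta>))"
  shows "\<exists>Vp Vm. invariant_splitting (Aut Y p) (tangent_action Y b \<theta> K) (cdim K) (hessian K (f b) (foot Y \<theta>)) Vp Vm"
proof -
  note D = etale_chartD[OF A]
  define \<rho> where "\<rho> = tangent_action Y b \<theta> K"
  have fin: "finite (Aut Y p)" by (rule finite_Aut[OF pd A])
  have Aut: "h \<in> Aut Y p \<longleftrightarrow> hom h p p" for h by (rule Aut_iff[OF D(1)])
  have \<rho>R: "\<rho> h v \<in> Rn (cdim K)" if "h \<in> Aut Y p" "v \<in> Rn (cdim K)" for h v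
    unfolding \<rho>_def using tangent_action_in[OF A] that Aut by blast
  have \<rho>: "linear_on_set (Rn (cdim K)) (\<rho> h)" if "h \<in> Aut Y p" for h
    unfolding \<rho>_def using tangent_action_linear[OF A] that Aut by blast
  have \<rho>comp: "\<rho> (h \<cdot> k) v = \<rho> h (\<rho> k v)" if "h \<in> Aut Y p" "k \<in> Aut Y p" "v \<in> Rn (cdim K)" for h k v
    unfolding \<rho>_def using tangent_action_comp[OF A] that Aut by blast
  have \<rho>idn: "\<rho> (idn Y p) v = v" if "v \<in> Rn (cdim K)" for v unfolding \<rho>_def by (rule tangent_action_idn[OF A that])
  have idn: "idn Y p \<in> Aut Y p" unfolding Aut by (rule idn_hom[OF point_Obj[OF D(1)]])
  have inv: "\<exists>k\<in>Aut Y p. h \<cdot> k = idn Y p \<and> k \<cdot> h = idn Y p" if "h \<in> Aut Y p" for h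
    by (rule point_inverse[OF D(1,1) that[unfolded Aut]]) (use Aut in blast)
  \<comment> \<open>A sum, not a mean: the term of the identity alone is the standard inner product,
    which gives the required lower bound.\<close>
  define B where "B v w = (\<Sum>h\<in>Aut Y p. \<Sum>i<cdim K. \<rho> h v i * \<rho> h w i)" for v w
  have "invariant_form (cdim K) (Aut Y p) \<rho> (hessian K (f b) (foot Y \<theta>)) B"
  proof
    show "bilinear_form (cdim K) (hessian K (f b) (foot Y \<theta>))"
      by (simp add: bilinear_form_def hessian_linear_left hessian_linear_right)
    show "hessian K (f b) (foot Y \<theta>) v w = hessian K (f b) (foot Y \<theta>) w v" for v w
      by (rule hessian_sym[OF hom_manifold(2)[OF D(3)] stack_function_smooth[OF f hom_Obj(2)[OF D(3)]] D(4,5)])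
    show "\<not> singular_form (cdim K) (hessian K (f b) (foot Y \<theta>))" by (rule nd)
    show "bilinear_form (cdim K) B"
      unfolding bilinear_form_def
    proof (intro ballI allI conjI)
      fix u v w r s assume u: "u \<in> Rn (cdim K)" "v \<in> Rn (cdim K)" "w \<in> Rn (cdim K)"
      have lin: "\<rho> h (\<lambda>i. r * v i + s * w i) = (\<lambda>i. r * \<rho> h v i + s * \<rho> h w i)" if "h \<in> Aut Y p" for h
        by (rule linear_on_setD[OF \<rho>[OF that] u(2,3)])
      show "B (\<lambda>i. r * v i + s * w i) u = r * B v u + s * B w u"
        unfolding B_def sum_distrib_left sum.distrib[symmetric] by (intro sum.cong refl) (simp add: lin algebra_simps)
      show "B u (\<lambda>i. r * v i + s * w i) = r * B u v + s * B u w"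
        unfolding B_def sum_distrib_left sum.distrib[symmetric] by (intro sum.cong refl) (simp add: lin algebra_simps)
    qed
    show "B v w = B w v" for v w by (simp add: B_def mult.commute)
    show "(\<Sum>i<cdim K. w i * w i) \<le> B w w" if "w \<in> Rn (cdim K)" for w
    proof -
      have "(\<Sum>i<cdim K. \<rho> (idn Y p) w i * \<rho> (idn Y p) w i) \<le> B w w"
        unfolding B_def by (rule member_le_sum[OF idn _ fin]) (simp add: sum_nonneg)
      then show ?thesis by (simp add: \<rho>idn[OF that])
    qed
    show "hessian K (f b) (foot Y \<theta>) (\<rho> h v) (\<rho> h w) = hessian K (f b) (foot Y \<theta>) v w"
      if "h \<in> Aut Y p" "v \<in> Rn (cdim K)" "w \<in> Rn (cdim K)" for h v w
      unfolding \<rho>_def by (rule tangent_action_dfun(2)[OF f A that(1)[unfolded Aut] that(2) dv that(3)])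
    show "B (\<rho> k v) (\<rho> k w) = B v w" if k: "k \<in> Aut Y p" and v: "v \<in> Rn (cdim K)" and w: "w \<in> Rn (cdim K)" for k v w
    proof -
      obtain k' where k': "k' \<in> Aut Y p" "k \<cdot> k' = idn Y p" using inv[OF k] by blast
      \<comment> \<open>Right translation by \<open>k\<close> permutes the finite group, so the sum
        over it can be reindexed.\<close>
      have inj: "inj_on (\<lambda>h. h \<cdot> k) (Aut Y p)"
      proof (rule inj_on_inverseI)
        fix h assume "h \<in> Aut Y p"
        then show "(h \<cdot> k) \<cdot> k' = h" using assoc[of k' p p k p h p] comp_idn[of h p p] k' k by (simp add: Aut)
      qed
      have "(\<lambda>h. h \<cdot> k) ` Aut Y p = Aut Y p" using k comp_hom by (intro endo_inj_surj[OF fin _ inj]) (auto simp: Aut)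
      then have "bij_betw (\<lambda>h. h \<cdot> k) (Aut Y p) (Aut Y p)" using inj by (simp add: bij_betw_def)
      from sum.reindex_bij_betw[OF this, of "\<lambda>h. \<Sum>i<cdim K. \<rho> h v i * \<rho> h w i"]
      have "B v w = (\<Sum>h\<in>Aut Y p. \<Sum>i<cdim K. \<rho> (h \<cdot> k) v i * \<rho> (h \<cdot> k) w i)" by (simp add: B_def)
      also have "\<dots> = B (\<rho> k v) (\<rho> k w)" unfolding B_def using \<rho>comp k v w by (intro sum.cong refl) simp
      finally show ?thesis ..
    qed
    show "\<exists>h'\<in>Aut Y p. \<forall>v\<in>Rn (cdim K). \<rho> h (\<rho> h' v) = v" if "h \<in> Aut Y p" for h
      using inv[OF that] \<rho>comp[OF that] \<rho>idn by metis
  qed (use \<rho>R \<rho> in blast)+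
  then show ?thesis unfolding \<rho>_def by (rule invariant_form.invariant_splitting_ex)
qed

end

text \<open>For one inclusion, an arbitrary splitting upstairs is compared with the splitting
  provided by \<open>split\<close>. For the other, the splitting hidden in the class downstairs is
  transported along \<open>J\<close>, and the class is closed under isomorphism.\<close>

lemma signed_index_inertia:
  assumes pd: "proper_diagonal Y" and f: "stack_function Y f" and A: "etale_chart_at Y p b \<theta> K" and gA: "g \<in> Aut Y p"
    and dv: "diff_vanishes K (f b) (foot Y \<theta>)" and split: "\<exists>Vp Vm. invariant_splitting (Aut Y p) (tangent_action Y b \<theta> K) (cdim K)
      (\<lambda>v w. s * hessian K (f b) (foot Y \<theta>) v w) Vp Vm"
  shows "signed_index s (inertia Y) (f \<circ> ev_obj) (p, g) = fixed_class Y p g (signed_index s Y f p)"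
proof (intro equalityI subsetI)
  interpret I: fibred "inertia Y" by unfold_locales (rule fibred_inertia[OF fib])
  fix R assume "R \<in> signed_index s (inertia Y) (f \<circ> ev_obj) (p, g)"
  then obtain a' \<theta>' K' Vp' Vm' where A': "etale_chart_at (inertia Y) (p, g) a' \<theta>' K'"
    and S': "invariant_splitting (Aut (inertia Y) (p, g)) (tangent_action (inertia Y) a' \<theta>' K') (cdim K')
      (\<lambda>v w. s * hessian K' ((f \<circ> ev_obj) a') (foot (inertia Y) \<theta>') v w) Vp' Vm'"
    and iso: "rep_iso (Aut (inertia Y) (p, g)) (Vm', tangent_action (inertia Y) a' \<theta>' K') R"
    by (auto simp: signed_index_def)
  obtain Vp Vm where S: "invariant_splitting (Aut Y p) (tangent_action Y b \<theta> K) (cdim K) (\<lambda>v w. s * hessian K (f b) (foot Y \<theta>) v w) Vp Vm"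
    using split by blast
  obtain J where "fixed_point_comparison (Aut Y p) (tangent_action Y b \<theta> K) (cdim K) (\<lambda>v w. s * hessian K (f b) (foot Y \<theta>) v w) g
    (Aut (inertia Y) (p, g)) (tangent_action (inertia Y) a' \<theta>' K') (cdim K')
    (\<lambda>v w. s * hessian K' ((f \<circ> ev_obj) a') (foot (inertia Y) \<theta>') v w) ev_arr J"
    by (rule fixed_point_comparison_inertia[OF pd f A gA dv A'])
  from fixed_point_comparison.negative_part_iso[OF this S S']
  have "rep_iso (Aut (inertia Y) (p, g)) ({v \<in> Vm. tangent_action Y b \<theta> K g v = v}, \<lambda>h. tangent_action Y b \<theta> K (ev_arr h))
    (Vm', tangent_action (inertia Y) a' \<theta>' K')"
    by (rule rep_iso_sym[where n = "cdim K'"]) (use S' in \<open>auto simp: invariant_splitting_def image_subset_iff\<close>)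
  then have "rep_iso (Aut (inertia Y) (p, g)) ({v \<in> Vm. tangent_action Y b \<theta> K g v = v}, \<lambda>h. tangent_action Y b \<theta> K (ev_arr h)) R"
    by (rule rep_iso_trans[OF _ iso])
  moreover have "(Vm, tangent_action Y b \<theta> K) \<in> signed_index s Y f p"
    unfolding signed_index_def using A dv S rep_iso_refl by blast
  ultimately show "R \<in> fixed_class Y p g (signed_index s Y f p)" unfolding fixed_class_def by blast
next
  interpret I: fibred "inertia Y" by unfold_locales (rule fibred_inertia[OF fib])
  fix R assume "R \<in> fixed_class Y p g (signed_index s Y f p)"
  then obtain W \<sigma> where W: "(W, \<sigma>) \<in> signed_index s Y f p"
    and R: "rep_iso (Aut (inertia Y) (p, g)) ({v \<in> W. \<sigma> g v = v}, \<lambda>h. \<sigma> (ev_arr h)) R"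
    by (auto simp: fixed_class_def)
  \<comment> \<open>From here on \<open>b\<close>, \<open>\<theta>\<close> and \<open>K\<close>
    denote the chart that witnesses membership in the class, which may differ from the given
    one.\<close>
  then obtain b \<theta> K Vp Vm where A: "etale_chart_at Y p b \<theta> K" and dv: "diff_vanishes K (f b) (foot Y \<theta>)"
    and S: "invariant_splitting (Aut Y p) (tangent_action Y b \<theta> K) (cdim K) (\<lambda>v w. s * hessian K (f b) (foot Y \<theta>) v w) Vp Vm"
    and iso: "rep_iso (Aut Y p) (Vm, tangent_action Y b \<theta> K) (W, \<sigma>)"
    by (auto simp: signed_index_def)
  obtain a' \<theta>' K' where A': "etale_chart_at (inertia Y) (p, g) a' \<theta>' K'" by (rule tangent_inertia[OF pd A gA])
  obtain J where "fixed_point_comparison (Aut Y p) (tangent_action Y b \<theta> K) (cdim K) (\<lambda>v w. s * hessian K (f b) (foot Y \<theta>) v w) g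
    (Aut (inertia Y) (p, g)) (tangent_action (inertia Y) a' \<theta>' K') (cdim K')
    (\<lambda>v w. s * hessian K' ((f \<circ> ev_obj) a') (foot (inertia Y) \<theta>') v w) ev_arr J"
    by (rule fixed_point_comparison_inertia[OF pd f A gA dv A'])
  then interpret C: fixed_point_comparison "Aut Y p" "tangent_action Y b \<theta> K" "cdim K" "\<lambda>v w. s * hessian K (f b) (foot Y \<theta>) v w" g
    "Aut (inertia Y) (p, g)" "tangent_action (inertia Y) a' \<theta>' K'" "cdim K'"
    "\<lambda>v w. s * hessian K' ((f \<circ> ev_obj) a') (foot (inertia Y) \<theta>') v w" ev_arr J .
  note S' = C.transport_splitting[OF S]
  have "rep_iso (Aut (inertia Y) (p, g)) ({v \<in> Vm. tangent_action Y b \<theta> K g v = v}, \<lambda>h. tangent_action Y b \<theta> K (ev_arr h))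
      ({v \<in> W. \<sigma> g v = v}, \<lambda>h. \<sigma> (ev_arr h))"
    by (rule rep_iso_fixed[OF iso gA C.\<tau>]) (use S gA in \<open>auto simp: invariant_splitting_def image_subset_iff\<close>)
  from rep_iso_trans[OF rep_iso_trans[OF C.negative_part_iso[OF S S'] this] R]
  have "rep_iso (Aut (inertia Y) (p, g)) ({v \<in> Rn (cdim K'). J v \<in> Vm}, tangent_action (inertia Y) a' \<theta>' K') R" .
  moreover have "diff_vanishes K' ((f \<circ> ev_obj) a') (foot (inertia Y) \<theta>')"
    using critical_at_inertia[OF pd f A gA] critical_at_iff[OF f A] I.critical_at_iff[OF stack_function_inertia[OF f] A'] dv by simp
  ultimately show "R \<in> signed_index s (inertia Y) (f \<circ> ev_obj) (p, g)"
    unfolding signed_index_def using A' S' by blast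
qed

section \<open>Conclusions for Morse functions\<close>

context
  fixes f a
  assumes pd: "proper_diagonal Y" and et: "representable_with etale_map Y a" and sj: "representable_with surjective Y a" and morse: "morse Y f"
begin

lemma morse_stack_function: "stack_function Y f"
  using morse by (simp add: morse_def)

lemma morse_nondegenerate:
  assumes p: "p \<in> point_objects Y" and A: "etale_chart_at Y p b \<theta> K" and dv: "diff_vanishes K (f b) (foot Y \<theta>)"
  shows "\<not> singular_form (cdim K) (hessian K (f b) (foot Y \<theta>))"
proof -
  have "iso_class Y p \<in> critical_points Y f"
    unfolding critical_points_iff[OF morse_stack_function p] critical_at_def using A dv by blast
  then have "\<not> degenerate_at Y f p" using morse iso_class_self[OF p] by (auto simp: morse_def)
  then show ?thesis unfolding degenerate_at_def using A dv by blast
qed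

lemma morse_inertia: "morse (inertia Y) (f \<circ> ev_obj)"
  unfolding morse_def
proof (intro conjI ballI notI)
  interpret I: fibred "inertia Y" by unfold_locales (rule fibred_inertia[OF fib])
  note f = morse_stack_function
  show "stack_function (inertia Y) (f \<circ> ev_obj)" by (rule stack_function_inertia[OF f])
  fix x q assume "degenerate_at (inertia Y) (f \<circ> ev_obj) q"
  then obtain a' \<theta>' K' where A': "etale_chart_at (inertia Y) q a' \<theta>' K'"
    and dv': "diff_vanishes K' ((f \<circ> ev_obj) a') (foot (inertia Y) \<theta>')"
    and sing: "singular_form (cdim K') (hessian K' ((f \<circ> ev_obj) a') (foot (inertia Y) \<theta>'))"
    by (auto simp: degenerate_at_def)
  obtain p g where q: "q = (p, g)" by (cases q)
  have p: "p \<in> point_objects Y" and gA: "g \<in> Aut Y p" using I.etale_chartD(1)[OF A'] by (simp_all add: q point_objects_inertia)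
  obtain \<theta> K where A: "etale_chart_at Y p a \<theta> K" by (rule etale_chart_ex[OF et sj p])
  have dv: "diff_vanishes K (f a) (foot Y \<theta>)"
    using critical_at_inertia[OF pd f A gA] critical_at_iff[OF f A]
      I.critical_at_iff[OF stack_function_inertia[OF f] A'[unfolded q]] dv' by simp
  show False
    using singular_form_inertia[OF pd f A gA dv A'[unfolded q] sing] morse_nondegenerate[OF p A dv] by blast
qed

lemma critical_point_inertia_iff:
  assumes p: "p \<in> point_objects Y" and gA: "g \<in> Aut Y p"
  shows "iso_class (inertia Y) (p, g) \<in> critical_points (inertia Y) (f \<circ> ev_obj) \<longleftrightarrow> iso_class Y p \<in> critical_points Y f"
proof -
  interpret I: fibred "inertia Y" by unfold_locales (rule fibred_inertia[OF fib])
  obtain \<theta> K where A: "etale_chart_at Y p a \<theta> K" by (rule etale_chart_ex[OF et sj p])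
  have pg: "(p, g) \<in> point_objects (inertia Y)" using p gA by (simp add: point_objects_inertia)
  show ?thesis
    unfolding critical_points_iff[OF morse_stack_function p] I.critical_points_iff[OF stack_function_inertia[OF morse_stack_function] pg]
    using critical_at_inertia[OF pd morse_stack_function A gA] by simp
qed

lemma critical_points_inertia: "critical_points (inertia Y) (f \<circ> ev_obj) =
    {iso_class (inertia Y) (c, g) | c g. c \<in> point_objects Y \<and> iso_class Y c \<in> critical_points Y f \<and> g \<in> Aut Y c}"
proof (intro equalityI subsetI)
  fix x assume x: "x \<in> critical_points (inertia Y) (f \<circ> ev_obj)"
  then obtain c g where "x = iso_class (inertia Y) (c, g)" "(c, g) \<in> point_objects (inertia Y)"
    by (auto simp: critical_points_def points_def)
  then show "x \<in> {iso_class (inertia Y) (c, g) | c g. c \<in> point_objects Y \<and> iso_class Y c \<in> critical_points Y f \<and> g \<in> Aut Y c}"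
    using x critical_point_inertia_iff[of c g] point_objects_inertia by auto
qed (use critical_point_inertia_iff in auto)

lemma morse_signed_index:
  assumes c: "c \<in> point_objects Y" "iso_class Y c \<in> critical_points Y f" and gA: "g \<in> Aut Y c" and s: "s = 1 \<or> s = -1"
  shows "signed_index s (inertia Y) (f \<circ> ev_obj) (c, g) = fixed_class Y c g (signed_index s Y f c)"
proof -
  note f = morse_stack_function
  obtain \<theta> K where A: "etale_chart_at Y c a \<theta> K" by (rule etale_chart_ex[OF et sj c(1)])
  have dv: "diff_vanishes K (f a) (foot Y \<theta>)"
    using c(2) unfolding critical_points_iff[OF f c(1)] critical_at_iff[OF f A] .
  obtain Vp Vm where "invariant_splitting (Aut Y c) (tangent_action Y a \<theta> K) (cdim K) (hessian K (f a) (foot Y \<theta>)) Vp Vm"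
    using invariant_splitting_hessian[OF pd f A gA dv morse_nondegenerate[OF c(1) A dv]] by blast
  then have "\<exists>Vp Vm. invariant_splitting (Aut Y c) (tangent_action Y a \<theta> K) (cdim K)
      (\<lambda>v w. s * hessian K (f a) (foot Y \<theta>) v w) Vp Vm"
    \<comment> \<open>For \<open>s = -1\<close> the positive and negative parts exchange their
      roles.\<close>
    using s by (elim disjE) (simp add: invariant_splitting_uminus_iff, blast)+
  then show ?thesis by (rule signed_index_inertia[OF pd f A gA dv])
qed

end

end

theorem theorem4p11:
  fixes X :: "('o, 'm) fibcat" and f :: "'o \<Rightarrow> point \<Rightarrow> real"
  assumes "deligne_mumford_stack X" and "morse X f"
  shows "morse (inertia X) (f \<circ> ev_obj) \<and>
    critical_points (inertia X) (f \<circ> ev_obj) =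
      {iso_class (inertia X) (c, g) | c g.
         c \<in> point_objects X \<and> iso_class X c \<in> critical_points X f \<and> g \<in> Aut X c} \<and>
    (\<forall>c g. c \<in> point_objects X \<and> iso_class X c \<in> critical_points X f \<and> g \<in> Aut X c \<longrightarrow>
       index (inertia X) (f \<circ> ev_obj) (c, g) = fixed_class X c g (index X f c) \<and>
       coindex (inertia X) (f \<circ> ev_obj) (c, g) = fixed_class X c g (coindex X f c))"
proof -
  interpret fibred X
    using assms(1) by unfold_locales (simp add: deligne_mumford_stack_def differentiable_stack_def stack_def)
  obtain a where a: "proper_diagonal X" "representable_with etale_map X a" "representable_with surjective X a"
    using assms(1) by (auto simp: deligne_mumford_stack_def)
  show ?thesis
    unfolding index_signed coindex_signed
    using morse_inertia[OF a assms(2)] critical_points_inertia[OF a assms(2)] morse_signed_index[OF a assms(2)] by auto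
qed

end
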